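(* Let $R$ be any ring. A map $f:X \to Y$ of pro-spaces is an $R$-homology weak equivalence if and only if it induces an isomorphism $f^*: H^{n}(Y; M) \to H^{n}(X; M)$ for all $n \geq 0$ and all $R$-modules $M$.
   Context: For a category $\mathcal C$, $\mathrm{pro}\text{-}\mathcal C$ has as objects all (small) cofiltered diagrams in $\mathcal C$, with morphisms $\mathrm{Hom}(X,Y)=\lim_s \operatorname{colim}_t \mathrm{Hom}_{\mathcal C}(X_t,Y_s)$. A pro-space is an object of $\mathrm{pro}\text{-}sSet$, where $sSet$ is the category of simplicial sets. For an abelian group $M$, $H^n(X;M)=\operatorname{colim}_s H^n(X_s;M)$. $H_n(X;R)$ denotes the pro-group obtained by applying $H_n(-;R)$ levelwise to $X$. An $R$-homology weak equivalence is a map of pro-spaces $X\to Y$ inducing isomorphisms $H_n(X;R)\to H_n(Y;R)$ of pro-groups for all $n\ge0$. *)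

theory Defs
  imports "HOL-Algebra.Product_Groups" "HOL-Algebra.Module"
begin

section \<open>Categories and pro-objects\<close>

text \<open>
  Hom-sets need not be disjoint, so composition takes the three objects as arguments:
  if \<open>f \<in> Hom C a b\<close> and \<open>g \<in> Hom C b c\<close>, then \<open>Cmp C a b c g f\<close> is
  \<open>g \<circ> f\<close> in \<open>Hom C a c\<close>.
\<close>

record ('o, 'a) category =
  Ob :: "'o set"
  Hom :: "'o \<Rightarrow> 'o \<Rightarrow> 'a set"
  Id :: "'o \<Rightarrow> 'a"
  Cmp :: "'o \<Rightarrow> 'o \<Rightarrow> 'o \<Rightarrow> 'a \<Rightarrow> 'a \<Rightarrow> 'a"

definition category :: "('o, 'a) category \<Rightarrow> bool" where
  "category C \<longleftrightarrow>
     (\<forall>a\<in>Ob C. Id C a \<in> Hom C a a) \<and>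
     (\<forall>a\<in>Ob C. \<forall>b\<in>Ob C. \<forall>c\<in>Ob C. \<forall>f\<in>Hom C a b. \<forall>g\<in>Hom C b c.
        Cmp C a b c g f \<in> Hom C a c) \<and>
     (\<forall>a\<in>Ob C. \<forall>b\<in>Ob C. \<forall>f\<in>Hom C a b.
        Cmp C a a b f (Id C a) = f \<and> Cmp C a b b (Id C b) f = f) \<and>
     (\<forall>a\<in>Ob C. \<forall>b\<in>Ob C. \<forall>c\<in>Ob C. \<forall>d\<in>Ob C.
        \<forall>f\<in>Hom C a b. \<forall>g\<in>Hom C b c. \<forall>h\<in>Hom C c d.
        Cmp C a c d h (Cmp C a b c g f) = Cmp C a b d (Cmp C b c d h g) f)"

definition cofiltered :: "('i, 'j) category \<Rightarrow> bool" where
  "cofiltered I \<longleftrightarrow> category I \<and> Ob I \<noteq> {} \<and>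
     (\<forall>s\<in>Ob I. \<forall>s'\<in>Ob I. \<exists>t\<in>Ob I. Hom I t s \<noteq> {} \<and> Hom I t s' \<noteq> {}) \<and>
     (\<forall>s\<in>Ob I. \<forall>s'\<in>Ob I. \<forall>u\<in>Hom I s s'. \<forall>v\<in>Hom I s s'.
        \<exists>t\<in>Ob I. \<exists>w\<in>Hom I t s. Cmp I t s s' u w = Cmp I t s s' v w)"

record ('i, 'j, 'o, 'a) pro_obj =
  Idx :: "('i, 'j) category"
  Fam :: "'i \<Rightarrow> 'o"
  Trans :: "'i \<Rightarrow> 'i \<Rightarrow> 'j \<Rightarrow> 'a"

definition pro_object :: "('o, 'a) category \<Rightarrow> ('i, 'j, 'o, 'a) pro_obj \<Rightarrow> bool" where
  "pro_object C X \<longleftrightarrow> cofiltered (Idx X) \<and>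
     (\<forall>s\<in>Ob (Idx X). Fam X s \<in> Ob C) \<and>
     (\<forall>s\<in>Ob (Idx X). \<forall>t\<in>Ob (Idx X). \<forall>u\<in>Hom (Idx X) s t.
        Trans X s t u \<in> Hom C (Fam X s) (Fam X t)) \<and>
     (\<forall>s\<in>Ob (Idx X). Trans X s s (Id (Idx X) s) = Id C (Fam X s)) \<and>
     (\<forall>r\<in>Ob (Idx X). \<forall>s\<in>Ob (Idx X). \<forall>t\<in>Ob (Idx X).
        \<forall>u\<in>Hom (Idx X) r s. \<forall>v\<in>Hom (Idx X) s t.
        Trans X r t (Cmp (Idx X) r s t v u) =
          Cmp C (Fam X r) (Fam X s) (Fam X t) (Trans X s t v) (Trans X r s u))"

subsection \<open>Colimits over the opposite of a cofiltered category\<close>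

text \<open>
  A functor from the opposite of \<open>I\<close> to sets is given by sets \<open>S s\<close> and maps
  \<open>T t s u : S s \<Rightarrow> S t\<close> for \<open>u \<in> Hom I t s\<close>.  Its colimit is the quotient of the
  disjoint union of the \<open>S s\<close> by the following relation, which is an equivalence
  since \<open>I\<close> is cofiltered.
\<close>

definition colim_rel ::
  "('i, 'j) category \<Rightarrow> ('i \<Rightarrow> 'a set) \<Rightarrow> ('i \<Rightarrow> 'i \<Rightarrow> 'j \<Rightarrow> 'a \<Rightarrow> 'a) \<Rightarrow>
    (('i \<times> 'a) \<times> ('i \<times> 'a)) set" where
  "colim_rel I S T = {((s, a), (s', b)). s \<in> Ob I \<and> a \<in> S s \<and> s' \<in> Ob I \<and> b \<in> S s' \<and>
     (\<exists>t\<in>Ob I. \<exists>u\<in>Hom I t s. \<exists>v\<in>Hom I t s'. T t s u a = T t s' v b)}"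

definition colim_set ::
  "('i, 'j) category \<Rightarrow> ('i \<Rightarrow> 'a set) \<Rightarrow> ('i \<Rightarrow> 'i \<Rightarrow> 'j \<Rightarrow> 'a \<Rightarrow> 'a) \<Rightarrow> ('i \<times> 'a) set set" where
  "colim_set I S T = (SIGMA s:Ob I. S s) // colim_rel I S T"

definition colim_group ::
  "('i, 'j) category \<Rightarrow> ('i \<Rightarrow> 'a monoid) \<Rightarrow> ('i \<Rightarrow> 'i \<Rightarrow> 'j \<Rightarrow> 'a \<Rightarrow> 'a) \<Rightarrow> ('i \<times> 'a) set monoid" where
  "colim_group I G T =
     (let r = colim_rel I (\<lambda>s. carrier (G s)) T in
      \<lparr> carrier = colim_set I (\<lambda>s. carrier (G s)) T,
        mult = (\<lambda>A B. r `` {(t, T t s u a \<otimes>\<^bsub>G t\<^esub> T t s' v b) | t s s' u v a b.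
                  t \<in> Ob I \<and> (s, a) \<in> A \<and> (s', b) \<in> B \<and> u \<in> Hom I t s \<and> v \<in> Hom I t s'}),
        one = r `` {(s, \<one>\<^bsub>G s\<^esub>) | s. s \<in> Ob I} \<rparr>)"

subsection \<open>Morphisms of pro-objects\<close>

text \<open>The germ relation whose quotient is the colimit over \<open>t\<close> of \<open>Hom C (Fam X t) y\<close>.\<close>

definition germ_rel ::
  "('o, 'a) category \<Rightarrow> ('i, 'j, 'o, 'a) pro_obj \<Rightarrow> 'o \<Rightarrow> (('i \<times> 'a) \<times> ('i \<times> 'a)) set" where
  "germ_rel C X y = colim_rel (Idx X) (\<lambda>t. Hom C (Fam X t) y)
     (\<lambda>t s u h. Cmp C (Fam X t) (Fam X s) y h (Trans X t s u))"

definition germs ::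
  "('o, 'a) category \<Rightarrow> ('i, 'j, 'o, 'a) pro_obj \<Rightarrow> 'o \<Rightarrow> ('i \<times> 'a) set set" where
  "germs C X y = colim_set (Idx X) (\<lambda>t. Hom C (Fam X t) y)
     (\<lambda>t s u h. Cmp C (Fam X t) (Fam X s) y h (Trans X t s u))"

text \<open>
  The limit over \<open>s\<close> of \<open>germs C X (Fam Y s)\<close>.  Elements of \<open>germs\<close> are equivalence classes,
  so a class is mapped to another one iff each of its representatives is mapped into the other.
\<close>

definition pro_hom ::
  "('o, 'a) category \<Rightarrow> ('i, 'j, 'o, 'a) pro_obj \<Rightarrow> ('k, 'l, 'o, 'a) pro_obj \<Rightarrow>
    ('k \<Rightarrow> ('i \<times> 'a) set) set" where
  "pro_hom C X Y = {f \<in> (\<Pi>\<^sub>E s\<in>Ob (Idx Y). germs C X (Fam Y s)).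
     \<forall>s\<in>Ob (Idx Y). \<forall>s'\<in>Ob (Idx Y). \<forall>u\<in>Hom (Idx Y) s s'. \<forall>(t, h)\<in>f s.
       (t, Cmp C (Fam X t) (Fam Y s) (Fam Y s') (Trans Y s s' u) h) \<in> f s'}"

definition pro_id :: "('o, 'a) category \<Rightarrow> ('i, 'j, 'o, 'a) pro_obj \<Rightarrow> 'i \<Rightarrow> ('i \<times> 'a) set" where
  "pro_id C X = (\<lambda>s\<in>Ob (Idx X). germ_rel C X (Fam X s) `` {(s, Id C (Fam X s))})"

definition pro_comp ::
  "('o, 'a) category \<Rightarrow> ('i, 'j, 'o, 'a) pro_obj \<Rightarrow> ('k, 'l, 'o, 'a) pro_obj \<Rightarrow>
    ('p, 'q, 'o, 'a) pro_obj \<Rightarrow> ('p \<Rightarrow> ('k \<times> 'a) set) \<Rightarrow> ('k \<Rightarrow> ('i \<times> 'a) set) \<Rightarrow>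
    'p \<Rightarrow> ('i \<times> 'a) set" where
  "pro_comp C X Y Z g f = (\<lambda>r\<in>Ob (Idx Z). germ_rel C X (Fam Z r) ``
     {(t, Cmp C (Fam X t) (Fam Y s) (Fam Z r) h k) | s h t k. (s, h) \<in> g r \<and> (t, k) \<in> f s})"

definition pro_iso ::
  "('o, 'a) category \<Rightarrow> ('i, 'j, 'o, 'a) pro_obj \<Rightarrow> ('k, 'l, 'o, 'a) pro_obj \<Rightarrow>
    ('k \<Rightarrow> ('i \<times> 'a) set) \<Rightarrow> bool" where
  "pro_iso C X Y f \<longleftrightarrow> f \<in> pro_hom C X Y \<and>
     (\<exists>g\<in>pro_hom C Y X. pro_comp C X Y X g f = pro_id C X \<and> pro_comp C Y X Y f g = pro_id C Y)"

text \<open>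
  Levelwise application of a functor, with values in a category \<open>D\<close>, that is given by \<open>F\<close> on
  objects and by \<open>F' a b : Hom C a b \<Rightarrow> Hom D (F a) (F b)\<close> on morphisms.
\<close>

definition levelwise ::
  "('o \<Rightarrow> 'p) \<Rightarrow> ('o \<Rightarrow> 'o \<Rightarrow> 'a \<Rightarrow> 'b) \<Rightarrow> ('i, 'j, 'o, 'a) pro_obj \<Rightarrow> ('i, 'j, 'p, 'b) pro_obj" where
  "levelwise F F' X = \<lparr> Idx = Idx X, Fam = (\<lambda>s. F (Fam X s)),
     Trans = (\<lambda>s t u. F' (Fam X s) (Fam X t) (Trans X s t u)) \<rparr>"

definition levelwise_map ::
  "('p, 'b) category \<Rightarrow> ('o \<Rightarrow> 'p) \<Rightarrow> ('o \<Rightarrow> 'o \<Rightarrow> 'a \<Rightarrow> 'b) \<Rightarrow>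
    ('i, 'j, 'o, 'a) pro_obj \<Rightarrow> ('k, 'l, 'o, 'a) pro_obj \<Rightarrow> ('k \<Rightarrow> ('i \<times> 'a) set) \<Rightarrow>
    'k \<Rightarrow> ('i \<times> 'b) set" where
  "levelwise_map D F F' X Y f = (\<lambda>s\<in>Ob (Idx Y).
     germ_rel D (levelwise F F' X) (F (Fam Y s)) ``
       {(t, F' (Fam X t) (Fam Y s) h) | t h. (t, h) \<in> f s})"

section \<open>The categories of groups and of simplicial sets\<close>

definition Grp :: "('g monoid, 'g \<Rightarrow> 'g) category" where
  "Grp = \<lparr> Ob = {G. group G},
           Hom = (\<lambda>G H. hom G H \<inter> extensional (carrier G)),
           Id = (\<lambda>G. \<lambda>x\<in>carrier G. x),
           Cmp = (\<lambda>G H K g f. compose (carrier G) g f) \<rparr>"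

text \<open>The monotone maps from \<open>[m] = {0,\<dots>,m}\<close> to \<open>[n] = {0,\<dots>,n}\<close>.\<close>

definition simplex_maps :: "nat \<Rightarrow> nat \<Rightarrow> (nat \<Rightarrow> nat) set" where
  "simplex_maps m n = {\<theta> \<in> {..m} \<rightarrow>\<^sub>E {..n}. mono_on {..m} \<theta>}"

text \<open>\<open>Act X m n \<theta>\<close>, for \<open>\<theta> \<in> simplex_maps m n\<close>, maps \<open>Simp X n\<close> to \<open>Simp X m\<close>.\<close>

record 'x sset =
  Simp :: "nat \<Rightarrow> 'x set"
  Act :: "nat \<Rightarrow> nat \<Rightarrow> (nat \<Rightarrow> nat) \<Rightarrow> 'x \<Rightarrow> 'x"

definition simplicial_set :: "'x sset \<Rightarrow> bool" where
  "simplicial_set X \<longleftrightarrow>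
     (\<forall>m n. \<forall>\<theta>\<in>simplex_maps m n. \<forall>x\<in>Simp X n. Act X m n \<theta> x \<in> Simp X m) \<and>
     (\<forall>n. \<forall>x\<in>Simp X n. Act X n n (\<lambda>i\<in>{..n}. i) x = x) \<and>
     (\<forall>k m n. \<forall>\<eta>\<in>simplex_maps k m. \<forall>\<theta>\<in>simplex_maps m n. \<forall>x\<in>Simp X n.
        Act X k n (compose {..k} \<theta> \<eta>) x = Act X k m \<eta> (Act X m n \<theta> x))"

definition simplicial_maps :: "'x sset \<Rightarrow> 'x sset \<Rightarrow> (nat \<Rightarrow> 'x \<Rightarrow> 'x) set" where
  "simplicial_maps X Y = {h. (\<forall>n. h n \<in> Simp X n \<rightarrow>\<^sub>E Simp Y n) \<and>
     (\<forall>m n. \<forall>\<theta>\<in>simplex_maps m n. \<forall>x\<in>Simp X n. h m (Act X m n \<theta> x) = Act Y m n \<theta> (h n x))}"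

definition sSet :: "('x sset, nat \<Rightarrow> 'x \<Rightarrow> 'x) category" where
  "sSet = \<lparr> Ob = {X. simplicial_set X},
            Hom = simplicial_maps,
            Id = (\<lambda>X n. \<lambda>x\<in>Simp X n. x),
            Cmp = (\<lambda>X Y Z g f n. compose (Simp X n) (g n) (f n)) \<rparr>"

type_synonym ('i, 'j, 'x) pro_space = "('i, 'j, 'x sset, nat \<Rightarrow> 'x \<Rightarrow> 'x) pro_obj"

abbreviation pro_space :: "('i, 'j, 'x) pro_space \<Rightarrow> bool" where
  "pro_space \<equiv> pro_object sSet"

section \<open>Homology and cohomology of simplicial sets\<close>

text \<open>
  \<open>face X n i\<close> is the \<open>i\<close>-th face map \<open>Simp X (Suc n) \<Rightarrow> Simp X n\<close>; it is induced by
  the injection \<open>[n] \<rightarrow> [n+1]\<close> that omits \<open>i\<close>.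
\<close>

definition face :: "'x sset \<Rightarrow> nat \<Rightarrow> nat \<Rightarrow> 'x \<Rightarrow> 'x" where
  "face X n i = Act X n (Suc n) (\<lambda>j\<in>{..n}. if j < i then j else Suc j)"

definition alt_sign :: "('a, 'b) ring_scheme \<Rightarrow> nat \<Rightarrow> 'a \<Rightarrow> 'a" where
  "alt_sign A i a = (if even i then a else \<ominus>\<^bsub>A\<^esub> a)"

definition chain_group :: "('r, 'b) ring_scheme \<Rightarrow> nat \<Rightarrow> 'x sset \<Rightarrow> ('x \<Rightarrow> 'r) monoid" where
  "chain_group R n X = sum_group (Simp X n) (\<lambda>_. add_monoid R)"

text \<open>Pushforward of finite formal sums along \<open>p : A \<rightarrow> B\<close>.\<close>

definition push_chain ::
  "('r, 'b) ring_scheme \<Rightarrow> 'x set \<Rightarrow> 'x set \<Rightarrow> ('x \<Rightarrow> 'x) \<Rightarrow> ('x \<Rightarrow> 'r) \<Rightarrow> 'x \<Rightarrow> 'r" where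
  "push_chain R A B p c = (\<lambda>y\<in>B. \<Oplus>\<^bsub>R\<^esub>x\<in>{x\<in>A. c x \<noteq> \<zero>\<^bsub>R\<^esub> \<and> p x = y}. c x)"

text \<open>The boundary map from \<open>(n+1)\<close>-chains to \<open>n\<close>-chains.\<close>

definition boundary :: "('r, 'b) ring_scheme \<Rightarrow> nat \<Rightarrow> 'x sset \<Rightarrow> ('x \<Rightarrow> 'r) \<Rightarrow> 'x \<Rightarrow> 'r" where
  "boundary R n X c = (\<lambda>y\<in>Simp X n. \<Oplus>\<^bsub>R\<^esub>i\<in>{..Suc n}.
     alt_sign R i (push_chain R (Simp X (Suc n)) (Simp X n) (face X n i) c y))"

definition cycles :: "('r, 'b) ring_scheme \<Rightarrow> nat \<Rightarrow> 'x sset \<Rightarrow> ('x \<Rightarrow> 'r) set" where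
  "cycles R n X = {c \<in> carrier (chain_group R n X).
     \<forall>m. n = Suc m \<longrightarrow> boundary R m X c = \<one>\<^bsub>chain_group R m X\<^esub>}"

definition boundaries :: "('r, 'b) ring_scheme \<Rightarrow> nat \<Rightarrow> 'x sset \<Rightarrow> ('x \<Rightarrow> 'r) set" where
  "boundaries R n X = boundary R n X ` carrier (chain_group R (Suc n) X)"

definition homology_group ::
  "('r, 'b) ring_scheme \<Rightarrow> nat \<Rightarrow> 'x sset \<Rightarrow> ('x \<Rightarrow> 'r) set monoid" where
  "homology_group R n X =
     subgroup_generated (chain_group R n X) (cycles R n X) Mod boundaries R n X"

definition homology_map ::
  "('r, 'b) ring_scheme \<Rightarrow> nat \<Rightarrow> 'x sset \<Rightarrow> 'x sset \<Rightarrow> (nat \<Rightarrow> 'x \<Rightarrow> 'x) \<Rightarrow>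
    ('x \<Rightarrow> 'r) set \<Rightarrow> ('x \<Rightarrow> 'r) set" where
  "homology_map R n X Y h = (\<lambda>A\<in>carrier (homology_group R n X).
     boundaries R n Y <#>\<^bsub>chain_group R n Y\<^esub> (push_chain R (Simp X n) (Simp Y n) (h n) ` A))"

definition cochain_group :: "nat \<Rightarrow> 'x sset \<Rightarrow> ('a, 'b) ring_scheme \<Rightarrow> ('x \<Rightarrow> 'a) monoid" where
  "cochain_group n X M = product_group (Simp X n) (\<lambda>_. add_monoid M)"

definition coboundary :: "nat \<Rightarrow> 'x sset \<Rightarrow> ('a, 'b) ring_scheme \<Rightarrow> ('x \<Rightarrow> 'a) \<Rightarrow> 'x \<Rightarrow> 'a" where
  "coboundary n X M \<phi> = (\<lambda>x\<in>Simp X (Suc n). \<Oplus>\<^bsub>M\<^esub>i\<in>{..Suc n}. alt_sign M i (\<phi> (face X n i x)))"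

definition cocycles :: "nat \<Rightarrow> 'x sset \<Rightarrow> ('a, 'b) ring_scheme \<Rightarrow> ('x \<Rightarrow> 'a) set" where
  "cocycles n X M = {\<phi> \<in> carrier (cochain_group n X M).
     coboundary n X M \<phi> = \<one>\<^bsub>cochain_group (Suc n) X M\<^esub>}"

definition coboundaries :: "nat \<Rightarrow> 'x sset \<Rightarrow> ('a, 'b) ring_scheme \<Rightarrow> ('x \<Rightarrow> 'a) set" where
  "coboundaries n X M = (case n of
     0 \<Rightarrow> {\<one>\<^bsub>cochain_group 0 X M\<^esub>}
   | Suc m \<Rightarrow> coboundary m X M ` carrier (cochain_group m X M))"

definition cohomology_group ::
  "nat \<Rightarrow> 'x sset \<Rightarrow> ('a, 'b) ring_scheme \<Rightarrow> ('x \<Rightarrow> 'a) set monoid" where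
  "cohomology_group n X M =
     subgroup_generated (cochain_group n X M) (cocycles n X M) Mod coboundaries n X M"

text \<open>For \<open>h : X \<rightarrow> Y\<close>, the map from \<open>cohomology_group n Y M\<close> to \<open>cohomology_group n X M\<close>.\<close>

definition cohomology_map ::
  "nat \<Rightarrow> 'x sset \<Rightarrow> 'x sset \<Rightarrow> ('a, 'b) ring_scheme \<Rightarrow> (nat \<Rightarrow> 'x \<Rightarrow> 'x) \<Rightarrow>
    ('x \<Rightarrow> 'a) set \<Rightarrow> ('x \<Rightarrow> 'a) set" where
  "cohomology_map n X Y M h = (\<lambda>A\<in>carrier (cohomology_group n Y M).
     coboundaries n X M <#>\<^bsub>cochain_group n X M\<^esub> ((\<lambda>\<phi>. \<lambda>x\<in>Simp X n. \<phi> (h n x)) ` A))"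

section \<open>Homology and cohomology of pro-spaces\<close>

definition pro_homology_map ::
  "('r, 'b) ring_scheme \<Rightarrow> nat \<Rightarrow> ('i, 'j, 'x) pro_space \<Rightarrow> ('k, 'l, 'x) pro_space \<Rightarrow>
    ('k \<Rightarrow> ('i \<times> (nat \<Rightarrow> 'x \<Rightarrow> 'x)) set) \<Rightarrow>
    'k \<Rightarrow> ('i \<times> (('x \<Rightarrow> 'r) set \<Rightarrow> ('x \<Rightarrow> 'r) set)) set" where
  "pro_homology_map R n = levelwise_map Grp (homology_group R n) (homology_map R n)"

definition pro_homology ::
  "('r, 'b) ring_scheme \<Rightarrow> nat \<Rightarrow> ('i, 'j, 'x) pro_space \<Rightarrow>
    ('i, 'j, ('x \<Rightarrow> 'r) set monoid, ('x \<Rightarrow> 'r) set \<Rightarrow> ('x \<Rightarrow> 'r) set) pro_obj" where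
  "pro_homology R n = levelwise (homology_group R n) (homology_map R n)"

definition homology_weak_equivalence ::
  "('r, 'b) ring_scheme \<Rightarrow> ('i, 'j, 'x) pro_space \<Rightarrow> ('k, 'l, 'x) pro_space \<Rightarrow>
    ('k \<Rightarrow> ('i \<times> (nat \<Rightarrow> 'x \<Rightarrow> 'x)) set) \<Rightarrow> bool" where
  "homology_weak_equivalence R X Y f \<longleftrightarrow>
     (\<forall>n. pro_iso Grp (pro_homology R n X) (pro_homology R n Y) (pro_homology_map R n X Y f))"

definition pro_cohomology ::
  "nat \<Rightarrow> ('i, 'j, 'x) pro_space \<Rightarrow> ('a, 'b) ring_scheme \<Rightarrow> ('i \<times> ('x \<Rightarrow> 'a) set) set monoid" where
  "pro_cohomology n X M = colim_group (Idx X) (\<lambda>s. cohomology_group n (Fam X s) M)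
     (\<lambda>t s u. cohomology_map n (Fam X t) (Fam X s) M (Trans X t s u))"

definition pro_cohomology_map ::
  "nat \<Rightarrow> ('i, 'j, 'x) pro_space \<Rightarrow> ('k, 'l, 'x) pro_space \<Rightarrow> ('a, 'b) ring_scheme \<Rightarrow>
    ('k \<Rightarrow> ('i \<times> (nat \<Rightarrow> 'x \<Rightarrow> 'x)) set) \<Rightarrow>
    ('k \<times> ('x \<Rightarrow> 'a) set) set \<Rightarrow> ('i \<times> ('x \<Rightarrow> 'a) set) set" where
  "pro_cohomology_map n X Y M f = (\<lambda>A\<in>carrier (pro_cohomology n Y M).
     colim_rel (Idx X) (\<lambda>s. carrier (cohomology_group n (Fam X s) M))
         (\<lambda>t s u. cohomology_map n (Fam X t) (Fam X s) M (Trans X t s u)) ``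
       {(t, cohomology_map n (Fam X t) (Fam Y s) M h a) | s a t h. (s, a) \<in> A \<and> (t, h) \<in> f s})"

section \<open>Modules\<close>

text \<open>The library's locale \<open>module\<close> requires a commutative ring of scalars.\<close>

locale left_module = R?: ring R + M?: abelian_group M
  for R :: "('r, 'b) ring_scheme" (structure) and M :: "('r, 'a, 'c) module_scheme" (structure) +
  assumes smult_closed:
      "\<lbrakk>a \<in> carrier R; x \<in> carrier M\<rbrakk> \<Longrightarrow> a \<odot>\<^bsub>M\<^esub> x \<in> carrier M"
    and smult_l_distr:
      "\<lbrakk>a \<in> carrier R; b \<in> carrier R; x \<in> carrier M\<rbrakk> \<Longrightarrow>
        (a \<oplus>\<^bsub>R\<^esub> b) \<odot>\<^bsub>M\<^esub> x = a \<odot>\<^bsub>M\<^esub> x \<oplus>\<^bsub>M\<^esub> b \<odot>\<^bsub>M\<^esub> x"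
    and smult_r_distr:
      "\<lbrakk>a \<in> carrier R; x \<in> carrier M; y \<in> carrier M\<rbrakk> \<Longrightarrow>
        a \<odot>\<^bsub>M\<^esub> (x \<oplus>\<^bsub>M\<^esub> y) = a \<odot>\<^bsub>M\<^esub> x \<oplus>\<^bsub>M\<^esub> a \<odot>\<^bsub>M\<^esub> y"
    and smult_assoc:
      "\<lbrakk>a \<in> carrier R; b \<in> carrier R; x \<in> carrier M\<rbrakk> \<Longrightarrow>
        (a \<otimes>\<^bsub>R\<^esub> b) \<odot>\<^bsub>M\<^esub> x = a \<odot>\<^bsub>M\<^esub> (b \<odot>\<^bsub>M\<^esub> x)"
    and smult_one: "x \<in> carrier M \<Longrightarrow> \<one>\<^bsub>R\<^esub> \<odot>\<^bsub>M\<^esub> x = x"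

text \<open>
  HOL cannot quantify over types inside a formula, so modules need a fixed type of elements.
  The parameter \<open>'m\<close> is arbitrary: every module over any type \<open>'m\<close> has an isomorphic copy in
  \<open>('m, 'x, 'r) module_elt\<close>.  The second summand makes the type large enough for the condition
  on all these modules to imply the condition on all modules of any size: it can hold any quotient
  of a direct sum of two chain modules of simplicial sets over \<open>'x\<close> (such as the chains of a
  mapping cone) with coefficients in a ring over \<open>'r\<close>.
\<close>

type_synonym ('m, 'x, 'r) module_elt = "'m + (('x \<Rightarrow> 'r) \<times> ('x \<Rightarrow> 'r)) set"

end

theory Submission
  imports Defs
begin

text \<open>
  Let \<open>K\<close> be the system of the mapping cones of all representatives \<open>h : X t \<rightarrow> Y s\<close> of \<open>f\<close>.
  Then \<open>f\<close> is an \<open>R\<close>-homology weak equivalence iff all pro-groups \<open>H\<^sub>n(K)\<close> vanish, and it induces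
  isomorphisms on cohomology with coefficients in \<open>M\<close> iff all colimits of the groups \<open>H\<^sup>n(K; M)\<close>
  vanish.  If the pro-homology of \<open>K\<close> vanishes, then, as chain modules are free, one finds by
  induction on the degree transition maps that are null homotopic up to any given degree, and these
  annihilate cohomology with all coefficients.  Conversely, apply the vanishing of cohomology to the
  projection \<open>K\<^sub>n \<rightarrow> K\<^sub>n / d K\<^sub>n\<^sub>+\<^sub>1\<close>, a cocycle: on some further stage it becomes \<open>\<Psi> d\<close>, so it
  maps cycles to 0, and the transition map sends cycles to boundaries.
\<close>

section \<open>Categories and direct systems\<close>

text \<open>The obstacle is that \<open>f\<close> is not a family of maps over one index category:
  its components are germs, and each germ has representatives at many stages. Instead of reindexing
  both pro-objects to turn \<open>f\<close> into a level map, the representatives themselves index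
  the cones, with commuting squares as arrows. Statements about limits and colimits are brought down
  to single stages: an isomorphism of pro-objects is tested by maps that invert a representative up
  to transition maps, a pro-group vanishes if every stage receives a zero transition map, a colimit
  vanishes if every element dies at a further stage. The long exact sequence of a cone then becomes
  a chase through a few stages. How far one has to go back depends on the degree, so no contraction
  in all degrees at once is constructed; this suffices since a cocycle lives in one degree. The
  universal cocycle takes values in a quotient of a cone module, whose elements are sets of pairs of
  chains; this dictates the type of the coefficient modules in the theorem.\<close>

lemma cat_simps:
  assumes "category C"
  shows cat_id: "a \<in> Ob C \<Longrightarrow> Id C a \<in> Hom C a a"
    and cat_comp: "\<lbrakk>f \<in> Hom C a b; g \<in> Hom C b c; a \<in> Ob C; b \<in> Ob C; c \<in> Ob C\<rbrakk>
      \<Longrightarrow> Cmp C a b c g f \<in> Hom C a c"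
    and cat_idr: "\<lbrakk>f \<in> Hom C a b; a \<in> Ob C; b \<in> Ob C\<rbrakk> \<Longrightarrow> Cmp C a a b f (Id C a) = f"
    and cat_idl: "\<lbrakk>f \<in> Hom C a b; a \<in> Ob C; b \<in> Ob C\<rbrakk> \<Longrightarrow> Cmp C a b b (Id C b) f = f"
    and cat_assoc: "\<lbrakk>f \<in> Hom C a b; g \<in> Hom C b c; h \<in> Hom C c d;
        a \<in> Ob C; b \<in> Ob C; c \<in> Ob C; d \<in> Ob C\<rbrakk>
      \<Longrightarrow> Cmp C a b d (Cmp C b c d h g) f = Cmp C a c d h (Cmp C a b c g f)"
  using assms unfolding category_def by (blast, blast, blast, blast, metis)

lemma cofiltered_category: "cofiltered I \<Longrightarrow> category I"
  by (simp add: cofiltered_def)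

lemma cofiltered_span:
  assumes "cofiltered I" "s \<in> Ob I" "s' \<in> Ob I"
  obtains t u v where "t \<in> Ob I" "u \<in> Hom I t s" "v \<in> Hom I t s'"
  using assms unfolding cofiltered_def by blast

lemma cofiltered_equalize:
  assumes "cofiltered I" "s \<in> Ob I" "s' \<in> Ob I" "u \<in> Hom I s s'" "v \<in> Hom I s s'"
  obtains t w where "t \<in> Ob I" "w \<in> Hom I t s" "Cmp I t s s' u w = Cmp I t s s' v w"
  using assms unfolding cofiltered_def by blast

text \<open>A span over \<open>t\<close> and \<open>t'\<close> gives two parallel arrows to
  \<open>s\<close>; an arrow that equalizes them turns the span into a commutative square.\<close>

lemma cofiltered_square:
  assumes I: "cofiltered I" and ob: "s \<in> Ob I" "t \<in> Ob I" "t' \<in> Ob I"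
    and u: "u \<in> Hom I t s" and v: "v \<in> Hom I t' s"
  obtains r a b where "r \<in> Ob I" "a \<in> Hom I r t" "b \<in> Hom I r t'"
    "Cmp I r t s u a = Cmp I r t' s v b"
proof -
  have C: "category I" using I by (rule cofiltered_category)
  obtain q a b where q: "q \<in> Ob I" "a \<in> Hom I q t" "b \<in> Hom I q t'"
    using cofiltered_span[OF I ob(2,3)] .
  obtain r w where r: "r \<in> Ob I" "w \<in> Hom I r q"
    "Cmp I r q s (Cmp I q t s u a) w = Cmp I r q s (Cmp I q t' s v b) w"
    using cofiltered_equalize[OF I q(1) ob(1) cat_comp[OF C q(2) u] cat_comp[OF C q(3) v]] q ob
    by metis
  show thesis
    by (rule that[of r "Cmp I r q t a w" "Cmp I r q t' b w"])
       (use r q ob u v in \<open>simp_all add: cat_comp[OF C] cat_assoc[OF C, symmetric]\<close>)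
qed

text \<open>Common setting of the two kinds of colimits that occur: the sets of germs of which
  morphisms of pro-objects consist, and the cohomology groups.\<close>

locale direct_system =
  fixes I :: "('i, 'j) category" and S :: "'i \<Rightarrow> 'a set" and T :: "'i \<Rightarrow> 'i \<Rightarrow> 'j \<Rightarrow> 'a \<Rightarrow> 'a"
  assumes cof: "cofiltered I"
    and T_closed: "\<lbrakk>u \<in> Hom I t s; a \<in> S s; t \<in> Ob I; s \<in> Ob I\<rbrakk> \<Longrightarrow> T t s u a \<in> S t"
    and T_id: "\<lbrakk>a \<in> S s; s \<in> Ob I\<rbrakk> \<Longrightarrow> T s s (Id I s) a = a"
    and T_comp: "\<lbrakk>v \<in> Hom I r t; u \<in> Hom I t s; a \<in> S s; r \<in> Ob I; t \<in> Ob I; s \<in> Ob I\<rbrakk> \<Longrightarrow>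
      T r s (Cmp I r t s u v) a = T r t v (T t s u a)"
begin

abbreviation rel where "rel \<equiv> colim_rel I S T"

lemma I_cat: "category I"
  using cof by (rule cofiltered_category)

lemma rel_iff: "((s, a), (s', b)) \<in> rel \<longleftrightarrow> s \<in> Ob I \<and> a \<in> S s \<and> s' \<in> Ob I \<and> b \<in> S s' \<and>
     (\<exists>t\<in>Ob I. \<exists>u\<in>Hom I t s. \<exists>v\<in>Hom I t s'. T t s u a = T t s' v b)"
  by (simp add: colim_rel_def)

lemma rel_T: "\<lbrakk>u \<in> Hom I t s; a \<in> S s; t \<in> Ob I; s \<in> Ob I\<rbrakk> \<Longrightarrow> ((s, a), (t, T t s u a)) \<in> rel"
  unfolding rel_iff using T_closed T_id cat_id[OF I_cat] by metis

lemma equiv_rel: "equiv (SIGMA s:Ob I. S s) rel"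
proof (rule equivI)
  show "refl_on (SIGMA s:Ob I. S s) rel"
    unfolding refl_on_def using cat_id[OF I_cat] by (auto simp: colim_rel_def)
  show "rel \<subseteq> (SIGMA s:Ob I. S s) \<times> (SIGMA s:Ob I. S s)"
    by (auto simp: colim_rel_def)
  show "sym rel"
    unfolding colim_rel_def by (rule symI) (force intro: sym)
  show "trans rel"
  proof (rule transI)
    fix x y z assume "(x, y) \<in> rel" "(y, z) \<in> rel"
    moreover obtain s a s' b s'' c where "x = (s, a)" "y = (s', b)" "z = (s'', c)"
      by (metis surj_pair)
    ultimately obtain t u v t' u' v' where xyz: "x = (s, a)" "y = (s', b)" "z = (s'', c)"
      and ob: "s \<in> Ob I" "s' \<in> Ob I" "s'' \<in> Ob I" "t \<in> Ob I" "t' \<in> Ob I"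
      and el: "a \<in> S s" "b \<in> S s'" "c \<in> S s''"
      and uv: "u \<in> Hom I t s" "v \<in> Hom I t s'" "T t s u a = T t s' v b"
      and uv': "u' \<in> Hom I t' s'" "v' \<in> Hom I t' s''" "T t' s' u' b = T t' s'' v' c"
      by (auto simp: rel_iff)
    \<comment> \<open>Both relations are witnessed by arrows into the middle index
      \<open>s'\<close>. A square over \<open>s'\<close> provides one stage at which the two
      equations can be chained.\<close>
    obtain r p q where r: "r \<in> Ob I" "p \<in> Hom I r t" "q \<in> Hom I r t'"
      "Cmp I r t s' v p = Cmp I r t' s' u' q"
      using cofiltered_square[OF cof ob(2,4,5) uv(2) uv'(1)] .
    have "T r s (Cmp I r t s u p) a = T r s' (Cmp I r t s' v p) b"
      using r(1-3) uv ob el by (simp add: T_comp)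
    also have "\<dots> = T r s'' (Cmp I r t' s'' v' q) c"
      unfolding r(4) using r(1-3) uv' ob el by (simp add: T_comp)
    finally show "(x, z) \<in> rel"
      unfolding xyz rel_iff using ob el r(1) cat_comp[OF I_cat r(2) uv(1)] cat_comp[OF I_cat r(3) uv'(2)]
      by blast
  qed
qed

lemma rel_sym: "(x, y) \<in> rel \<Longrightarrow> (y, x) \<in> rel"
  using equiv_rel by (meson equivE symE)

lemma rel_trans: "(x, y) \<in> rel \<Longrightarrow> (y, z) \<in> rel \<Longrightarrow> (x, z) \<in> rel"
  using equiv_rel by (meson equivE transE)

lemma rel_refl: "\<lbrakk>s \<in> Ob I; a \<in> S s\<rbrakk> \<Longrightarrow> ((s, a), (s, a)) \<in> rel"
  using equiv_rel unfolding equiv_def refl_on_def by blast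

lemma colim_class: "A \<in> colim_set I S T \<Longrightarrow> p \<in> A \<Longrightarrow> A = rel `` {p}"
  unfolding colim_set_def
  by (metis Image_singleton_iff equiv_class_eq equiv_rel quotientE)

lemma colim_memD: "A \<in> colim_set I S T \<Longrightarrow> (s, a) \<in> A \<Longrightarrow> s \<in> Ob I \<and> a \<in> S s"
  unfolding colim_set_def using in_quotient_imp_subset[OF equiv_rel] by blast

lemma colim_nonempty: "A \<in> colim_set I S T \<Longrightarrow> \<exists>s a. (s, a) \<in> A"
  unfolding colim_set_def using in_quotient_imp_non_empty[OF equiv_rel] by fast

lemma colim_classI: "\<lbrakk>s \<in> Ob I; a \<in> S s\<rbrakk> \<Longrightarrow> rel `` {(s, a)} \<in> colim_set I S T"
  unfolding colim_set_def by (auto intro: quotientI)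

text \<open>Composition of pro-morphisms, levelwise maps and the operations on colimits are defined
  by saturating the values at all representatives. Well-definedness is thereby reduced to relating
  every such value to a single one.\<close>

lemma Image_eq_class:
  assumes "A \<noteq> {}" "\<And>q. q \<in> A \<Longrightarrow> (p, q) \<in> rel"
  shows "rel `` A = rel `` {p}"
  using assms rel_trans rel_sym by blast

lemma class_eq_iff: "\<lbrakk>s \<in> Ob I; a \<in> S s\<rbrakk> \<Longrightarrow>
    rel `` {(s, a)} = rel `` {p} \<longleftrightarrow> ((s, a), p) \<in> rel"
  using rel_refl rel_trans rel_sym by blast

end

section \<open>Germs and representatives of a morphism of pro-objects\<close>

lemma pro_objectD:
  assumes "pro_object C X"
  shows pro_cof: "cofiltered (Idx X)"
    and pro_Fam: "s \<in> Ob (Idx X) \<Longrightarrow> Fam X s \<in> Ob C"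
    and pro_Trans: "\<lbrakk>u \<in> Hom (Idx X) s t; s \<in> Ob (Idx X); t \<in> Ob (Idx X)\<rbrakk> \<Longrightarrow>
      Trans X s t u \<in> Hom C (Fam X s) (Fam X t)"
    and pro_Trans_id: "s \<in> Ob (Idx X) \<Longrightarrow> Trans X s s (Id (Idx X) s) = Id C (Fam X s)"
    and pro_Trans_comp: "\<lbrakk>u \<in> Hom (Idx X) r s; v \<in> Hom (Idx X) s t;
        r \<in> Ob (Idx X); s \<in> Ob (Idx X); t \<in> Ob (Idx X)\<rbrakk> \<Longrightarrow>
      Trans X r t (Cmp (Idx X) r s t v u) =
        Cmp C (Fam X r) (Fam X s) (Fam X t) (Trans X s t v) (Trans X r s u)"
  using assms unfolding pro_object_def by blast+

lemma germ_system:
  assumes C: "category C" and X: "pro_object C X" and y: "y \<in> Ob C"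
  shows "direct_system (Idx X) (\<lambda>t. Hom C (Fam X t) y)
     (\<lambda>t s u h. Cmp C (Fam X t) (Fam X s) y h (Trans X t s u))"
proof
  show "cofiltered (Idx X)" using X by (rule pro_cof)
qed (use y pro_Fam[OF X] pro_Trans[OF X] in
     \<open>simp_all add: cat_comp[OF C] cat_idr[OF C] cat_assoc[OF C] pro_Trans_id[OF X] pro_Trans_comp[OF X]\<close>)

locale pro_map =
  fixes C :: "('o, 'a) category" and X :: "('i, 'j, 'o, 'a) pro_obj"
    and Y :: "('k, 'l, 'o, 'a) pro_obj" and f :: "'k \<Rightarrow> ('i \<times> 'a) set"
  assumes cat: "category C" and X: "pro_object C X" and Y: "pro_object C Y"
    and f: "f \<in> pro_hom C X Y"
begin

abbreviation "I \<equiv> Idx X"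
abbreviation "J \<equiv> Idx Y"
abbreviation "XX \<equiv> Fam X"
abbreviation "YY \<equiv> Fam Y"
abbreviation "TX \<equiv> Trans X"
abbreviation "TY \<equiv> Trans Y"

lemmas I_cof = pro_cof[OF X] and J_cof = pro_cof[OF Y]
lemmas I_cat = cofiltered_category[OF I_cof] and J_cat = cofiltered_category[OF J_cof]
lemmas XX = pro_Fam[OF X] and YY = pro_Fam[OF Y]
lemmas TX = pro_Trans[OF X] and TY = pro_Trans[OF Y]
lemmas TX_comp = pro_Trans_comp[OF X] and TY_comp = pro_Trans_comp[OF Y]
lemmas TX_id = pro_Trans_id[OF X] and TY_id = pro_Trans_id[OF Y]

lemma germ_sys: "s \<in> Ob J \<Longrightarrow> direct_system I (\<lambda>t. Hom C (XX t) (YY s))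
     (\<lambda>t s' u h. Cmp C (XX t) (XX s') (YY s) h (TX t s' u))"
  using germ_system[OF cat X YY] .

lemma f_germs: "s \<in> Ob J \<Longrightarrow> f s \<in> germs C X (YY s)"
  using f by (auto simp: pro_hom_def)

lemma fD: "\<lbrakk>(t, h) \<in> f s; s \<in> Ob J\<rbrakk> \<Longrightarrow> t \<in> Ob I \<and> h \<in> Hom C (XX t) (YY s)"
  using direct_system.colim_memD[OF germ_sys f_germs[unfolded germs_def]] .

lemma fD1: "\<lbrakk>(t, h) \<in> f s; s \<in> Ob J\<rbrakk> \<Longrightarrow> t \<in> Ob I"
  and fD2: "\<lbrakk>(t, h) \<in> f s; s \<in> Ob J\<rbrakk> \<Longrightarrow> h \<in> Hom C (XX t) (YY s)"
  using fD by auto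

lemma f_nonempty: assumes "s \<in> Ob J" obtains t h where "(t, h) \<in> f s"
  using direct_system.colim_nonempty[OF germ_sys f_germs[unfolded germs_def], OF assms assms] by blast

lemma f_class: "\<lbrakk>(t, h) \<in> f s; s \<in> Ob J\<rbrakk> \<Longrightarrow> f s = germ_rel C X (YY s) `` {(t, h)}"
  unfolding germ_rel_def
  by (rule direct_system.colim_class[OF germ_sys f_germs[unfolded germs_def]])

lemma f_pre:
  assumes h: "(t, h) \<in> f s" and s: "s \<in> Ob J" and u: "u \<in> Hom I t' t" "t' \<in> Ob I"
  shows "(t', Cmp C (XX t') (XX t) (YY s) h (TX t' t u)) \<in> f s"
  unfolding f_class[OF h s] germ_rel_def Image_singleton_iff
  by (rule direct_system.rel_T[OF germ_sys[OF s] u(1) fD2[OF h s] u(2) fD1[OF h s]])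

lemma f_post: "\<lbrakk>(t, h) \<in> f s'; w \<in> Hom J s' s; s' \<in> Ob J; s \<in> Ob J\<rbrakk> \<Longrightarrow>
    (t, Cmp C (XX t) (YY s') (YY s) (TY s' s w) h) \<in> f s"
  using f unfolding pro_hom_def mem_Collect_eq by fast

lemma f_join:
  assumes h: "(t, h) \<in> f s" "(t', h') \<in> f s" and s: "s \<in> Ob J"
  obtains r u v where "r \<in> Ob I" "u \<in> Hom I r t" "v \<in> Hom I r t'"
    "Cmp C (XX r) (XX t) (YY s) h (TX r t u) = Cmp C (XX r) (XX t') (YY s) h' (TX r t' v)"
proof -
  have "((t, h), (t', h')) \<in> germ_rel C X (YY s)"
    using h(2) unfolding f_class[OF h(1) s] by simp
  then show thesis
    using that unfolding germ_rel_def colim_rel_def by blast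
qed

lemma f_span:
  assumes s: "s \<in> Ob J" and t: "t \<in> Ob I"
  obtains t' h u where "(t', h) \<in> f s" "u \<in> Hom I t' t" "t' \<in> Ob I"
proof -
  obtain t0 h where h: "(t0, h) \<in> f s" using f_nonempty[OF s] .
  obtain t' u v where "t' \<in> Ob I" "u \<in> Hom I t' t" "v \<in> Hom I t' t0"
    using cofiltered_span[OF I_cof t fD1[OF h s]] .
  then show thesis using that f_pre[OF h s] by blast
qed

text \<open>Compatibility of the family \<open>f\<close> with \<open>w\<close> at the level of
  representatives: \<open>h'\<close> followed by the transition map along \<open>w\<close>
  represents the same germ as \<open>h\<close>, so the two agree after restriction to a common
  \<open>r\<close>.\<close>

lemma f_square:
  assumes s: "s \<in> Ob J" and s': "s' \<in> Ob J" and h: "(t, h) \<in> f s" and w: "w \<in> Hom J s' s"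
    and h': "(t', h') \<in> f s'"
  obtains r u v where "r \<in> Ob I" "u \<in> Hom I r t" "v \<in> Hom I r t'"
    "(r, Cmp C (XX r) (XX t') (YY s') h' (TX r t' v)) \<in> f s'"
    "Cmp C (XX r) (XX t) (YY s) h (TX r t u) =
     Cmp C (XX r) (YY s') (YY s) (TY s' s w) (Cmp C (XX r) (XX t') (YY s') h' (TX r t' v))"
proof -
  obtain r u v where r: "r \<in> Ob I" "u \<in> Hom I r t" "v \<in> Hom I r t'"
    "Cmp C (XX r) (XX t) (YY s) h (TX r t u) =
     Cmp C (XX r) (XX t') (YY s) (Cmp C (XX t') (YY s') (YY s) (TY s' s w) h') (TX r t' v)"
    using f_join[OF h f_post[OF h' w s' s] s] .
  show thesis
    by (rule that[OF r(1-3) f_pre[OF h' s' r(3,1)]])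
       (simp only: r(4) cat_assoc[OF cat TX[OF r(3,1) fD1[OF h' s']] fD2[OF h' s'] TY[OF w s' s]
         XX[OF r(1)] XX[OF fD1[OF h' s']] YY[OF s'] YY[OF s]])
qed

text \<open>Differs from \<open>f_square\<close> in that the arrow on the side of \<open>X\<close>
  has to factor through the given \<open>u\<close>. Comparing germs yields two arrows
  \<open>x\<close> and \<open>y\<close> from \<open>q\<close> to \<open>t'\<close>; equalizing them
  makes the square commute over \<open>u\<close> followed by one arrow.\<close>

lemma f_square_along:
  assumes s: "s \<in> Ob J" and s': "s' \<in> Ob J" and h: "(t, h) \<in> f s" and w: "w \<in> Hom J s' s"
    and h': "(t', h') \<in> f s'" and u: "u \<in> Hom I t' t"
  obtains r v where "r \<in> Ob I" "v \<in> Hom I r t'"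
    "Cmp C (XX r) (XX t) (YY s) h (TX r t (Cmp I r t' t u v)) =
     Cmp C (XX r) (YY s') (YY s) (TY s' s w) (Cmp C (XX r) (XX t') (YY s') h' (TX r t' v))"
proof -
  note t = fD1[OF h s] and t' = fD1[OF h' s'] and hh = fD2[OF h s] fD2[OF h' s']
  obtain q x y where q: "q \<in> Ob I" "x \<in> Hom I q t'" "y \<in> Hom I q t'"
    "Cmp C (XX q) (XX t') (YY s) (Cmp C (XX t') (XX t) (YY s) h (TX t' t u)) (TX q t' x) =
     Cmp C (XX q) (XX t') (YY s) (Cmp C (XX t') (YY s') (YY s) (TY s' s w) h') (TX q t' y)"
    using f_join[OF f_pre[OF h s u t'] f_post[OF h' w s' s] s] .
  obtain r c where r: "r \<in> Ob I" "c \<in> Hom I r q" "Cmp I r q t' x c = Cmp I r q t' y c"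
    using cofiltered_equalize[OF I_cof q(1) t' q(2,3)] .
  note obs = s s' t t' q(1) r(1)
  show thesis
  proof (rule that[OF r(1) cat_comp[OF I_cat r(2) q(2) r(1) q(1) t']])
    have "Cmp C (XX r) (XX t) (YY s) h (TX r t (Cmp I r t' t u (Cmp I r q t' x c))) =
      Cmp C (XX r) (XX q) (YY s) (Cmp C (XX q) (XX t') (YY s) (Cmp C (XX t') (XX t) (YY s) h (TX t' t u)) (TX q t' x)) (TX r q c)"
      using obs u hh q(2) r(2) by (simp add: TX_comp cat_comp[OF I_cat] cat_comp[OF cat] cat_assoc[OF cat] XX YY TX)
    also have "\<dots> = Cmp C (XX r) (YY s') (YY s) (TY s' s w) (Cmp C (XX r) (XX t') (YY s') h' (TX r t' (Cmp I r q t' x c)))"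
      unfolding q(4) r(3) using obs w hh q(3) r(2)
      by (simp add: TX_comp cat_comp[OF cat] cat_assoc[OF cat] XX YY TX TY)
    finally show "Cmp C (XX r) (XX t) (YY s) h (TX r t (Cmp I r t' t u (Cmp I r q t' x c))) =
      Cmp C (XX r) (YY s') (YY s) (TY s' s w) (Cmp C (XX r) (XX t') (YY s') h' (TX r t' (Cmp I r q t' x c)))" .
  qed
qed

end

section \<open>Isomorphisms of pro-objects\<close>

context pro_map
begin

text \<open>The stagewise test for isomorphisms of pro-objects: some \<open>k\<close> from a further
  stage of \<open>Y\<close> back to \<open>XX t\<close> inverts \<open>h\<close> up to transition
  maps on both sides. No coherence between the maps \<open>k\<close> for different representatives
  is built in; it is derived below.\<close>

definition invertible_at :: "'k \<Rightarrow> 'i \<Rightarrow> 'a \<Rightarrow> bool" where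
  "invertible_at s t h \<longleftrightarrow> (\<exists>s' w t' h' u k. s' \<in> Ob J \<and> w \<in> Hom J s' s \<and> t' \<in> Ob I \<and> u \<in> Hom I t' t \<and>
     (t', h') \<in> f s' \<and> k \<in> Hom C (YY s') (XX t) \<and>
     Cmp C (XX t') (YY s') (XX t) k h' = TX t' t u \<and> Cmp C (YY s') (XX t) (YY s) h k = TY s' s w)"

lemma pro_iso_imp_invertible_at:
  assumes iso: "pro_iso C X Y f" and s: "s \<in> Ob J" and h: "(t, h) \<in> f s"
  shows "invertible_at s t h"
proof -
  obtain g where g: "g \<in> pro_hom C Y X" and gf: "pro_comp C X Y X g f = pro_id C X"
    and fg: "pro_comp C Y X Y f g = pro_id C Y"
    using iso unfolding pro_iso_def by blast
  interpret G: pro_map C Y X g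
    by unfold_locales (rule cat Y X g)+
  have t: "t \<in> Ob I" using fD1[OF h s] .
  obtain s1 k1 where k1: "(s1, k1) \<in> g t" using G.f_nonempty[OF t] .
  note k1' = G.fD1[OF k1 t] G.fD2[OF k1 t]
  interpret sys: direct_system J "\<lambda>r. Hom C (YY r) (YY s)"
    "\<lambda>r s' u h. Cmp C (YY r) (YY s') (YY s) h (TY r s' u)"
    using germ_system[OF cat Y YY[OF s]] .
  \<comment> \<open>\<open>h k1\<close> represents the component of \<open>f g\<close> at
    \<open>s\<close>, hence the germ of the identity. Unfolding the germ relation gives a stage
    \<open>s2\<close> at which it becomes a transition map.\<close>
  have "(s1, Cmp C (YY s1) (XX t) (YY s) h k1) \<in> pro_comp C Y X Y f g s"
    unfolding pro_comp_def germ_rel_def using s h k1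
    by (auto intro!: exI sys.rel_refl cat_comp[OF cat] k1' fD2[OF h s] XX YY t)
  then have "(s1, Cmp C (YY s1) (XX t) (YY s) h k1) \<in> pro_id C Y s"
    unfolding fg .
  then obtain s2 v w where s2: "s2 \<in> Ob J" "v \<in> Hom J s2 s1" "w \<in> Hom J s2 s"
    "Cmp C (YY s2) (YY s) (YY s) (category.Id C (YY s)) (TY s2 s w) =
     Cmp C (YY s2) (YY s1) (YY s) (Cmp C (YY s1) (XX t) (YY s) h k1) (TY s2 s1 v)"
    unfolding pro_id_def germ_rel_def using s by (auto simp: colim_rel_def)
  \<comment> \<open>After this restriction \<open>h k2\<close> is a transition map and stays so: the
    second identity is used for \<open>k2\<close>, and it restricts only the source of
    \<open>h1\<close> in \<open>X\<close>.\<close>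
  define k2 where "k2 = Cmp C (YY s2) (YY s1) (XX t) k1 (TY s2 s1 v)"
  have k2: "(s2, k2) \<in> g t"
    unfolding k2_def using G.f_pre[OF k1 t s2(2,1)] .
  note k2' = G.fD2[OF k2 t]
  have hk: "Cmp C (YY s2) (XX t) (YY s) h k2 = TY s2 s w"
    using s2(4) unfolding k2_def
    using cat_assoc[OF cat TY[OF s2(2,1) k1'(1)] k1'(2) fD2[OF h s] YY[OF s2(1)] YY[OF k1'(1)] XX[OF t] YY[OF s]]
      cat_idl[OF cat TY[OF s2(3,1) s] YY[OF s2(1)] YY[OF s]] by simp
  obtain t1 h1 where h1: "(t1, h1) \<in> f s2" using f_nonempty[OF s2(1)] .
  note h1' = fD1[OF h1 s2(1)] fD2[OF h1 s2(1)]
  interpret sys': direct_system I "\<lambda>r. Hom C (XX r) (XX t)"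
    "\<lambda>r s' u h. Cmp C (XX r) (XX s') (XX t) h (TX r s' u)"
    using germ_system[OF cat X XX[OF t]] .
  have "(t1, Cmp C (XX t1) (YY s2) (XX t) k2 h1) \<in> pro_comp C X Y X g f t"
    unfolding pro_comp_def germ_rel_def using t h1 k2
    by (auto intro!: exI sys'.rel_refl cat_comp[OF cat] k2' h1' XX YY t s2)
  then have "(t1, Cmp C (XX t1) (YY s2) (XX t) k2 h1) \<in> pro_id C X t"
    unfolding gf .
  then obtain t2 a u where t2: "t2 \<in> Ob I" "a \<in> Hom I t2 t1" "u \<in> Hom I t2 t"
    "Cmp C (XX t2) (XX t) (XX t) (category.Id C (XX t)) (TX t2 t u) =
     Cmp C (XX t2) (XX t1) (XX t) (Cmp C (XX t1) (YY s2) (XX t) k2 h1) (TX t2 t1 a)"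
    unfolding pro_id_def germ_rel_def using t by (auto simp: colim_rel_def)
  have "Cmp C (XX t2) (YY s2) (XX t) k2 (Cmp C (XX t2) (XX t1) (YY s2) h1 (TX t2 t1 a)) = TX t2 t u"
    using t2(4) cat_assoc[OF cat TX[OF t2(2,1) h1'(1)] h1'(2) k2' XX[OF t2(1)] XX[OF h1'(1)] YY[OF s2(1)] XX[OF t]]
      cat_idl[OF cat TX[OF t2(3,1) t] XX[OF t2(1)] XX[OF t]] by simp
  then show ?thesis
    unfolding invertible_at_def
    using s2(1,3) t2(1,3) f_pre[OF h1 s2(1) t2(2,1)] k2' hk by blast
qed

text \<open>The germ at \<open>t\<close> of the inverse of \<open>f\<close>, singled out by the left
  inverse equation alone. Collecting all such \<open>k\<close> avoids choices: once the set is known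
  to be a single class, compatibility with the transition maps of \<open>X\<close> is
  immediate.\<close>

definition inv_rep :: "'i \<Rightarrow> ('k \<times> 'a) set" where
  "inv_rep t = {(s, k). s \<in> Ob J \<and> k \<in> Hom C (YY s) (XX t) \<and>
     (\<exists>t' h u. (t', h) \<in> f s \<and> u \<in> Hom I t' t \<and> Cmp C (XX t') (YY s) (XX t) k h = TX t' t u)}"

lemma inv_repD: "(s, k) \<in> inv_rep t \<Longrightarrow> s \<in> Ob J" "(s, k) \<in> inv_rep t \<Longrightarrow> k \<in> Hom C (YY s) (XX t)"
  by (auto simp: inv_rep_def)

text \<open>The definition of \<open>inv_rep\<close> provides one representative of \<open>f\<close>
  that \<open>k\<close> inverts. Any other one agrees with it after restriction, so \<open>k\<close>
  inverts that one as well.\<close>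

lemma inv_rep_refine:
  assumes k: "(s, k) \<in> inv_rep t" and h1: "(t1, h1) \<in> f s" and t: "t \<in> Ob I"
  obtains t2 a u where "t2 \<in> Ob I" "a \<in> Hom I t2 t1" "u \<in> Hom I t2 t"
    "Cmp C (XX t2) (YY s) (XX t) k (Cmp C (XX t2) (XX t1) (YY s) h1 (TX t2 t1 a)) = TX t2 t u"
proof -
  have s: "s \<in> Ob J" and k': "k \<in> Hom C (YY s) (XX t)" using k by (auto dest: inv_repD)
  obtain t' h u where h: "(t', h) \<in> f s" "u \<in> Hom I t' t" "Cmp C (XX t') (YY s) (XX t) k h = TX t' t u"
    using k unfolding inv_rep_def by blast
  note h' = fD1[OF h(1) s] fD2[OF h(1) s]
  obtain r v a where r: "r \<in> Ob I" "v \<in> Hom I r t'" "a \<in> Hom I r t1"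
    "Cmp C (XX r) (XX t') (YY s) h (TX r t' v) = Cmp C (XX r) (XX t1) (YY s) h1 (TX r t1 a)"
    using f_join[OF h(1) h1 s] .
  show thesis
  proof (rule that[OF r(1,3) cat_comp[OF I_cat r(2) h(2) r(1) h'(1) t]])
    show "Cmp C (XX r) (YY s) (XX t) k (Cmp C (XX r) (XX t1) (YY s) h1 (TX r t1 a)) =
      TX r t (Cmp I r t' t u v)"
      unfolding r(4)[symmetric] TX_comp[OF r(2) h(2) r(1) h'(1) t] h(3)[symmetric]
      using r(1,2) s h' t k' by (simp add: cat_assoc[OF cat] XX YY TX)
  qed
qed

text \<open>\<open>k\<close> and \<open>k'\<close> agree on some \<open>YY r\<close>. A
  representative of \<open>f\<close> at \<open>r\<close> that \<open>k\<close> inverts after the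
  transition map to \<open>s\<close> is therefore also inverted by \<open>k'\<close> after the
  transition map to \<open>s'\<close>.\<close>

lemma inv_rep_closed:
  assumes k: "(s, k) \<in> inv_rep t" and rel: "((s, k), (s', k')) \<in> germ_rel C Y (XX t)" and t: "t \<in> Ob I"
  shows "(s', k') \<in> inv_rep t"
proof -
  have s: "s \<in> Ob J" "k \<in> Hom C (YY s) (XX t)" using k by (auto dest: inv_repD)
  obtain r v v' where s': "s' \<in> Ob J" "k' \<in> Hom C (YY s') (XX t)"
    and r: "r \<in> Ob J" "v \<in> Hom J r s" "v' \<in> Hom J r s'"
    "Cmp C (YY r) (YY s) (XX t) k (TY r s v) = Cmp C (YY r) (YY s') (XX t) k' (TY r s' v')"
    using rel unfolding germ_rel_def colim_rel_def by auto
  obtain t1 h1 where h1: "(t1, h1) \<in> f r" using f_nonempty[OF r(1)] .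
  note h1' = fD1[OF h1 r(1)] fD2[OF h1 r(1)]
  obtain t2 a u where t2: "t2 \<in> Ob I" "a \<in> Hom I t2 t1" "u \<in> Hom I t2 t"
    "Cmp C (XX t2) (YY s) (XX t) k (Cmp C (XX t2) (XX t1) (YY s)
       (Cmp C (XX t1) (YY r) (YY s) (TY r s v) h1) (TX t2 t1 a)) = TX t2 t u"
    using inv_rep_refine[OF k f_post[OF h1 r(2,1) s(1)] t] .
  define h2 where "h2 = Cmp C (XX t2) (XX t1) (YY r) h1 (TX t2 t1 a)"
  have h2: "(t2, h2) \<in> f r" unfolding h2_def by (rule f_pre[OF h1 r(1) t2(2,1)])
  note h2' = fD2[OF h2 r(1)]
  have "Cmp C (XX t2) (YY s') (XX t) k' (Cmp C (XX t2) (YY r) (YY s') (TY r s' v') h2) =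
    Cmp C (XX t2) (YY r) (XX t) (Cmp C (YY r) (YY s') (XX t) k' (TY r s' v')) h2"
    using r(1-3) s s' h2' t2(1-3) t by (simp add: cat_assoc[OF cat] XX YY TY)
  also have "\<dots> = TX t2 t u"
    unfolding r(4)[symmetric] t2(4)[symmetric] h2_def
    using r(1-3) s s' h1' t2(1-3) t by (simp add: cat_assoc[OF cat] cat_comp[OF cat] XX YY TX TY)
  finally show ?thesis
    unfolding inv_rep_def using s' t2(3) f_post[OF h2 r(3,1) s'(1)] by blast
qed

text \<open>Invertibility is asked for only after a restriction along some \<open>u0\<close>. This
  is the form that is available for levelwise maps, where a germ may have representatives that come
  from \<open>f\<close> only after restriction.\<close>

context
  assumes inv: "\<And>s t h. \<lbrakk>s \<in> Ob J; (t, h) \<in> f s\<rbrakk> \<Longrightarrow> \<exists>t0 u0. t0 \<in> Ob I \<and> u0 \<in> Hom I t0 t \<and>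
    invertible_at s t0 (Cmp C (XX t0) (XX t) (YY s) h (TX t0 t u0))"
begin

text \<open>The local inverse makes a transition map of \<open>Y\<close> factor through
  \<open>h\<close>. Two maps that agree after \<open>h\<close> therefore agree after that transition
  map, so \<open>f\<close> is an epimorphism.\<close>

lemma f_epi:
  assumes h: "(t, h) \<in> f s" and s: "s \<in> Ob J" and c: "c \<in> Ob C"
    and z: "z \<in> Hom C (YY s) c" "z' \<in> Hom C (YY s) c"
    and eq: "Cmp C (XX t) (YY s) c z h = Cmp C (XX t) (YY s) c z' h"
  obtains s' w where "s' \<in> Ob J" "w \<in> Hom J s' s"
    "Cmp C (YY s') (YY s) c z (TY s' s w) = Cmp C (YY s') (YY s) c z' (TY s' s w)"
proof -
  note h' = fD1[OF h s] fD2[OF h s]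
  obtain t0 u0 where t0: "t0 \<in> Ob I" "u0 \<in> Hom I t0 t"
    and i: "invertible_at s t0 (Cmp C (XX t0) (XX t) (YY s) h (TX t0 t u0))"
    using inv[OF s h] by blast
  from i obtain s' w k where k: "s' \<in> Ob J" "w \<in> Hom J s' s" "k \<in> Hom C (YY s') (XX t0)"
    "Cmp C (YY s') (XX t0) (YY s) (Cmp C (XX t0) (XX t) (YY s) h (TX t0 t u0)) k = TY s' s w"
    unfolding invertible_at_def by blast
  have "Cmp C (YY s') (YY s) c y (TY s' s w) = Cmp C (YY s') (XX t) c (Cmp C (XX t) (YY s) c y h)
      (Cmp C (YY s') (XX t0) (XX t) (TX t0 t u0) k)" if "y \<in> Hom C (YY s) c" for y
    unfolding k(4)[symmetric] using that k(1-3) t0 h' s c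
    by (simp add: cat_assoc[OF cat] cat_comp[OF cat] XX YY TX)
  then show thesis
    using that[OF k(1,2)] z eq by simp
qed

text \<open>Any index \<open>s\<close> of \<open>Y\<close> serves: some representative at
  \<open>s\<close> has a source over \<open>t\<close>, and its local inverse is composed with the
  transition map down to \<open>t\<close>.\<close>

lemma inv_rep_exists:
  assumes t: "t \<in> Ob I" shows "inv_rep t \<noteq> {}"
proof -
  obtain s where s: "s \<in> Ob J" using J_cof unfolding cofiltered_def by blast
  obtain t1 h u1 where h: "(t1, h) \<in> f s" "u1 \<in> Hom I t1 t" "t1 \<in> Ob I" using f_span[OF s t] .
  obtain t0 u0 where t0: "t0 \<in> Ob I" "u0 \<in> Hom I t0 t1"
    and i: "invertible_at s t0 (Cmp C (XX t0) (XX t1) (YY s) h (TX t0 t1 u0))"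
    using inv[OF s h(1)] by blast
  from i obtain s' w t' h' u k where k: "s' \<in> Ob J" "t' \<in> Ob I" "u \<in> Hom I t' t0"
    "(t', h') \<in> f s'" "k \<in> Hom C (YY s') (XX t0)"
    "Cmp C (XX t') (YY s') (XX t0) k h' = TX t' t0 u"
    unfolding invertible_at_def by blast
  define v where "v = Cmp I t0 t1 t u1 u0"
  have v: "v \<in> Hom I t0 t" unfolding v_def using cat_comp[OF I_cat t0(2) h(2) t0(1) h(3) t] .
  have "Cmp C (XX t') (YY s') (XX t) (Cmp C (YY s') (XX t0) (XX t) (TX t0 t v) k) h' =
    TX t' t (Cmp I t' t0 t v u)"
    unfolding TX_comp[OF k(3) v k(2) t0(1) t] k(6)[symmetric]
    using v k(1-3,5) fD2[OF k(4,1)] t0 t by (simp add: cat_assoc[OF cat] XX YY TX)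
  then have "(s', Cmp C (YY s') (XX t0) (XX t) (TX t0 t v) k) \<in> inv_rep t"
    unfolding inv_rep_def
    using k(1,4) cat_comp[OF cat k(5) TX[OF v t0(1) t] YY[OF k(1)] XX[OF t0(1)] XX[OF t]]
      cat_comp[OF I_cat k(3) v k(2) t0(1) t] by blast
  then show ?thesis by blast
qed

text \<open>After restriction to a common \<open>YY r\<close>, both maps become transition maps to
  \<open>XX t\<close> when composed with a representative of \<open>f\<close> that is far enough
  out. At a stage where these transition maps coincide, \<open>f_epi\<close> cancels the
  representative.\<close>

lemma inv_rep_unique:
  assumes k: "(s, k) \<in> inv_rep t" and k': "(s', k') \<in> inv_rep t" and t: "t \<in> Ob I"
  shows "((s, k), (s', k')) \<in> germ_rel C Y (XX t)"
proof -
  have s: "s \<in> Ob J" "k \<in> Hom C (YY s) (XX t)" using k by (auto dest: inv_repD)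
  have s': "s' \<in> Ob J" "k' \<in> Hom C (YY s') (XX t)" using k' by (auto dest: inv_repD)
  obtain r v v' where r: "r \<in> Ob J" "v \<in> Hom J r s" "v' \<in> Hom J r s'"
    using cofiltered_span[OF J_cof s(1) s'(1)] .
  define z where "z = Cmp C (YY r) (YY s) (XX t) k (TY r s v)"
  define z' where "z' = Cmp C (YY r) (YY s') (XX t) k' (TY r s' v')"
  have zz: "z \<in> Hom C (YY r) (XX t)" "z' \<in> Hom C (YY r) (XX t)"
    unfolding z_def z'_def using s s' r t by (auto intro!: cat_comp[OF cat] XX YY TY)
  have rz: "((s, k), (r, z)) \<in> germ_rel C Y (XX t)" and rz': "((s', k'), (r, z')) \<in> germ_rel C Y (XX t)"
    unfolding germ_rel_def z_def z'_def
    by (rule direct_system.rel_T[OF germ_system[OF cat Y XX[OF t]]]; use r s s' in simp)+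
  note k1 = inv_rep_closed[OF k rz t] and k1' = inv_rep_closed[OF k' rz' t]
  obtain t1 h1 where h1: "(t1, h1) \<in> f r" using f_nonempty[OF r(1)] .
  obtain t2 a u where t2: "t2 \<in> Ob I" "a \<in> Hom I t2 t1" "u \<in> Hom I t2 t"
    "Cmp C (XX t2) (YY r) (XX t) z (Cmp C (XX t2) (XX t1) (YY r) h1 (TX t2 t1 a)) = TX t2 t u"
    using inv_rep_refine[OF k1 h1 t] .
  define h2 where "h2 = Cmp C (XX t2) (XX t1) (YY r) h1 (TX t2 t1 a)"
  have h2: "(t2, h2) \<in> f r" unfolding h2_def by (rule f_pre[OF h1 r(1) t2(2,1)])
  note h2' = fD2[OF h2 r(1)]
  obtain t3 b u' where t3: "t3 \<in> Ob I" "b \<in> Hom I t3 t2" "u' \<in> Hom I t3 t"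
    "Cmp C (XX t3) (YY r) (XX t) z' (Cmp C (XX t3) (XX t2) (YY r) h2 (TX t3 t2 b)) = TX t3 t u'"
    using inv_rep_refine[OF k1' h2 t] .
  have ub: "Cmp I t3 t2 t u b \<in> Hom I t3 t"
    using cat_comp[OF I_cat t3(2) t2(3) t3(1) t2(1) t] .
  \<comment> \<open>The composites of \<open>z\<close> and \<open>z'\<close> with \<open>h3\<close>
    are transition maps along two parallel arrows from \<open>t3\<close> to \<open>t\<close>, which
    may differ in the index category; \<open>t4\<close> equalizes them.\<close>
  obtain t4 c where t4: "t4 \<in> Ob I" "c \<in> Hom I t4 t3"
    "Cmp I t4 t3 t (Cmp I t3 t2 t u b) c = Cmp I t4 t3 t u' c"
    using cofiltered_equalize[OF I_cof t3(1) t ub t3(3)] .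
  define h3 where "h3 = Cmp C (XX t3) (XX t2) (YY r) h2 (TX t3 t2 b)"
  have h3: "(t3, h3) \<in> f r" unfolding h3_def by (rule f_pre[OF h2 r(1) t3(2,1)])
  note h3' = fD2[OF h3 r(1)]
  have zh3: "Cmp C (XX t3) (YY r) (XX t) z h3 = TX t3 t (Cmp I t3 t2 t u b)"
    unfolding h3_def TX_comp[OF t3(2) t2(3) t3(1) t2(1) t] t2(4)[folded h2_def, symmetric]
    using zz h2' r(1) t2(1) t3(1,2) t by (simp add: cat_assoc[OF cat] XX YY TX)
  have "Cmp C (XX t4) (YY r) (XX t) y (Cmp C (XX t4) (XX t3) (YY r) h3 (TX t4 t3 c)) =
    Cmp C (XX t4) (XX t3) (XX t) (Cmp C (XX t3) (YY r) (XX t) y h3) (TX t4 t3 c)"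
    if "y \<in> Hom C (YY r) (XX t)" for y
    using that h3' r(1) t3(1) t4(1,2) t by (simp add: cat_assoc[OF cat] XX YY TX)
  then have "Cmp C (XX t4) (YY r) (XX t) z (Cmp C (XX t4) (XX t3) (YY r) h3 (TX t4 t3 c)) =
    Cmp C (XX t4) (YY r) (XX t) z' (Cmp C (XX t4) (XX t3) (YY r) h3 (TX t4 t3 c))"
    using zz TX_comp[OF t4(2) ub t4(1) t3(1) t] TX_comp[OF t4(2) t3(3) t4(1) t3(1) t] t4(3)
    by (simp add: zh3 t3(4)[folded h3_def])
  then obtain q w where q: "q \<in> Ob J" "w \<in> Hom J q r"
    "Cmp C (YY q) (YY r) (XX t) z (TY q r w) = Cmp C (YY q) (YY r) (XX t) z' (TY q r w)"
    using f_epi[OF f_pre[OF h3 r(1) t4(2,1)] r(1) XX[OF t] zz] by blast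
  interpret sys: direct_system J "\<lambda>q. Hom C (YY q) (XX t)"
    "\<lambda>q s u h. Cmp C (YY q) (YY s) (XX t) h (TY q s u)"
    using germ_system[OF cat Y XX[OF t]] .
  have "((r, z), (r, z')) \<in> germ_rel C Y (XX t)"
    unfolding germ_rel_def sys.rel_iff using q r(1) zz by blast
  then show ?thesis
    using rz rz' sys.rel_sym sys.rel_trans unfolding germ_rel_def by blast
qed

lemma inv_rep_class:
  assumes k: "(s, k) \<in> inv_rep t" and t: "t \<in> Ob I"
  shows "inv_rep t = germ_rel C Y (XX t) `` {(s, k)}"
  using inv_rep_unique[OF k _ t] inv_rep_closed[OF k _ t] by auto

text \<open>That \<open>g f\<close> is the identity is the defining property of
  \<open>inv_rep\<close>. The equation for \<open>f g\<close> follows from it because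
  \<open>f\<close> is an epimorphism.\<close>

lemma pro_isoI: "pro_iso C X Y f"
proof -
  define g where "g = (\<lambda>t\<in>Ob I. inv_rep t)"
  have g: "g \<in> pro_hom C Y X"
    unfolding pro_hom_def
  proof (intro CollectI conjI ballI)
    show "g \<in> (\<Pi>\<^sub>E t\<in>Ob I. germs C Y (XX t))"
    proof (rule PiE_I)
      fix t assume t: "t \<in> Ob I"
      obtain s k where k: "(s, k) \<in> inv_rep t" using inv_rep_exists[OF t] by auto
      show "g t \<in> germs C Y (XX t)"
        unfolding germs_def g_def restrict_apply using t
        using direct_system.colim_classI[OF germ_system[OF cat Y XX[OF t]] inv_repD[OF k]]
        by (simp add: inv_rep_class[OF k t] germ_rel_def)
    qed (simp add: g_def)
    fix t t' u p assume t: "t \<in> Ob I" "t' \<in> Ob I" and u: "u \<in> Hom I t t'" and p: "p \<in> g t"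
    obtain s k where pk: "p = (s, k)" "(s, k) \<in> inv_rep t" using p t by (cases p) (auto simp: g_def)
    have s: "s \<in> Ob J" "k \<in> Hom C (YY s) (XX t)" using pk(2) by (auto dest: inv_repD)
    obtain t1 h v where h: "(t1, h) \<in> f s" "v \<in> Hom I t1 t" "Cmp C (XX t1) (YY s) (XX t) k h = TX t1 t v"
      using pk(2) unfolding inv_rep_def by blast
    note h' = fD1[OF h(1) s(1)] fD2[OF h(1) s(1)]
    have "Cmp C (XX t1) (YY s) (XX t') (Cmp C (YY s) (XX t) (XX t') (TX t t' u) k) h =
       TX t1 t' (Cmp I t1 t t' u v)"
      unfolding TX_comp[OF h(2) u h'(1) t] h(3)[symmetric]
      using s t u h' by (simp add: cat_assoc[OF cat] XX YY TX)
    then have "(s, Cmp C (YY s) (XX t) (XX t') (TX t t' u) k) \<in> inv_rep t'"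
      unfolding inv_rep_def using s h(1) cat_comp[OF cat s(2) TX[OF u t] YY[OF s(1)] XX[OF t(1)] XX[OF t(2)]]
        cat_comp[OF I_cat h(2) u h'(1) t] by blast
    then show "case p of (s, k) \<Rightarrow> (s, Cmp C (YY s) (XX t) (XX t') (TX t t' u) k) \<in> g t'"
      using t pk(1) by (simp add: g_def)
  qed
  have gf: "pro_comp C X Y X g f = pro_id C X"
    unfolding pro_comp_def pro_id_def
  proof (rule restrict_ext)
    fix t assume t: "t \<in> Ob I"
    interpret sys: direct_system I "\<lambda>q. Hom C (XX q) (XX t)"
      "\<lambda>q s u h. Cmp C (XX q) (XX s) (XX t) h (TX q s u)"
      using germ_system[OF cat X XX[OF t]] .
    show "germ_rel C X (XX t) `` {(t', Cmp C (XX t') (YY s) (XX t) h k) |s h t' k.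
            (s, h) \<in> g t \<and> (t', k) \<in> f s} = germ_rel C X (XX t) `` {(t, category.Id C (XX t))}"
      unfolding germ_rel_def
    proof (rule sys.Image_eq_class)
      obtain s k where k: "(s, k) \<in> g t" using inv_rep_exists[OF t] t by (auto simp: g_def)
      obtain t' h where "(t', h) \<in> f s"
        using k t f_nonempty inv_repD(1) by (metis g_def restrict_apply')
      then show "{(t', Cmp C (XX t') (YY s) (XX t) h k) |s h t' k. (s, h) \<in> g t \<and> (t', k) \<in> f s} \<noteq> {}"
        using k by blast
      fix p assume "p \<in> {(t', Cmp C (XX t') (YY s) (XX t) h k) |s h t' k. (s, h) \<in> g t \<and> (t', k) \<in> f s}"
      then obtain s k t' h where p: "p = (t', Cmp C (XX t') (YY s) (XX t) k h)"
        and k: "(s, k) \<in> inv_rep t" and h: "(t', h) \<in> f s"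
        using t by (auto simp: g_def)
      have s: "s \<in> Ob J" "k \<in> Hom C (YY s) (XX t)" using k by (auto dest: inv_repD)
      note h' = fD1[OF h s(1)] fD2[OF h s(1)]
      obtain r a u where r: "r \<in> Ob I" "a \<in> Hom I r t'" "u \<in> Hom I r t"
        "Cmp C (XX r) (YY s) (XX t) k (Cmp C (XX r) (XX t') (YY s) h (TX r t' a)) = TX r t u"
        using inv_rep_refine[OF k h t] .
      have "Cmp C (XX r) (XX t) (XX t) (category.Id C (XX t)) (TX r t u) =
        Cmp C (XX r) (XX t') (XX t) (Cmp C (XX t') (YY s) (XX t) k h) (TX r t' a)"
        using r s h' t by (simp add: cat_assoc[OF cat] cat_idl[OF cat] XX YY TX)
      then show "((t, category.Id C (XX t)), p) \<in> sys.rel"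
        unfolding p sys.rel_iff using r t h' s cat_id[OF cat XX[OF t]]
          cat_comp[OF cat h'(2) s(2) XX[OF h'(1)] YY[OF s(1)] XX[OF t]] by blast
    qed
  qed
  have fg: "pro_comp C Y X Y f g = pro_id C Y"
    unfolding pro_comp_def pro_id_def
  proof (rule restrict_ext)
    fix s assume s: "s \<in> Ob J"
    interpret sys: direct_system J "\<lambda>q. Hom C (YY q) (YY s)"
      "\<lambda>q r u h. Cmp C (YY q) (YY r) (YY s) h (TY q r u)"
      using germ_system[OF cat Y YY[OF s]] .
    show "germ_rel C Y (YY s) `` {(r, Cmp C (YY r) (XX t) (YY s) h k) |t h r k.
            (t, h) \<in> f s \<and> (r, k) \<in> g t} = germ_rel C Y (YY s) `` {(s, category.Id C (YY s))}"
      unfolding germ_rel_def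
    proof (rule sys.Image_eq_class)
      obtain t h where h: "(t, h) \<in> f s" using f_nonempty[OF s] .
      then obtain r k where "(r, k) \<in> g t"
        using inv_rep_exists[OF fD1[OF h s]] fD1[OF h s] by (auto simp: g_def)
      then show "{(r, Cmp C (YY r) (XX t) (YY s) h k) |t h r k. (t, h) \<in> f s \<and> (r, k) \<in> g t} \<noteq> {}"
        using h by blast
      fix p assume "p \<in> {(r, Cmp C (YY r) (XX t) (YY s) h k) |t h r k. (t, h) \<in> f s \<and> (r, k) \<in> g t}"
      then obtain t h r k where p: "p = (r, Cmp C (YY r) (XX t) (YY s) h k)"
        and h: "(t, h) \<in> f s" and k0: "(r, k) \<in> g t" by blast
      have t: "t \<in> Ob I" and h': "h \<in> Hom C (XX t) (YY s)" using fD[OF h s] by auto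
      have k: "(r, k) \<in> inv_rep t" using k0 t by (simp add: g_def)
      have r: "r \<in> Ob J" "k \<in> Hom C (YY r) (XX t)" using k by (auto dest: inv_repD)
      \<comment> \<open>To compare \<open>h k\<close> on \<open>YY r\<close> with the identity of
        \<open>YY s\<close>, both are restricted to \<open>YY q\<close> and composed with a
        representative of \<open>f\<close> at \<open>q\<close>. There \<open>k\<close> turns into a
        transition map of \<open>X\<close>, and \<open>f_epi\<close> removes the representative
        again.\<close>
      obtain q v w where q: "q \<in> Ob J" "v \<in> Hom J q r" "w \<in> Hom J q s"
        using cofiltered_span[OF J_cof r(1) s] .
      obtain t1 h1 where h1: "(t1, h1) \<in> f q" using f_nonempty[OF q(1)] .
      obtain t2 a b where t2: "t2 \<in> Ob I" "a \<in> Hom I t2 t" "b \<in> Hom I t2 t1"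
        and h2: "(t2, Cmp C (XX t2) (XX t1) (YY q) h1 (TX t2 t1 b)) \<in> f q"
        using f_square[OF s q(1) h q(3) h1] by metis
      define h2 where "h2 = Cmp C (XX t2) (XX t1) (YY q) h1 (TX t2 t1 b)"
      note h2 = h2[folded h2_def]
      obtain t3 c u where t3: "t3 \<in> Ob I" "c \<in> Hom I t3 t2" "u \<in> Hom I t3 t"
        and ku: "Cmp C (XX t3) (YY r) (XX t) k (Cmp C (XX t3) (XX t2) (YY r)
          (Cmp C (XX t2) (YY q) (YY r) (TY q r v) h2) (TX t3 t2 c)) = TX t3 t u"
        using inv_rep_refine[OF k f_post[OF h2 q(2,1) r(1)] t] .
      define h3 where "h3 = Cmp C (XX t3) (XX t2) (YY q) h2 (TX t3 t2 c)"
      have h3: "(t3, h3) \<in> f q" unfolding h3_def by (rule f_pre[OF h2 q(1) t3(2,1)])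
      have ku: "Cmp C (XX t3) (YY r) (XX t) k (Cmp C (XX t3) (YY q) (YY r) (TY q r v) h3) = TX t3 t u"
        unfolding ku[symmetric] h3_def
        using r q t2(1) t3(1,2) fD2[OF h2 q(1)] by (simp add: cat_assoc[OF cat] XX YY TX TY)
      obtain t4 d e where t4: "t4 \<in> Ob I" "d \<in> Hom I t4 t3" "e \<in> Hom I t4 t3"
        and hw: "Cmp C (XX t4) (XX t3) (YY s) (Cmp C (XX t3) (XX t) (YY s) h (TX t3 t u)) (TX t4 t3 d) =
          Cmp C (XX t4) (XX t3) (YY s) (Cmp C (XX t3) (YY q) (YY s) (TY q s w) h3) (TX t4 t3 e)"
        using f_join[OF f_pre[OF h s t3(3,1)] f_post[OF h3 q(3,1) s] s] .
      \<comment> \<open>The two sides of \<open>hw\<close> are restricted along different arrows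
        \<open>d\<close> and \<open>e\<close>. Once these are equalized, the same representative
        \<open>h5\<close> occurs on both sides, as \<open>f_epi\<close> requires.\<close>
      obtain t5 m where t5: "t5 \<in> Ob I" "m \<in> Hom I t5 t4"
        "Cmp I t5 t4 t3 d m = Cmp I t5 t4 t3 e m"
        using cofiltered_equalize[OF I_cof t4(1) t3(1) t4(2,3)] .
      define h5 where "h5 = Cmp C (XX t5) (XX t3) (YY q) h3 (TX t5 t3 (Cmp I t5 t4 t3 e m))"
      have em: "Cmp I t5 t4 t3 e m \<in> Hom I t5 t3"
        using cat_comp[OF I_cat t5(2) t4(3) t5(1) t4(1) t3(1)] .
      have h5: "(t5, h5) \<in> f q" unfolding h5_def by (rule f_pre[OF h3 q(1) em t5(1)])
      note h3' = fD2[OF h3 q(1)]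
      have "Cmp C (XX t5) (YY q) (YY s) (TY q s w) h5 = Cmp C (XX t5) (XX t4) (YY s)
         (Cmp C (XX t4) (XX t3) (YY s) (Cmp C (XX t3) (YY q) (YY s) (TY q s w) h3) (TX t4 t3 e)) (TX t5 t4 m)"
        unfolding h5_def TX_comp[OF t5(2) t4(3) t5(1) t4(1) t3(1)]
        using q s t3(1) t4 t5(1,2) h3' by (simp add: cat_assoc[OF cat] cat_comp[OF cat] XX YY TX TY)
      also have "\<dots> = Cmp C (XX t5) (XX t3) (YY s) (Cmp C (XX t3) (XX t) (YY s) h (TX t3 t u)) (TX t5 t3 (Cmp I t5 t4 t3 d m))"
        unfolding hw[symmetric] TX_comp[OF t5(2) t4(2) t5(1) t4(1) t3(1)]
        using t s t3(1,3) t4 t5(1,2) h' by (simp add: cat_assoc[OF cat] cat_comp[OF cat] XX YY TX TY)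
      also have "\<dots> = Cmp C (XX t5) (YY q) (YY s) (Cmp C (YY q) (YY r) (YY s) (Cmp C (YY r) (XX t) (YY s) h k) (TY q r v)) h5"
        unfolding h5_def t5(3) ku[symmetric]
        using t s r q t3(1) t5(1) em h3' h' by (simp add: cat_assoc[OF cat] cat_comp[OF cat] XX YY TX TY)
      finally have eq: "Cmp C (XX t5) (YY q) (YY s) (TY q s w) h5 = Cmp C (XX t5) (YY q) (YY s)
        (Cmp C (YY q) (YY r) (YY s) (Cmp C (YY r) (XX t) (YY s) h k) (TY q r v)) h5" .
      have hk: "Cmp C (YY r) (XX t) (YY s) h k \<in> Hom C (YY r) (YY s)"
        using cat_comp[OF cat r(2) h' YY[OF r(1)] XX[OF t] YY[OF s]] .
      obtain q' w' where q': "q' \<in> Ob J" "w' \<in> Hom J q' q"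
        "Cmp C (YY q') (YY q) (YY s) (TY q s w) (TY q' q w') =
         Cmp C (YY q') (YY q) (YY s) (Cmp C (YY q) (YY r) (YY s) (Cmp C (YY r) (XX t) (YY s) h k) (TY q r v)) (TY q' q w')"
        using f_epi[OF h5 q(1) YY[OF s] TY[OF q(3,1) s]
            cat_comp[OF cat TY[OF q(2,1) r(1)] hk YY[OF q(1)] YY[OF r(1)] YY[OF s]] eq] .
      have "Cmp C (YY q') (YY s) (YY s) (category.Id C (YY s)) (TY q' s (Cmp J q' q s w w')) =
        Cmp C (YY q') (YY r) (YY s) (Cmp C (YY r) (XX t) (YY s) h k) (TY q' r (Cmp J q' q r v w'))"
        unfolding cat_idl[OF cat TY[OF cat_comp[OF J_cat q'(2) q(3) q'(1) q(1) s] q'(1) s] YY[OF q'(1)] YY[OF s]]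
        using q'(3) q q'(1,2) r s hk by (simp add: TY_comp TY YY cat_assoc[OF cat])
      then show "((s, category.Id C (YY s)), p) \<in> sys.rel"
        unfolding p sys.rel_iff using s r(1) hk q'(1) cat_id[OF cat YY[OF s]]
          cat_comp[OF J_cat q'(2) q(3) q'(1) q(1) s] cat_comp[OF J_cat q'(2) q(2) q'(1) q(1) r(1)]
        by blast
    qed
  qed
  show ?thesis
    unfolding pro_iso_def using f g gf fg by blast
qed

end

end

section \<open>Left modules and linear maps\<close>

lemma (in abelian_group) a_inv_zero: "\<ominus> \<zero> = \<zero>"
  by (rule minus_equality) simp_all

lemma (in abelian_group) a_inv_eq_zeroD: "\<ominus> x = \<zero> \<Longrightarrow> x \<in> carrier G \<Longrightarrow> x = \<zero>"
  using minus_minus[of x] by (simp add: a_inv_zero)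

lemma (in abelian_group) add_minus_cancel:
  "x \<in> carrier G \<Longrightarrow> y \<in> carrier G \<Longrightarrow> y \<oplus> (x \<ominus> y) = x"
  unfolding a_minus_def using a_lcomm[of y x "\<ominus> y"] by (simp add: r_neg)

lemma left_moduleD:
  assumes "left_module R M"
  shows left_module_ring: "ring R" and left_module_group: "abelian_group M"
  using assms by (simp_all add: left_module_def)

lemma left_moduleI:
  assumes "ring R" "abelian_group M"
    and "\<And>a x. \<lbrakk>a \<in> carrier R; x \<in> carrier M\<rbrakk> \<Longrightarrow> a \<odot>\<^bsub>M\<^esub> x \<in> carrier M"
    and "\<And>a b x. \<lbrakk>a \<in> carrier R; b \<in> carrier R; x \<in> carrier M\<rbrakk> \<Longrightarrow>
        (a \<oplus>\<^bsub>R\<^esub> b) \<odot>\<^bsub>M\<^esub> x = a \<odot>\<^bsub>M\<^esub> x \<oplus>\<^bsub>M\<^esub> b \<odot>\<^bsub>M\<^esub> x"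
    and "\<And>a x y. \<lbrakk>a \<in> carrier R; x \<in> carrier M; y \<in> carrier M\<rbrakk> \<Longrightarrow>
        a \<odot>\<^bsub>M\<^esub> (x \<oplus>\<^bsub>M\<^esub> y) = a \<odot>\<^bsub>M\<^esub> x \<oplus>\<^bsub>M\<^esub> a \<odot>\<^bsub>M\<^esub> y"
    and "\<And>a b x. \<lbrakk>a \<in> carrier R; b \<in> carrier R; x \<in> carrier M\<rbrakk> \<Longrightarrow>
        (a \<otimes>\<^bsub>R\<^esub> b) \<odot>\<^bsub>M\<^esub> x = a \<odot>\<^bsub>M\<^esub> (b \<odot>\<^bsub>M\<^esub> x)"
    and "\<And>x. x \<in> carrier M \<Longrightarrow> \<one>\<^bsub>R\<^esub> \<odot>\<^bsub>M\<^esub> x = x"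
  shows "left_module R M"
  using assms by (simp add: left_module_def left_module_axioms_def)

definition lin ::
  "('r, 'b) ring_scheme \<Rightarrow> ('r, 'a, 'c) module_scheme \<Rightarrow> ('r, 'd, 'e) module_scheme \<Rightarrow> ('a \<Rightarrow> 'd) \<Rightarrow> bool" where
  "lin R M N g \<longleftrightarrow> g \<in> carrier M \<rightarrow> carrier N \<and>
     (\<forall>x\<in>carrier M. \<forall>y\<in>carrier M. g (x \<oplus>\<^bsub>M\<^esub> y) = g x \<oplus>\<^bsub>N\<^esub> g y) \<and>
     (\<forall>a\<in>carrier R. \<forall>x\<in>carrier M. g (a \<odot>\<^bsub>M\<^esub> x) = a \<odot>\<^bsub>N\<^esub> g x)"

lemma linD:
  assumes "lin R M N g"
  shows lin_closed: "x \<in> carrier M \<Longrightarrow> g x \<in> carrier N"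
    and lin_add: "\<lbrakk>x \<in> carrier M; y \<in> carrier M\<rbrakk> \<Longrightarrow> g (x \<oplus>\<^bsub>M\<^esub> y) = g x \<oplus>\<^bsub>N\<^esub> g y"
    and lin_smult: "\<lbrakk>a \<in> carrier R; x \<in> carrier M\<rbrakk> \<Longrightarrow> g (a \<odot>\<^bsub>M\<^esub> x) = a \<odot>\<^bsub>N\<^esub> g x"
  using assms by (auto simp: lin_def)

lemma linI:
  assumes "\<And>x. x \<in> carrier M \<Longrightarrow> g x \<in> carrier N"
    and "\<And>x y. \<lbrakk>x \<in> carrier M; y \<in> carrier M\<rbrakk> \<Longrightarrow> g (x \<oplus>\<^bsub>M\<^esub> y) = g x \<oplus>\<^bsub>N\<^esub> g y"
    and "\<And>a x. \<lbrakk>a \<in> carrier R; x \<in> carrier M\<rbrakk> \<Longrightarrow> g (a \<odot>\<^bsub>M\<^esub> x) = a \<odot>\<^bsub>N\<^esub> g x"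
  shows "lin R M N g"
  using assms by (auto simp: lin_def)

lemma lin_cong:
  assumes "left_module R M" "\<And>x. x \<in> carrier M \<Longrightarrow> g x = h x" "lin R M N g"
  shows "lin R M N h"
  using assms abelian_groupE(1)[OF left_module_group[OF assms(1)]] left_module.smult_closed[OF assms(1)]
  by (simp add: lin_def Pi_iff)

lemma lin_comp: "lin R M N g \<Longrightarrow> lin R N P h \<Longrightarrow> lin R M P (\<lambda>x. h (g x))"
  by (auto simp: lin_def Pi_iff)

lemma smult_zero_right:
  assumes "left_module R M" "a \<in> carrier R" shows "a \<odot>\<^bsub>M\<^esub> \<zero>\<^bsub>M\<^esub> = \<zero>\<^bsub>M\<^esub>"
proof -
  interpret M: abelian_group M using assms by (simp add: left_module_group)
  have "a \<odot>\<^bsub>M\<^esub> \<zero>\<^bsub>M\<^esub> \<oplus>\<^bsub>M\<^esub> a \<odot>\<^bsub>M\<^esub> \<zero>\<^bsub>M\<^esub> = a \<odot>\<^bsub>M\<^esub> \<zero>\<^bsub>M\<^esub> \<oplus>\<^bsub>M\<^esub> \<zero>\<^bsub>M\<^esub>"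
    using assms left_module.smult_r_distr[OF assms(1,2) M.zero_closed M.zero_closed]
    by (simp add: left_module.smult_closed)
  then show ?thesis using assms by (simp add: left_module.smult_closed)
qed

lemma smult_zero_left:
  assumes "left_module R M" "x \<in> carrier M" shows "\<zero>\<^bsub>R\<^esub> \<odot>\<^bsub>M\<^esub> x = \<zero>\<^bsub>M\<^esub>"
proof -
  interpret M: abelian_group M using assms by (simp add: left_module_group)
  interpret R: ring R using assms by (simp add: left_module_ring)
  have "\<zero>\<^bsub>R\<^esub> \<odot>\<^bsub>M\<^esub> x \<oplus>\<^bsub>M\<^esub> \<zero>\<^bsub>R\<^esub> \<odot>\<^bsub>M\<^esub> x = \<zero>\<^bsub>R\<^esub> \<odot>\<^bsub>M\<^esub> x \<oplus>\<^bsub>M\<^esub> \<zero>\<^bsub>M\<^esub>"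
    using assms left_module.smult_l_distr[OF assms(1) R.zero_closed R.zero_closed assms(2)]
    by (simp add: left_module.smult_closed)
  then show ?thesis using assms by (simp add: left_module.smult_closed)
qed

lemma smult_neg:
  assumes "left_module R M" "a \<in> carrier R" "x \<in> carrier M"
  shows "a \<odot>\<^bsub>M\<^esub> (\<ominus>\<^bsub>M\<^esub> x) = \<ominus>\<^bsub>M\<^esub> (a \<odot>\<^bsub>M\<^esub> x)"
proof -
  interpret M: abelian_group M using assms by (simp add: left_module_group)
  have "a \<odot>\<^bsub>M\<^esub> (\<ominus>\<^bsub>M\<^esub> x) \<oplus>\<^bsub>M\<^esub> a \<odot>\<^bsub>M\<^esub> x = \<zero>\<^bsub>M\<^esub>"
    using assms smult_zero_right[OF assms(1,2)]
    by (simp add: left_module.smult_r_distr[symmetric] M.l_neg)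
  then show ?thesis
    using assms by (intro M.minus_equality[symmetric]) (simp_all add: left_module.smult_closed)
qed

lemma lin_zero:
  assumes "left_module R M" "left_module R N" "lin R M N g" shows "g \<zero>\<^bsub>M\<^esub> = \<zero>\<^bsub>N\<^esub>"
proof -
  interpret M: abelian_group M using assms by (simp add: left_module_group)
  interpret N: abelian_group N using assms by (simp add: left_module_group)
  have "g \<zero>\<^bsub>M\<^esub> \<oplus>\<^bsub>N\<^esub> g \<zero>\<^bsub>M\<^esub> = g \<zero>\<^bsub>M\<^esub> \<oplus>\<^bsub>N\<^esub> \<zero>\<^bsub>N\<^esub>"
    using lin_add[OF assms(3) M.zero_closed M.zero_closed] lin_closed[OF assms(3)] by simp
  then show ?thesis using lin_closed[OF assms(3)] by simp
qed

lemma lin_neg: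
  assumes "left_module R M" "left_module R N" "lin R M N g" "x \<in> carrier M"
  shows "g (\<ominus>\<^bsub>M\<^esub> x) = \<ominus>\<^bsub>N\<^esub> g x"
proof -
  interpret M: abelian_group M using assms by (simp add: left_module_group)
  interpret N: abelian_group N using assms by (simp add: left_module_group)
  have "g (\<ominus>\<^bsub>M\<^esub> x) \<oplus>\<^bsub>N\<^esub> g x = \<zero>\<^bsub>N\<^esub>"
    using lin_add[OF assms(3), of "\<ominus>\<^bsub>M\<^esub> x" x] lin_zero[OF assms(1-3)] assms(4) by (simp add: M.l_neg)
  then show ?thesis
    using assms lin_closed[OF assms(3)] by (intro N.minus_equality[symmetric]) simp_all
qed

lemma lin_minus:
  assumes "left_module R M" "left_module R N" "lin R M N g" "x \<in> carrier M" "y \<in> carrier M"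
  shows "g (x \<ominus>\<^bsub>M\<^esub> y) = g x \<ominus>\<^bsub>N\<^esub> g y"
  using assms lin_neg[OF assms(1-3)] lin_add[OF assms(3)]
  by (simp add: a_minus_def abelian_group.a_inv_closed[OF left_module_group[OF assms(1)]])

lemma lin_zero_map: "left_module R N \<Longrightarrow> lin R M N (\<lambda>_. \<zero>\<^bsub>N\<^esub>)"
  using smult_zero_right abelian_groupE(2,5)[OF left_module_group] by (intro linI) fastforce+

lemma lin_plus_map:
  assumes "left_module R N" "lin R M N g" "lin R M N h"
  shows "lin R M N (\<lambda>x. g x \<oplus>\<^bsub>N\<^esub> h x)"
proof -
  interpret N: abelian_group N using assms by (simp add: left_module_group)
  show ?thesis
    using assms by (intro linI)
      (simp_all add: linD[OF assms(2)] linD[OF assms(3)] N.a_ac left_module.smult_r_distr)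
qed

lemma lin_neg_map:
  assumes "left_module R N" "lin R M N g"
  shows "lin R M N (\<lambda>x. \<ominus>\<^bsub>N\<^esub> g x)"
proof -
  interpret N: abelian_group N using assms by (simp add: left_module_group)
  show ?thesis
    using assms by (intro linI)
      (simp_all add: linD[OF assms(2)] N.minus_add smult_neg)
qed

lemma lin_minus_map:
  assumes "left_module R N" "lin R M N g" "lin R M N h"
  shows "lin R M N (\<lambda>x. g x \<ominus>\<^bsub>N\<^esub> h x)"
  unfolding a_minus_def using lin_plus_map[OF assms(1,2) lin_neg_map[OF assms(1,3)]] .

lemma alt_sign_closed: "abelian_group M \<Longrightarrow> x \<in> carrier M \<Longrightarrow> alt_sign M i x \<in> carrier M"
  by (simp add: alt_sign_def abelian_group.a_inv_closed)

lemma lin_alt_sign: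
  assumes "left_module R M" "left_module R N" "lin R M N g" "x \<in> carrier M"
  shows "g (alt_sign M i x) = alt_sign N i (g x)"
  using lin_neg[OF assms] by (simp add: alt_sign_def)

lemma lin_alt_sign_map:
  assumes "left_module R N" "lin R M N g"
  shows "lin R M N (\<lambda>x. alt_sign N i (g x))"
  using assms lin_neg_map[OF assms] by (cases "even i") (simp_all add: alt_sign_def)

lemma lin_finsum:
  assumes "left_module R M" "left_module R N" "lin R M N g" "\<And>i. i \<in> A \<Longrightarrow> c i \<in> carrier M"
  shows "g (\<Oplus>\<^bsub>M\<^esub>i\<in>A. c i) = (\<Oplus>\<^bsub>N\<^esub>i\<in>A. g (c i))"
proof -
  interpret M: abelian_group M using assms by (simp add: left_module_group)
  interpret N: abelian_group N using assms by (simp add: left_module_group)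
  show ?thesis
  proof (cases "finite A")
    case True
    then show ?thesis using assms(4)
    proof (induction A rule: finite_induct)
      case empty
      then show ?case using lin_zero[OF assms(1-3)] by simp
    next
      case (insert x F)
      then show ?case
        using lin_closed[OF assms(3)] lin_add[OF assms(3)] by (simp add: Pi_iff)
    qed
  qed (simp add: lin_zero[OF assms(1-3)])
qed

lemma lin_finsum_map:
  assumes M: "left_module R M" and N: "left_module R N"
    and g: "\<And>i. i \<in> A \<Longrightarrow> lin R M N (g i)" and A: "finite A"
  shows "lin R M N (\<lambda>x. \<Oplus>\<^bsub>N\<^esub>i\<in>A. g i x)"
proof -
  interpret N: abelian_group N using assms by (simp add: left_module_group)
  show ?thesis using A g
  proof (induction A rule: finite_induct)
    case empty
    then show ?case using lin_zero_map[OF N] by simp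
  next
    case (insert i F)
    have "lin R M N (\<lambda>x. g i x \<oplus>\<^bsub>N\<^esub> (\<Oplus>\<^bsub>N\<^esub>i\<in>F. g i x))"
      using insert by (intro lin_plus_map[OF N]) auto
    moreover have "g i x \<oplus>\<^bsub>N\<^esub> (\<Oplus>\<^bsub>N\<^esub>i\<in>F. g i x) = (\<Oplus>\<^bsub>N\<^esub>i\<in>insert i F. g i x)" if "x \<in> carrier M" for x
      using insert that by (subst N.finsum_insert) (auto intro: lin_closed)
    ultimately show ?case
      by (rule lin_cong[OF M, rotated])
  qed
qed

section \<open>Products and quotients of modules\<close>

definition prod_module ::
  "('r, 'a, 'c) module_scheme \<Rightarrow> ('r, 'd, 'e) module_scheme \<Rightarrow> ('r, 'a \<times> 'd) module" where
  "prod_module M N = \<lparr>carrier = carrier M \<times> carrier N, mult = \<lambda>_ _. undefined, one = undefined,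
     zero = (\<zero>\<^bsub>M\<^esub>, \<zero>\<^bsub>N\<^esub>), add = \<lambda>p q. (fst p \<oplus>\<^bsub>M\<^esub> fst q, snd p \<oplus>\<^bsub>N\<^esub> snd q),
     smult = \<lambda>a p. (a \<odot>\<^bsub>M\<^esub> fst p, a \<odot>\<^bsub>N\<^esub> snd p)\<rparr>"

lemma prod_module_simps [simp]:
  "carrier (prod_module M N) = carrier M \<times> carrier N"
  "\<zero>\<^bsub>prod_module M N\<^esub> = (\<zero>\<^bsub>M\<^esub>, \<zero>\<^bsub>N\<^esub>)"
  "(x, y) \<oplus>\<^bsub>prod_module M N\<^esub> (x', y') = (x \<oplus>\<^bsub>M\<^esub> x', y \<oplus>\<^bsub>N\<^esub> y')"
  "a \<odot>\<^bsub>prod_module M N\<^esub> (x, y) = (a \<odot>\<^bsub>M\<^esub> x, a \<odot>\<^bsub>N\<^esub> y)"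
  by (simp_all add: prod_module_def)

lemma left_module_prod:
  assumes M: "left_module R M" and N: "left_module R N"
  shows "left_module R (prod_module M N)"
proof -
  interpret M: abelian_group M using M by (rule left_module_group)
  interpret N: abelian_group N using N by (rule left_module_group)
  show ?thesis
  proof (rule left_moduleI)
    show "abelian_group (prod_module M N)"
    proof (rule abelian_groupI)
      fix p assume "p \<in> carrier (prod_module M N)"
      then show "\<exists>q\<in>carrier (prod_module M N). q \<oplus>\<^bsub>prod_module M N\<^esub> p = \<zero>\<^bsub>prod_module M N\<^esub>"
        by (intro bexI[of _ "(\<ominus>\<^bsub>M\<^esub> fst p, \<ominus>\<^bsub>N\<^esub> snd p)"]) (auto simp: M.l_neg N.l_neg)
    qed (auto simp: M.a_ac N.a_ac)
  qed (use left_module_ring[OF M] in \<open>auto simp: left_module.smult_closed[OF M] left_module.smult_closed[OF N]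
      left_module.smult_l_distr[OF M] left_module.smult_l_distr[OF N]
      left_module.smult_r_distr[OF M] left_module.smult_r_distr[OF N]
      left_module.smult_assoc[OF M] left_module.smult_assoc[OF N]
      left_module.smult_one[OF M] left_module.smult_one[OF N]\<close>)
qed

lemma lin_Pair:
  "lin R P M g \<Longrightarrow> lin R P N h \<Longrightarrow> lin R P (prod_module M N) (\<lambda>x. (g x, h x))"
  by (simp add: lin_def Pi_iff)

lemma lin_fst: "lin R (prod_module M N) M fst" and lin_snd: "lin R (prod_module M N) N snd"
  by (auto simp: lin_def)

lemma lin_inl: "left_module R N \<Longrightarrow> lin R M (prod_module M N) (\<lambda>x. (x, \<zero>\<^bsub>N\<^esub>))"
  and lin_inr: "left_module R M \<Longrightarrow> lin R N (prod_module M N) (\<lambda>y. (\<zero>\<^bsub>M\<^esub>, y))"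
  by (auto simp: lin_def smult_zero_right abelian_groupE(2,5)[OF left_module_group])

text \<open>The cokernel of \<open>d\<close>. Its elements are the cosets of the image, copied by
  \<iota> into the type \<open>'e\<close>, so that the module can be built over the one type of
  coefficients that the theorem quantifies over.\<close>

lemma quotient_module:
  fixes K :: "('r, 'a, 'c) module_scheme" and \<iota> :: "'a set \<Rightarrow> 'e"
  assumes K: "left_module R K" and \<iota>: "inj \<iota>"
    and L: "left_module R L" and d: "lin R L K d"
  obtains M :: "('r, 'e) module" and \<pi> where "left_module R M" "lin R K M \<pi>"
    "\<And>x. x \<in> carrier K \<Longrightarrow> \<pi> x = \<zero>\<^bsub>M\<^esub> \<longleftrightarrow> x \<in> d ` carrier L"
proof -
  interpret K: abelian_group K using K by (rule left_module_group)
  interpret L: abelian_group L using L by (rule left_module_group)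
  define \<pi> where "\<pi> x = \<iota> {x \<oplus>\<^bsub>K\<^esub> d y | y. y \<in> carrier L}" for x
  note dc = lin_closed[OF d]
  have \<pi>_eqI: "\<pi> (x \<oplus>\<^bsub>K\<^esub> d y) = \<pi> x" if "x \<in> carrier K" "y \<in> carrier L" for x y
  proof -
    have "x \<oplus>\<^bsub>K\<^esub> d y \<oplus>\<^bsub>K\<^esub> d z \<in> {x \<oplus>\<^bsub>K\<^esub> d z | z. z \<in> carrier L}" if "z \<in> carrier L" for z
      using that \<open>x \<in> carrier K\<close> \<open>y \<in> carrier L\<close> dc
      by (auto intro!: exI[of _ "y \<oplus>\<^bsub>L\<^esub> z"] simp: lin_add[OF d] K.a_assoc)
    moreover have "x \<oplus>\<^bsub>K\<^esub> d z \<in> {x \<oplus>\<^bsub>K\<^esub> d y \<oplus>\<^bsub>K\<^esub> d z | z. z \<in> carrier L}" if "z \<in> carrier L" for z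
      using that \<open>x \<in> carrier K\<close> \<open>y \<in> carrier L\<close> dc
      by (auto intro!: exI[of _ "\<ominus>\<^bsub>L\<^esub> y \<oplus>\<^bsub>L\<^esub> z"] simp: lin_add[OF d] lin_neg[OF L K d] K.a_assoc K.r_neg2)
    ultimately show ?thesis unfolding \<pi>_def by (intro arg_cong[of _ _ \<iota>]) blast
  qed
  have \<pi>_eqD: "\<exists>z\<in>carrier L. y = x \<oplus>\<^bsub>K\<^esub> d z" if "\<pi> x = \<pi> y" "x \<in> carrier K" "y \<in> carrier K" for x y
  proof -
    have "y \<in> {y \<oplus>\<^bsub>K\<^esub> d z | z. z \<in> carrier L}"
      using that lin_zero[OF L K d] by (auto intro!: exI[of _ "\<zero>\<^bsub>L\<^esub>"])
    also have "\<dots> = {x \<oplus>\<^bsub>K\<^esub> d z | z. z \<in> carrier L}"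
      using that(1) \<iota> unfolding \<pi>_def by (simp add: inj_eq)
    finally show ?thesis by blast
  qed
  \<comment> \<open>Sums and scalar multiples of cosets are computed at chosen representatives. A
    different choice changes the result by an element of the image of \<open>d\<close>, which
    \<open>\<pi>_eqI\<close> absorbs.\<close>
  define \<rho> where "\<rho> = inv_into (carrier K) \<pi>"
  have \<rho>: "\<rho> (\<pi> x) \<in> carrier K" "\<pi> (\<rho> (\<pi> x)) = \<pi> x" if "x \<in> carrier K" for x
    unfolding \<rho>_def using that by (auto intro: inv_into_into f_inv_into_f)
  have \<rho>_d: "\<exists>z\<in>carrier L. \<rho> (\<pi> x) = x \<oplus>\<^bsub>K\<^esub> d z" if "x \<in> carrier K" for x
    using \<pi>_eqD[of x "\<rho> (\<pi> x)"] \<rho>[OF that] that by simp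
  define M :: "('r, 'e) module" where
    "M = \<lparr>carrier = \<pi> ` carrier K, mult = \<lambda>_ _. undefined, one = undefined, zero = \<pi> \<zero>\<^bsub>K\<^esub>,
       add = \<lambda>a b. \<pi> (\<rho> a \<oplus>\<^bsub>K\<^esub> \<rho> b), smult = \<lambda>r a. \<pi> (r \<odot>\<^bsub>K\<^esub> \<rho> a)\<rparr>"
  have M: "carrier M = \<pi> ` carrier K" "\<zero>\<^bsub>M\<^esub> = \<pi> \<zero>\<^bsub>K\<^esub>"
    by (simp_all add: M_def)
  have add: "\<pi> x \<oplus>\<^bsub>M\<^esub> \<pi> y = \<pi> (x \<oplus>\<^bsub>K\<^esub> y)" if xy: "x \<in> carrier K" "y \<in> carrier K" for x y
  proof -
    obtain z z' where z: "z \<in> carrier L" "z' \<in> carrier L"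
      "\<rho> (\<pi> x) = x \<oplus>\<^bsub>K\<^esub> d z" "\<rho> (\<pi> y) = y \<oplus>\<^bsub>K\<^esub> d z'"
      using \<rho>_d xy by metis
    have "\<rho> (\<pi> x) \<oplus>\<^bsub>K\<^esub> \<rho> (\<pi> y) = (x \<oplus>\<^bsub>K\<^esub> y) \<oplus>\<^bsub>K\<^esub> d (z \<oplus>\<^bsub>L\<^esub> z')"
      using z xy dc by (simp add: lin_add[OF d] K.a_ac)
    then show ?thesis using z xy by (simp add: M_def \<pi>_eqI)
  qed
  have sm: "a \<odot>\<^bsub>M\<^esub> \<pi> x = \<pi> (a \<odot>\<^bsub>K\<^esub> x)" if xy: "a \<in> carrier R" "x \<in> carrier K" for a x
  proof -
    obtain z where z: "z \<in> carrier L" "\<rho> (\<pi> x) = x \<oplus>\<^bsub>K\<^esub> d z"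
      using \<rho>_d xy by metis
    have "a \<odot>\<^bsub>K\<^esub> \<rho> (\<pi> x) = (a \<odot>\<^bsub>K\<^esub> x) \<oplus>\<^bsub>K\<^esub> d (a \<odot>\<^bsub>L\<^esub> z)"
      using z xy dc by (simp add: lin_smult[OF d] left_module.smult_r_distr[OF K])
    then show ?thesis
      using z xy by (simp add: M_def \<pi>_eqI left_module.smult_closed[OF L] left_module.smult_closed[OF K])
  qed
  have "left_module R M"
  proof (rule left_moduleI)
    show "abelian_group M"
    proof (rule abelian_groupI)
      fix x assume "x \<in> carrier M"
      then obtain y where "y \<in> carrier K" "x = \<pi> y" by (auto simp: M)
      then show "\<exists>z\<in>carrier M. z \<oplus>\<^bsub>M\<^esub> x = \<zero>\<^bsub>M\<^esub>"
        by (intro bexI[of _ "\<pi> (\<ominus>\<^bsub>K\<^esub> y)"]) (auto simp: M add K.l_neg)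
    qed (auto simp: M add K.a_ac)
  qed (use left_module_ring[OF K] in \<open>auto simp: M add sm left_module.smult_closed[OF K]
      left_module.smult_l_distr[OF K] left_module.smult_r_distr[OF K] ring.ring_simprules
      left_module.smult_assoc[OF K] left_module.smult_one[OF K]\<close>)
  moreover have "lin R K M \<pi>"
    by (rule linI) (auto simp: M add sm)
  moreover have "\<pi> x = \<zero>\<^bsub>M\<^esub> \<longleftrightarrow> x \<in> d ` carrier L" if x: "x \<in> carrier K" for x
    using \<pi>_eqD[of "\<zero>\<^bsub>K\<^esub>" x] \<pi>_eqI[of "\<zero>\<^bsub>K\<^esub>"] x dc by (auto simp: M)
  ultimately show thesis by (rule that)
qed

section \<open>Contractions of systems of complexes\<close>

text \<open>The abstract form of the system of cones. Composites are required up to their action on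
  chains; \<open>Arr_id\<close> supplies an endo-arrow for the start of the induction, in position
  0, where the modules vanish. \<open>K_projective\<close> is what freeness provides: a linear map
  whose values are boundaries lifts through the differential.\<close>

locale complex_system =
  fixes R :: "('r, 'b) ring_scheme" and Obj :: "'p set" and Arr :: "'p \<Rightarrow> 'p \<Rightarrow> 'q set"
    and K :: "'p \<Rightarrow> nat \<Rightarrow> ('r, 'k) module" and d :: "'p \<Rightarrow> nat \<Rightarrow> 'k \<Rightarrow> 'k"
    and P :: "'p \<Rightarrow> 'p \<Rightarrow> 'q \<Rightarrow> nat \<Rightarrow> 'k \<Rightarrow> 'k"
  assumes K_module: "a \<in> Obj \<Longrightarrow> left_module R (K a n)"
    and d_lin: "a \<in> Obj \<Longrightarrow> lin R (K a (Suc n)) (K a n) (d a n)"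
    and d_d: "\<lbrakk>a \<in> Obj; x \<in> carrier (K a (Suc (Suc n)))\<rbrakk> \<Longrightarrow> d a n (d a (Suc n) x) = \<zero>\<^bsub>K a n\<^esub>"
    and P_lin: "\<lbrakk>a \<in> Obj; b \<in> Obj; p \<in> Arr a b\<rbrakk> \<Longrightarrow> lin R (K a n) (K b n) (P a b p n)"
    and P_d: "\<lbrakk>a \<in> Obj; b \<in> Obj; p \<in> Arr a b; x \<in> carrier (K a (Suc n))\<rbrakk> \<Longrightarrow>
      P a b p n (d a n x) = d b n (P a b p (Suc n) x)"
    and Arr_id: "a \<in> Obj \<Longrightarrow> Arr a a \<noteq> {}"
    and Arr_comp: "\<lbrakk>a \<in> Obj; b \<in> Obj; c \<in> Obj; p \<in> Arr a b; q \<in> Arr b c\<rbrakk> \<Longrightarrow>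
      \<exists>r\<in>Arr a c. \<forall>n. \<forall>x\<in>carrier (K a n). P a c r n x = P b c q n (P a b p n x)"
    and K_0: "\<lbrakk>a \<in> Obj; x \<in> carrier (K a 0)\<rbrakk> \<Longrightarrow> x = \<zero>\<^bsub>K a 0\<^esub>"
    and K_projective: "\<lbrakk>a \<in> Obj; b \<in> Obj; lin R (K a n) (K b m) g;
        \<forall>x\<in>carrier (K a n). g x \<in> d b m ` carrier (K b (Suc m))\<rbrakk> \<Longrightarrow>
      \<exists>k. lin R (K a n) (K b (Suc m)) k \<and> (\<forall>x\<in>carrier (K a n). d b m (k x) = g x)"
begin

text \<open>Vanishing of the pro-group of homology in position \<open>Suc n\<close>: one transition
  map into \<open>a\<close> is zero on all homology classes at once.\<close>

definition homology_null :: "nat \<Rightarrow> bool" where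
  "homology_null n \<longleftrightarrow> (\<forall>a\<in>Obj. \<exists>b\<in>Obj. \<exists>p\<in>Arr b a. \<forall>z\<in>carrier (K b (Suc n)).
     d b n z = \<zero>\<^bsub>K b n\<^esub> \<longrightarrow> P b a p (Suc n) z \<in> d a (Suc n) ` carrier (K a (Suc (Suc n))))"

text \<open>Vanishing of the colimit of the cohomology in position \<open>Suc n\<close>, with linear
  maps as cochains. In contrast to \<open>homology_null\<close>, the further stage may depend on the
  cocycle \<Phi>.\<close>

definition cohomology_null :: "nat \<Rightarrow> ('r, 'e, 'f) module_scheme \<Rightarrow> bool" where
  "cohomology_null n M \<longleftrightarrow> (\<forall>a\<in>Obj. \<forall>\<Phi>. lin R (K a (Suc n)) M \<Phi> \<longrightarrow>
     (\<forall>x\<in>carrier (K a (Suc (Suc n))). \<Phi> (d a (Suc n) x) = \<zero>\<^bsub>M\<^esub>) \<longrightarrow>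
     (\<exists>b\<in>Obj. \<exists>p\<in>Arr b a. \<exists>\<Psi>. lin R (K b n) M \<Psi> \<and>
        (\<forall>x\<in>carrier (K b (Suc n)). \<Phi> (P b a p (Suc n) x) = \<Psi> (d b n x))))"

text \<open>
  A null homotopy of \<open>p\<close> would satisfy \<open>p = H d + d H\<close>.  The step from one degree to the next only
  uses its consequence \<open>p d = d H d\<close>, so the homotopies in different degrees need not be related.
\<close>

lemma contraction_step:
  assumes null: "\<And>n. homology_null n" and a: "a \<in> Obj"
    and IH: "\<And>a. a \<in> Obj \<Longrightarrow> \<exists>b\<in>Obj. \<exists>p\<in>Arr b a. \<exists>H. lin R (K b n) (K a (Suc n)) H \<and>
      (\<forall>x\<in>carrier (K b (Suc n)). P b a p n (d b n x) = d a n (H (d b n x)))"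
  obtains b p H H' where "b \<in> Obj" "p \<in> Arr b a" "lin R (K b n) (K a (Suc n)) H"
    "lin R (K b (Suc n)) (K a (Suc (Suc n))) H'"
    "\<And>x. x \<in> carrier (K b (Suc n)) \<Longrightarrow>
      P b a p (Suc n) x = H (d b n x) \<oplus>\<^bsub>K a (Suc n)\<^esub> d a (Suc n) (H' x)"
proof -
  obtain a1 q where a1: "a1 \<in> Obj" "q \<in> Arr a1 a" and null_a1: "\<And>z. \<lbrakk>z \<in> carrier (K a1 (Suc n));
     d a1 n z = \<zero>\<^bsub>K a1 n\<^esub>\<rbrakk> \<Longrightarrow> P a1 a q (Suc n) z \<in> d a (Suc n) ` carrier (K a (Suc (Suc n)))"
    using null[of n] a unfolding homology_null_def by blast
  obtain b p H where b: "b \<in> Obj" "p \<in> Arr b a1" and H: "lin R (K b n) (K a1 (Suc n)) H"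
    and pH: "\<And>x. x \<in> carrier (K b (Suc n)) \<Longrightarrow> P b a1 p n (d b n x) = d a1 n (H (d b n x))"
    using IH[OF a1(1)] by blast
  obtain r where r: "r \<in> Arr b a"
    "\<And>n x. x \<in> carrier (K b n) \<Longrightarrow> P b a r n x = P a1 a q n (P b a1 p n x)"
    using Arr_comp[OF b(1) a1(1) a b(2) a1(2)] by blast
  note mods = K_module[OF b(1)] K_module[OF a1(1)] K_module[OF a]
  interpret A1: abelian_group "K a1 m" for m by (rule left_module_group[OF K_module[OF a1(1)]])
  interpret A: abelian_group "K a m" for m by (rule left_module_group[OF K_module[OF a]])
  \<comment> \<open>The error made by replacing \<open>p\<close> with \<open>H d\<close>. By
    \<open>pH\<close> its values are cycles, so \<open>q\<close> sends them to boundaries and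
    \<open>K_projective\<close> lifts \<open>q g\<close> to \<open>H'\<close>. Hence
    \<open>q p\<close> equals \<open>q H d\<close> plus \<open>d H'\<close>.\<close>
  define g where "g x = P b a1 p (Suc n) x \<ominus>\<^bsub>K a1 (Suc n)\<^esub> H (d b n x)" for x
  have g: "lin R (K b (Suc n)) (K a1 (Suc n)) g"
    unfolding g_def by (intro lin_minus_map mods P_lin b a1 lin_comp[OF d_lin H])
  have "d a1 n (g x) = \<zero>\<^bsub>K a1 n\<^esub>" if x: "x \<in> carrier (K b (Suc n))" for x
  proof -
    have "d a1 n (g x) = d a1 n (P b a1 p (Suc n) x) \<ominus>\<^bsub>K a1 n\<^esub> d a1 n (H (d b n x))"
      unfolding g_def using lin_closed[OF P_lin[OF b(1) a1(1) b(2)] x] lin_closed[OF lin_comp[OF d_lin[OF b(1)] H] x]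
      by (rule lin_minus[OF mods(2,2) d_lin[OF a1(1)]])
    also have "\<dots> = \<zero>\<^bsub>K a1 n\<^esub>"
      using pH[OF x] P_d[OF b(1) a1(1) b(2) x] lin_closed[OF lin_comp[OF P_lin[OF b(1) a1(1) b(2)] d_lin[OF a1(1)]] x]
      by (simp add: a_minus_def A1.r_neg)
    finally show ?thesis .
  qed
  then have "\<forall>x\<in>carrier (K b (Suc n)). P a1 a q (Suc n) (g x) \<in> d a (Suc n) ` carrier (K a (Suc (Suc n)))"
    using null_a1 lin_closed[OF g] by blast
  then obtain H' where H': "lin R (K b (Suc n)) (K a (Suc (Suc n))) H'"
    and dH': "\<And>x. x \<in> carrier (K b (Suc n)) \<Longrightarrow> d a (Suc n) (H' x) = P a1 a q (Suc n) (g x)"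
    using K_projective[OF b(1) a lin_comp[OF g P_lin[OF a1(1) a a1(2)]]] by blast
  show thesis
  proof (rule that[OF b(1) r(1) lin_comp[OF H P_lin[OF a1(1) a a1(2)]] H'])
    fix x assume x: "x \<in> carrier (K b (Suc n))"
    note c = lin_closed[OF lin_comp[OF d_lin[OF b(1)] H] x] lin_closed[OF P_lin[OF b(1) a1(1) b(2)] x]
      lin_closed[OF g x]
    have "H (d b n x) \<oplus>\<^bsub>K a1 (Suc n)\<^esub> g x = P b a1 p (Suc n) x"
      unfolding g_def a_minus_def using c A1.a_lcomm[OF c(1,2) A1.a_inv_closed[OF c(1)]]
      by (simp add: A1.r_neg)
    then show "P b a r (Suc n) x = P a1 a q (Suc n) (H (d b n x)) \<oplus>\<^bsub>K a (Suc n)\<^esub> d a (Suc n) (H' x)"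
      unfolding dH'[OF x] r(2)[OF x] using lin_add[OF P_lin[OF a1(1) a a1(2)] c(1,3)] by simp
  qed
qed

text \<open>In position 0 the zero map is a homotopy. The induction has to generalize over
  \<open>a\<close>, because the step applies its hypothesis at a stage further out than
  \<open>a\<close>.\<close>

lemma contraction:
  assumes null: "\<And>n. homology_null n" and a: "a \<in> Obj"
  shows "\<exists>b\<in>Obj. \<exists>p\<in>Arr b a. \<exists>H. lin R (K b n) (K a (Suc n)) H \<and>
      (\<forall>x\<in>carrier (K b (Suc n)). P b a p n (d b n x) = d a n (H (d b n x)))"
  using a
proof (induction n arbitrary: a)
  case 0
  obtain p where p: "p \<in> Arr a a" using Arr_id[OF 0] by blast
  note mods = K_module[OF 0]
  have "P a a p 0 (d a 0 x) = d a 0 \<zero>\<^bsub>K a (Suc 0)\<^esub>" if "x \<in> carrier (K a (Suc 0))" for x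
    using K_0[OF 0] lin_closed[OF P_lin[OF 0 0 p] lin_closed[OF d_lin[OF 0] that]]
      lin_zero[OF mods mods d_lin[OF 0]] by simp
  then show ?case
    using 0 p lin_zero_map[OF mods] by blast
next
  case (Suc n)
  obtain b p H H' where b: "b \<in> Obj" "p \<in> Arr b a" "lin R (K b n) (K a (Suc n)) H"
    "lin R (K b (Suc n)) (K a (Suc (Suc n))) H'"
    "\<And>x. x \<in> carrier (K b (Suc n)) \<Longrightarrow>
      P b a p (Suc n) x = H (d b n x) \<oplus>\<^bsub>K a (Suc n)\<^esub> d a (Suc n) (H' x)"
    using contraction_step[OF null Suc.prems Suc.IH] by blast
  note mods = K_module[OF b(1)] K_module[OF Suc.prems]
  interpret A: abelian_group "K a (Suc n)" by (rule left_module_group[OF K_module[OF Suc.prems]])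
  \<comment> \<open>On \<open>d x\<close> the summand with \<open>H\<close> contains
    \<open>d d\<close> and vanishes. What remains is \<open>d H' d x\<close>, so \<open>H'\<close>
    is the homotopy in the next degree.\<close>
  have "P b a p (Suc n) (d b (Suc n) x) = d a (Suc n) (H' (d b (Suc n) x))"
    if x: "x \<in> carrier (K b (Suc (Suc n)))" for x
    using b(5)[OF lin_closed[OF d_lin[OF b(1)] x]] d_d[OF b(1) x] lin_zero[OF mods b(3)]
      lin_closed[OF lin_comp[OF lin_comp[OF d_lin[OF b(1)] b(4)] d_lin[OF Suc.prems]] x] by simp
  then show ?case using b by blast
qed

text \<open>If a transition map is \<open>H d\<close> plus \<open>d H'\<close>, a cocycle \<Phi>
  annihilates the second summand after pull-back, and the first exhibits the pull-back of \<Phi> as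
  the coboundary of \<Phi> after \<open>H\<close>. Freeness concerns the complexes only, so
  \<open>M\<close> is arbitrary.\<close>

theorem homology_null_imp_cohomology_null:
  assumes null: "\<And>n. homology_null n" and M: "left_module R M"
  shows "cohomology_null n M"
  unfolding cohomology_null_def
proof (intro ballI allI impI)
  fix a \<Phi> assume a: "a \<in> Obj" and \<Phi>: "lin R (K a (Suc n)) M \<Phi>"
    and \<Phi>d: "\<forall>x\<in>carrier (K a (Suc (Suc n))). \<Phi> (d a (Suc n) x) = \<zero>\<^bsub>M\<^esub>"
  obtain b p H H' where b: "b \<in> Obj" "p \<in> Arr b a" "lin R (K b n) (K a (Suc n)) H"
    "lin R (K b (Suc n)) (K a (Suc (Suc n))) H'"
    "\<And>x. x \<in> carrier (K b (Suc n)) \<Longrightarrow>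
      P b a p (Suc n) x = H (d b n x) \<oplus>\<^bsub>K a (Suc n)\<^esub> d a (Suc n) (H' x)"
    using contraction_step[OF null a contraction[OF null]] by blast
  interpret M: abelian_group M by (rule left_module_group[OF M])
  have "\<Phi> (P b a p (Suc n) x) = \<Phi> (H (d b n x))" if x: "x \<in> carrier (K b (Suc n))" for x
    unfolding b(5)[OF x]
    using lin_add[OF \<Phi> lin_closed[OF lin_comp[OF d_lin[OF b(1)] b(3)] x]
        lin_closed[OF lin_comp[OF b(4) d_lin[OF a]] x]]
      \<Phi>d lin_closed[OF b(4) x] lin_closed[OF lin_comp[OF lin_comp[OF d_lin[OF b(1)] b(3)] \<Phi>] x] by simp
  then show "\<exists>b\<in>Obj. \<exists>p\<in>Arr b a. \<exists>\<Psi>. lin R (K b n) M \<Psi> \<and>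
        (\<forall>x\<in>carrier (K b (Suc n)). \<Phi> (P b a p (Suc n) x) = \<Psi> (d b n x))"
    using b(1,2) lin_comp[OF b(3) \<Phi>] by blast
qed

text \<open>The projection onto the cokernel of the differential is the universal cocycle.\<close>

theorem cohomology_null_imp_homology_null:
  fixes \<iota> :: "'k set \<Rightarrow> 'e"
  assumes \<iota>: "inj \<iota>" and null: "\<And>M :: ('r, 'e) module. left_module R M \<Longrightarrow> cohomology_null n M"
  shows "homology_null n"
  unfolding homology_null_def
proof
  fix a assume a: "a \<in> Obj"
  obtain M :: "('r, 'e) module" and \<pi> where M: "left_module R M" and \<pi>: "lin R (K a (Suc n)) M \<pi>"
    "\<And>x. x \<in> carrier (K a (Suc n)) \<Longrightarrow> \<pi> x = \<zero>\<^bsub>M\<^esub> \<longleftrightarrow> x \<in> d a (Suc n) ` carrier (K a (Suc (Suc n)))"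
    using quotient_module[OF K_module[OF a] \<iota> K_module[OF a] d_lin[OF a]] by blast
  have "\<pi> (d a (Suc n) x) = \<zero>\<^bsub>M\<^esub>" if "x \<in> carrier (K a (Suc (Suc n)))" for x
    using \<pi>(2) that lin_closed[OF d_lin[OF a] that] by blast
  then obtain b p \<Psi> where b: "b \<in> Obj" "p \<in> Arr b a" "lin R (K b n) M \<Psi>"
    "\<And>x. x \<in> carrier (K b (Suc n)) \<Longrightarrow> \<pi> (P b a p (Suc n) x) = \<Psi> (d b n x)"
    using null[OF M] a \<pi>(1) unfolding cohomology_null_def by meson
  have "P b a p (Suc n) z \<in> d a (Suc n) ` carrier (K a (Suc (Suc n)))"
    if z: "z \<in> carrier (K b (Suc n))" "d b n z = \<zero>\<^bsub>K b n\<^esub>" for z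
    using b(4)[OF z(1)] z(2) lin_zero[OF K_module[OF b(1)] M b(3)] \<pi>(2)[OF lin_closed[OF P_lin[OF b(1) a b(2)] z(1)]]
    by simp
  then show "\<exists>b\<in>Obj. \<exists>p\<in>Arr b a. \<forall>z\<in>carrier (K b (Suc n)). d b n z = \<zero>\<^bsub>K b n\<^esub> \<longrightarrow>
    P b a p (Suc n) z \<in> d a (Suc n) ` carrier (K a (Suc (Suc n)))"
    using b by blast
qed

end

section \<open>Mapping cones\<close>

text \<open>Chains of simplicial sets, reduced to what the cones need. The modules \<open>L\<close>
  and \<open>N\<close> in \<open>E_projective\<close> have elements in \<open>'e \<times> 'e\<close>
  because type variables are fixed inside a locale and the liftings that occur go through
  differentials of cones.\<close>

locale chain_functor =
  fixes C :: "('o, 'a) category" and R :: "('r, 'b) ring_scheme"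
    and E :: "'o \<Rightarrow> nat \<Rightarrow> ('r, 'e) module" and D :: "'o \<Rightarrow> nat \<Rightarrow> 'e \<Rightarrow> 'e"
    and Mp :: "'o \<Rightarrow> 'o \<Rightarrow> 'a \<Rightarrow> nat \<Rightarrow> 'e \<Rightarrow> 'e"
  assumes E_module: "a \<in> Ob C \<Longrightarrow> left_module R (E a n)"
    and D_lin: "a \<in> Ob C \<Longrightarrow> lin R (E a (Suc n)) (E a n) (D a n)"
    and D_D: "\<lbrakk>a \<in> Ob C; x \<in> carrier (E a (Suc (Suc n)))\<rbrakk> \<Longrightarrow> D a n (D a (Suc n) x) = \<zero>\<^bsub>E a n\<^esub>"
    and Mp_lin: "\<lbrakk>h \<in> Hom C a b; a \<in> Ob C; b \<in> Ob C\<rbrakk> \<Longrightarrow> lin R (E a n) (E b n) (Mp a b h n)"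
    and Mp_D: "\<lbrakk>h \<in> Hom C a b; a \<in> Ob C; b \<in> Ob C; x \<in> carrier (E a (Suc n))\<rbrakk> \<Longrightarrow>
      Mp a b h n (D a n x) = D b n (Mp a b h (Suc n) x)"
    and Mp_Id: "\<lbrakk>a \<in> Ob C; x \<in> carrier (E a n)\<rbrakk> \<Longrightarrow> Mp a a (Id C a) n x = x"
    and Mp_Cmp: "\<lbrakk>g \<in> Hom C a b; h \<in> Hom C b c; a \<in> Ob C; b \<in> Ob C; c \<in> Ob C; x \<in> carrier (E a n)\<rbrakk> \<Longrightarrow>
      Mp a c (Cmp C a b c h g) n x = Mp b c h n (Mp a b g n x)"
    and E_0: "\<lbrakk>a \<in> Ob C; x \<in> carrier (E a 0)\<rbrakk> \<Longrightarrow> x = \<zero>\<^bsub>E a 0\<^esub>"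
    and E_1: "\<lbrakk>a \<in> Ob C; x \<in> carrier (E a (Suc 0))\<rbrakk> \<Longrightarrow> x = \<zero>\<^bsub>E a (Suc 0)\<^esub>"
    and E_projective: "\<And>a n (L :: ('r, 'e \<times> 'e) module) (N :: ('r, 'e \<times> 'e) module) g e.
      \<lbrakk>a \<in> Ob C; left_module R L; left_module R N; lin R L N e; lin R (E a n) N g;
        \<forall>x\<in>carrier (E a n). g x \<in> e ` carrier L\<rbrakk> \<Longrightarrow>
      \<exists>k. lin R (E a n) L k \<and> (\<forall>x\<in>carrier (E a n). e (k x) = g x)"

locale pro_chain = pro_map C X Y f + chain_functor C R E D Mp
  for C :: "('o, 'a) category" and X :: "('i, 'j, 'o, 'a) pro_obj"
    and Y :: "('k, 'l, 'o, 'a) pro_obj" and f :: "'k \<Rightarrow> ('i \<times> 'a) set"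
    and R :: "('r, 'b) ring_scheme" and E :: "'o \<Rightarrow> nat \<Rightarrow> ('r, 'e) module"
    and D :: "'o \<Rightarrow> nat \<Rightarrow> 'e \<Rightarrow> 'e" and Mp :: "'o \<Rightarrow> 'o \<Rightarrow> 'a \<Rightarrow> nat \<Rightarrow> 'e \<Rightarrow> 'e"
begin

text \<open>These triples, with the commuting squares \<open>arrows\<close> between them, replace a
  level representation of \<open>f\<close>: every representative at every stage has its own
  cone.\<close>

definition reps :: "('k \<times> 'i \<times> 'a) set" where
  "reps = {(s, t, h). s \<in> Ob J \<and> (t, h) \<in> f s}"

definition arrows :: "'k \<times> 'i \<times> 'a \<Rightarrow> 'k \<times> 'i \<times> 'a \<Rightarrow> ('l \<times> 'j) set" where
  "arrows = (\<lambda>(s', t', h') (s, t, h). {(w, u). w \<in> Hom J s' s \<and> u \<in> Hom I t' t \<and>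
     Cmp C (XX t') (XX t) (YY s) h (TX t' t u) = Cmp C (XX t') (YY s') (YY s) (TY s' s w) h'})"

abbreviation "CX t n \<equiv> E (XX t) n"
abbreviation "CY s n \<equiv> E (YY s) n"
abbreviation "DX t n \<equiv> D (XX t) n"
abbreviation "DY s n \<equiv> D (YY s) n"
abbreviation "mX t' t u n \<equiv> Mp (XX t') (XX t) (TX t' t u) n"
abbreviation "mY s' s w n \<equiv> Mp (YY s') (YY s) (TY s' s w) n"
abbreviation "mf t s h n \<equiv> Mp (XX t) (YY s) h n"

text \<open>Indexed one lower than the usual cone: position \<open>n\<close> holds \<open>Y\<close>
  in position \<open>n + 1\<close> and \<open>X\<close> in position \<open>n\<close>. Position 0
  therefore vanishes by \<open>E_0\<close> and \<open>E_1\<close>, as \<open>complex_system\<close>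
  demands.\<close>

definition cone :: "'k \<times> 'i \<times> 'a \<Rightarrow> nat \<Rightarrow> ('r, 'e \<times> 'e) module" where
  "cone = (\<lambda>(s, t, h) n. prod_module (CY s (Suc n)) (CX t n))"

definition cone_d :: "'k \<times> 'i \<times> 'a \<Rightarrow> nat \<Rightarrow> 'e \<times> 'e \<Rightarrow> 'e \<times> 'e" where
  "cone_d = (\<lambda>(s, t, h) n p. (DY s (Suc n) (fst p) \<oplus>\<^bsub>CY s (Suc n)\<^esub> mf t s h (Suc n) (snd p),
     \<ominus>\<^bsub>CX t n\<^esub> DX t n (snd p)))"

definition cone_map :: "'k \<times> 'i \<times> 'a \<Rightarrow> 'k \<times> 'i \<times> 'a \<Rightarrow> 'l \<times> 'j \<Rightarrow> nat \<Rightarrow> 'e \<times> 'e \<Rightarrow> 'e \<times> 'e" where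
  "cone_map = (\<lambda>(s', t', h') (s, t, h) (w, u) n p.
     (mY s' s w (Suc n) (fst p), mX t' t u n (snd p)))"

lemma repsD:
  assumes "(s, t, h) \<in> reps"
  shows "s \<in> Ob J" "t \<in> Ob I" "(t, h) \<in> f s" "h \<in> Hom C (XX t) (YY s)" "YY s \<in> Ob C" "XX t \<in> Ob C"
  using assms fD XX YY by (auto simp: reps_def)

lemma arrowsD:
  assumes "(w, u) \<in> arrows (s', t', h') (s, t, h)"
  shows "w \<in> Hom J s' s" "u \<in> Hom I t' t"
    "Cmp C (XX t') (XX t) (YY s) h (TX t' t u) = Cmp C (XX t') (YY s') (YY s) (TY s' s w) h'"
  using assms by (auto simp: arrows_def)

lemma arrow_TX: assumes "(w, u) \<in> arrows (s', t', h') (s, t, h)" "(s, t, h) \<in> reps" "(s', t', h') \<in> reps"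
  shows "TX t' t u \<in> Hom C (XX t') (XX t)" "TY s' s w \<in> Hom C (YY s') (YY s)"
  using arrowsD[OF assms(1)] repsD[OF assms(2)] repsD[OF assms(3)] TX TY by auto

lemma mf_natural:
  assumes "(w, u) \<in> arrows (s', t', h') (s, t, h)" "(s, t, h) \<in> reps" "(s', t', h') \<in> reps"
    and x: "x \<in> carrier (CX t' n)"
  shows "mf t s h n (mX t' t u n x) = mY s' s w n (mf t' s' h' n x)"
  using arrowsD(3)[OF assms(1)] Mp_Cmp[OF arrow_TX(1)[OF assms(1-3)] repsD(4)[OF assms(2)]
      repsD(6)[OF assms(3)] repsD(6,5)[OF assms(2)] x]
    Mp_Cmp[OF repsD(4)[OF assms(3)] arrow_TX(2)[OF assms(1-3)]
      repsD(6,5)[OF assms(3)] repsD(5)[OF assms(2)] x] by simp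

lemma cone_module: "a \<in> reps \<Longrightarrow> left_module R (cone a n)"
  unfolding cone_def using repsD by (auto intro!: left_module_prod E_module split: prod.split)

text \<open>A direct sum of projective modules is projective: the lifts on the two summands are
  found separately and added.\<close>

lemma cone_projective:
  assumes a: "a \<in> reps" and b: "b \<in> reps" and g: "lin R (cone a n) (cone b m) g"
    and gd: "\<forall>x\<in>carrier (cone a n). g x \<in> cone_d b m ` carrier (cone b (Suc m))"
    and d: "lin R (cone b (Suc m)) (cone b m) (cone_d b m)"
  shows "\<exists>k. lin R (cone a n) (cone b (Suc m)) k \<and> (\<forall>x\<in>carrier (cone a n). cone_d b m (k x) = g x)"
proof -
  obtain s t h where a_eq: "a = (s, t, h)" by (metis surj_pair)
  note r = repsD[OF a[unfolded a_eq]]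
  let ?Y = "CY s (Suc n)" and ?X = "CX t n"
  have mods: "left_module R ?Y" "left_module R ?X" using r by (auto intro: E_module)
  have cone_a: "cone a n = prod_module ?Y ?X" by (simp add: cone_def a_eq)
  note il = lin_inl[OF mods(2), of ?Y] lin_inr[OF mods(1), of ?X]
  note bm = cone_module[OF b]
  interpret Y: abelian_group ?Y by (rule left_module_group[OF mods(1)])
  interpret X: abelian_group ?X by (rule left_module_group[OF mods(2)])
  have "\<forall>y\<in>carrier ?Y. g (y, \<zero>\<^bsub>?X\<^esub>) \<in> cone_d b m ` carrier (cone b (Suc m))"
    using gd unfolding cone_a by simp
  then obtain k1 where k1: "lin R ?Y (cone b (Suc m)) k1"
    "\<And>y. y \<in> carrier ?Y \<Longrightarrow> cone_d b m (k1 y) = g (y, \<zero>\<^bsub>?X\<^esub>)"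
    using E_projective[OF r(5) bm bm d lin_comp[OF il(1) g[unfolded cone_a]]] by blast
  have "\<forall>x\<in>carrier ?X. g (\<zero>\<^bsub>?Y\<^esub>, x) \<in> cone_d b m ` carrier (cone b (Suc m))"
    using gd unfolding cone_a by simp
  then obtain k2 where k2: "lin R ?X (cone b (Suc m)) k2"
    "\<And>x. x \<in> carrier ?X \<Longrightarrow> cone_d b m (k2 x) = g (\<zero>\<^bsub>?Y\<^esub>, x)"
    using E_projective[OF r(6) bm bm d lin_comp[OF il(2) g[unfolded cone_a]]] by blast
  let ?k = "\<lambda>p. k1 (fst p) \<oplus>\<^bsub>cone b (Suc m)\<^esub> k2 (snd p)"
  have "lin R (cone a n) (cone b (Suc m)) ?k"
    unfolding cone_a by (intro lin_plus_map bm lin_comp[OF lin_fst k1(1)] lin_comp[OF lin_snd k2(1)])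
  moreover have "cone_d b m (?k p) = g p" if p: "p \<in> carrier (cone a n)" for p
  proof -
    obtain y x where yx: "p = (y, x)" "y \<in> carrier ?Y" "x \<in> carrier ?X"
      using p unfolding cone_a by (cases p) auto
    have "cone_d b m (?k p) = g (y, \<zero>\<^bsub>?X\<^esub>) \<oplus>\<^bsub>cone b m\<^esub> g (\<zero>\<^bsub>?Y\<^esub>, x)"
      using yx by (simp add: lin_add[OF d] lin_closed[OF k1(1)] lin_closed[OF k2(1)] k1(2) k2(2))
    also have "\<dots> = g p"
      using yx lin_add[OF g[unfolded cone_a], of "(y, \<zero>\<^bsub>?X\<^esub>)" "(\<zero>\<^bsub>?Y\<^esub>, x)"] by simp
    finally show ?thesis .
  qed
  ultimately show ?thesis by blast
qed

lemma cone_d_lin: "a \<in> reps \<Longrightarrow> lin R (cone a (Suc n)) (cone a n) (cone_d a n)"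
  unfolding cone_def cone_d_def
  by (cases a) (auto intro!: lin_Pair lin_plus_map lin_neg_map E_module
      lin_comp[OF lin_fst D_lin] lin_comp[OF lin_snd D_lin] lin_comp[OF lin_snd Mp_lin] dest: repsD)

lemma reps_refine:
  assumes a: "(s, t, h) \<in> reps" and s': "s' \<in> Ob J" "w \<in> Hom J s' s" and h': "(t', h') \<in> f s'"
  obtains r u v where "r \<in> Ob I" "v \<in> Hom I r t'"
    "(s', r, Cmp C (XX r) (XX t') (YY s') h' (TX r t' v)) \<in> reps"
    "(w, u) \<in> arrows (s', r, Cmp C (XX r) (XX t') (YY s') h' (TX r t' v)) (s, t, h)"
  by (rule f_square[OF repsD(1)[OF a] s'(1) repsD(3)[OF a] s'(2) h'])
    (rule that, use s' in \<open>auto simp: reps_def arrows_def\<close>)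

sublocale cone: complex_system R reps arrows cone cone_d cone_map
proof (rule complex_system.intro)
  show "left_module R (cone a n)" if "a \<in> reps" for a n
    using that by (rule cone_module)
  show "lin R (cone a (Suc n)) (cone a n) (cone_d a n)" if "a \<in> reps" for a n
    using that by (rule cone_d_lin)
  show "cone_d a n (cone_d a (Suc n) x) = \<zero>\<^bsub>cone a n\<^esub>"
    if a: "a \<in> reps" and x: "x \<in> carrier (cone a (Suc (Suc n)))" for a n x
  proof -
    obtain s t h where [simp]: "a = (s, t, h)" by (metis surj_pair)
    note r = repsD[OF a[simplified]]
    obtain y z where [simp]: "x = (y, z)" and y: "y \<in> carrier (CY s (Suc (Suc (Suc n))))"
      and z: "z \<in> carrier (CX t (Suc (Suc n)))"
      using x by (cases x) (auto simp: cone_def)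
    note m = E_module[OF r(5)] E_module[OF r(6)]
    interpret Y: abelian_group "CY s m" for m by (rule left_module_group[OF m(1)])
    interpret X: abelian_group "CX t m" for m by (rule left_module_group[OF m(2)])
    note Dz = lin_closed[OF D_lin[OF r(6)] z] and Dy = lin_closed[OF D_lin[OF r(5)] y]
    note hz = lin_closed[OF Mp_lin[OF r(4,6,5)] z]
    \<comment> \<open>By \<open>D_D\<close> and naturality only \<open>h D z\<close> survives in the
      first component. The sign in the second component of the cone differential produces the same
      term with a minus.\<close>
    have "DY s (Suc n) (DY s (Suc (Suc n)) y \<oplus>\<^bsub>CY s (Suc (Suc n))\<^esub> mf t s h (Suc (Suc n)) z) =
      mf t s h (Suc n) (DX t (Suc n) z)"
      using lin_add[OF D_lin[OF r(5)] Dy hz] D_D[OF r(5) y] Mp_D[OF r(4,6,5) z]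
        lin_closed[OF D_lin[OF r(5)] hz] by simp
    then show ?thesis
      using lin_neg[OF m(2,1) Mp_lin[OF r(4,6,5)] Dz] lin_closed[OF Mp_lin[OF r(4,6,5)] Dz]
        lin_neg[OF m(2,2) D_lin[OF r(6)] Dz] D_D[OF r(6) z]
      by (simp add: cone_def cone_d_def Y.r_neg)
  qed
  show "lin R (cone a n) (cone b n) (cone_map a b p n)"
    if "a \<in> reps" "b \<in> reps" "p \<in> arrows a b" for a b p n
    unfolding cone_def cone_map_def using that
    by (cases a; cases b; cases p) (auto intro!: lin_Pair 
      lin_comp[OF lin_fst Mp_lin] lin_comp[OF lin_snd Mp_lin] dest: repsD arrow_TX)
  show "cone_map a b p n (cone_d a n x) = cone_d b n (cone_map a b p (Suc n) x)"
    if ab: "a \<in> reps" "b \<in> reps" "p \<in> arrows a b" and x: "x \<in> carrier (cone a (Suc n))" for a b p n x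
  proof -
    obtain s t h s' t' h' w u where [simp]: "b = (s, t, h)" "a = (s', t', h')" "p = (w, u)" by (metis surj_pair)
    note r = repsD[OF ab(1)[simplified]] and r' = repsD[OF ab(2)[simplified]]
    note T = arrow_TX[OF ab(3)[simplified] ab(2,1)[simplified]]
    obtain y z where [simp]: "x = (y, z)" and y: "y \<in> carrier (CY s' (Suc (Suc n)))"
      and z: "z \<in> carrier (CX t' (Suc n))"
      using x by (cases x) (auto simp: cone_def)
    show ?thesis
      using lin_add[OF Mp_lin[OF T(2) r(5) r'(5)] lin_closed[OF D_lin[OF r(5)] y] lin_closed[OF Mp_lin[OF r(4,6,5)] z]]
        lin_neg[OF E_module[OF r(6)] E_module[OF r'(6)] Mp_lin[OF T(1) r(6) r'(6)] lin_closed[OF D_lin[OF r(6)] z]]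
        Mp_D[OF T(2) r(5) r'(5) y] Mp_D[OF T(1) r(6) r'(6) z]
        mf_natural[OF ab(3)[simplified] ab(2,1)[simplified] z]
      by (simp add: cone_d_def cone_map_def)
  qed
  show "arrows a a \<noteq> {}" if a: "a \<in> reps" for a
  proof -
    obtain s t h where [simp]: "a = (s, t, h)" by (metis surj_pair)
    note r = repsD[OF a[simplified]]
    have "(category.Id J s, category.Id I t) \<in> arrows a a"
      using r by (simp add: arrows_def cat_id[OF I_cat] cat_id[OF J_cat] TX_id TY_id cat_idl[OF cat] cat_idr[OF cat])
    then show ?thesis by blast
  qed
  show "\<exists>r\<in>arrows a c. \<forall>n. \<forall>x\<in>carrier (cone a n). cone_map a c r n x = cone_map b c q n (cone_map a b p n x)"
    if a: "a \<in> reps" and b: "b \<in> reps" and c: "c \<in> reps" and p: "p \<in> arrows a b" and q: "q \<in> arrows b c"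
    for a b c p q
  proof -
    obtain s t h s' t' h' s'' t'' h'' w u w' u' where [simp]: "c = (s, t, h)" "b = (s', t', h')"
      "a = (s'', t'', h'')" "q = (w, u)" "p = (w', u')" by (metis surj_pair)
    note r = repsD[OF c[simplified]] and r' = repsD[OF b[simplified]] and r'' = repsD[OF a[simplified]]
    note q' = arrowsD[OF q[simplified]] and p' = arrowsD[OF p[simplified]]
    note Tq = arrow_TX[OF q[simplified] c[simplified] b[simplified]]
    note Tp = arrow_TX[OF p[simplified] b[simplified] a[simplified]]
    \<comment> \<open>Pasting of the two commuting squares: their composite is again an element of
      \<open>arrows\<close>.\<close>
    have "Cmp C (XX t'') (XX t) (YY s) h (Cmp C (XX t'') (XX t') (XX t) (TX t' t u) (TX t'' t' u')) =
      Cmp C (XX t'') (XX t') (YY s) (Cmp C (XX t') (XX t) (YY s) h (TX t' t u)) (TX t'' t' u')"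
      by (rule cat_assoc[OF cat Tp(1) Tq(1) r(4) r''(6) r'(6) r(6) r(5), symmetric])
    also have "\<dots> = Cmp C (XX t'') (YY s') (YY s) (TY s' s w) (Cmp C (XX t'') (XX t') (YY s') h' (TX t'' t' u'))"
      unfolding q'(3) by (rule cat_assoc[OF cat Tp(1) r'(4) Tq(2) r''(6) r'(6) r'(5) r(5)])
    also have "\<dots> = Cmp C (XX t'') (YY s'') (YY s) (Cmp C (YY s'') (YY s') (YY s) (TY s' s w) (TY s'' s' w')) h''"
      unfolding p'(3) by (rule cat_assoc[OF cat r''(4) Tp(2) Tq(2) r''(6) r''(5) r'(5) r(5), symmetric])
    finally have "(Cmp J s'' s' s w w', Cmp I t'' t' t u u') \<in> arrows a c"
      using p'(1,2) q'(1,2) r(1,2) r'(1,2) r''(1,2)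
      by (simp add: arrows_def cat_comp[OF I_cat] cat_comp[OF J_cat] TX_comp TY_comp)
    moreover have "cone_map a c (Cmp J s'' s' s w w', Cmp I t'' t' t u u') n x = cone_map b c q n (cone_map a b p n x)"
      if "x \<in> carrier (cone a n)" for n x
      using that p'(1,2) q'(1,2) r r' r'' Tp Tq
      by (auto simp: cone_map_def cone_def TX_comp TY_comp Mp_Cmp)
    ultimately show ?thesis by blast
  qed
  show "x = \<zero>\<^bsub>cone a 0\<^esub>" if "a \<in> reps" "x \<in> carrier (cone a 0)" for a x
    using that E_0 E_1 repsD by (cases a) (auto simp: cone_def)
  show "\<exists>k. lin R (cone a n) (cone b (Suc m)) k \<and> (\<forall>x\<in>carrier (cone a n). cone_d b m (k x) = g x)"
    if "a \<in> reps" "b \<in> reps" "lin R (cone a n) (cone b m) g"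
      "\<forall>x\<in>carrier (cone a n). g x \<in> cone_d b m ` carrier (cone b (Suc m))" for a b n m g
    using cone_projective[OF that cone_d_lin[OF that(2)]] .
qed

section \<open>Homology of the cones and the map induced by \<open>f\<close> on pro-homology\<close>

definition mono_arrow :: "nat \<Rightarrow> 'k \<times> 'i \<times> 'a \<Rightarrow> 'k \<times> 'i \<times> 'a \<Rightarrow> 'l \<times> 'j \<Rightarrow> bool" where
  "mono_arrow n = (\<lambda>(s', t', h') (s, t, h) (w, u). \<forall>x\<in>carrier (CX t' (Suc n)). DX t' n x = \<zero>\<^bsub>CX t' n\<^esub> \<longrightarrow>
     mf t' s' h' (Suc n) x \<in> DY s' (Suc n) ` carrier (CY s' (Suc (Suc n))) \<longrightarrow>
     mX t' t u (Suc n) x \<in> DX t (Suc n) ` carrier (CX t (Suc (Suc n))))"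

definition epi_arrow :: "nat \<Rightarrow> 'k \<times> 'i \<times> 'a \<Rightarrow> 'k \<times> 'i \<times> 'a \<Rightarrow> 'l \<times> 'j \<Rightarrow> bool" where
  "epi_arrow n = (\<lambda>(s', t', h') (s, t, h) (w, u). \<forall>y\<in>carrier (CY s' (Suc n)). DY s' n y = \<zero>\<^bsub>CY s' n\<^esub> \<longrightarrow>
     (\<exists>x\<in>carrier (CX t (Suc n)). DX t n x = \<zero>\<^bsub>CX t n\<^esub> \<and> (\<exists>z\<in>carrier (CY s (Suc (Suc n))).
        mY s' s w (Suc n) y = mf t s h (Suc n) x \<oplus>\<^bsub>CY s (Suc n)\<^esub> DY s (Suc n) z)))"

text \<open>The first half of being a pro-isomorphism; \<open>homology_pro_epi\<close> is the other.
  A \<open>mono_arrow\<close> kills on homology of \<open>X\<close> whatever \<open>h'\<close>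
  kills, an \<open>epi_arrow\<close> moves homology of \<open>Y\<close> into the image of
  \<open>h\<close>, both in position \<open>Suc n\<close>. Quantifying over \<open>reps\<close> lets
  the conditions be compared with the cones square by square.\<close>

definition homology_pro_mono :: "nat \<Rightarrow> bool" where
  "homology_pro_mono n \<longleftrightarrow> (\<forall>a\<in>reps. \<exists>b\<in>reps. \<exists>p\<in>arrows b a. mono_arrow n b a p)"

definition homology_pro_epi :: "nat \<Rightarrow> bool" where
  "homology_pro_epi n \<longleftrightarrow> (\<forall>a\<in>reps. \<exists>b\<in>reps. \<exists>p\<in>arrows b a. epi_arrow n b a p)"

lemma reps_id: "a \<in> reps \<Longrightarrow> \<exists>p. p \<in> arrows a a"
  using cone.Arr_id by blast

text \<open>Position 1 lies below the simplicial degrees and contains only 0. This is the half of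
  the condition for \<open>cone.homology_null 0\<close> that is not among those with index
  \<open>Suc n\<close>.\<close>

lemma homology_pro_mono_0: "homology_pro_mono 0"
  unfolding homology_pro_mono_def
proof
  fix a assume a: "a \<in> reps"
  obtain s t h where a_eq: "a = (s, t, h)" by (metis surj_pair)
  obtain w u where p: "(w, u) \<in> arrows a a" using reps_id[OF a] by (metis surj_pair)
  note r = repsD[OF a[unfolded a_eq]] and T = arrow_TX[OF p[unfolded a_eq] a[unfolded a_eq] a[unfolded a_eq]]
  have "mX t t u (Suc 0) x \<in> DX t (Suc 0) ` carrier (CX t (Suc (Suc 0)))" if "x \<in> carrier (CX t (Suc 0))" for x
    unfolding E_1[OF r(6) lin_closed[OF Mp_lin[OF T(1) r(6) r(6)] that]]
    by (rule image_eqI, rule lin_zero[OF E_module[OF r(6)] E_module[OF r(6)] D_lin[OF r(6)], symmetric],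
      rule abelian_groupE(2)[OF left_module_group[OF E_module[OF r(6)]]])
  then have "mono_arrow 0 a a (w, u)"
    unfolding mono_arrow_def a_eq prod.case by blast
  then show "\<exists>b\<in>reps. \<exists>p\<in>arrows b a. mono_arrow 0 b a p"
    using a p by blast
qed

text \<open>If \<open>h' x\<close> is the boundary of \<open>y\<close>, then \<open>(- y, x)\<close>
  is a cycle of the cone. Its image is a boundary, and the second component says that the transition
  map sends \<open>x\<close> to a boundary.\<close>

lemma cone_null_imp_mono:
  assumes "cone.homology_null n" shows "homology_pro_mono n"
  unfolding homology_pro_mono_def
proof
  fix a assume a: "a \<in> reps"
  obtain b p where b: "b \<in> reps" "p \<in> arrows b a" and null: "\<And>z. z \<in> carrier (cone b (Suc n)) \<Longrightarrow>
     cone_d b n z = \<zero>\<^bsub>cone b n\<^esub> \<Longrightarrow> cone_map b a p (Suc n) z \<in> cone_d a (Suc n) ` carrier (cone a (Suc (Suc n)))"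
    using assms a unfolding cone.homology_null_def by blast
  obtain s t h s' t' h' w u where eq: "a = (s, t, h)" "b = (s', t', h')" "p = (w, u)" by (metis surj_pair)
  note r = repsD[OF a[unfolded eq]] and r' = repsD[OF b(1)[unfolded eq]]
  interpret X: abelian_group "CX t m" for m by (rule left_module_group[OF E_module[OF r(6)]])
  interpret X': abelian_group "CX t' m" for m by (rule left_module_group[OF E_module[OF r'(6)]])
  interpret Y': abelian_group "CY s' m" for m by (rule left_module_group[OF E_module[OF r'(5)]])
  have "mX t' t u (Suc n) x \<in> DX t (Suc n) ` carrier (CX t (Suc (Suc n)))"
    if x: "x \<in> carrier (CX t' (Suc n))" "DX t' n x = \<zero>\<^bsub>CX t' n\<^esub>"
      and y: "mf t' s' h' (Suc n) x = DY s' (Suc n) y" "y \<in> carrier (CY s' (Suc (Suc n)))" for x y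
  proof -
    have "cone_d b n (\<ominus>\<^bsub>CY s' (Suc (Suc n))\<^esub> y, x) = \<zero>\<^bsub>cone b n\<^esub>"
      using x y lin_neg[OF E_module[OF r'(5)] E_module[OF r'(5)] D_lin[OF r'(5)] y(2)]
        lin_closed[OF D_lin[OF r'(5)] y(2)]
      by (simp add: eq cone_d_def cone_def Y'.l_neg)
    then have "cone_map b a p (Suc n) (\<ominus>\<^bsub>CY s' (Suc (Suc n))\<^esub> y, x) \<in> cone_d a (Suc n) ` carrier (cone a (Suc (Suc n)))"
      using null x y by (simp add: eq cone_def)
    then obtain x' where x': "x' \<in> carrier (CX t (Suc (Suc n)))" "mX t' t u (Suc n) x = \<ominus>\<^bsub>CX t (Suc n)\<^esub> DX t (Suc n) x'"
      by (auto simp: eq cone_map_def cone_d_def cone_def)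
    then show ?thesis
      using lin_neg[OF E_module[OF r(6)] E_module[OF r(6)] D_lin[OF r(6)] x'(1), symmetric] X.a_inv_closed by simp
  qed
  then have "mono_arrow n b a p" unfolding mono_arrow_def eq prod.case by blast
  then show "\<exists>b\<in>reps. \<exists>p\<in>arrows b a. mono_arrow n b a p" using b by blast
qed

text \<open>A cycle \<open>y\<close> of \<open>Y\<close> is the cycle \<open>(y, 0)\<close> of the
  cone. If its image is the boundary of \<open>(z, x)\<close>, then \<open>x\<close> is a cycle and
  the image of \<open>y\<close> is \<open>h x\<close> up to the boundary of \<open>z\<close>. The
  shift of \<open>Y\<close> in the cone accounts for \<open>Suc n\<close>.\<close>

lemma cone_null_imp_epi:
  assumes "cone.homology_null n" shows "homology_pro_epi (Suc n)"
  unfolding homology_pro_epi_def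
proof
  fix a assume a: "a \<in> reps"
  obtain b p where b: "b \<in> reps" "p \<in> arrows b a" and null: "\<And>z. z \<in> carrier (cone b (Suc n)) \<Longrightarrow>
     cone_d b n z = \<zero>\<^bsub>cone b n\<^esub> \<Longrightarrow> cone_map b a p (Suc n) z \<in> cone_d a (Suc n) ` carrier (cone a (Suc (Suc n)))"
    using assms a unfolding cone.homology_null_def by blast
  obtain s t h s' t' h' w u where eq: "a = (s, t, h)" "b = (s', t', h')" "p = (w, u)" by (metis surj_pair)
  note r = repsD[OF a[unfolded eq]] and r' = repsD[OF b(1)[unfolded eq]]
  note T = arrow_TX[OF b(2)[unfolded eq] a[unfolded eq] b(1)[unfolded eq]]
  interpret X: abelian_group "CX t m" for m by (rule left_module_group[OF E_module[OF r(6)]])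
  interpret X': abelian_group "CX t' m" for m by (rule left_module_group[OF E_module[OF r'(6)]])
  interpret Y: abelian_group "CY s m" for m by (rule left_module_group[OF E_module[OF r(5)]])
  interpret Y': abelian_group "CY s' m" for m by (rule left_module_group[OF E_module[OF r'(5)]])
  have "\<exists>x\<in>carrier (CX t (Suc (Suc n))). DX t (Suc n) x = \<zero>\<^bsub>CX t (Suc n)\<^esub> \<and> (\<exists>z\<in>carrier (CY s (Suc (Suc (Suc n)))).
        mY s' s w (Suc (Suc n)) y = mf t s h (Suc (Suc n)) x \<oplus>\<^bsub>CY s (Suc (Suc n))\<^esub> DY s (Suc (Suc n)) z)"
    if y: "y \<in> carrier (CY s' (Suc (Suc n)))" "DY s' (Suc n) y = \<zero>\<^bsub>CY s' (Suc n)\<^esub>" for y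
  proof -
    have "cone_d b n (y, \<zero>\<^bsub>CX t' (Suc n)\<^esub>) = \<zero>\<^bsub>cone b n\<^esub>"
      using y lin_zero[OF E_module[OF r'(6)] E_module[OF r'(6)] D_lin[OF r'(6)]]
        lin_zero[OF E_module[OF r'(6)] E_module[OF r'(5)] Mp_lin[OF r'(4,6,5)]]
      by (simp add: eq cone_d_def cone_def X'.a_inv_zero)
    then have "cone_map b a p (Suc n) (y, \<zero>\<^bsub>CX t' (Suc n)\<^esub>) \<in> cone_d a (Suc n) ` carrier (cone a (Suc (Suc n)))"
      using null y by (simp add: eq cone_def)
    then obtain z x where zx: "z \<in> carrier (CY s (Suc (Suc (Suc n))))" "x \<in> carrier (CX t (Suc (Suc n)))"
      "mY s' s w (Suc (Suc n)) y = DY s (Suc (Suc n)) z \<oplus>\<^bsub>CY s (Suc (Suc n))\<^esub> mf t s h (Suc (Suc n)) x"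
      "\<zero>\<^bsub>CX t (Suc n)\<^esub> = \<ominus>\<^bsub>CX t (Suc n)\<^esub> DX t (Suc n) x"
      using lin_zero[OF E_module[OF r'(6)] E_module[OF r(6)] Mp_lin[OF T(1) r'(6) r(6)]]
      by (auto simp: eq cone_map_def cone_d_def cone_def)
    have "DX t (Suc n) x = \<zero>\<^bsub>CX t (Suc n)\<^esub>"
      using X.a_inv_eq_zeroD[OF zx(4)[symmetric] lin_closed[OF D_lin[OF r(6)] zx(2)]] .
    then show ?thesis
      using zx(1-3) Y.a_comm[OF lin_closed[OF D_lin[OF r(5)] zx(1)] lin_closed[OF Mp_lin[OF r(4,6,5)] zx(2)]]
      by auto
  qed
  then have "epi_arrow (Suc n) b a p" unfolding epi_arrow_def eq prod.case by blast
  then show "\<exists>b\<in>reps. \<exists>p\<in>arrows b a. epi_arrow (Suc n) b a p" using b by blast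
qed

text \<open>Exactness of the long sequence of the cone, spread over two stages: the mono-arrow turns
  the component of a cone cycle in \<open>X\<close> into a boundary, which leaves a cycle of
  \<open>Y\<close>; the epi-arrow lifts that cycle to \<open>X\<close>.\<close>

lemma mono_epi_imp_cone_null:
  assumes mono: "homology_pro_mono n" and epi: "homology_pro_epi (Suc n)"
  shows "cone.homology_null n"
  unfolding cone.homology_null_def
proof
  fix a assume a: "a \<in> reps"
  \<comment> \<open>Arrows point towards \<open>a\<close>, so the epi-arrow, which is applied last,
    is chosen first.\<close>
  obtain a1 p1 where a1: "a1 \<in> reps" "p1 \<in> arrows a1 a" "epi_arrow (Suc n) a1 a p1"
    using epi a unfolding homology_pro_epi_def by blast
  obtain a2 p2 where a2: "a2 \<in> reps" "p2 \<in> arrows a2 a1" "mono_arrow n a2 a1 p2"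
    using mono a1(1) unfolding homology_pro_mono_def by blast
  obtain p where p: "p \<in> arrows a2 a" "\<And>n x. x \<in> carrier (cone a2 n) \<Longrightarrow>
     cone_map a2 a p n x = cone_map a1 a p1 n (cone_map a2 a1 p2 n x)"
    using cone.Arr_comp[OF a2(1) a1(1) a a2(2) a1(2)] by blast
  obtain s t h s1 t1 h1 w1 u1 s2 t2 h2 w2 u2 where eq: "a = (s, t, h)"
    "a1 = (s1, t1, h1)" "p1 = (w1, u1)" "a2 = (s2, t2, h2)" "p2 = (w2, u2)" by (metis surj_pair)
  note r = repsD[OF a[unfolded eq]] and r1 = repsD[OF a1(1)[unfolded eq]] and r2 = repsD[OF a2(1)[unfolded eq]]
  note T1 = arrow_TX[OF a1(2)[unfolded eq] a[unfolded eq] a1(1)[unfolded eq]]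
  note T2 = arrow_TX[OF a2(2)[unfolded eq] a1(1)[unfolded eq] a2(1)[unfolded eq]]
  note epi1 = a1(3)[unfolded epi_arrow_def eq prod.case, rule_format]
  note mono2 = a2(3)[unfolded mono_arrow_def eq prod.case, rule_format]
  note mX = E_module[OF r(6)] and mY = E_module[OF r(5)]
  note mX1 = E_module[OF r1(6)] and mY1 = E_module[OF r1(5)]
  note mX2 = E_module[OF r2(6)] and mY2 = E_module[OF r2(5)]
  interpret X: abelian_group "CX t m" for m by (rule left_module_group[OF mX])
  interpret X2: abelian_group "CX t2 m" for m by (rule left_module_group[OF mX2])
  interpret Y: abelian_group "CY s m" for m by (rule left_module_group[OF mY])
  interpret Y1: abelian_group "CY s1 m" for m by (rule left_module_group[OF mY1])
  interpret Y2: abelian_group "CY s2 m" for m by (rule left_module_group[OF mY2])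
  have "cone_map a2 a p (Suc n) c \<in> cone_d a (Suc n) ` carrier (cone a (Suc (Suc n)))"
    if c: "c \<in> carrier (cone a2 (Suc n))" "cone_d a2 n c = \<zero>\<^bsub>cone a2 n\<^esub>" for c
  proof -
    obtain y x where yx: "c = (y, x)" "y \<in> carrier (CY s2 (Suc (Suc n)))" "x \<in> carrier (CX t2 (Suc n))"
      using c(1) by (cases c) (auto simp: eq cone_def)
    have d: "DY s2 (Suc n) y \<oplus>\<^bsub>CY s2 (Suc n)\<^esub> mf t2 s2 h2 (Suc n) x = \<zero>\<^bsub>CY s2 (Suc n)\<^esub>"
      and dx: "\<ominus>\<^bsub>CX t2 n\<^esub> DX t2 n x = \<zero>\<^bsub>CX t2 n\<^esub>"
      using c(2) by (auto simp: yx eq cone_def cone_d_def)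
    have Dx: "DX t2 n x = \<zero>\<^bsub>CX t2 n\<^esub>"
      using X2.a_inv_eq_zeroD[OF dx lin_closed[OF D_lin[OF r2(6)] yx(3)]] .
    note Dy = lin_closed[OF D_lin[OF r2(5)] yx(2)] and h2x = lin_closed[OF Mp_lin[OF r2(4,6,5)] yx(3)]
    have "mf t2 s2 h2 (Suc n) x = DY s2 (Suc n) (\<ominus>\<^bsub>CY s2 (Suc (Suc n))\<^esub> y)"
      unfolding lin_neg[OF mY2 mY2 D_lin[OF r2(5)] yx(2)]
      using Y2.minus_equality[OF d[unfolded Y2.a_comm[OF Dy h2x]] Dy h2x] by simp
    then have "mf t2 s2 h2 (Suc n) x \<in> DY s2 (Suc n) ` carrier (CY s2 (Suc (Suc n)))"
      using yx(2) by blast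
    from mono2[OF yx(3) Dx this] obtain x' where x': "x' \<in> carrier (CX t1 (Suc (Suc n)))"
      "mX t2 t1 u2 (Suc n) x = DX t1 (Suc n) x'" by blast
    note w2y = lin_closed[OF Mp_lin[OF T2(2) r2(5) r1(5)] yx(2)]
    note h1x' = lin_closed[OF Mp_lin[OF r1(4,6,5)] x'(1)]
    \<comment> \<open>Adding \<open>h1 x'\<close> to \<open>w2 y\<close> gives a cycle: its
      differential is \<open>w2\<close> of \<open>D y\<close> plus \<open>h2 x\<close>, and this sum
      is 0 because \<open>(y, x)\<close> is a cycle of the cone.\<close>
    let ?y1 = "mY s2 s1 w2 (Suc (Suc n)) y \<oplus>\<^bsub>CY s1 (Suc (Suc n))\<^esub> mf t1 s1 h1 (Suc (Suc n)) x'"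
    have y1: "?y1 \<in> carrier (CY s1 (Suc (Suc n)))" using w2y h1x' by simp
    have "DY s1 (Suc n) ?y1 = mY s2 s1 w2 (Suc n) (DY s2 (Suc n) y) \<oplus>\<^bsub>CY s1 (Suc n)\<^esub>
        mY s2 s1 w2 (Suc n) (mf t2 s2 h2 (Suc n) x)"
      using lin_add[OF D_lin[OF r1(5)] w2y h1x'] Mp_D[OF T2(2) r2(5) r1(5) yx(2)]
        Mp_D[OF r1(4,6,5) x'(1)] x'(2) mf_natural[OF a2(2)[unfolded eq] a1(1)[unfolded eq] a2(1)[unfolded eq] yx(3)]
      by simp
    also have "\<dots> = \<zero>\<^bsub>CY s1 (Suc n)\<^esub>"
      using lin_add[OF Mp_lin[OF T2(2) r2(5) r1(5)] Dy h2x] d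
        lin_zero[OF mY2 mY1 Mp_lin[OF T2(2) r2(5) r1(5)]] by simp
    finally obtain x'' z where x'': "x'' \<in> carrier (CX t (Suc (Suc n)))" "DX t (Suc n) x'' = \<zero>\<^bsub>CX t (Suc n)\<^esub>"
      and z: "z \<in> carrier (CY s (Suc (Suc (Suc n))))"
      and w1: "mY s1 s w1 (Suc (Suc n)) ?y1 = mf t s h (Suc (Suc n)) x'' \<oplus>\<^bsub>CY s (Suc (Suc n))\<^esub> DY s (Suc (Suc n)) z"
      using epi1[OF y1] by blast
    note u1x' = lin_closed[OF Mp_lin[OF T1(1) r1(6) r(6)] x'(1)]
    note w1w2y = lin_closed[OF Mp_lin[OF T1(2) r1(5) r(5)] w2y]
    note hu = lin_closed[OF Mp_lin[OF r(4,6,5)] u1x'] and hx'' = lin_closed[OF Mp_lin[OF r(4,6,5)] x''(1)]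
    note Dz = lin_closed[OF D_lin[OF r(5)] z]
    \<comment> \<open>Second component of the primitive. Subtracting \<open>u1 x'\<close> removes
      the correction term from the first component, and with the sign of the cone differential it
      yields \<open>u1 u2 x\<close> in the second.\<close>
    let ?x = "x'' \<ominus>\<^bsub>CX t (Suc (Suc n))\<^esub> mX t1 t u1 (Suc (Suc n)) x'"
    have nat1: "mf t s h (Suc (Suc n)) (mX t1 t u1 (Suc (Suc n)) x') = mY s1 s w1 (Suc (Suc n)) (mf t1 s1 h1 (Suc (Suc n)) x')"
      by (rule mf_natural[OF a1(2)[unfolded eq] a[unfolded eq] a1(1)[unfolded eq] x'(1)])
    have sum: "mY s1 s w1 (Suc (Suc n)) (mY s2 s1 w2 (Suc (Suc n)) y) \<oplus>\<^bsub>CY s (Suc (Suc n))\<^esub>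
        mf t s h (Suc (Suc n)) (mX t1 t u1 (Suc (Suc n)) x') =
        mf t s h (Suc (Suc n)) x'' \<oplus>\<^bsub>CY s (Suc (Suc n))\<^esub> DY s (Suc (Suc n)) z"
      using w1 lin_add[OF Mp_lin[OF T1(2) r1(5) r(5)] w2y h1x'] nat1 by simp
    have "DY s (Suc (Suc n)) z \<oplus>\<^bsub>CY s (Suc (Suc n))\<^esub> mf t s h (Suc (Suc n)) ?x =
      (mf t s h (Suc (Suc n)) x'' \<oplus>\<^bsub>CY s (Suc (Suc n))\<^esub> DY s (Suc (Suc n)) z)
        \<ominus>\<^bsub>CY s (Suc (Suc n))\<^esub> mf t s h (Suc (Suc n)) (mX t1 t u1 (Suc (Suc n)) x')"
      unfolding lin_minus[OF mX mY Mp_lin[OF r(4,6,5)] x''(1) u1x']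
      using Dz hx'' hu by (simp add: a_minus_def Y.a_ac)
    also have "\<dots> = mY s1 s w1 (Suc (Suc n)) (mY s2 s1 w2 (Suc (Suc n)) y)"
      unfolding sum[symmetric] using w1w2y hu by (simp add: a_minus_def Y.a_assoc Y.r_neg)
    finally have A: "DY s (Suc (Suc n)) z \<oplus>\<^bsub>CY s (Suc (Suc n))\<^esub> mf t s h (Suc (Suc n)) ?x =
      mY s1 s w1 (Suc (Suc n)) (mY s2 s1 w2 (Suc (Suc n)) y)" .
    have "\<ominus>\<^bsub>CX t (Suc n)\<^esub> DX t (Suc n) ?x = DX t (Suc n) (mX t1 t u1 (Suc (Suc n)) x')"
      unfolding lin_minus[OF mX mX D_lin[OF r(6)] x''(1) u1x'] x''(2)
      using lin_closed[OF D_lin[OF r(6)] u1x'] by (simp add: a_minus_def)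
    also have "\<dots> = mX t1 t u1 (Suc n) (mX t2 t1 u2 (Suc n) x)"
      using Mp_D[OF T1(1) r1(6) r(6) x'(1)] x'(2) by simp
    finally have "cone_map a1 a p1 (Suc n) (cone_map a2 a1 p2 (Suc n) c) = cone_d a (Suc n) (z, ?x)"
      using A by (simp add: eq yx cone_map_def cone_d_def)
    moreover have "(z, ?x) \<in> carrier (cone a (Suc (Suc n)))"
      using z x''(1) u1x' by (simp add: eq cone_def)
    ultimately show ?thesis
      using p(2)[OF c(1)] by simp
  qed
  then show "\<exists>b\<in>reps. \<exists>p\<in>arrows b a. \<forall>z\<in>carrier (cone b (Suc n)). cone_d b n z = \<zero>\<^bsub>cone b n\<^esub> \<longrightarrow>
    cone_map b a p (Suc n) z \<in> cone_d a (Suc n) ` carrier (cone a (Suc (Suc n)))"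
    using a2(1) p(1) by blast
qed

lemma homology_null_iff:
  "(\<forall>n. cone.homology_null n) \<longleftrightarrow> (\<forall>n. homology_pro_mono (Suc n) \<and> homology_pro_epi (Suc n))"
proof (intro iffI allI conjI)
  fix n assume *: "\<forall>n. homology_pro_mono (Suc n) \<and> homology_pro_epi (Suc n)"
  show "cone.homology_null n"
    using * homology_pro_mono_0 by (cases n) (auto intro: mono_epi_imp_cone_null)
qed (auto intro: cone_null_imp_mono cone_null_imp_epi)

section \<open>Cohomology of the cones and the map induced by \<open>f\<close> on colimits of
  cohomology\<close>

definition cohomology_pro_inj :: "nat \<Rightarrow> ('r, 'm, 'c) module_scheme \<Rightarrow> bool" where
  "cohomology_pro_inj n M \<longleftrightarrow> (\<forall>s t h \<psi> \<chi>. (s, t, h) \<in> reps \<longrightarrow> lin R (CY s (Suc n)) M \<psi> \<longrightarrow>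
     (\<forall>y\<in>carrier (CY s (Suc (Suc n))). \<psi> (DY s (Suc n) y) = \<zero>\<^bsub>M\<^esub>) \<longrightarrow> lin R (CX t n) M \<chi> \<longrightarrow>
     (\<forall>x\<in>carrier (CX t (Suc n)). \<psi> (mf t s h (Suc n) x) = \<chi> (DX t n x)) \<longrightarrow>
     (\<exists>s'\<in>Ob J. \<exists>w\<in>Hom J s' s. \<exists>\<chi>'. lin R (CY s' n) M \<chi>' \<and>
       (\<forall>y\<in>carrier (CY s' (Suc n)). \<psi> (mY s' s w (Suc n) y) = \<chi>' (DY s' n y))))"

text \<open>Like \<open>cohomology_pro_inj\<close> this concerns position \<open>Suc n\<close>, with
  linear maps on chains as cochains and \<chi> after the differential as coboundary: the class of
  \<phi>, pulled back to a further stage, comes from the class of \<psi>.\<close>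

definition cohomology_pro_surj :: "nat \<Rightarrow> ('r, 'm, 'c) module_scheme \<Rightarrow> bool" where
  "cohomology_pro_surj n M \<longleftrightarrow> (\<forall>t \<phi>. t \<in> Ob I \<longrightarrow> lin R (CX t (Suc n)) M \<phi> \<longrightarrow>
     (\<forall>x\<in>carrier (CX t (Suc (Suc n))). \<phi> (DX t (Suc n) x) = \<zero>\<^bsub>M\<^esub>) \<longrightarrow>
     (\<exists>s t' h u \<psi> \<chi>. (s, t', h) \<in> reps \<and> u \<in> Hom I t' t \<and> lin R (CY s (Suc n)) M \<psi> \<and>
       (\<forall>y\<in>carrier (CY s (Suc (Suc n))). \<psi> (DY s (Suc n) y) = \<zero>\<^bsub>M\<^esub>) \<and> lin R (CX t' n) M \<chi> \<and>
       (\<forall>x\<in>carrier (CX t' (Suc n)). \<phi> (mX t' t u (Suc n) x) =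
          \<psi> (mf t' s h (Suc n) x) \<oplus>\<^bsub>M\<^esub> \<chi> (DX t' n x))))"

text \<open>All cochains in position 1 vanish. The case plays the same part as
  \<open>homology_pro_mono_0\<close>; \<open>f_span\<close> merely supplies a representative whose
  source lies over \<open>t\<close>.\<close>

lemma cohomology_pro_surj_0:
  assumes M: "left_module R M" shows "cohomology_pro_surj 0 M"
  unfolding cohomology_pro_surj_def
proof (intro allI impI)
  fix t \<phi> assume t: "t \<in> Ob I" and \<phi>: "lin R (CX t (Suc 0)) M \<phi>"
  interpret M: abelian_group M by (rule left_module_group[OF M])
  obtain s where s: "s \<in> Ob J" using J_cof unfolding cofiltered_def by blast
  obtain t' h u where h: "(t', h) \<in> f s" "u \<in> Hom I t' t" "t' \<in> Ob I" using f_span[OF s t] .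
  have "\<phi> (mX t' t u (Suc 0) x) = \<zero>\<^bsub>M\<^esub>" if "x \<in> carrier (CX t' (Suc 0))" for x
    using E_1[OF XX[OF t] lin_closed[OF Mp_lin[OF TX[OF h(2,3) t] XX[OF h(3)] XX[OF t]] that]]
      lin_zero[OF E_module[OF XX[OF t]] M \<phi>] by simp
  then show "\<exists>s t' h u \<psi> \<chi>. (s, t', h) \<in> reps \<and> u \<in> Hom I t' t \<and> lin R (CY s (Suc 0)) M \<psi> \<and>
       (\<forall>y\<in>carrier (CY s (Suc (Suc 0))). \<psi> (DY s (Suc 0) y) = \<zero>\<^bsub>M\<^esub>) \<and> lin R (CX t' 0) M \<chi> \<and>
       (\<forall>x\<in>carrier (CX t' (Suc 0)). \<phi> (mX t' t u (Suc 0) x) =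
          \<psi> (mf t' s h (Suc 0) x) \<oplus>\<^bsub>M\<^esub> \<chi> (DX t' 0 x))"
    using s h by (intro exI[of _ s] exI[of _ t'] exI[of _ h] exI[of _ u] exI[of _ "\<lambda>_. \<zero>\<^bsub>M\<^esub>"])
      (simp add: reps_def lin_zero_map[OF M])
qed

text \<open>A cocycle of \<open>X\<close>, extended by 0 over the summand of \<open>Y\<close>, is a
  cocycle of the cone. When it becomes \<Psi> after the differential, the part of \<Psi> on
  \<open>Y\<close> is a cocycle that pulls back to \<phi> up to a coboundary.\<close>

lemma cone_null_imp_surj:
  assumes M: "left_module R M" and null: "cone.cohomology_null n M"
  shows "cohomology_pro_surj n M"
  unfolding cohomology_pro_surj_def
proof (intro allI impI)
  fix t \<phi> assume t: "t \<in> Ob I" and \<phi>: "lin R (CX t (Suc n)) M \<phi>"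
    and \<phi>D: "\<forall>x\<in>carrier (CX t (Suc (Suc n))). \<phi> (DX t (Suc n) x) = \<zero>\<^bsub>M\<^esub>"
  interpret M: abelian_group M by (rule left_module_group[OF M])
  obtain s where s: "s \<in> Ob J" using J_cof unfolding cofiltered_def by blast
  obtain t1 h1 u1 where h1: "(t1, h1) \<in> f s" "u1 \<in> Hom I t1 t" "t1 \<in> Ob I" using f_span[OF s t] .
  have a: "(s, t1, h1) \<in> reps" using s h1 by (simp add: reps_def)
  note r = repsD[OF a]
  note T1 = TX[OF h1(2,3) t] r(6) XX[OF t]
  have l1: "lin R (CX t1 (Suc n)) M (\<lambda>x. \<phi> (mX t1 t u1 (Suc n) x))"
    by (rule lin_comp[OF Mp_lin[OF T1] \<phi>])
  let ?\<Phi> = "\<lambda>p. \<phi> (mX t1 t u1 (Suc n) (snd p))"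
  have \<Phi>: "lin R (cone (s, t1, h1) (Suc n)) M ?\<Phi>"
    using lin_comp[OF lin_snd l1] by (simp add: cone_def)
  have "?\<Phi> (cone_d (s, t1, h1) (Suc n) p) = \<zero>\<^bsub>M\<^esub>" if p: "p \<in> carrier (cone (s, t1, h1) (Suc (Suc n)))" for p
  proof -
    have x: "snd p \<in> carrier (CX t1 (Suc (Suc n)))" using p by (auto simp: cone_def)
    have "?\<Phi> (cone_d (s, t1, h1) (Suc n) p) = \<ominus>\<^bsub>M\<^esub> \<phi> (mX t1 t u1 (Suc n) (DX t1 (Suc n) (snd p)))"
      unfolding cone_d_def using lin_neg[OF E_module[OF r(6)] M l1 lin_closed[OF D_lin[OF r(6)] x]] by simp
    also have "\<dots> = \<zero>\<^bsub>M\<^esub>"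
      unfolding Mp_D[OF T1 x] using \<phi>D lin_closed[OF Mp_lin[OF T1] x] by (simp add: M.a_inv_zero)
    finally show ?thesis .
  qed
  then obtain b q \<Psi> where b: "b \<in> reps" and q: "q \<in> arrows b (s, t1, h1)" and \<Psi>: "lin R (cone b n) M \<Psi>"
    and \<Psi>d: "\<And>p. p \<in> carrier (cone b (Suc n)) \<Longrightarrow> ?\<Phi> (cone_map b (s, t1, h1) q (Suc n) p) = \<Psi> (cone_d b n p)"
    using null a \<Phi> unfolding cone.cohomology_null_def by meson
  obtain s2 t2 h2 w u where eq: "b = (s2, t2, h2)" "q = (w, u)" by (metis surj_pair)
  note r2 = repsD[OF b[unfolded eq]]
  note mX2 = E_module[OF r2(6)] and mY2 = E_module[OF r2(5)]
  interpret X2: abelian_group "CX t2 m" for m by (rule left_module_group[OF mX2])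
  interpret Y2: abelian_group "CY s2 m" for m by (rule left_module_group[OF mY2])
  note T = arrow_TX[OF q[unfolded eq] a b[unfolded eq]] and q' = arrowsD[OF q[unfolded eq]]
  have cone_b: "cone b m = prod_module (CY s2 (Suc m)) (CX t2 m)" for m
    by (simp add: eq cone_def)
  define \<psi> where "\<psi> y = \<Psi> (y, \<zero>\<^bsub>CX t2 n\<^esub>)" for y
  \<comment> \<open>The minus sign compensates the one in the second component of the cone
    differential, so that \<chi> after \<open>DX\<close> appears with a plus sign.\<close>
  define \<chi> where "\<chi> x = \<Psi> (\<zero>\<^bsub>CY s2 (Suc n)\<^esub>, \<ominus>\<^bsub>CX t2 n\<^esub> x)" for x
  have id: "lin R (CX t2 n) (CX t2 n) (\<lambda>x. x)" by (simp add: lin_def)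
  have \<psi>: "lin R (CY s2 (Suc n)) M \<psi>"
    unfolding \<psi>_def by (rule lin_comp[OF lin_inl[OF mX2] \<Psi>[unfolded cone_b]])
  have \<chi>: "lin R (CX t2 n) M \<chi>"
    unfolding \<chi>_def by (rule lin_comp[OF lin_comp[OF lin_neg_map[OF mX2 id] lin_inr[OF mY2]] \<Psi>[unfolded cone_b]])
  have 1: "\<psi> (DY s2 (Suc n) y) = \<zero>\<^bsub>M\<^esub>" if y: "y \<in> carrier (CY s2 (Suc (Suc n)))" for y
    unfolding \<psi>_def using \<Psi>d[of "(y, \<zero>\<^bsub>CX t2 (Suc n)\<^esub>)"] y lin_closed[OF D_lin[OF r2(5)] y]
      lin_zero[OF mX2 mX2 D_lin[OF r2(6)], of n] lin_zero[OF mX2 mY2 Mp_lin[OF r2(4,6,5)], of "Suc n"]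
      lin_zero[OF mX2 M lin_comp[OF Mp_lin[OF T(1) r2(6) r(6)] l1]]
    by (simp add: eq cone_def cone_d_def cone_map_def X2.a_inv_zero)
  have 2: "\<phi> (mX t2 t (Cmp I t2 t1 t u1 u) (Suc n) x) = \<psi> (mf t2 s2 h2 (Suc n) x) \<oplus>\<^bsub>M\<^esub> \<chi> (DX t2 n x)"
    if x: "x \<in> carrier (CX t2 (Suc n))" for x
  proof -
    note Dx = lin_closed[OF D_lin[OF r2(6)] x] and hx = lin_closed[OF Mp_lin[OF r2(4,6,5)] x]
    have "\<phi> (mX t2 t (Cmp I t2 t1 t u1 u) (Suc n) x) = \<phi> (mX t1 t u1 (Suc n) (mX t2 t1 u (Suc n) x))"
      unfolding TX_comp[OF q'(2) h1(2) r2(2) h1(3) t] Mp_Cmp[OF T(1) T1(1) r2(6) r(6) T1(3) x] ..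
    also have "\<dots> = \<Psi> (mf t2 s2 h2 (Suc n) x, \<ominus>\<^bsub>CX t2 n\<^esub> DX t2 n x)"
      using \<Psi>d[of "(\<zero>\<^bsub>CY s2 (Suc (Suc n))\<^esub>, x)"] x hx lin_zero[OF mY2 mY2 D_lin[OF r2(5)], of "Suc n"]
      by (simp add: eq cone_def cone_d_def cone_map_def)
    also have "\<dots> = \<psi> (mf t2 s2 h2 (Suc n) x) \<oplus>\<^bsub>M\<^esub> \<chi> (DX t2 n x)"
      unfolding \<psi>_def \<chi>_def using hx Dx lin_add[OF \<Psi>[unfolded cone_b], of "(mf t2 s2 h2 (Suc n) x, \<zero>\<^bsub>CX t2 n\<^esub>)"
        "(\<zero>\<^bsub>CY s2 (Suc n)\<^esub>, \<ominus>\<^bsub>CX t2 n\<^esub> DX t2 n x)"] by simp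
    finally show ?thesis .
  qed
  show "\<exists>s t' h u \<psi> \<chi>. (s, t', h) \<in> reps \<and> u \<in> Hom I t' t \<and> lin R (CY s (Suc n)) M \<psi> \<and>
       (\<forall>y\<in>carrier (CY s (Suc (Suc n))). \<psi> (DY s (Suc n) y) = \<zero>\<^bsub>M\<^esub>) \<and> lin R (CX t' n) M \<chi> \<and>
       (\<forall>x\<in>carrier (CX t' (Suc n)). \<phi> (mX t' t u (Suc n) x) =
          \<psi> (mf t' s h (Suc n) x) \<oplus>\<^bsub>M\<^esub> \<chi> (DX t' n x))"
    using b[unfolded eq] cat_comp[OF I_cat q'(2) h1(2) r2(2) h1(3) t] \<psi> 1 \<chi> 2 by blast
qed

text \<open>The equation of \<psi> after \<open>h\<close> with \<chi> after the differential says
  precisely that \<psi> and \<chi> together form a cocycle of the cone. Its primitive at a further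
  stage, restricted to \<open>Y\<close>, is a primitive of the pull-back of \<psi>.\<close>

lemma cone_null_imp_inj:
  assumes M: "left_module R M" and null: "cone.cohomology_null n M"
  shows "cohomology_pro_inj (Suc n) M"
  unfolding cohomology_pro_inj_def
proof (intro allI impI)
  fix s t h \<psi> \<chi> assume a: "(s, t, h) \<in> reps" and \<psi>: "lin R (CY s (Suc (Suc n))) M \<psi>"
    and \<psi>D: "\<forall>y\<in>carrier (CY s (Suc (Suc (Suc n)))). \<psi> (DY s (Suc (Suc n)) y) = \<zero>\<^bsub>M\<^esub>"
    and \<chi>: "lin R (CX t (Suc n)) M \<chi>"
    and \<psi>h: "\<forall>x\<in>carrier (CX t (Suc (Suc n))). \<psi> (mf t s h (Suc (Suc n)) x) = \<chi> (DX t (Suc n) x)"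
  interpret M: abelian_group M by (rule left_module_group[OF M])
  note r = repsD[OF a]
  let ?\<Phi> = "\<lambda>p. \<psi> (fst p) \<oplus>\<^bsub>M\<^esub> \<chi> (snd p)"
  have \<Phi>: "lin R (cone (s, t, h) (Suc n)) M ?\<Phi>"
    using lin_plus_map[OF M lin_comp[OF lin_fst \<psi>] lin_comp[OF lin_snd \<chi>]] by (simp add: cone_def)
  have "?\<Phi> (cone_d (s, t, h) (Suc n) p) = \<zero>\<^bsub>M\<^esub>" if p: "p \<in> carrier (cone (s, t, h) (Suc (Suc n)))" for p
  proof -
    obtain y x where yx: "p = (y, x)" "y \<in> carrier (CY s (Suc (Suc (Suc n))))" "x \<in> carrier (CX t (Suc (Suc n)))"
      using p by (cases p) (auto simp: cone_def)
    note Dy = lin_closed[OF D_lin[OF r(5)] yx(2)] and Dx = lin_closed[OF D_lin[OF r(6)] yx(3)]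
      and hx = lin_closed[OF Mp_lin[OF r(4,6,5)] yx(3)]
    show ?thesis
      using lin_add[OF \<psi> Dy hx] lin_neg[OF E_module[OF r(6)] M \<chi> Dx] \<psi>D \<psi>h yx lin_closed[OF \<chi> Dx]
      by (simp add: cone_d_def M.r_neg)
  qed
  then obtain b q \<Psi> where b: "b \<in> reps" and q: "q \<in> arrows b (s, t, h)" and \<Psi>: "lin R (cone b n) M \<Psi>"
    and \<Psi>d: "\<And>p. p \<in> carrier (cone b (Suc n)) \<Longrightarrow> ?\<Phi> (cone_map b (s, t, h) q (Suc n) p) = \<Psi> (cone_d b n p)"
    using null a \<Phi> unfolding cone.cohomology_null_def by meson
  obtain s2 t2 h2 w u where eq: "b = (s2, t2, h2)" "q = (w, u)" by (metis surj_pair)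
  note r2 = repsD[OF b[unfolded eq]]
  note mX2 = E_module[OF r2(6)] and mY2 = E_module[OF r2(5)]
  interpret X2: abelian_group "CX t2 m" for m by (rule left_module_group[OF mX2])
  interpret Y2: abelian_group "CY s2 m" for m by (rule left_module_group[OF mY2])
  note T = arrow_TX[OF q[unfolded eq] a b[unfolded eq]] and q' = arrowsD[OF q[unfolded eq]]
  have "lin R (CY s2 (Suc n)) M (\<lambda>y. \<Psi> (y, \<zero>\<^bsub>CX t2 n\<^esub>))"
    using \<Psi> by (intro lin_comp[OF lin_inl[OF mX2]]) (simp add: eq cone_def)
  moreover have "\<psi> (mY s2 s w (Suc (Suc n)) y) = \<Psi> (DY s2 (Suc n) y, \<zero>\<^bsub>CX t2 n\<^esub>)"
    if y: "y \<in> carrier (CY s2 (Suc (Suc n)))" for y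
    using \<Psi>d[of "(y, \<zero>\<^bsub>CX t2 (Suc n)\<^esub>)"] y lin_closed[OF D_lin[OF r2(5)] y]
      lin_zero[OF mX2 mX2 D_lin[OF r2(6)], of n] lin_zero[OF mX2 mY2 Mp_lin[OF r2(4,6,5)], of "Suc n"]
      lin_zero[OF mX2 M lin_comp[OF Mp_lin[OF T(1) r2(6) r(6)] \<chi>]]
      lin_closed[OF \<psi> lin_closed[OF Mp_lin[OF T(2) r2(5) r(5)] y]]
    by (simp add: eq cone_def cone_d_def cone_map_def X2.a_inv_zero)
  ultimately show "\<exists>s'\<in>Ob J. \<exists>w\<in>Hom J s' s. \<exists>\<chi>'. lin R (CY s' (Suc n)) M \<chi>' \<and>
       (\<forall>y\<in>carrier (CY s' (Suc (Suc n))). \<psi> (mY s' s w (Suc (Suc n)) y) = \<chi>' (DY s' (Suc n) y))"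
    using r2(1) q'(1) by blast
qed

text \<open>The point is that the same \<open>u\<close> serves both squares, so a cochain on
  \<open>XX t\<close> has a single pull-back. The first square comes from
  \<open>reps_refine\<close>; comparing germs for \<open>h2\<close> gives two arrows into
  \<open>r\<close>, which are equalized.\<close>

lemma reps_span:
  assumes a: "(s1, t, h1) \<in> reps" and b: "(s2, t, h2) \<in> reps"
  obtains s3 t3 h3 v v' u where "(s3, t3, h3) \<in> reps"
    "(v, u) \<in> arrows (s3, t3, h3) (s1, t, h1)" "(v', u) \<in> arrows (s3, t3, h3) (s2, t, h2)"
proof -
  note r1 = repsD[OF a] and r2 = repsD[OF b]
  obtain s3 v v' where s3: "s3 \<in> Ob J" "v \<in> Hom J s3 s1" "v' \<in> Hom J s3 s2"
    using cofiltered_span[OF J_cof r1(1) r2(1)] .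
  obtain t' h' where h': "(t', h') \<in> f s3" using f_nonempty[OF s3(1)] .
  obtain r u u0 where "r \<in> Ob I" and c: "(s3, r, Cmp C (XX r) (XX t') (YY s3) h' (TX r t' u0)) \<in> reps"
    and vu: "(v, u) \<in> arrows (s3, r, Cmp C (XX r) (XX t') (YY s3) h' (TX r t' u0)) (s1, t, h1)"
    using reps_refine[OF a s3(1,2) h'] .
  define h where "h = Cmp C (XX r) (XX t') (YY s3) h' (TX r t' u0)"
  note c = c[folded h_def] and vu = vu[folded h_def]
  note r3 = repsD[OF c] and u = arrowsD[OF vu]
  obtain p x y where p: "p \<in> Ob I" "x \<in> Hom I p r" "y \<in> Hom I p r"
    and hxy: "Cmp C (XX p) (XX r) (YY s2) (Cmp C (XX r) (XX t) (YY s2) h2 (TX r t u)) (TX p r x) =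
      Cmp C (XX p) (XX r) (YY s2) (Cmp C (XX r) (YY s3) (YY s2) (TY s3 s2 v') h) (TX p r y)"
    using f_join[OF f_pre[OF r2(3,1) u(2) r3(2)] f_post[OF r3(3) s3(3,1) r2(1)] r2(1)] .
  obtain q z where q: "q \<in> Ob I" "z \<in> Hom I q p" "Cmp I q p r x z = Cmp I q p r y z"
    using cofiltered_equalize[OF I_cof p(1) r3(2) p(2,3)] .
  define e where "e = Cmp I q p r x z"
  have e: "e \<in> Hom I q r" unfolding e_def by (rule cat_comp[OF I_cat q(2) p(2) q(1) p(1) r3(2)])
  let ?h = "Cmp C (XX q) (XX r) (YY s3) h (TX q r e)"
  note obs = q(1) p(1) r3(1,2) r1(1,2) r2(1)
  have "(s3, q, ?h) \<in> reps" using f_pre[OF r3(3,1) e q(1)] r3(1) by (simp add: reps_def)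
  moreover have "(v, Cmp I q r t u e) \<in> arrows (s3, q, ?h) (s1, t, h1)"
  proof -
    have "Cmp C (XX q) (XX t) (YY s1) h1 (TX q t (Cmp I q r t u e)) =
      Cmp C (XX q) (XX r) (YY s1) (Cmp C (XX r) (XX t) (YY s1) h1 (TX r t u)) (TX q r e)"
      using obs e u(2) r1(4) by (simp add: TX_comp cat_assoc[OF cat] XX YY TX)
    also have "\<dots> = Cmp C (XX q) (YY s3) (YY s1) (TY s3 s1 v) ?h"
      unfolding u(3) using obs e u(1) r3(4) by (simp add: cat_assoc[OF cat] XX YY TX TY)
    finally show ?thesis
      using obs e u(1,2) s3(2) by (simp add: arrows_def cat_comp[OF I_cat])
  qed
  moreover have "(v', Cmp I q r t u e) \<in> arrows (s3, q, ?h) (s2, t, h2)"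
  proof -
    have "Cmp C (XX q) (XX t) (YY s2) h2 (TX q t (Cmp I q r t u e)) =
      Cmp C (XX q) (XX p) (YY s2) (Cmp C (XX p) (XX r) (YY s2) (Cmp C (XX r) (XX t) (YY s2) h2 (TX r t u)) (TX p r x)) (TX q p z)"
      unfolding e_def
      using obs e u(2) p q(1,2) r2(4) by (simp add: TX_comp cat_assoc[OF cat] cat_comp[OF cat] cat_comp[OF I_cat] XX YY TX)
    also have "\<dots> = Cmp C (XX q) (YY s3) (YY s2) (TY s3 s2 v') ?h"
      unfolding hxy e_def q(3) using obs p q(1,2) s3 r3(4)
      by (simp add: TX_comp cat_assoc[OF cat] cat_comp[OF cat] XX YY TX TY)
    finally show ?thesis
      using obs e u(1,2) s3(3) by (simp add: arrows_def cat_comp[OF I_cat])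
  qed
  ultimately show thesis by (rule that)
qed

text \<open>Injectivity makes the component of \<Phi> on \<open>Y\<close> a coboundary. Subtracting
  the corresponding correction leaves a cocycle on \<open>X\<close>, which by surjectivity comes
  from \<open>Y\<close> up to a coboundary. These pieces assemble to a primitive.\<close>

lemma inj_surj_imp_cone_null:
  assumes M: "left_module R M" and inj: "cohomology_pro_inj (Suc n) M" and surj: "cohomology_pro_surj n M"
  shows "cone.cohomology_null n M"
  unfolding cone.cohomology_null_def
proof (intro ballI allI impI)
  fix a \<Phi> assume a: "a \<in> reps" and \<Phi>: "lin R (cone a (Suc n)) M \<Phi>"
    and \<Phi>d: "\<forall>x\<in>carrier (cone a (Suc (Suc n))). \<Phi> (cone_d a (Suc n) x) = \<zero>\<^bsub>M\<^esub>"
  interpret M: abelian_group M by (rule left_module_group[OF M])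
  obtain s t h where a_eq: "a = (s, t, h)" by (metis surj_pair)
  note a' = a[unfolded a_eq]
  note r = repsD[OF a']
  note mX = E_module[OF r(6)] and mY = E_module[OF r(5)]
  interpret X: abelian_group "CX t m" for m by (rule left_module_group[OF mX])
  interpret Y: abelian_group "CY s m" for m by (rule left_module_group[OF mY])
  have cone_a: "cone a m = prod_module (CY s (Suc m)) (CX t m)" for m
    by (simp add: a_eq cone_def)
  define \<psi> where "\<psi> y = \<Phi> (y, \<zero>\<^bsub>CX t (Suc n)\<^esub>)" for y
  define \<phi> where "\<phi> x = \<Phi> (\<zero>\<^bsub>CY s (Suc (Suc n))\<^esub>, x)" for x
  have \<psi>: "lin R (CY s (Suc (Suc n))) M \<psi>"
    unfolding \<psi>_def by (rule lin_comp[OF lin_inl[OF mX] \<Phi>[unfolded cone_a]])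
  have \<phi>: "lin R (CX t (Suc n)) M \<phi>"
    unfolding \<phi>_def by (rule lin_comp[OF lin_inr[OF mY] \<Phi>[unfolded cone_a]])
  have \<Phi>_eq: "\<Phi> (y, x) = \<psi> y \<oplus>\<^bsub>M\<^esub> \<phi> x"
    if "y \<in> carrier (CY s (Suc (Suc n)))" "x \<in> carrier (CX t (Suc n))" for y x
    unfolding \<psi>_def \<phi>_def using that lin_add[OF \<Phi>[unfolded cone_a], of "(y, \<zero>\<^bsub>CX t (Suc n)\<^esub>)"
        "(\<zero>\<^bsub>CY s (Suc (Suc n))\<^esub>, x)"] by simp
  have \<psi>D: "\<psi> (DY s (Suc (Suc n)) y) = \<zero>\<^bsub>M\<^esub>" if y: "y \<in> carrier (CY s (Suc (Suc (Suc n))))" for y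
    using \<Phi>d[rule_format, of "(y, \<zero>\<^bsub>CX t (Suc (Suc n))\<^esub>)"] y lin_closed[OF D_lin[OF r(5)] y]
      lin_zero[OF mX mX D_lin[OF r(6)], of "Suc n"] lin_zero[OF mX mY Mp_lin[OF r(4,6,5)], of "Suc (Suc n)"]
    by (simp add: \<psi>_def a_eq cone_def cone_d_def X.a_inv_zero)
  have \<psi>h: "\<psi> (mf t s h (Suc (Suc n)) x) = \<phi> (DX t (Suc n) x)" if x: "x \<in> carrier (CX t (Suc (Suc n)))" for x
  proof -
    note hx = lin_closed[OF Mp_lin[OF r(4,6,5)] x] and Dx = lin_closed[OF D_lin[OF r(6)] x]
    have "\<Phi> (mf t s h (Suc (Suc n)) x, \<ominus>\<^bsub>CX t (Suc n)\<^esub> DX t (Suc n) x) = \<zero>\<^bsub>M\<^esub>"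
      using \<Phi>d[rule_format, of "(\<zero>\<^bsub>CY s (Suc (Suc (Suc n)))\<^esub>, x)"] x hx
        lin_zero[OF mY mY D_lin[OF r(5)], of "Suc (Suc n)"]
      by (simp add: a_eq cone_def cone_d_def)
    then have "\<psi> (mf t s h (Suc (Suc n)) x) \<oplus>\<^bsub>M\<^esub> \<ominus>\<^bsub>M\<^esub> \<phi> (DX t (Suc n) x) = \<zero>\<^bsub>M\<^esub>"
      using \<Phi>_eq[OF hx X.a_inv_closed[OF Dx]] lin_neg[OF mX M \<phi> Dx] by simp
    then show ?thesis
      using lin_closed[OF \<psi> hx] lin_closed[OF \<phi> Dx] M.minus_equality M.minus_minus M.a_inv_closed by metis
  qed
  obtain s1 w1 \<psi>1 where s1: "s1 \<in> Ob J" "w1 \<in> Hom J s1 s" and \<psi>1: "lin R (CY s1 (Suc n)) M \<psi>1"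
    and \<psi>1D: "\<And>y. y \<in> carrier (CY s1 (Suc (Suc n))) \<Longrightarrow> \<psi> (mY s1 s w1 (Suc (Suc n)) y) = \<psi>1 (DY s1 (Suc n) y)"
    using inj[unfolded cohomology_pro_inj_def, rule_format, OF a' \<psi> \<psi>D \<phi> \<psi>h] by blast
  obtain t0 h0 where h0: "(t0, h0) \<in> f s1" using f_nonempty[OF s1(1)] .
  obtain t1 h1 u1 where a1: "(s1, t1, h1) \<in> reps" and p1: "(w1, u1) \<in> arrows (s1, t1, h1) (s, t, h)"
    using reps_refine[OF a' s1 h0] by metis
  note r1 = repsD[OF a1] and T1 = arrow_TX[OF p1 a' a1]
  note mX1 = E_module[OF r1(6)] and mY1 = E_module[OF r1(5)]
  \<comment> \<open>The part of \<phi> that \<open>\<psi>1\<close> does not account for. It is a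
    cocycle because \<open>\<psi>1\<close> after the differential is the pull-back of \<psi>, and
    \<psi> after \<open>h\<close> is \<phi> after the differential.\<close>
  define \<theta>0 where "\<theta>0 x = \<phi> (mX t1 t u1 (Suc n) x) \<ominus>\<^bsub>M\<^esub> \<psi>1 (mf t1 s1 h1 (Suc n) x)" for x
  have \<theta>0: "lin R (CX t1 (Suc n)) M \<theta>0"
    unfolding \<theta>0_def
    by (intro lin_minus_map M lin_comp[OF Mp_lin[OF T1(1) r1(6) r(6)] \<phi>] lin_comp[OF Mp_lin[OF r1(4,6,5)] \<psi>1])
  have \<theta>0D: "\<theta>0 (DX t1 (Suc n) x) = \<zero>\<^bsub>M\<^esub>" if x: "x \<in> carrier (CX t1 (Suc (Suc n)))" for x
  proof -
    note u1x = lin_closed[OF Mp_lin[OF T1(1) r1(6) r(6)] x] and h1x = lin_closed[OF Mp_lin[OF r1(4,6,5)] x]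
    have "\<psi>1 (mf t1 s1 h1 (Suc n) (DX t1 (Suc n) x)) = \<psi> (mf t s h (Suc (Suc n)) (mX t1 t u1 (Suc (Suc n)) x))"
      unfolding Mp_D[OF r1(4,6,5) x] \<psi>1D[OF h1x, symmetric] mf_natural[OF p1 a' a1 x] ..
    also have "\<dots> = \<phi> (mX t1 t u1 (Suc n) (DX t1 (Suc n) x))"
      unfolding \<psi>h[OF u1x] Mp_D[OF T1(1) r1(6) r(6) x] ..
    finally show ?thesis
      unfolding \<theta>0_def
      using lin_closed[OF lin_comp[OF Mp_lin[OF T1(1) r1(6) r(6)] \<phi>] lin_closed[OF D_lin[OF r1(6)] x]]
      by (simp add: a_minus_def M.r_neg)
  qed
  obtain s2 t2 h2 u2 \<chi> \<theta> where a2: "(s2, t2, h2) \<in> reps" and u2: "u2 \<in> Hom I t2 t1"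
    and \<chi>: "lin R (CY s2 (Suc n)) M \<chi>"
    and \<chi>D: "\<And>y. y \<in> carrier (CY s2 (Suc (Suc n))) \<Longrightarrow> \<chi> (DY s2 (Suc n) y) = \<zero>\<^bsub>M\<^esub>"
    and \<theta>: "lin R (CX t2 n) M \<theta>"
    and \<theta>0_eq: "\<And>x. x \<in> carrier (CX t2 (Suc n)) \<Longrightarrow>
      \<theta>0 (mX t2 t1 u2 (Suc n) x) = \<chi> (mf t2 s2 h2 (Suc n) x) \<oplus>\<^bsub>M\<^esub> \<theta> (DX t2 n x)"
    using surj[unfolded cohomology_pro_surj_def, rule_format, OF r1(2) \<theta>0 \<theta>0D] by blast
  note r2 = repsD[OF a2]
  note mX2 = E_module[OF r2(6)] and mY2 = E_module[OF r2(5)]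
  \<comment> \<open>Restricting \<open>h1\<close> to \<open>XX t2\<close> gives it the same source
    as \<open>h2\<close>, which is what \<open>reps_span\<close> asks for.\<close>
  define h12 where "h12 = Cmp C (XX t2) (XX t1) (YY s1) h1 (TX t2 t1 u2)"
  have a12: "(s1, t2, h12) \<in> reps"
    unfolding h12_def reps_def using f_pre[OF r1(3,1) u2 r2(2)] r1(1) by simp
  note r12 = repsD[OF a12]
  have p2: "(category.Id J s1, u2) \<in> arrows (s1, t2, h12) (s1, t1, h1)"
    unfolding arrows_def using r1 u2 r12(4,6) by (simp add: h12_def cat_id[OF J_cat] TY_id cat_idl[OF cat])
  obtain s3 t3 h3 v v' u where a3: "(s3, t3, h3) \<in> reps"
    and p3: "(v, u) \<in> arrows (s3, t3, h3) (s1, t2, h12)" and p3': "(v', u) \<in> arrows (s3, t3, h3) (s2, t2, h2)"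
    using reps_span[OF a12 a2] .
  note r3 = repsD[OF a3] and T3 = arrow_TX[OF p3 a12 a3] and T3' = arrow_TX[OF p3' a2 a3]
  note T2 = arrow_TX[OF p2 a1 a12]
  note mX3 = E_module[OF r3(6)] and mY3 = E_module[OF r3(5)]
  obtain q where q: "q \<in> arrows (s3, t3, h3) (s1, t1, h1)" "\<And>n x. x \<in> carrier (cone (s3, t3, h3) n) \<Longrightarrow>
     cone_map (s3, t3, h3) (s1, t1, h1) q n x =
     cone_map (s1, t2, h12) (s1, t1, h1) (category.Id J s1, u2) n (cone_map (s3, t3, h3) (s1, t2, h12) (v, u) n x)"
    using cone.Arr_comp[OF a3 a12 a1 p3 p2] by blast
  obtain p where p: "p \<in> arrows (s3, t3, h3) a" "\<And>n x. x \<in> carrier (cone (s3, t3, h3) n) \<Longrightarrow>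
     cone_map (s3, t3, h3) a p n x =
     cone_map (s1, t1, h1) a (w1, u1) n (cone_map (s3, t3, h3) (s1, t1, h1) q n x)"
    using cone.Arr_comp[OF a3 a1 a q(1) p1[folded a_eq]] by blast
  \<comment> \<open>On \<open>Y\<close>, \<open>\<psi>1\<close> accounts for the component \<psi>,
    and the cocycle \<chi> may be added because it kills boundaries. The minus sign before \<theta>
    matches the second component of the cone differential.\<close>
  define \<Psi> where "\<Psi> c = (\<psi>1 (mY s3 s1 v (Suc n) (fst c)) \<oplus>\<^bsub>M\<^esub> \<chi> (mY s3 s2 v' (Suc n) (fst c)))
    \<ominus>\<^bsub>M\<^esub> \<theta> (mX t3 t2 u n (snd c))" for c
  have lv: "lin R (CY s3 (Suc n)) M (\<lambda>y. \<psi>1 (mY s3 s1 v (Suc n) y))"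
    by (rule lin_comp[OF Mp_lin[OF T3(2) r3(5) r1(5)] \<psi>1])
  have lv': "lin R (CY s3 (Suc n)) M (\<lambda>y. \<chi> (mY s3 s2 v' (Suc n) y))"
    by (rule lin_comp[OF Mp_lin[OF T3'(2) r3(5) r2(5)] \<chi>])
  have lu: "lin R (CX t3 n) M (\<lambda>x. \<theta> (mX t3 t2 u n x))"
    by (rule lin_comp[OF Mp_lin[OF T3(1) r3(6) r2(6)] \<theta>])
  have \<Psi>: "lin R (cone (s3, t3, h3) n) M \<Psi>"
    unfolding cone_def prod.case \<Psi>_def
    by (intro lin_minus_map lin_plus_map M lin_comp[OF lin_fst lv] lin_comp[OF lin_fst lv'] lin_comp[OF lin_snd lu])
  have "\<Phi> (cone_map (s3, t3, h3) a p (Suc n) c) = \<Psi> (cone_d (s3, t3, h3) n c)"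
    if c: "c \<in> carrier (cone (s3, t3, h3) (Suc n))" for c
  proof -
    obtain y x where yx: "c = (y, x)" "y \<in> carrier (CY s3 (Suc (Suc n)))" "x \<in> carrier (CX t3 (Suc n))"
      using c by (cases c) (auto simp: cone_def)
    note vy = lin_closed[OF Mp_lin[OF T3(2) r3(5) r1(5)] yx(2)]
      and v'y = lin_closed[OF Mp_lin[OF T3'(2) r3(5) r2(5)] yx(2)]
      and ux = lin_closed[OF Mp_lin[OF T3(1) r3(6) r2(6)] yx(3)]
      and Dy = lin_closed[OF D_lin[OF r3(5)] yx(2)] and Dx = lin_closed[OF D_lin[OF r3(6)] yx(3)]
      and h3x = lin_closed[OF Mp_lin[OF r3(4,6,5)] yx(3)]
    note u2ux = lin_closed[OF Mp_lin[OF T2(1) r2(6) r1(6)] ux]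
    note u1u2ux = lin_closed[OF Mp_lin[OF T1(1) r1(6) r(6)] u2ux]
    note w1vy = lin_closed[OF Mp_lin[OF T1(2) r1(5) r(5)] vy]
    let ?A = "\<psi>1 (mY s3 s1 v (Suc n) (DY s3 (Suc n) y))"
    let ?B = "\<psi>1 (mY s3 s1 v (Suc n) (mf t3 s3 h3 (Suc n) x))"
    let ?C = "\<chi> (mY s3 s2 v' (Suc n) (mf t3 s3 h3 (Suc n) x))"
    let ?T = "\<theta> (mX t3 t2 u n (DX t3 n x))"
    have ABCT: "?A \<in> carrier M" "?B \<in> carrier M" "?C \<in> carrier M" "?T \<in> carrier M"
      using lin_closed[OF lv] lin_closed[OF lv'] lin_closed[OF lu] Dy h3x Dx by auto
    have id: "mY s1 s1 (category.Id J s1) (Suc (Suc n)) (mY s3 s1 v (Suc (Suc n)) y) = mY s3 s1 v (Suc (Suc n)) y"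
      using Mp_Id[OF r1(5) vy] TY_id[OF r1(1)] by simp
    have "\<Phi> (cone_map (s3, t3, h3) a p (Suc n) c) =
        \<Phi> (mY s1 s w1 (Suc (Suc n)) (mY s3 s1 v (Suc (Suc n)) y), mX t1 t u1 (Suc n) (mX t2 t1 u2 (Suc n) (mX t3 t2 u (Suc n) x)))"
      unfolding p(2)[OF c] q(2)[OF c] by (simp add: yx a_eq cone_map_def id)
    also have "\<dots> = \<psi> (mY s1 s w1 (Suc (Suc n)) (mY s3 s1 v (Suc (Suc n)) y)) \<oplus>\<^bsub>M\<^esub>
        \<phi> (mX t1 t u1 (Suc n) (mX t2 t1 u2 (Suc n) (mX t3 t2 u (Suc n) x)))"
      by (rule \<Phi>_eq[OF w1vy u1u2ux])
    also have "\<psi> (mY s1 s w1 (Suc (Suc n)) (mY s3 s1 v (Suc (Suc n)) y)) = ?A"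
      unfolding \<psi>1D[OF vy] Mp_D[OF T3(2) r3(5) r1(5) yx(2)] ..
    also have "\<phi> (mX t1 t u1 (Suc n) (mX t2 t1 u2 (Suc n) (mX t3 t2 u (Suc n) x))) = ?B \<oplus>\<^bsub>M\<^esub> (?C \<oplus>\<^bsub>M\<^esub> ?T)"
    proof -
      have "?B = \<psi>1 (mf t1 s1 h1 (Suc n) (mX t2 t1 u2 (Suc n) (mX t3 t2 u (Suc n) x)))"
        unfolding mf_natural[OF p3 a12 a3 yx(3), symmetric] h12_def
        using Mp_Cmp[OF T2(1) r1(4) r2(6) r1(6,5) ux] by simp
      moreover have "?C \<oplus>\<^bsub>M\<^esub> ?T = \<theta>0 (mX t2 t1 u2 (Suc n) (mX t3 t2 u (Suc n) x))"
        unfolding \<theta>0_eq[OF ux] mf_natural[OF p3' a2 a3 yx(3)] Mp_D[OF T3(1) r3(6) r2(6) yx(3)] ..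
      ultimately show ?thesis
        unfolding \<theta>0_def using M.add_minus_cancel[OF lin_closed[OF \<phi> u1u2ux] ABCT(2)] by simp
    qed
    also have "?A \<oplus>\<^bsub>M\<^esub> (?B \<oplus>\<^bsub>M\<^esub> (?C \<oplus>\<^bsub>M\<^esub> ?T)) = \<Psi> (cone_d (s3, t3, h3) n c)"
    proof -
      have "\<chi> (mY s3 s2 v' (Suc n) (DY s3 (Suc n) y)) = \<zero>\<^bsub>M\<^esub>"
        unfolding Mp_D[OF T3'(2) r3(5) r2(5) yx(2)] by (rule \<chi>D[OF v'y])
      then have "\<Psi> (cone_d (s3, t3, h3) n c) = ((?A \<oplus>\<^bsub>M\<^esub> ?B) \<oplus>\<^bsub>M\<^esub> ?C) \<ominus>\<^bsub>M\<^esub> (\<ominus>\<^bsub>M\<^esub> ?T)"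
        unfolding \<Psi>_def cone_d_def
        using lin_add[OF lv Dy h3x] lin_add[OF lv' Dy h3x] lin_neg[OF mX3 M lu Dx] ABCT
        by (simp add: yx)
      then show ?thesis
        using ABCT by (simp add: a_minus_def M.a_assoc)
    qed
    finally show ?thesis .
  qed
  then show "\<exists>b\<in>reps. \<exists>p\<in>arrows b a. \<exists>\<Psi>. lin R (cone b n) M \<Psi> \<and>
        (\<forall>x\<in>carrier (cone b (Suc n)). \<Phi> (cone_map b a p (Suc n) x) = \<Psi> (cone_d b n x))"
    using a3 p(1) \<Psi> by blast
qed

lemma cohomology_null_iff:
  assumes M: "left_module R M"
  shows "(\<forall>n. cone.cohomology_null n M) \<longleftrightarrow>
    (\<forall>n. cohomology_pro_inj (Suc n) M \<and> cohomology_pro_surj (Suc n) M)"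
proof (intro iffI allI conjI)
  fix n assume *: "\<forall>n. cohomology_pro_inj (Suc n) M \<and> cohomology_pro_surj (Suc n) M"
  show "cone.cohomology_null n M"
    using * cohomology_pro_surj_0[OF M] by (cases n) (auto intro: inj_surj_imp_cone_null[OF M])
qed (auto intro: cone_null_imp_inj[OF M] cone_null_imp_surj[OF M])

text \<open>From homology to cohomology the argument works over each module separately. The converse
  evaluates the hypothesis at a quotient of a cone module; its elements are subsets of
  \<open>'e \<times> 'e\<close>, and \<iota> makes room for them in \<open>'m\<close>.\<close>

theorem homology_iff_cohomology:
  fixes \<iota> :: "('e \<times> 'e) set \<Rightarrow> 'm"
  assumes "inj \<iota>"
  shows "(\<forall>n. homology_pro_mono (Suc n) \<and> homology_pro_epi (Suc n)) \<longleftrightarrow>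
    (\<forall>n. \<forall>M :: ('r, 'm) module. left_module R M \<longrightarrow>
       cohomology_pro_inj (Suc n) M \<and> cohomology_pro_surj (Suc n) M)"
  using cone.homology_null_imp_cohomology_null cone.cohomology_null_imp_homology_null[OF assms]
    homology_null_iff cohomology_null_iff by blast

end

section \<open>Free modules\<close>

text \<open>The ring as a left module over itself. It is the target of the coordinate maps of
  chains, which makes these maps accessible to the lemmas about \<open>lin\<close>.\<close>

definition ring_module :: "('r, 'b) ring_scheme \<Rightarrow> ('r, 'r) module" where
  "ring_module R = \<lparr>carrier = carrier R, mult = mult R, one = one R, zero = zero R, add = add R, smult = mult R\<rparr>"

lemma ring_module_simps [simp]:
  "carrier (ring_module R) = carrier R" "\<zero>\<^bsub>ring_module R\<^esub> = \<zero>\<^bsub>R\<^esub>"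
  "(\<oplus>\<^bsub>ring_module R\<^esub>) = (\<oplus>\<^bsub>R\<^esub>)" "(\<odot>\<^bsub>ring_module R\<^esub>) = (\<otimes>\<^bsub>R\<^esub>)"
  by (simp_all add: ring_module_def)

lemma left_module_ring_module: "ring R \<Longrightarrow> left_module R (ring_module R)"
proof (rule left_moduleI)
  assume R: "ring R"
  interpret R: ring R by (rule R)
  show "abelian_group (ring_module R)"
    using R.add.l_inv_ex by (intro abelian_groupI) (auto simp: R.a_ac)
qed (auto simp: ring.ring_simprules)

lemma finsum_ring_module: "finsum (ring_module R) f A = finsum R f A"
  by (simp add: finsum_def finprod_def comp_def)

lemma a_inv_ring_module: "\<ominus>\<^bsub>ring_module R\<^esub> x = \<ominus>\<^bsub>R\<^esub> x"
  by (simp add: a_inv_def m_inv_def)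

lemma alt_sign_ring_module: "alt_sign (ring_module R) i x = alt_sign R i x"
  by (simp add: alt_sign_def a_inv_ring_module)

text \<open>The free module on \<open>S\<close>. Chains are extensional functions with finite
  support, so that carrier and addition coincide with those of \<open>chain_group\<close>; what is
  added is the scalar multiplication.\<close>

definition chain_module :: "('r, 'b) ring_scheme \<Rightarrow> 'x set \<Rightarrow> ('r, 'x \<Rightarrow> 'r) module" where
  "chain_module R S = \<lparr>carrier = {c \<in> S \<rightarrow>\<^sub>E carrier R. finite {x \<in> S. c x \<noteq> \<zero>\<^bsub>R\<^esub>}},
     mult = \<lambda>_ _. undefined, one = undefined, zero = \<lambda>x\<in>S. \<zero>\<^bsub>R\<^esub>,
     add = \<lambda>c d. \<lambda>x\<in>S. c x \<oplus>\<^bsub>R\<^esub> d x, smult = \<lambda>a c. \<lambda>x\<in>S. a \<otimes>\<^bsub>R\<^esub> c x\<rparr>"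

lemma chain_module_simps [simp]:
  "carrier (chain_module R S) = {c \<in> S \<rightarrow>\<^sub>E carrier R. finite {x \<in> S. c x \<noteq> \<zero>\<^bsub>R\<^esub>}}"
  "\<zero>\<^bsub>chain_module R S\<^esub> = (\<lambda>x\<in>S. \<zero>\<^bsub>R\<^esub>)"
  "c \<oplus>\<^bsub>chain_module R S\<^esub> d = (\<lambda>x\<in>S. c x \<oplus>\<^bsub>R\<^esub> d x)"
  "a \<odot>\<^bsub>chain_module R S\<^esub> c = (\<lambda>x\<in>S. a \<otimes>\<^bsub>R\<^esub> c x)"
  by (simp_all add: chain_module_def)

definition delta :: "('r, 'b) ring_scheme \<Rightarrow> 'x set \<Rightarrow> 'x \<Rightarrow> 'x \<Rightarrow> 'r" where
  "delta R S x = (\<lambda>y\<in>S. if y = x then \<one>\<^bsub>R\<^esub> else \<zero>\<^bsub>R\<^esub>)"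

text \<open>The universal property of the free module: the linear extension of \<phi>. It also
  serves as the pairing of the cochain \<phi> with the chain \<open>c\<close>.\<close>

definition lin_ext ::
  "('r, 'b) ring_scheme \<Rightarrow> ('r, 'a, 'c) module_scheme \<Rightarrow> 'x set \<Rightarrow> ('x \<Rightarrow> 'a) \<Rightarrow> ('x \<Rightarrow> 'r) \<Rightarrow> 'a" where
  "lin_ext R M S \<phi> c = (\<Oplus>\<^bsub>M\<^esub>x\<in>{x\<in>S. c x \<noteq> \<zero>\<^bsub>R\<^esub>}. c x \<odot>\<^bsub>M\<^esub> \<phi> x)"

context ring
begin

lemma left_module_chain: "left_module R (chain_module R S)"
proof (rule left_moduleI)
  show "ring R" by (rule ring_axioms)
  have add: "(\<lambda>x\<in>S. c x \<oplus> d x) \<in> carrier (chain_module R S)"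
    if "c \<in> carrier (chain_module R S)" "d \<in> carrier (chain_module R S)" for c d
  proof -
    have "finite {x \<in> S. c x \<oplus> d x \<noteq> \<zero>}"
      by (rule finite_subset[of _ "{x \<in> S. c x \<noteq> \<zero>} \<union> {x \<in> S. d x \<noteq> \<zero>}"]) (use that in auto)
    then show ?thesis using that by (auto simp: PiE_iff cong: conj_cong)
  qed
  have map: "(\<lambda>x\<in>S. g (c x)) \<in> carrier (chain_module R S)"
    if "c \<in> carrier (chain_module R S)" "g \<zero> = \<zero>" "\<And>x. x \<in> carrier R \<Longrightarrow> g x \<in> carrier R" for c g
  proof -
    have "finite {x \<in> S. g (c x) \<noteq> \<zero>}"
      by (rule finite_subset[of _ "{x \<in> S. c x \<noteq> \<zero>}"]) (use that in auto)
    then show ?thesis using that by (auto simp: PiE_iff cong: conj_cong)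
  qed
  show "abelian_group (chain_module R S)"
  proof (rule abelian_groupI)
    fix c assume c: "c \<in> carrier (chain_module R S)"
    show "\<exists>d\<in>carrier (chain_module R S). d \<oplus>\<^bsub>chain_module R S\<^esub> c = \<zero>\<^bsub>chain_module R S\<^esub>"
      by (rule bexI[OF _ map[OF c, of "\<lambda>x. \<ominus> x"]]) (use c in \<open>auto simp: l_neg PiE_iff intro!: restrict_ext\<close>)
  next
    fix c assume c: "c \<in> carrier (chain_module R S)"
    then show "\<zero>\<^bsub>chain_module R S\<^esub> \<oplus>\<^bsub>chain_module R S\<^esub> c = c"
      by (auto simp: fun_eq_iff PiE_iff extensional_def)
  next
    fix c d assume "c \<in> carrier (chain_module R S)" "d \<in> carrier (chain_module R S)"
    then show "c \<oplus>\<^bsub>chain_module R S\<^esub> d \<in> carrier (chain_module R S)"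
      using add by simp
  qed (auto simp: PiE_iff a_ac cong: conj_cong intro!: restrict_ext)
  fix a c assume a: "a \<in> carrier R" and c: "c \<in> carrier (chain_module R S)"
  show "a \<odot>\<^bsub>chain_module R S\<^esub> c \<in> carrier (chain_module R S)"
    using map[OF c, of "\<lambda>x. a \<otimes> x"] a by simp
next
  fix c assume "c \<in> carrier (chain_module R S)"
  then show "\<one> \<odot>\<^bsub>chain_module R S\<^esub> c = c"
    by (auto simp: fun_eq_iff PiE_iff extensional_def)
qed (auto simp: PiE_iff l_distr r_distr m_assoc intro!: restrict_ext)

lemma delta_carrier: "x \<in> S \<Longrightarrow> delta R S x \<in> carrier (chain_module R S)"
proof -
  assume "x \<in> S"
  have "finite {y \<in> S. (if y = x then \<one> else \<zero>) \<noteq> \<zero>}"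
    by (rule finite_subset[of _ "{x}"]) auto
  then show ?thesis by (auto simp: delta_def cong: conj_cong)
qed

text \<open>Terms outside the support vanish. The enlarged range lets the sums for two chains and
  for their sum run over one common finite set.\<close>

lemma lin_ext_superset:
  assumes M: "left_module R M" and \<phi>: "\<phi> \<in> S \<rightarrow> carrier M" and c: "c \<in> carrier (chain_module R S)"
    and F: "finite F" "F \<subseteq> S" "{x\<in>S. c x \<noteq> \<zero>} \<subseteq> F"
  shows "lin_ext R M S \<phi> c = (\<Oplus>\<^bsub>M\<^esub>x\<in>F. c x \<odot>\<^bsub>M\<^esub> \<phi> x)"
proof -
  interpret M: abelian_group M by (rule left_module_group[OF M])
  show ?thesis
    unfolding lin_ext_def
  proof (rule M.add.finprod_mono_neutral_cong_left)
    show "c x \<odot>\<^bsub>M\<^esub> \<phi> x = \<zero>\<^bsub>M\<^esub>" if "x \<in> F - {x \<in> S. c x \<noteq> \<zero>}" for x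
      using that F \<phi> smult_zero_left[OF M] by (auto simp: Pi_iff subset_iff)
    show "(\<lambda>x. c x \<odot>\<^bsub>M\<^esub> \<phi> x) \<in> F \<rightarrow> carrier M"
      using F(2) \<phi> c by (intro Pi_I left_module.smult_closed[OF M]) (auto simp: PiE_iff)
  qed (use F in auto)
qed

lemma lin_ext_delta:
  assumes M: "left_module R M" and \<phi>: "\<phi> \<in> S \<rightarrow> carrier M" and x: "x \<in> S"
  shows "lin_ext R M S \<phi> (delta R S x) = \<phi> x"
proof -
  interpret M: abelian_group M by (rule left_module_group[OF M])
  have "\<phi> x \<in> carrier M" using \<phi> x by auto
  moreover have "{y \<in> S. delta R S x y \<noteq> \<zero>} \<subseteq> {x}" by (auto simp: delta_def split: if_splits)
  ultimately show ?thesis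
    using lin_ext_superset[OF M \<phi> delta_carrier[OF x], of "{x}"] x
    by (simp add: delta_def left_module.smult_one[OF M])
qed

lemma lin_ext_lin:
  assumes M: "left_module R M" and \<phi>: "\<phi> \<in> S \<rightarrow> carrier M"
  shows "lin R (chain_module R S) M (lin_ext R M S \<phi>)"
proof (rule linI)
  interpret M: abelian_group M by (rule left_module_group[OF M])
  interpret C: abelian_group "chain_module R S" by (rule left_module_group[OF left_module_chain])
  have fin: "finite {x \<in> S. c x \<noteq> \<zero>}" if "c \<in> carrier (chain_module R S)" for c
    using that by simp
  have sm: "c x \<odot>\<^bsub>M\<^esub> \<phi> x \<in> carrier M" if "c \<in> carrier (chain_module R S)" "x \<in> S" for c x
    using that \<phi> by (intro left_module.smult_closed[OF M]) (auto simp: PiE_iff)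
  fix c assume c: "c \<in> carrier (chain_module R S)"
  show "lin_ext R M S \<phi> c \<in> carrier M"
    unfolding lin_ext_def using sm[OF c] by (intro M.finsum_closed) auto
  fix d assume d: "d \<in> carrier (chain_module R S)"
  let ?F = "{x \<in> S. c x \<noteq> \<zero>} \<union> {x \<in> S. d x \<noteq> \<zero>}"
  have cd: "c \<oplus>\<^bsub>chain_module R S\<^esub> d \<in> carrier (chain_module R S)" using c d by (rule C.a_closed)
  have cx: "c x \<in> carrier R" "d x \<in> carrier R" if "x \<in> S" for x using c d that by (auto simp: PiE_iff)
  have F: "finite ?F" "?F \<subseteq> S" "{x\<in>S. c x \<noteq> \<zero>} \<subseteq> ?F" "{x\<in>S. d x \<noteq> \<zero>} \<subseteq> ?F"
    "{x\<in>S. (c \<oplus>\<^bsub>chain_module R S\<^esub> d) x \<noteq> \<zero>} \<subseteq> ?F"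
    using fin[OF c] fin[OF d] by auto
  have "lin_ext R M S \<phi> (c \<oplus>\<^bsub>chain_module R S\<^esub> d) = (\<Oplus>\<^bsub>M\<^esub>x\<in>?F. c x \<odot>\<^bsub>M\<^esub> \<phi> x \<oplus>\<^bsub>M\<^esub> d x \<odot>\<^bsub>M\<^esub> \<phi> x)"
    unfolding lin_ext_superset[OF M \<phi> cd F(1,2,5)]
  proof (rule M.finsum_cong')
    show "(\<lambda>x. c x \<odot>\<^bsub>M\<^esub> \<phi> x \<oplus>\<^bsub>M\<^esub> d x \<odot>\<^bsub>M\<^esub> \<phi> x) \<in> ?F \<rightarrow> carrier M"
      using sm[OF c] sm[OF d] by auto
    fix x assume "x \<in> ?F"
    then have x: "x \<in> S" by auto
    then show "(c \<oplus>\<^bsub>chain_module R S\<^esub> d) x \<odot>\<^bsub>M\<^esub> \<phi> x = c x \<odot>\<^bsub>M\<^esub> \<phi> x \<oplus>\<^bsub>M\<^esub> d x \<odot>\<^bsub>M\<^esub> \<phi> x"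
      using funcset_mem[OF \<phi> x] cx[OF x] by (simp add: left_module.smult_l_distr[OF M])
  qed simp
  also have "\<dots> = lin_ext R M S \<phi> c \<oplus>\<^bsub>M\<^esub> lin_ext R M S \<phi> d"
    unfolding lin_ext_superset[OF M \<phi> c F(1,2,3)] lin_ext_superset[OF M \<phi> d F(1,2,4)]
    using sm[OF c] sm[OF d] F(2) by (intro M.finsum_addf) auto
  finally show "lin_ext R M S \<phi> (c \<oplus>\<^bsub>chain_module R S\<^esub> d) = lin_ext R M S \<phi> c \<oplus>\<^bsub>M\<^esub> lin_ext R M S \<phi> d" .
next
  interpret M: abelian_group M by (rule left_module_group[OF M])
  fix a c assume a: "a \<in> carrier R" and c: "c \<in> carrier (chain_module R S)"
  let ?F = "{x \<in> S. c x \<noteq> \<zero>}"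
  have ac: "a \<odot>\<^bsub>chain_module R S\<^esub> c \<in> carrier (chain_module R S)"
    using a c by (rule left_module.smult_closed[OF left_module_chain])
  have F: "finite ?F" "?F \<subseteq> S" "{x\<in>S. (a \<odot>\<^bsub>chain_module R S\<^esub> c) x \<noteq> \<zero>} \<subseteq> ?F"
    using c a by auto
  have id: "lin R M M (\<lambda>x. x)" by (simp add: lin_def)
  have sm: "c x \<odot>\<^bsub>M\<^esub> \<phi> x \<in> carrier M" if "x \<in> S" for x
    using that \<phi> c by (intro left_module.smult_closed[OF M]) (auto simp: PiE_iff)
  have add: "a \<odot>\<^bsub>M\<^esub> (\<Oplus>\<^bsub>M\<^esub>x\<in>A. g x) = (\<Oplus>\<^bsub>M\<^esub>x\<in>A. a \<odot>\<^bsub>M\<^esub> g x)"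
    if "finite A" "g \<in> A \<rightarrow> carrier M" for A g
    using that
  proof (induction A rule: finite_induct)
    case (insert x A)
    then show ?case
      using a by (auto simp: left_module.smult_r_distr[OF M] left_module.smult_closed[OF M] Pi_iff)
  qed (simp add: smult_zero_right[OF M a])
  have "lin_ext R M S \<phi> (a \<odot>\<^bsub>chain_module R S\<^esub> c) = (\<Oplus>\<^bsub>M\<^esub>x\<in>?F. a \<odot>\<^bsub>M\<^esub> (c x \<odot>\<^bsub>M\<^esub> \<phi> x))"
    unfolding lin_ext_superset[OF M \<phi> ac F]
  proof (rule M.finsum_cong')
    show "(\<lambda>x. a \<odot>\<^bsub>M\<^esub> (c x \<odot>\<^bsub>M\<^esub> \<phi> x)) \<in> ?F \<rightarrow> carrier M"
      using sm a left_module.smult_closed[OF M] by auto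
    fix x assume "x \<in> ?F"
    then have "x \<in> S" "c x \<in> carrier R" "\<phi> x \<in> carrier M" using c \<phi> by (auto simp: PiE_iff)
    then show "(a \<odot>\<^bsub>chain_module R S\<^esub> c) x \<odot>\<^bsub>M\<^esub> \<phi> x = a \<odot>\<^bsub>M\<^esub> (c x \<odot>\<^bsub>M\<^esub> \<phi> x)"
      using a by (simp add: left_module.smult_assoc[OF M])
  qed simp
  also have "\<dots> = a \<odot>\<^bsub>M\<^esub> lin_ext R M S \<phi> c"
    unfolding lin_ext_def using sm by (intro add[symmetric] F(1)) auto
  finally show "lin_ext R M S \<phi> (a \<odot>\<^bsub>chain_module R S\<^esub> c) = a \<odot>\<^bsub>M\<^esub> lin_ext R M S \<phi> c" .
qed

text \<open>Every chain is a finite combination of the \<open>delta R S x\<close>; the induction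
  removes one point from a finite set containing the support. Identities between maps of chains are
  checked on simplices by means of this.\<close>

lemma lin_unique:
  assumes M: "left_module R M" and g: "lin R (chain_module R S) M g" "lin R (chain_module R S) M h"
    and eq: "\<And>x. x \<in> S \<Longrightarrow> g (delta R S x) = h (delta R S x)"
    and c: "c \<in> carrier (chain_module R S)"
  shows "g c = h c"
proof -
  interpret C: abelian_group "chain_module R S" by (rule left_module_group[OF left_module_chain])
  have "finite F \<Longrightarrow> F \<subseteq> S \<Longrightarrow> c \<in> carrier (chain_module R S) \<Longrightarrow> {x \<in> S. c x \<noteq> \<zero>} \<subseteq> F \<Longrightarrow> g c = h c" for F c
  proof (induction F arbitrary: c rule: finite_induct)
    case empty
    then have "c = \<zero>\<^bsub>chain_module R S\<^esub>" by (auto simp: fun_eq_iff PiE_iff extensional_def)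
    then show ?case by (simp only: lin_zero[OF left_module_chain M g(1)] lin_zero[OF left_module_chain M g(2)])
  next
    case (insert x F)
    let ?d = "\<lambda>y\<in>S. if y = x then \<zero> else c y"
    have x: "x \<in> S" "c x \<in> carrier R" using insert.prems by (auto simp: PiE_iff)
    have supp: "{y \<in> S. ?d y \<noteq> \<zero>} \<subseteq> F" using insert.prems by (auto split: if_splits)
    then have fin: "finite {y \<in> S. ?d y \<noteq> \<zero>}" using insert.hyps(1) by (rule finite_subset)
    have "?d \<in> S \<rightarrow>\<^sub>E carrier R" using insert.prems by (auto simp: PiE_iff)
    with fin have d: "?d \<in> carrier (chain_module R S)" by simp
    have c: "c = ?d \<oplus>\<^bsub>chain_module R S\<^esub> (c x \<odot>\<^bsub>chain_module R S\<^esub> delta R S x)"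
      using insert.prems x by (auto simp: fun_eq_iff delta_def PiE_iff extensional_def)
    have cx: "c x \<odot>\<^bsub>chain_module R S\<^esub> delta R S x \<in> carrier (chain_module R S)"
      using x by (intro left_module.smult_closed[OF left_module_chain] delta_carrier)
    have step: "f c = f ?d \<oplus>\<^bsub>M\<^esub> c x \<odot>\<^bsub>M\<^esub> f (delta R S x)" if "lin R (chain_module R S) M f" for f
      by (subst c) (simp only: lin_add[OF that d cx] lin_smult[OF that x(2) delta_carrier[OF x(1)]])
    have F: "F \<subseteq> S" using insert.prems by simp
    show ?case
      by (simp only: step[OF g(1)] step[OF g(2)] eq[OF x(1)] insert.IH[OF F d supp])
  qed
  then show ?thesis using c by (metis (no_types, lifting) chain_module_simps(1) mem_Collect_eq order_refl subsetI)
qed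

text \<open>Free modules are projective: preimages under \<open>e\<close> are chosen for the basis
  elements and extended linearly.\<close>

lemma chain_projective:
  assumes L: "left_module R L" and N: "left_module R N" and e: "lin R L N e"
    and g: "lin R (chain_module R S) N g"
    and im: "\<forall>c\<in>carrier (chain_module R S). g c \<in> e ` carrier L"
  shows "\<exists>k. lin R (chain_module R S) L k \<and> (\<forall>c\<in>carrier (chain_module R S). e (k c) = g c)"
proof -
  have "\<forall>x\<in>S. \<exists>l\<in>carrier L. e l = g (delta R S x)"
    using im delta_carrier by (metis (no_types, lifting) imageE)
  then obtain \<phi> where \<phi>: "\<And>x. x \<in> S \<Longrightarrow> \<phi> x \<in> carrier L \<and> e (\<phi> x) = g (delta R S x)" by metis
  then have \<phi>': "\<phi> \<in> S \<rightarrow> carrier L" by auto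
  have "e (lin_ext R L S \<phi> c) = g c" if "c \<in> carrier (chain_module R S)" for c
    by (rule lin_unique[OF N lin_comp[OF lin_ext_lin[OF L \<phi>'] e] g _ that])
      (use \<phi> in \<open>simp add: lin_ext_delta[OF L \<phi>']\<close>)
  then show ?thesis using lin_ext_lin[OF L \<phi>'] by blast
qed

lemma eval_lin: "x \<in> S \<Longrightarrow> lin R (chain_module R S) (ring_module R) (\<lambda>c. c x)"
  by (auto simp: lin_def PiE_iff)

lemma lin_pointwise:
  assumes N: "left_module R N"
    and g: "\<And>x. x \<in> carrier N \<Longrightarrow> g x \<in> carrier (chain_module R S)"
    and lin: "\<And>y. y \<in> S \<Longrightarrow> lin R N (ring_module R) (\<lambda>x. g x y)"
  shows "lin R N (chain_module R S) g"
proof (rule linI)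
  interpret N: abelian_group N by (rule left_module_group[OF N])
  fix x y assume xy: "x \<in> carrier N" "y \<in> carrier N"
  show "g (x \<oplus>\<^bsub>N\<^esub> y) = g x \<oplus>\<^bsub>chain_module R S\<^esub> g y"
    using lin_add[OF lin xy] g[of "x \<oplus>\<^bsub>N\<^esub> y"] xy by (auto simp: fun_eq_iff PiE_iff extensional_def)
next
  fix a x assume ax: "a \<in> carrier R" "x \<in> carrier N"
  show "g (a \<odot>\<^bsub>N\<^esub> x) = a \<odot>\<^bsub>chain_module R S\<^esub> g x"
    using lin_smult[OF lin ax] g[OF left_module.smult_closed[OF N ax]] by (auto simp: fun_eq_iff PiE_iff extensional_def)
qed (rule g)

end

section \<open>Simplicial chains\<close>

lemma simplicial_setD:
  assumes "simplicial_set X"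
  shows Act_closed: "\<lbrakk>\<theta> \<in> simplex_maps m n; x \<in> Simp X n\<rbrakk> \<Longrightarrow> Act X m n \<theta> x \<in> Simp X m"
    and Act_comp: "\<lbrakk>\<eta> \<in> simplex_maps k m; \<theta> \<in> simplex_maps m n; x \<in> Simp X n\<rbrakk> \<Longrightarrow>
      Act X k n (compose {..k} \<theta> \<eta>) x = Act X k m \<eta> (Act X m n \<theta> x)"
  using assms unfolding simplicial_set_def by blast+

lemma simplicial_mapsD:
  assumes "h \<in> simplicial_maps X Y"
  shows simplicial_maps_PiE: "h n \<in> Simp X n \<rightarrow>\<^sub>E Simp Y n"
    and simplicial_maps_closed: "x \<in> Simp X n \<Longrightarrow> h n x \<in> Simp Y n"
    and simplicial_maps_Act: "\<lbrakk>\<theta> \<in> simplex_maps m n; x \<in> Simp X n\<rbrakk> \<Longrightarrow> h m (Act X m n \<theta> x) = Act Y m n \<theta> (h n x)"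
  using assms unfolding simplicial_maps_def by blast+

lemma sSet_simps [simp]:
  "Ob sSet = {X. simplicial_set X}" "Hom sSet = simplicial_maps"
  "category.Id sSet = (\<lambda>X n. \<lambda>x\<in>Simp X n. x)"
  "Cmp sSet = (\<lambda>X Y Z g f n. compose (Simp X n) (g n) (f n))"
  by (simp_all add: sSet_def)

lemma category_sSet: "category sSet"
  unfolding category_def
proof (intro conjI ballI)
  fix X :: "'a sset" assume X: "X \<in> Ob sSet"
  then show "category.Id sSet X \<in> Hom sSet X X"
    by (auto simp: simplicial_maps_def Act_closed)
next
  fix X Y Z :: "'a sset" and f g
  assume X: "X \<in> Ob sSet" and f: "f \<in> Hom sSet X Y" and g: "g \<in> Hom sSet Y Z"
  show "Cmp sSet X Y Z g f \<in> Hom sSet X Z"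
    using X f g by (auto simp: simplicial_maps_def compose_def Act_closed PiE_iff)
next
  fix X Y :: "'a sset" and f
  assume f: "f \<in> Hom sSet X Y"
  have "f n \<in> extensional (Simp X n)" "f n \<in> Simp X n \<rightarrow> Simp Y n" for n
    using f simplicial_maps_PiE[of f X Y n] by (auto simp: PiE_iff)
  then show "Cmp sSet X X Y f (category.Id sSet X) = f" "Cmp sSet X Y Y (category.Id sSet Y) f = f"
    by (auto simp: fun_eq_iff compose_def extensional_def)
next
  fix W X Y Z :: "'a sset" and f g h
  assume "f \<in> Hom sSet W X"
  then show "Cmp sSet W Y Z h (Cmp sSet W X Y g f) = Cmp sSet W X Z (Cmp sSet X Y Z h g) f"
    by (auto simp: fun_eq_iff compose_def dest: simplicial_maps_closed)
qed

lemma face_map: "(\<lambda>j\<in>{..n}. if j < i then j else Suc j) \<in> simplex_maps n (Suc n)"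
  by (auto simp: simplex_maps_def mono_on_def)

lemma face_closed: "simplicial_set X \<Longrightarrow> x \<in> Simp X (Suc n) \<Longrightarrow> face X n i x \<in> Simp X n"
  unfolding face_def by (rule Act_closed[OF _ face_map])

text \<open>Both composites of coface maps are the monotone injection into \<open>{..n + 2}\<close>
  that omits \<open>j\<close> and \<open>i + 1\<close>.\<close>

lemma face_face:
  assumes X: "simplicial_set X" and x: "x \<in> Simp X (Suc (Suc n))" and ji: "j \<le> i"
  shows "face X n j (face X (Suc n) (Suc i) x) = face X n i (face X (Suc n) j x)"
proof -
  have "compose {..n} (\<lambda>k\<in>{..Suc n}. if k < Suc i then k else Suc k) (\<lambda>k\<in>{..n}. if k < j then k else Suc k) =
    compose {..n} (\<lambda>k\<in>{..Suc n}. if k < j then k else Suc k) (\<lambda>k\<in>{..n}. if k < i then k else Suc k)"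
    using ji by (auto simp: compose_def fun_eq_iff)
  then show ?thesis
    unfolding face_def by (metis Act_comp[OF X face_map face_map x])
qed

lemma simplicial_maps_face:
  "h \<in> simplicial_maps X Y \<Longrightarrow> x \<in> Simp X (Suc n) \<Longrightarrow> h n (face X n i x) = face Y n i (h (Suc n) x)"
  unfolding face_def by (rule simplicial_maps_Act[OF _ face_map])

text \<open>The cancellation behind the vanishing of the square of a coboundary, for any family with
  the symmetry of iterated faces. The induction peels off the last row and the last column, which
  cancel each other.\<close>

lemma (in abelian_group) alternating_double_sum:
  assumes "\<And>i j. j \<le> i \<Longrightarrow> i \<le> n \<Longrightarrow> F (Suc i) j = F j i"
    and "\<And>i j. i \<le> Suc n \<Longrightarrow> j \<le> n \<Longrightarrow> F i j \<in> carrier G"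
  shows "(\<Oplus>i\<in>{..Suc n}. \<Oplus>j\<in>{..n}. alt_sign G i (alt_sign G j (F i j))) = \<zero>"
  using assms
proof (induction n)
  case 0
  let ?t = "\<lambda>i. \<Oplus>j\<in>{..0}. alt_sign G i (alt_sign G j (F i j))"
  have F: "F 0 0 \<in> carrier G" "F (Suc 0) 0 = F 0 0" using 0 by auto
  have t: "?t 0 = F 0 0" "?t (Suc 0) = \<ominus> F 0 0"
    by (subst finsum_0, use F in \<open>simp_all add: alt_sign_def\<close>)+
  have "(\<Oplus>i\<in>{..Suc 0}. ?t i) = ?t (Suc 0) \<oplus> (\<Oplus>i\<in>{..0}. ?t i)"
    by (rule finsum_Suc) (use F in \<open>auto simp: alt_sign_def le_Suc_eq\<close>)
  also have "(\<Oplus>i\<in>{..0}. ?t i) = ?t 0"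
    by (rule finsum_0) (use F in \<open>auto simp: alt_sign_def\<close>)
  finally show ?case
    unfolding t using F by (simp add: l_neg)
next
  case (Suc n)
  let ?t = "\<lambda>i j. alt_sign G i (alt_sign G j (F i j))"
  have t: "?t i j \<in> carrier G" if "i \<le> Suc (Suc n)" "j \<le> Suc n" for i j
    using Suc.prems(2) that by (simp add: alt_sign_closed abelian_group_axioms)
  have 1: "(\<Oplus>i\<in>{..Suc n}. \<Oplus>j\<in>{..Suc n}. ?t i j) = (\<Oplus>i\<in>{..Suc n}. ?t i (Suc n)) \<oplus> (\<Oplus>i\<in>{..Suc n}. \<Oplus>j\<in>{..n}. ?t i j)"
  proof -
    have "(\<Oplus>i\<in>{..Suc n}. \<Oplus>j\<in>{..Suc n}. ?t i j) = (\<Oplus>i\<in>{..Suc n}. ?t i (Suc n) \<oplus> (\<Oplus>j\<in>{..n}. ?t i j))"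
      by (intro finsum_cong') (use t in \<open>auto simp del: finsum_Suc simp: finsum_Suc[of _ n] intro!: finsum_closed\<close>)
    also have "\<dots> = (\<Oplus>i\<in>{..Suc n}. ?t i (Suc n)) \<oplus> (\<Oplus>i\<in>{..Suc n}. \<Oplus>j\<in>{..n}. ?t i j)"
      by (rule finsum_addf) (use t in \<open>auto intro!: finsum_closed\<close>)
    finally show ?thesis .
  qed
  have 2: "(\<Oplus>i\<in>{..Suc n}. \<Oplus>j\<in>{..n}. ?t i j) = \<zero>"
    by (rule Suc.IH) (use Suc.prems in auto)
  \<comment> \<open>The term at \<open>(n + 2, j)\<close> has the same entry as the one at
    \<open>(j, n + 1)\<close>, and their total signs have exponents that differ by 1.\<close>
  have 3: "(\<Oplus>j\<in>{..Suc n}. ?t (Suc (Suc n)) j) \<oplus> (\<Oplus>i\<in>{..Suc n}. ?t i (Suc n)) = \<zero>"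
  proof -
    have "(\<Oplus>j\<in>{..Suc n}. ?t (Suc (Suc n)) j) \<oplus> (\<Oplus>i\<in>{..Suc n}. ?t i (Suc n)) =
      (\<Oplus>j\<in>{..Suc n}. ?t (Suc (Suc n)) j \<oplus> ?t j (Suc n))"
      by (rule finsum_addf[symmetric]) (use t in auto)
    also have "\<dots> = (\<Oplus>j\<in>{..Suc n}. \<zero>)"
    proof (rule finsum_cong')
      fix j assume j: "j \<in> {..Suc n}"
      then have "F (Suc (Suc n)) j = F j (Suc n)" "F j (Suc n) \<in> carrier G" using Suc.prems by auto
      then show "?t (Suc (Suc n)) j \<oplus> ?t j (Suc n) = \<zero>"
        by (simp add: alt_sign_def l_neg r_neg)
    qed auto
    finally show ?thesis by simp
  qed
  have cl: "(\<Oplus>j\<in>{..Suc n}. ?t (Suc (Suc n)) j) \<in> carrier G" "(\<Oplus>i\<in>{..Suc n}. ?t i (Suc n)) \<in> carrier G"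
    by (rule finsum_closed; use t in auto)+
  have "(\<Oplus>i\<in>{..Suc (Suc n)}. \<Oplus>j\<in>{..Suc n}. ?t i j) = (\<Oplus>j\<in>{..Suc n}. ?t (Suc (Suc n)) j) \<oplus> (\<Oplus>i\<in>{..Suc n}. \<Oplus>j\<in>{..Suc n}. ?t i j)"
    by (rule finsum_Suc) (use t in \<open>auto simp del: finsum_Suc intro!: finsum_closed\<close>)
  also have "\<dots> = \<zero>"
    unfolding 1 2 using 3 cl by simp
  finally show ?case .
qed

section \<open>Push-forward of chains, boundary and coboundary\<close>

context ring
begin

text \<open>The coefficient at \<open>y\<close> is the pairing with the indicator function of the
  fibre over \<open>y\<close>. Linearity of \<open>push_chain\<close> follows coordinate by
  coordinate.\<close>

lemma push_value:
  assumes c: "c \<in> carrier (chain_module R A)" and y: "y \<in> B"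
  shows "push_chain R A B p c y = lin_ext R (ring_module R) A (\<lambda>x. if p x = y then \<one> else \<zero>) c"
proof -
  have cx: "c x \<in> carrier R" if "x \<in> A" for x using c that by (auto simp: PiE_iff)
  have "push_chain R A B p c y = (\<Oplus>x\<in>{x \<in> A. c x \<noteq> \<zero> \<and> p x = y}. c x)"
    using y by (simp add: push_chain_def)
  also have "\<dots> = (\<Oplus>x\<in>{x \<in> A. c x \<noteq> \<zero>}. c x \<otimes> (if p x = y then \<one> else \<zero>))"
    by (rule add.finprod_mono_neutral_cong_left) (use c cx in auto)
  finally show ?thesis by (simp add: lin_ext_def finsum_ring_module)
qed

lemma indicator_funcset: "(\<lambda>x. if p x = y then \<one> else \<zero>) \<in> A \<rightarrow> carrier (ring_module R)"
  by auto

lemma push_closed: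
  assumes p: "p \<in> A \<rightarrow> B" and c: "c \<in> carrier (chain_module R A)"
  shows "push_chain R A B p c \<in> carrier (chain_module R B)"
proof -
  have "push_chain R A B p c y \<in> carrier R" if "y \<in> B" for y
    using lin_closed[OF lin_ext_lin[OF left_module_ring_module[OF ring_axioms] indicator_funcset] c] push_value[OF c that]
    by simp
  moreover have "finite {y \<in> B. push_chain R A B p c y \<noteq> \<zero>}"
  proof (rule finite_subset)
    have "push_chain R A B p c y = \<zero>" if "y \<in> B" "y \<notin> p ` {x \<in> A. c x \<noteq> \<zero>}" for y
    proof -
      have e: "{x \<in> A. c x \<noteq> \<zero> \<and> p x = y} = {}" using that by auto
      show ?thesis unfolding push_chain_def using that(1) by (simp add: e)
    qed
    then show "{y \<in> B. push_chain R A B p c y \<noteq> \<zero>} \<subseteq> p ` {x \<in> A. c x \<noteq> \<zero>}" by auto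
    show "finite (p ` {x \<in> A. c x \<noteq> \<zero>})" using c by simp
  qed
  ultimately show ?thesis by (auto simp: push_chain_def)
qed

lemma push_lin:
  assumes p: "p \<in> A \<rightarrow> B"
  shows "lin R (chain_module R A) (chain_module R B) (push_chain R A B p)"
proof (rule lin_pointwise[OF left_module_chain push_closed[OF p]])
  fix y assume y: "y \<in> B"
  show "lin R (chain_module R A) (ring_module R) (\<lambda>x. push_chain R A B p x y)"
    by (rule lin_cong[OF left_module_chain push_value[OF _ y, symmetric]
       lin_ext_lin[OF left_module_ring_module[OF ring_axioms] indicator_funcset]])
qed

lemma push_delta:
  assumes p: "p \<in> A \<rightarrow> B" and x: "x \<in> A"
  shows "push_chain R A B p (delta R A x) = delta R B (p x)"
proof
  fix y
  show "push_chain R A B p (delta R A x) y = delta R B (p x) y"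
  proof (cases "y \<in> B")
    case True
    then show ?thesis
      using push_value[OF delta_carrier[OF x] True, of p]
        lin_ext_delta[OF left_module_ring_module[OF ring_axioms] indicator_funcset[where p = p and y = y] x]
      by (auto simp: delta_def)
  qed (simp add: push_chain_def delta_def)
qed

lemma push_comp:
  assumes p: "p \<in> A \<rightarrow> B" and q: "q \<in> B \<rightarrow> D" and c: "c \<in> carrier (chain_module R A)"
  shows "push_chain R A D (\<lambda>x\<in>A. q (p x)) c = push_chain R B D q (push_chain R A B p c)"
proof (rule lin_unique[OF left_module_chain _ lin_comp[OF push_lin[OF p] push_lin[OF q]] _ c])
  have qp: "(\<lambda>x\<in>A. q (p x)) \<in> A \<rightarrow> D" using p q by auto
  show "lin R (chain_module R A) (chain_module R D) (push_chain R A D (\<lambda>x\<in>A. q (p x)))"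
    by (rule push_lin[OF qp])
  show "push_chain R A D (\<lambda>x\<in>A. q (p x)) (delta R A x) = push_chain R B D q (push_chain R A B p (delta R A x))"
    if "x \<in> A" for x
    using push_delta[OF qp that] push_delta[OF p that] push_delta[OF q funcset_mem[OF p that]] that by simp
qed

lemma push_id:
  assumes c: "c \<in> carrier (chain_module R A)"
  shows "push_chain R A A (\<lambda>x\<in>A. x) c = c"
proof (rule lin_unique[OF left_module_chain _ _ _ c])
  show "lin R (chain_module R A) (chain_module R A) (push_chain R A A (\<lambda>x\<in>A. x))"
    by (rule push_lin) auto
  show "lin R (chain_module R A) (chain_module R A) (\<lambda>c. c)" by (auto simp: lin_def)
  show "push_chain R A A (\<lambda>x\<in>A. x) (delta R A x) = delta R A x" if "x \<in> A" for x
    using push_delta[of "\<lambda>x\<in>A. x" A A x] that by auto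
qed

lemma lin_ext_push:
  assumes M: "left_module R M" and \<phi>: "\<phi> \<in> B \<rightarrow> carrier M" and p: "p \<in> A \<rightarrow> B"
    and c: "c \<in> carrier (chain_module R A)"
  shows "lin_ext R M B \<phi> (push_chain R A B p c) = lin_ext R M A (\<lambda>x\<in>A. \<phi> (p x)) c"
proof (rule lin_unique[OF M lin_comp[OF push_lin[OF p] lin_ext_lin[OF M \<phi>]] _ _ c])
  have \<phi>p: "(\<lambda>x\<in>A. \<phi> (p x)) \<in> A \<rightarrow> carrier M" using \<phi> p by auto
  show "lin R (chain_module R A) M (lin_ext R M A (\<lambda>x\<in>A. \<phi> (p x)))" by (rule lin_ext_lin[OF M \<phi>p])
  show "lin_ext R M B \<phi> (push_chain R A B p (delta R A x)) = lin_ext R M A (\<lambda>x\<in>A. \<phi> (p x)) (delta R A x)"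
    if "x \<in> A" for x
    using push_delta[OF p that] lin_ext_delta[OF M \<phi> funcset_mem[OF p that]] lin_ext_delta[OF M \<phi>p that] that by simp
qed

lemma face_funcset: "simplicial_set X \<Longrightarrow> face X n i \<in> Simp X (Suc n) \<rightarrow> Simp X n"
  using face_closed by auto

text \<open>\<open>boundary\<close> is given by its coefficients. As a sum of push-forwards in the
  chain module it is visibly linear; evaluation at \<open>y\<close> commutes with the sum because it
  is linear too.\<close>

lemma boundary_eq:
  assumes X: "simplicial_set X" and c: "c \<in> carrier (chain_module R (Simp X (Suc n)))"
  shows "boundary R n X c = (\<Oplus>\<^bsub>chain_module R (Simp X n)\<^esub>i\<in>{..Suc n}. alt_sign (chain_module R (Simp X n)) i
     (push_chain R (Simp X (Suc n)) (Simp X n) (face X n i) c))"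
proof
  let ?C = "chain_module R (Simp X n)"
  let ?p = "\<lambda>i. push_chain R (Simp X (Suc n)) (Simp X n) (face X n i) c"
  interpret C: abelian_group ?C by (rule left_module_group[OF left_module_chain])
  note p = push_closed[OF face_funcset[OF X] c]
  have ap: "alt_sign ?C i (?p i) \<in> carrier ?C" for i
    by (rule alt_sign_closed[OF C.abelian_group_axioms p])
  fix y
  show "boundary R n X c y = (\<Oplus>\<^bsub>?C\<^esub>i\<in>{..Suc n}. alt_sign ?C i (?p i)) y"
  proof (cases "y \<in> Simp X n")
    case True
    note ev = eval_lin[OF True] and rm = left_module_ring_module[OF ring_axioms]
    show ?thesis
      unfolding lin_finsum[OF left_module_chain rm ev ap] lin_alt_sign[OF left_module_chain rm ev p]
      using True by (simp add: boundary_def finsum_ring_module alt_sign_ring_module)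
  next
    case False
    have "(\<Oplus>\<^bsub>?C\<^esub>i\<in>{..Suc n}. alt_sign ?C i (?p i)) \<in> carrier ?C"
      by (rule C.finsum_closed) (use ap in blast)
    then show ?thesis using False by (auto simp: boundary_def PiE_iff extensional_def)
  qed
qed

lemma boundary_lin:
  assumes X: "simplicial_set X"
  shows "lin R (chain_module R (Simp X (Suc n))) (chain_module R (Simp X n)) (boundary R n X)"
  by (rule lin_cong[OF left_module_chain boundary_eq[OF X, symmetric]])
    (auto intro!: lin_finsum_map lin_alt_sign_map left_module_chain push_lin face_closed[OF X])

lemma boundary_delta:
  assumes X: "simplicial_set X" and x: "x \<in> Simp X (Suc n)"
  shows "boundary R n X (delta R (Simp X (Suc n)) x) =
    (\<Oplus>\<^bsub>chain_module R (Simp X n)\<^esub>i\<in>{..Suc n}. alt_sign (chain_module R (Simp X n)) i (delta R (Simp X n) (face X n i x)))"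
  using boundary_eq[OF X delta_carrier[OF x]] push_delta[OF face_funcset[OF X] x] by simp

lemma lin_boundary_delta:
  assumes X: "simplicial_set X" and x: "x \<in> Simp X (Suc n)" and M: "left_module R M"
    and g: "lin R (chain_module R (Simp X n)) M g"
  shows "g (boundary R n X (delta R (Simp X (Suc n)) x)) =
    (\<Oplus>\<^bsub>M\<^esub>i\<in>{..Suc n}. alt_sign M i (g (delta R (Simp X n) (face X n i x))))"
proof -
  note d = delta_carrier[OF face_closed[OF X x]]
  note ad = alt_sign_closed[OF left_module_group[OF left_module_chain] d]
  show ?thesis
    unfolding boundary_delta[OF X x] lin_finsum[OF left_module_chain M g ad] lin_alt_sign[OF left_module_chain M g d] ..
qed

lemma coboundary_closed:
  assumes X: "simplicial_set X" and M: "abelian_group M" and \<phi>: "\<phi> \<in> Simp X n \<rightarrow> carrier M"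
  shows "coboundary n X M \<phi> \<in> Simp X (Suc n) \<rightarrow>\<^sub>E carrier M"
proof -
  interpret M: abelian_group M by (rule M)
  have "alt_sign M i (\<phi> (face X n i x)) \<in> carrier M" if "x \<in> Simp X (Suc n)" for i x
    using funcset_mem[OF \<phi> face_closed[OF X that]] by (rule alt_sign_closed[OF M])
  then show ?thesis unfolding coboundary_def by (auto intro!: M.finsum_closed)
qed

text \<open>Boundary and coboundary are adjoint under the pairing \<open>lin_ext\<close>. On a
  single simplex both sides are the alternating sum of \<phi> over its faces.\<close>

lemma lin_ext_boundary:
  assumes X: "simplicial_set X" and M: "left_module R M" and \<phi>: "\<phi> \<in> Simp X n \<rightarrow> carrier M"
    and c: "c \<in> carrier (chain_module R (Simp X (Suc n)))"
  shows "lin_ext R M (Simp X n) \<phi> (boundary R n X c) = lin_ext R M (Simp X (Suc n)) (coboundary n X M \<phi>) c"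
proof (rule lin_unique[OF M lin_comp[OF boundary_lin[OF X] lin_ext_lin[OF M \<phi>]] _ _ c])
  have cb: "coboundary n X M \<phi> \<in> Simp X (Suc n) \<rightarrow> carrier M"
    using coboundary_closed[OF X left_module_group[OF M] \<phi>] by auto
  show "lin R (chain_module R (Simp X (Suc n))) M (lin_ext R M (Simp X (Suc n)) (coboundary n X M \<phi>))"
    by (rule lin_ext_lin[OF M cb])
  fix x assume x: "x \<in> Simp X (Suc n)"
  show "lin_ext R M (Simp X n) \<phi> (boundary R n X (delta R (Simp X (Suc n)) x)) =
    lin_ext R M (Simp X (Suc n)) (coboundary n X M \<phi>) (delta R (Simp X (Suc n)) x)"
    unfolding lin_boundary_delta[OF X x M lin_ext_lin[OF M \<phi>]] lin_ext_delta[OF M cb x]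
      lin_ext_delta[OF M \<phi> face_closed[OF X x]]
    using x by (simp add: coboundary_def)
qed

lemma coboundary_coboundary:
  assumes X: "simplicial_set X" and M: "left_module R M" and \<phi>: "\<phi> \<in> Simp X n \<rightarrow> carrier M"
    and x: "x \<in> Simp X (Suc (Suc n))"
  shows "coboundary (Suc n) X M (coboundary n X M \<phi>) x = \<zero>\<^bsub>M\<^esub>"
proof -
  interpret M: abelian_group M by (rule left_module_group[OF M])
  have id: "lin R M M (\<lambda>x. x)" by (simp add: lin_def)
  let ?F = "\<lambda>i j. \<phi> (face X n j (face X (Suc n) i x))"
  have F: "?F i j \<in> carrier M" for i j
    using funcset_mem[OF \<phi> face_closed[OF X face_closed[OF X x]]] .
  have "coboundary (Suc n) X M (coboundary n X M \<phi>) x =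
    (\<Oplus>\<^bsub>M\<^esub>i\<in>{..Suc (Suc n)}. alt_sign M i (\<Oplus>\<^bsub>M\<^esub>j\<in>{..Suc n}. alt_sign M j (?F i j)))"
    using x face_closed[OF X x] by (simp add: coboundary_def)
  also have "\<dots> = (\<Oplus>\<^bsub>M\<^esub>i\<in>{..Suc (Suc n)}. \<Oplus>\<^bsub>M\<^esub>j\<in>{..Suc n}. alt_sign M i (alt_sign M j (?F i j)))"
    by (simp only: lin_finsum[OF M M lin_alt_sign_map[OF M id] alt_sign_closed[OF M.abelian_group_axioms F]])
  also have "\<dots> = \<zero>\<^bsub>M\<^esub>"
    by (rule M.alternating_double_sum) (use F face_face[OF X x] in auto)
  finally show ?thesis .
qed

lemma lin_ext_zero:
  assumes M: "left_module R M"
    and \<phi>: "\<And>x. x \<in> S \<Longrightarrow> \<phi> x = \<zero>\<^bsub>M\<^esub>" and c: "c \<in> carrier (chain_module R S)"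
  shows "lin_ext R M S \<phi> c = \<zero>\<^bsub>M\<^esub>"
proof -
  interpret M: abelian_group M by (rule left_module_group[OF M])
  have \<phi>': "\<phi> \<in> S \<rightarrow> carrier M" using \<phi> by auto
  show ?thesis
    by (rule lin_unique[OF M lin_ext_lin[OF M \<phi>'] lin_zero_map[OF M] _ c])
      (simp add: lin_ext_delta[OF M \<phi>'] \<phi>)
qed

text \<open>The coefficient at \<open>y\<close> is the pairing with the indicator of
  \<open>y\<close>. Moving both boundaries across by adjointness leaves the coboundary of a
  coboundary, so the signed sum has to be computed only once.\<close>

lemma boundary_boundary:
  assumes X: "simplicial_set X" and c: "c \<in> carrier (chain_module R (Simp X (Suc (Suc n))))"
  shows "boundary R n X (boundary R (Suc n) X c) = \<zero>\<^bsub>chain_module R (Simp X n)\<^esub>"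
proof
  note rm = left_module_ring_module[OF ring_axioms]
  note bc = lin_closed[OF boundary_lin[OF X] c]
  note bbc = lin_closed[OF boundary_lin[OF X] bc]
  fix y
  show "boundary R n X (boundary R (Suc n) X c) y = \<zero>\<^bsub>chain_module R (Simp X n)\<^esub> y"
  proof (cases "y \<in> Simp X n")
    case True
    let ?\<phi> = "\<lambda>x. if x = y then \<one> else \<zero>"
    have \<phi>: "?\<phi> \<in> Simp X n \<rightarrow> carrier (ring_module R)" by auto
    note cb = coboundary_closed[OF X left_module_group[OF rm] \<phi>]
    have cb': "coboundary n X (ring_module R) ?\<phi> \<in> Simp X (Suc n) \<rightarrow> carrier (ring_module R)" using cb by auto
    have "boundary R n X (boundary R (Suc n) X c) y = lin_ext R (ring_module R) (Simp X n) ?\<phi> (boundary R n X (boundary R (Suc n) X c))"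
      by (rule lin_unique[OF rm eval_lin[OF True] lin_ext_lin[OF rm \<phi>] _ bbc])
        (subst lin_ext_delta[OF rm \<phi>], use True in \<open>auto simp: delta_def\<close>)
    also have "\<dots> = lin_ext R (ring_module R) (Simp X (Suc (Suc n))) (coboundary (Suc n) X (ring_module R) (coboundary n X (ring_module R) ?\<phi>)) c"
      unfolding lin_ext_boundary[OF X rm \<phi> bc] lin_ext_boundary[OF X rm cb' c] ..
    also have "\<dots> = \<zero>"
      using lin_ext_zero[OF rm coboundary_coboundary[OF X rm \<phi>] c] by simp
    finally show ?thesis using True by simp
  next
    case False
    then show ?thesis using bbc by (auto simp: PiE_iff extensional_def)
  qed
qed

lemma boundary_push:
  assumes X: "simplicial_set X" and Y: "simplicial_set Y" and h: "h \<in> simplicial_maps X Y"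
    and c: "c \<in> carrier (chain_module R (Simp X (Suc n)))"
  shows "push_chain R (Simp X n) (Simp Y n) (h n) (boundary R n X c) =
    boundary R n Y (push_chain R (Simp X (Suc n)) (Simp Y (Suc n)) (h (Suc n)) c)"
proof -
  have hf: "h m \<in> Simp X m \<rightarrow> Simp Y m" for m using simplicial_maps_closed[OF h] by auto
  show ?thesis
  proof (rule lin_unique[OF left_module_chain lin_comp[OF boundary_lin[OF X] push_lin[OF hf]]
        lin_comp[OF push_lin[OF hf] boundary_lin[OF Y]] _ c])
    fix x assume x: "x \<in> Simp X (Suc n)"
    show "push_chain R (Simp X n) (Simp Y n) (h n) (boundary R n X (delta R (Simp X (Suc n)) x)) =
      boundary R n Y (push_chain R (Simp X (Suc n)) (Simp Y (Suc n)) (h (Suc n)) (delta R (Simp X (Suc n)) x))"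
      unfolding lin_boundary_delta[OF X x left_module_chain push_lin[OF hf]] push_delta[OF hf x]
        push_delta[OF hf face_closed[OF X x]] boundary_delta[OF Y funcset_mem[OF hf x]] simplicial_maps_face[OF h x] ..
  qed
qed

end

text \<open>
  Degrees are shifted by two, so that the chain modules in degrees 0 and 1 vanish.  Then cycles,
  cocycles and coboundaries need no case distinction in the lowest degree, and neither does the
  mapping cone, which shifts the degree once more.
\<close>

fun simplices :: "'x sset \<Rightarrow> nat \<Rightarrow> 'x set" where
  "simplices X (Suc (Suc n)) = Simp X n"
| "simplices X n = {}"

text \<open>In the two lowest positions the target is the chain module on the empty set. Its only
  element is the function that is \<open>undefined\<close> everywhere, which is also its
  zero.\<close>

fun differential :: "('r, 'b) ring_scheme \<Rightarrow> 'x sset \<Rightarrow> nat \<Rightarrow> ('x \<Rightarrow> 'r) \<Rightarrow> 'x \<Rightarrow> 'r" where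
  "differential R X (Suc (Suc n)) = boundary R n X"
| "differential R X n = (\<lambda>_ _. undefined)"

fun chain_map :: "('r, 'b) ring_scheme \<Rightarrow> 'x sset \<Rightarrow> 'x sset \<Rightarrow> (nat \<Rightarrow> 'x \<Rightarrow> 'x) \<Rightarrow> nat \<Rightarrow> ('x \<Rightarrow> 'r) \<Rightarrow> 'x \<Rightarrow> 'r" where
  "chain_map R X Y h (Suc (Suc n)) = push_chain R (Simp X n) (Simp Y n) (h n)"
| "chain_map R X Y h n = (\<lambda>_ _. undefined)"

lemma chain_functor_sSet:
  fixes R :: "('r, 'b) ring_scheme"
  assumes R: "ring R"
  shows "chain_functor sSet R (\<lambda>X n. chain_module R (simplices X n)) (differential R) (chain_map R)"
proof (rule chain_functor.intro)
  interpret ring R by (rule R)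
  have zero: "\<zero>\<^bsub>chain_module R {}\<^esub> = (\<lambda>_. undefined)" by (auto simp: fun_eq_iff)
  have triv: "c = (\<lambda>_. undefined)" if "c \<in> carrier (chain_module R {})" for c :: "'x \<Rightarrow> 'r"
    using that by auto
  have lin0: "lin R M (chain_module R {}) (\<lambda>_ _. undefined)" for M :: "('r, 'y \<Rightarrow> 'r) module"
    using lin_zero_map[OF left_module_chain, of M "{}"] unfolding zero .
  have funcset: "h n \<in> Simp X n \<rightarrow> Simp Y n" if "h \<in> Hom sSet X Y" for X Y :: "'x sset" and h n
    using that simplicial_maps_closed by auto
  show "left_module R (chain_module R (simplices X n))" for X n
    by (rule left_module_chain)
  show "lin R (chain_module R (simplices X (Suc n))) (chain_module R (simplices X n)) (differential R X n)"
    if "X \<in> Ob sSet" for X n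
    using that lin0 boundary_lin by (cases "(X, n)" rule: simplices.cases) (simp_all add: fun_eq_iff)
  show "differential R X n (differential R X (Suc n) c) = \<zero>\<^bsub>chain_module R (simplices X n)\<^esub>"
    if "X \<in> Ob sSet" "c \<in> carrier (chain_module R (simplices X (Suc (Suc n))))" for X n c
    using that boundary_boundary
    by (cases "(X, n)" rule: simplices.cases) (simp_all add: zero del: chain_module_simps)
  show "lin R (chain_module R (simplices X n)) (chain_module R (simplices Y n)) (chain_map R X Y h n)"
    if "h \<in> Hom sSet X Y" for X Y h n
    using lin0 push_lin[OF funcset[OF that]] by (cases "(X, n)" rule: simplices.cases) simp_all
  show "chain_map R X Y h n (differential R X n c) = differential R Y n (chain_map R X Y h (Suc n) c)"
    if "h \<in> Hom sSet X Y" "X \<in> Ob sSet" "Y \<in> Ob sSet" "c \<in> carrier (chain_module R (simplices X (Suc n)))"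
    for X Y h n c
    using that boundary_push by (cases "(X, n)" rule: simplices.cases) simp_all
  show "chain_map R X X (category.Id sSet X) n c = c"
    if "c \<in> carrier (chain_module R (simplices X n))" for X n c
    using that push_id triv by (cases "(X, n)" rule: simplices.cases) (simp_all add: fun_eq_iff)
  show "chain_map R X Z (Cmp sSet X Y Z h g) n c = chain_map R Y Z h n (chain_map R X Y g n c)"
    if "g \<in> Hom sSet X Y" "h \<in> Hom sSet Y Z" "c \<in> carrier (chain_module R (simplices X n))" for X Y Z g h n c
    using that(3) push_comp[OF funcset[OF that(1)] funcset[OF that(2)]]
    by (cases "(X, n)" rule: simplices.cases) (simp_all add: compose_def)
  show "c = \<zero>\<^bsub>chain_module R (simplices X 0)\<^esub>" if "c \<in> carrier (chain_module R (simplices X 0))" for X c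
    using that triv by (simp add: fun_eq_iff)
  show "c = \<zero>\<^bsub>chain_module R (simplices X (Suc 0))\<^esub>" if "c \<in> carrier (chain_module R (simplices X (Suc 0)))" for X c
    using that triv by (simp add: fun_eq_iff)
qed (rule ring.chain_projective[OF R])

section \<open>Functors applied levelwise\<close>

locale cat_functor =
  fixes C :: "('o, 'a) category" and D :: "('p, 'b) category"
    and F :: "'o \<Rightarrow> 'p" and F' :: "'o \<Rightarrow> 'o \<Rightarrow> 'a \<Rightarrow> 'b"
  assumes C: "category C" and D: "category D"
    and F_Ob: "a \<in> Ob C \<Longrightarrow> F a \<in> Ob D"
    and F_Hom: "\<lbrakk>h \<in> Hom C a b; a \<in> Ob C; b \<in> Ob C\<rbrakk> \<Longrightarrow> F' a b h \<in> Hom D (F a) (F b)"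
    and F_Id: "a \<in> Ob C \<Longrightarrow> F' a a (Id C a) = Id D (F a)"
    and F_Cmp: "\<lbrakk>g \<in> Hom C a b; h \<in> Hom C b c; a \<in> Ob C; b \<in> Ob C; c \<in> Ob C\<rbrakk> \<Longrightarrow>
      F' a c (Cmp C a b c h g) = Cmp D (F a) (F b) (F c) (F' b c h) (F' a b g)"
begin

lemma levelwise_simps [simp]:
  "Idx (levelwise F F' X) = Idx X" "Fam (levelwise F F' X) s = F (Fam X s)"
  "Trans (levelwise F F' X) s t u = F' (Fam X s) (Fam X t) (Trans X s t u)"
  by (simp_all add: levelwise_def)

lemma levelwise_pro_object: "pro_object C X \<Longrightarrow> pro_object D (levelwise F F' X)"
  unfolding pro_object_def[of D]
  by (simp add: pro_cof pro_Fam pro_Trans pro_Trans_id pro_Trans_comp F_Ob F_Hom F_Id F_Cmp)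

end

locale functor_pro_map = cat_functor C D F F' + pro_map C X Y f
  for C :: "('o, 'a) category" and D :: "('p, 'b) category" and F F'
    and X :: "('i, 'j, 'o, 'a) pro_obj" and Y :: "('k, 'l, 'o, 'a) pro_obj" and f
begin

abbreviation "LX \<equiv> levelwise F F' X"
abbreviation "LY \<equiv> levelwise F F' Y"
abbreviation "Lf \<equiv> levelwise_map D F F' X Y f"

lemma L_germ_system: "s \<in> Ob J \<Longrightarrow> direct_system I (\<lambda>t. Hom D (F (XX t)) (F (YY s)))
     (\<lambda>t s' u h. Cmp D (F (XX t)) (F (XX s')) (F (YY s)) h (F' (XX t) (XX s') (TX t s' u)))"
  using germ_system[OF D levelwise_pro_object[OF X] F_Ob[OF YY]] by simp

lemma L_germ_rel: "germ_rel D LX (F (YY s)) = colim_rel I (\<lambda>t. Hom D (F (XX t)) (F (YY s)))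
     (\<lambda>t s' u h. Cmp D (F (XX t)) (F (XX s')) (F (YY s)) h (F' (XX t) (XX s') (TX t s' u)))"
  by (simp add: germ_rel_def)

lemma L_germ_mono:
  assumes s: "s \<in> Ob J" and rel: "((t, h), (t', h')) \<in> germ_rel C X (YY s)"
  shows "((t, F' (XX t) (YY s) h), (t', F' (XX t') (YY s) h')) \<in> germ_rel D LX (F (YY s))"
proof -
  obtain r u v where r: "t \<in> Ob I" "h \<in> Hom C (XX t) (YY s)" "t' \<in> Ob I" "h' \<in> Hom C (XX t') (YY s)"
    "r \<in> Ob I" "u \<in> Hom I r t" "v \<in> Hom I r t'"
    and eq: "Cmp C (XX r) (XX t) (YY s) h (TX r t u) = Cmp C (XX r) (XX t') (YY s) h' (TX r t' v)"
    using rel unfolding germ_rel_def colim_rel_def by auto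
  have "Cmp D (F (XX r)) (F (XX t)) (F (YY s)) (F' (XX t) (YY s) h) (F' (XX r) (XX t) (TX r t u)) =
    Cmp D (F (XX r)) (F (XX t')) (F (YY s)) (F' (XX t') (YY s) h') (F' (XX r) (XX t') (TX r t' v))"
    using F_Cmp[OF TX[OF r(6,5,1)] r(2) XX[OF r(5)] XX[OF r(1)] YY[OF s]]
      F_Cmp[OF TX[OF r(7,5,3)] r(4) XX[OF r(5)] XX[OF r(3)] YY[OF s]] eq by simp
  then show ?thesis
    unfolding L_germ_rel direct_system.rel_iff[OF L_germ_system[OF s]]
    using r F_Hom[OF r(2) XX[OF r(1)] YY[OF s]] F_Hom[OF r(4) XX[OF r(3)] YY[OF s]] by blast
qed

lemma Lf_class:
  assumes h: "(t, h) \<in> f s" and s: "s \<in> Ob J"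
  shows "Lf s = germ_rel D LX (F (YY s)) `` {(t, F' (XX t) (YY s) h)}"
proof -
  interpret sys: direct_system I "\<lambda>t. Hom D (F (XX t)) (F (YY s))"
     "\<lambda>t s' u h. Cmp D (F (XX t)) (F (XX s')) (F (YY s)) h (F' (XX t) (XX s') (TX t s' u))"
    by (rule L_germ_system[OF s])
  have "Lf s = germ_rel D LX (F (YY s)) `` {(t, F' (XX t) (YY s) h) | t h. (t, h) \<in> f s}"
    using s by (simp add: levelwise_map_def)
  also have "\<dots> = germ_rel D LX (F (YY s)) `` {(t, F' (XX t) (YY s) h)}"
    unfolding L_germ_rel
  proof (rule sys.Image_eq_class)
    fix q assume "q \<in> {(t, F' (XX t) (YY s) h) | t h. (t, h) \<in> f s}"
    then obtain t' h' where q: "q = (t', F' (XX t') (YY s) h')" "(t', h') \<in> f s" by blast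
    have "((t, h), (t', h')) \<in> germ_rel C X (YY s)" using q(2) f_class[OF h s] by simp
    then show "((t, F' (XX t) (YY s) h), q) \<in> sys.rel"
      using L_germ_mono[OF s] unfolding q(1) L_germ_rel by blast
  qed (use h in blast)
  finally show ?thesis .
qed

lemma Lf_mem: "(t, h) \<in> f s \<Longrightarrow> s \<in> Ob J \<Longrightarrow> (t, F' (XX t) (YY s) h) \<in> Lf s"
  unfolding Lf_class L_germ_rel
  using direct_system.rel_refl[OF L_germ_system] fD F_Hom XX YY by simp

text \<open>A representative \<open>h'\<close> of the germ \<open>Lf s\<close> need not be the value
  of the functor at a representative of \<open>f\<close>, but after restriction along
  \<open>v\<close> it is.\<close>

lemma Lf_join:
  assumes h: "(t, h) \<in> f s" and h': "(t', h') \<in> Lf s" and s: "s \<in> Ob J"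
  obtains r u v where "r \<in> Ob I" "u \<in> Hom I r t" "v \<in> Hom I r t'" "t' \<in> Ob I"
    "h' \<in> Hom D (F (XX t')) (F (YY s))" "(r, Cmp C (XX r) (XX t) (YY s) h (TX r t u)) \<in> f s"
    "F' (XX r) (YY s) (Cmp C (XX r) (XX t) (YY s) h (TX r t u)) =
     Cmp D (F (XX r)) (F (XX t')) (F (YY s)) h' (F' (XX r) (XX t') (TX r t' v))"
proof -
  have "((t, F' (XX t) (YY s) h), (t', h')) \<in> germ_rel D LX (F (YY s))"
    using h' unfolding Lf_class[OF h s] by simp
  then obtain r u v where r: "r \<in> Ob I" "u \<in> Hom I r t" "v \<in> Hom I r t'" "t' \<in> Ob I" "h' \<in> Hom D (F (XX t')) (F (YY s))"
    "Cmp D (F (XX r)) (F (XX t)) (F (YY s)) (F' (XX t) (YY s) h) (F' (XX r) (XX t) (TX r t u)) =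
     Cmp D (F (XX r)) (F (XX t')) (F (YY s)) h' (F' (XX r) (XX t') (TX r t' v))"
    unfolding L_germ_rel direct_system.rel_iff[OF L_germ_system[OF s]] by blast
  show thesis
    by (rule that[OF r(1-5) f_pre[OF h s r(2,1)]])
      (use r(6) F_Cmp[OF TX[OF r(2,1) fD1[OF h s]] fD2[OF h s] XX[OF r(1)] XX[OF fD1[OF h s]] YY[OF s]] in simp)
qed

lemma Lf_pro_hom: "Lf \<in> pro_hom D LX LY"
  unfolding pro_hom_def
proof (intro CollectI conjI ballI PiE_I)
  fix s assume "s \<in> Ob (Idx LY)"
  then have s: "s \<in> Ob J" by simp
  obtain t h where h: "(t, h) \<in> f s" using f_nonempty[OF s] .
  show "Lf s \<in> germs D LX (Fam LY s)"
    using direct_system.colim_classI[OF L_germ_system[OF s] fD1[OF h s] F_Hom[OF fD2[OF h s] XX[OF fD1[OF h s]] YY[OF s]]]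
    by (simp add: Lf_class[OF h s] L_germ_rel germs_def)
next
  fix s assume "s \<notin> Ob (Idx LY)"
  then show "Lf s = undefined" by (simp add: levelwise_map_def)
next
  fix s s' w p assume "s \<in> Ob (Idx LY)" "s' \<in> Ob (Idx LY)" and "w \<in> Hom (Idx LY) s s'" and p: "p \<in> Lf s"
  then have s: "s \<in> Ob J" "s' \<in> Ob J" and w: "w \<in> Hom J s s'" by simp_all
  obtain t' k where pk: "p = (t', k)" by (metis surj_pair)
  obtain t h where h: "(t, h) \<in> f s" using f_nonempty[OF s(1)] .
  obtain r u v where r: "r \<in> Ob I" "u \<in> Hom I r t" "v \<in> Hom I r t'" "t' \<in> Ob I"
    "k \<in> Hom D (F (XX t')) (F (YY s))" "(r, Cmp C (XX r) (XX t) (YY s) h (TX r t u)) \<in> f s"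
    "F' (XX r) (YY s) (Cmp C (XX r) (XX t) (YY s) h (TX r t u)) =
     Cmp D (F (XX r)) (F (XX t')) (F (YY s)) k (F' (XX r) (XX t') (TX r t' v))"
    using Lf_join[OF h p[unfolded pk] s(1)] .
  define h' where "h' = Cmp C (XX r) (XX t) (YY s) h (TX r t u)"
  note h' = fD2[OF r(6)[folded h'_def] s(1)]
  interpret sys: direct_system I "\<lambda>t. Hom D (F (XX t)) (F (YY s'))"
     "\<lambda>t r u h. Cmp D (F (XX t)) (F (XX r)) (F (YY s')) h (F' (XX t) (XX r) (TX t r u))"
    by (rule L_germ_system[OF s(2)])
  let ?k = "Cmp D (F (XX t')) (F (YY s)) (F (YY s')) (F' (YY s) (YY s') (TY s s' w)) k"
  have k: "?k \<in> Hom D (F (XX t')) (F (YY s'))"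
    by (rule cat_comp[OF D r(5) F_Hom[OF TY[OF w s] YY[OF s(1)] YY[OF s(2)]]]) (simp_all add: F_Ob XX YY r s)
  have "Cmp D (F (XX r)) (F (XX t')) (F (YY s')) ?k (F' (XX r) (XX t') (TX r t' v)) =
    Cmp D (F (XX r)) (F (YY s)) (F (YY s')) (F' (YY s) (YY s') (TY s s' w)) (F' (XX r) (YY s) h')"
    unfolding h'_def r(7)
    by (rule cat_assoc[OF D F_Hom[OF TX[OF r(3,1,4)] XX[OF r(1)] XX[OF r(4)]] r(5) F_Hom[OF TY[OF w s] YY[OF s(1)] YY[OF s(2)]]])
      (simp_all add: F_Ob XX YY r s)
  also have "\<dots> = F' (XX r) (YY s') (Cmp C (XX r) (YY s) (YY s') (TY s s' w) h')"
    by (rule F_Cmp[OF h' TY[OF w s] XX[OF r(1)] YY[OF s(1)] YY[OF s(2)], symmetric])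
  finally have eq: "Cmp D (F (XX r)) (F (XX t')) (F (YY s')) ?k (F' (XX r) (XX t') (TX r t' v)) =
    F' (XX r) (YY s') (Cmp C (XX r) (YY s) (YY s') (TY s s' w) h')" .
  note h'' = f_post[OF r(6)[folded h'_def] w s]
  have "((r, F' (XX r) (YY s') (Cmp C (XX r) (YY s) (YY s') (TY s s' w) h')), (t', ?k)) \<in> sys.rel"
    using sys.rel_sym[OF sys.rel_T[OF r(3) k r(1,4)]] eq by simp
  then have "(t', ?k) \<in> Lf s'"
    unfolding Lf_class[OF h'' s(2)] L_germ_rel by simp
  then show "case p of (t, h) \<Rightarrow> (t, Cmp D (Fam LX t) (Fam LY s) (Fam LY s') (Trans LY s s' w) h) \<in> Lf s'"
    by (simp add: pk)
qed

sublocale L: pro_map D LX LY Lf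
  by (rule pro_map.intro[OF D levelwise_pro_object[OF X] levelwise_pro_object[OF Y] Lf_pro_hom])

text \<open>Compared with \<open>L.invertible_at\<close>, the maps \<open>h\<close> and
  \<open>h'\<close> are representatives of \<open>f\<close> itself; only the inverse
  \<open>k\<close> lives in \<open>D\<close>. In this form the criterion can be evaluated on
  cycles.\<close>

definition F_invertible_at :: "'k \<Rightarrow> 'i \<Rightarrow> 'a \<Rightarrow> bool" where
  "F_invertible_at s t h \<longleftrightarrow> (\<exists>s' w t' h' u k. s' \<in> Ob J \<and> w \<in> Hom J s' s \<and> t' \<in> Ob I \<and> u \<in> Hom I t' t \<and>
     (t', h') \<in> f s' \<and> k \<in> Hom D (F (YY s')) (F (XX t)) \<and>
     Cmp D (F (XX t')) (F (YY s')) (F (XX t)) k (F' (XX t') (YY s') h') = F' (XX t') (XX t) (TX t' t u) \<and>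
     Cmp D (F (YY s')) (F (XX t)) (F (YY s)) (F' (XX t) (YY s) h) k = F' (YY s') (YY s) (TY s' s w))"

text \<open>\<open>Lf_join\<close> mediates in both directions: a representative in
  \<open>Lf s'\<close> is replaced by one coming from \<open>f\<close>, at the price of a
  restriction, which the local hypothesis of \<open>L.pro_isoI\<close> permits.\<close>

theorem pro_iso_levelwise_iff:
  "pro_iso D LX LY Lf \<longleftrightarrow> (\<forall>s\<in>Ob J. \<forall>(t, h)\<in>f s. F_invertible_at s t h)"
proof (intro iffI ballI)
  fix s p assume iso: "pro_iso D LX LY Lf" and s: "s \<in> Ob J" and p: "p \<in> f s"
  obtain t h where p_eq: "p = (t, h)" by (metis surj_pair)
  have h: "(t, h) \<in> f s" using p p_eq by simp
  note t = fD1[OF h s]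
  have "L.invertible_at s t (F' (XX t) (YY s) h)"
    using L.pro_iso_imp_invertible_at[OF iso] Lf_mem[OF h s] s by simp
  then obtain s' w t' g u k where k: "s' \<in> Ob J" "w \<in> Hom J s' s" "t' \<in> Ob I" "u \<in> Hom I t' t" "(t', g) \<in> Lf s'"
    "k \<in> Hom D (F (YY s')) (F (XX t))"
    and kg: "Cmp D (F (XX t')) (F (YY s')) (F (XX t)) k g = F' (XX t') (XX t) (TX t' t u)"
    and hk: "Cmp D (F (YY s')) (F (XX t)) (F (YY s)) (F' (XX t) (YY s) h) k = F' (YY s') (YY s) (TY s' s w)"
    unfolding L.invertible_at_def levelwise_simps by blast
  obtain t1 h1 where h1: "(t1, h1) \<in> f s'" using f_nonempty[OF k(1)] .
  obtain r a b where r: "r \<in> Ob I" "a \<in> Hom I r t1" "b \<in> Hom I r t'"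
    "g \<in> Hom D (F (XX t')) (F (YY s'))" "(r, Cmp C (XX r) (XX t1) (YY s') h1 (TX r t1 a)) \<in> f s'"
    "F' (XX r) (YY s') (Cmp C (XX r) (XX t1) (YY s') h1 (TX r t1 a)) =
     Cmp D (F (XX r)) (F (XX t')) (F (YY s')) g (F' (XX r) (XX t') (TX r t' b))"
    using Lf_join[OF h1 k(5,1)] .
  note bD = F_Hom[OF TX[OF r(3,1) k(3)] XX[OF r(1)] XX[OF k(3)]]
  have "Cmp D (F (XX r)) (F (YY s')) (F (XX t)) k (F' (XX r) (YY s') (Cmp C (XX r) (XX t1) (YY s') h1 (TX r t1 a))) =
    Cmp D (F (XX r)) (F (XX t')) (F (XX t)) (Cmp D (F (XX t')) (F (YY s')) (F (XX t)) k g) (F' (XX r) (XX t') (TX r t' b))"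
    unfolding r(6) by (rule cat_assoc[OF D bD r(4) k(6), symmetric]) (simp_all add: F_Ob XX YY r(1) k(1,3) t)
  also have "\<dots> = F' (XX r) (XX t) (TX r t (Cmp I r t' t u b))"
    unfolding kg TX_comp[OF r(3) k(4) r(1) k(3) t]
    by (rule F_Cmp[OF TX[OF r(3,1) k(3)] TX[OF k(4,3) t] XX[OF r(1)] XX[OF k(3)] XX[OF t], symmetric])
  finally show "case p of (t, h) \<Rightarrow> F_invertible_at s t h"
    unfolding p_eq prod.case F_invertible_at_def
    using k(1,2,6) r(1,5) hk cat_comp[OF I_cat r(3) k(4) r(1) k(3) t] by blast
next
  assume inv: "\<forall>s\<in>Ob J. \<forall>(t, h)\<in>f s. F_invertible_at s t h"
  show "pro_iso D LX LY Lf"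
  proof (rule L.pro_isoI)
    fix s t g assume "s \<in> Ob (Idx LY)" and g: "(t, g) \<in> Lf s"
    then have s: "s \<in> Ob J" by simp
    obtain t1 h1 where h1: "(t1, h1) \<in> f s" using f_nonempty[OF s] .
    obtain r a b where r: "r \<in> Ob I" "a \<in> Hom I r t1" "b \<in> Hom I r t" "t \<in> Ob I"
      "(r, Cmp C (XX r) (XX t1) (YY s) h1 (TX r t1 a)) \<in> f s"
      "F' (XX r) (YY s) (Cmp C (XX r) (XX t1) (YY s) h1 (TX r t1 a)) =
       Cmp D (F (XX r)) (F (XX t)) (F (YY s)) g (F' (XX r) (XX t) (TX r t b))"
      using Lf_join[OF h1 g s] .
    have "F_invertible_at s r (Cmp C (XX r) (XX t1) (YY s) h1 (TX r t1 a))"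
      using inv s r(5) by blast
    then have "L.invertible_at s r (F' (XX r) (YY s) (Cmp C (XX r) (XX t1) (YY s) h1 (TX r t1 a)))"
      unfolding F_invertible_at_def L.invertible_at_def levelwise_simps using Lf_mem by blast
    then show "\<exists>t0 u0. t0 \<in> Ob (Idx LX) \<and> u0 \<in> Hom (Idx LX) t0 t \<and>
      L.invertible_at s t0 (Cmp D (Fam LX t0) (Fam LX t) (Fam LY s) g (Trans LX t0 t u0))"
      using r(1,3,6) by auto
  qed
qed

end

section \<open>Colimits of groups\<close>

locale group_system = direct_system I "\<lambda>s. carrier (G s)" T
  for I :: "('i, 'j) category" and G :: "'i \<Rightarrow> 'a monoid" and T :: "'i \<Rightarrow> 'i \<Rightarrow> 'j \<Rightarrow> 'a \<Rightarrow> 'a" +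
  assumes group: "s \<in> Ob I \<Longrightarrow> Group.group (G s)"
    and T_hom: "\<lbrakk>u \<in> Hom I t s; t \<in> Ob I; s \<in> Ob I\<rbrakk> \<Longrightarrow> T t s u \<in> hom (G s) (G t)"
begin

abbreviation "colim \<equiv> colim_group I G T"
abbreviation "cls s a \<equiv> rel `` {(s, a)}"

lemma carrier_colim: "carrier colim = colim_set I (\<lambda>s. carrier (G s)) T"
  by (simp add: colim_group_def Let_def)

lemma cls_closed: "s \<in> Ob I \<Longrightarrow> a \<in> carrier (G s) \<Longrightarrow> cls s a \<in> carrier colim"
  unfolding carrier_colim by (rule colim_classI)

lemma cls_cases:
  assumes "A \<in> carrier colim" obtains s a where "s \<in> Ob I" "a \<in> carrier (G s)" "A = cls s a"
  using assms colim_nonempty[of A] colim_memD[of A] colim_class[of A] unfolding carrier_colim by metis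

lemma cls_eq_iff: "\<lbrakk>s \<in> Ob I; a \<in> carrier (G s)\<rbrakk> \<Longrightarrow> cls s a = cls s' a' \<longleftrightarrow> ((s, a), (s', a')) \<in> rel"
  by (rule class_eq_iff)

lemma cls_T: "\<lbrakk>u \<in> Hom I t s; a \<in> carrier (G s); t \<in> Ob I; s \<in> Ob I\<rbrakk> \<Longrightarrow> cls t (T t s u a) = cls s a"
  using cls_eq_iff rel_T by metis

text \<open>Two related pairs are made equal at one stage by the same two arrows, so that
  homomorphisms can be applied to products. A square over \<open>t\<close> aligns the arrows to
  \<open>t\<close>; those to \<open>t'\<close> are then equalized.\<close>

lemma rel_join2:
  assumes x: "((t, x), (t', x')) \<in> rel" and y: "((t, y), (t', y')) \<in> rel"
  obtains r p q where "r \<in> Ob I" "p \<in> Hom I r t" "q \<in> Hom I r t'"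
    "T r t p x = T r t' q x'" "T r t p y = T r t' q y'"
proof -
  obtain r1 p1 q1 where r1: "r1 \<in> Ob I" "p1 \<in> Hom I r1 t" "q1 \<in> Hom I r1 t'" "T r1 t p1 x = T r1 t' q1 x'"
    and t: "t \<in> Ob I" "t' \<in> Ob I" "x \<in> carrier (G t)" "x' \<in> carrier (G t')"
    using x unfolding rel_iff by blast
  obtain r2 p2 q2 where r2: "r2 \<in> Ob I" "p2 \<in> Hom I r2 t" "q2 \<in> Hom I r2 t'" "T r2 t p2 y = T r2 t' q2 y'"
    and y: "y \<in> carrier (G t)" "y' \<in> carrier (G t')"
    using y unfolding rel_iff by blast
  obtain r3 a b where r3: "r3 \<in> Ob I" "a \<in> Hom I r3 r1" "b \<in> Hom I r3 r2"
    "Cmp I r3 r1 t p1 a = Cmp I r3 r2 t p2 b"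
    using cofiltered_square[OF cof t(1) r1(1) r2(1) r1(2) r2(2)] .
  note qa = cat_comp[OF I_cat r3(2) r1(3) r3(1) r1(1) t(2)] and qb = cat_comp[OF I_cat r3(3) r2(3) r3(1) r2(1) t(2)]
  note pa = cat_comp[OF I_cat r3(2) r1(2) r3(1) r1(1) t(1)]
  obtain r c where r: "r \<in> Ob I" "c \<in> Hom I r r3"
    "Cmp I r r3 t' (Cmp I r3 r1 t' q1 a) c = Cmp I r r3 t' (Cmp I r3 r2 t' q2 b) c"
    using cofiltered_equalize[OF cof r3(1) t(2) qa qb] .
  show thesis
  proof (rule that[OF r(1) cat_comp[OF I_cat r(2) pa r(1) r3(1) t(1)] cat_comp[OF I_cat r(2) qa r(1) r3(1) t(2)]])
    show "T r t (Cmp I r r3 t (Cmp I r3 r1 t p1 a) c) x = T r t' (Cmp I r r3 t' (Cmp I r3 r1 t' q1 a) c) x'"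
      using T_comp[OF r(2) pa t(3) r(1) r3(1) t(1)] T_comp[OF r(2) qa t(4) r(1) r3(1) t(2)]
        T_comp[OF r3(2) r1(2) t(3) r3(1) r1(1) t(1)] T_comp[OF r3(2) r1(3) t(4) r3(1) r1(1) t(2)] r1(4) by simp
    show "T r t (Cmp I r r3 t (Cmp I r3 r1 t p1 a) c) y = T r t' (Cmp I r r3 t' (Cmp I r3 r1 t' q1 a) c) y'"
      unfolding r(3) using T_comp[OF r(2) pa y(1) r(1) r3(1) t(1)] T_comp[OF r(2) qb y(2) r(1) r3(1) t(2)]
        T_comp[OF r3(3) r2(2) y(1) r3(1) r2(1) t(1)] T_comp[OF r3(3) r2(3) y(2) r3(1) r2(1) t(2)] r2(4) r3(4) by simp
  qed
qed

lemma mult_cls: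
  assumes s: "s \<in> Ob I" "a \<in> carrier (G s)" "b \<in> carrier (G s)"
  shows "cls s a \<otimes>\<^bsub>colim\<^esub> cls s b = cls s (a \<otimes>\<^bsub>G s\<^esub> b)"
proof -
  let ?Q = "{(t, T t s1 u a' \<otimes>\<^bsub>G t\<^esub> T t s2 v b') | t s1 s2 u v a' b'.
    t \<in> Ob I \<and> (s1, a') \<in> cls s a \<and> (s2, b') \<in> cls s b \<and> u \<in> Hom I t s1 \<and> v \<in> Hom I t s2}"
  have "cls s a \<otimes>\<^bsub>colim\<^esub> cls s b = rel `` ?Q"
    by (simp add: colim_group_def Let_def)
  also have "\<dots> = cls s (a \<otimes>\<^bsub>G s\<^esub> b)"
  proof (rule Image_eq_class)
    have "(s, T s s (Id I s) a \<otimes>\<^bsub>G s\<^esub> T s s (Id I s) b) \<in> ?Q"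
      using s rel_refl cat_id[OF I_cat s(1)] by blast
    then show "?Q \<noteq> {}" by blast
    fix q assume "q \<in> ?Q"
    then obtain t s1 s2 u v a' b' where q: "q = (t, T t s1 u a' \<otimes>\<^bsub>G t\<^esub> T t s2 v b')" "t \<in> Ob I"
      "((s, a), (s1, a')) \<in> rel" "((s, b), (s2, b')) \<in> rel" "u \<in> Hom I t s1" "v \<in> Hom I t s2" by blast
    have ob: "s1 \<in> Ob I" "a' \<in> carrier (G s1)" "s2 \<in> Ob I" "b' \<in> carrier (G s2)"
      using q(3,4) unfolding rel_iff by blast+
    let ?a = "T t s1 u a'" and ?b = "T t s2 v b'"
    have ab: "?a \<in> carrier (G t)" "?b \<in> carrier (G t)" using ob q(2,5,6) T_closed by auto
    have "((s, a), (t, ?a)) \<in> rel" "((s, b), (t, ?b)) \<in> rel"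
      using q ob rel_trans rel_T by blast+
    then obtain r x y where r: "r \<in> Ob I" "x \<in> Hom I r s" "y \<in> Hom I r t"
      "T r s x a = T r t y ?a" "T r s x b = T r t y ?b"
      by (rule rel_join2)
    have "T r s x (a \<otimes>\<^bsub>G s\<^esub> b) = T r t y (?a \<otimes>\<^bsub>G t\<^esub> ?b)"
      using hom_mult[OF T_hom[OF r(2,1) s(1)] s(2,3)] hom_mult[OF T_hom[OF r(3,1) q(2)] ab] r(4,5) by simp
    then show "((s, a \<otimes>\<^bsub>G s\<^esub> b), q) \<in> rel"
      unfolding q(1) rel_iff using r(1-3) s q(2) ab group[OF s(1)] group[OF q(2)]
      by (auto simp: Group.group_def monoid.m_closed)
  qed
  finally show ?thesis .
qed

lemma cls_common:
  assumes "A \<in> carrier colim" "B \<in> carrier colim"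
  obtains s a b where "s \<in> Ob I" "a \<in> carrier (G s)" "b \<in> carrier (G s)" "A = cls s a" "B = cls s b"
proof -
  obtain s a where a: "s \<in> Ob I" "a \<in> carrier (G s)" "A = cls s a" using cls_cases[OF assms(1)] .
  obtain s' b where b: "s' \<in> Ob I" "b \<in> carrier (G s')" "B = cls s' b" using cls_cases[OF assms(2)] .
  obtain t u v where t: "t \<in> Ob I" "u \<in> Hom I t s" "v \<in> Hom I t s'" using cofiltered_span[OF cof a(1) b(1)] .
  show thesis
    by (rule that[of t "T t s u a" "T t s' v b"]) (use a b t T_closed cls_T in auto)
qed

end

text \<open>A map of direct systems over different index categories, given by all its
  representatives: \<open>(t, \<mu>)\<close> in \<open>m s\<close> stands for a homomorphism from
  \<open>G s\<close> to \<open>H t\<close>. The conditions say that representatives agree in the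
  colimit and are stable under restriction on either side.\<close>

locale system_map = dom: group_system J G TG + cod: group_system I H TH
  for J :: "('k, 'l) category" and G :: "'k \<Rightarrow> 'a monoid" and TG
    and I :: "('i, 'j) category" and H :: "'i \<Rightarrow> 'b monoid" and TH +
  fixes m :: "'k \<Rightarrow> ('i \<times> ('a \<Rightarrow> 'b)) set"
  assumes m_nonempty: "s \<in> Ob J \<Longrightarrow> m s \<noteq> {}"
    and m_hom: "\<lbrakk>(t, \<mu>) \<in> m s; s \<in> Ob J\<rbrakk> \<Longrightarrow> t \<in> Ob I \<and> \<mu> \<in> hom (G s) (H t)"
    and m_join: "\<lbrakk>(t, \<mu>) \<in> m s; (t', \<mu>') \<in> m s; s \<in> Ob J; a \<in> carrier (G s)\<rbrakk> \<Longrightarrow>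
      ((t, \<mu> a), (t', \<mu>' a)) \<in> cod.rel"
    and m_pre: "\<lbrakk>(t, \<mu>) \<in> m s; s \<in> Ob J; t' \<in> Ob I; u \<in> Hom I t' t\<rbrakk> \<Longrightarrow>
      \<exists>\<mu>'. (t', \<mu>') \<in> m s \<and> (\<forall>a\<in>carrier (G s). \<mu>' a = TH t' t u (\<mu> a))"
    and m_post: "\<lbrakk>(t, \<mu>) \<in> m s'; s \<in> Ob J; s' \<in> Ob J; w \<in> Hom J s' s\<rbrakk> \<Longrightarrow>
      \<exists>\<mu>'. (t, \<mu>') \<in> m s \<and> (\<forall>a\<in>carrier (G s). \<mu>' a = \<mu> (TG s' s w a))"
begin

definition colim_map :: "('k \<times> 'a) set \<Rightarrow> ('i \<times> 'b) set" where
  "colim_map = (\<lambda>A\<in>carrier dom.colim. cod.rel `` {(t, \<mu> a) | s a t \<mu>. (s, a) \<in> A \<and> (t, \<mu>) \<in> m s})"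

lemma m_closed: "\<lbrakk>(t, \<mu>) \<in> m s; s \<in> Ob J; a \<in> carrier (G s)\<rbrakk> \<Longrightarrow> \<mu> a \<in> carrier (H t)"
  using m_hom hom_in_carrier by metis

lemma colim_map_cls:
  assumes s: "s \<in> Ob J" "a \<in> carrier (G s)" and \<mu>: "(t, \<mu>) \<in> m s"
  shows "colim_map (dom.cls s a) = cod.cls t (\<mu> a)"
proof -
  have "colim_map (dom.cls s a) = cod.rel `` {(t, \<mu> a') | s' a' t \<mu>. (s', a') \<in> dom.cls s a \<and> (t, \<mu>) \<in> m s'}"
    using dom.cls_closed[OF s] by (simp add: colim_map_def)
  also have "\<dots> = cod.cls t (\<mu> a)"
  proof (rule cod.Image_eq_class)
    show "{(t, \<mu> a') | s' a' t \<mu>. (s', a') \<in> dom.cls s a \<and> (t, \<mu>) \<in> m s'} \<noteq> {}"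
      using \<mu> dom.rel_refl[OF s] by blast
    fix q assume "q \<in> {(t, \<mu> a') | s' a' t \<mu>. (s', a') \<in> dom.cls s a \<and> (t, \<mu>) \<in> m s'}"
    then obtain s' a' t' \<mu>' where q: "q = (t', \<mu>' a')" "((s, a), (s', a')) \<in> dom.rel" "(t', \<mu>') \<in> m s'" by blast
    then obtain r w w' where r: "s' \<in> Ob J" "a' \<in> carrier (G s')" "r \<in> Ob J" "w \<in> Hom J r s" "w' \<in> Hom J r s'"
      "TG r s w a = TG r s' w' a'"
      unfolding dom.rel_iff by blast
    obtain t2 \<mu>2 where \<mu>2: "(t2, \<mu>2) \<in> m r" using m_nonempty[OF r(3)] by auto
    obtain \<mu>3 where \<mu>3: "(t2, \<mu>3) \<in> m s" "\<mu>3 a = \<mu>2 (TG r s w a)"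
      using m_post[OF \<mu>2 s(1) r(3,4)] s(2) by blast
    obtain \<mu>4 where \<mu>4: "(t2, \<mu>4) \<in> m s'" "\<mu>4 a' = \<mu>2 (TG r s' w' a')"
      using m_post[OF \<mu>2 r(1,3,5)] r(2) by blast
    show "((t, \<mu> a), q) \<in> cod.rel"
      using cod.rel_trans[OF m_join[OF \<mu> \<mu>3(1) s]] m_join[OF \<mu>4(1) q(3) r(1,2)] \<mu>3(2) \<mu>4(2) r(6) q(1) by simp
  qed
  finally show ?thesis .
qed

lemma colim_map_hom: "colim_map \<in> hom dom.colim cod.colim"
proof (rule homI)
  fix A assume A: "A \<in> carrier dom.colim"
  obtain s a where a: "s \<in> Ob J" "a \<in> carrier (G s)" "A = dom.cls s a" using dom.cls_cases[OF A] .
  obtain t \<mu> where \<mu>: "(t, \<mu>) \<in> m s" using m_nonempty[OF a(1)] by auto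
  show "colim_map A \<in> carrier cod.colim"
    unfolding a(3) colim_map_cls[OF a(1,2) \<mu>] using m_hom[OF \<mu> a(1)] m_closed[OF \<mu> a(1,2)] cod.cls_closed by blast
next
  fix A B assume AB: "A \<in> carrier dom.colim" "B \<in> carrier dom.colim"
  obtain s a b where s: "s \<in> Ob J" "a \<in> carrier (G s)" "b \<in> carrier (G s)" "A = dom.cls s a" "B = dom.cls s b"
    using dom.cls_common[OF AB] .
  obtain t \<mu> where \<mu>: "(t, \<mu>) \<in> m s" using m_nonempty[OF s(1)] by auto
  have t: "t \<in> Ob I" and \<mu>_hom: "\<mu> \<in> hom (G s) (H t)" using m_hom[OF \<mu> s(1)] by auto
  have ab: "a \<otimes>\<^bsub>G s\<^esub> b \<in> carrier (G s)" using dom.group[OF s(1)] s by (simp add: Group.group_def monoid.m_closed)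
  show "colim_map (A \<otimes>\<^bsub>dom.colim\<^esub> B) = colim_map A \<otimes>\<^bsub>cod.colim\<^esub> colim_map B"
    unfolding s(4,5) dom.mult_cls[OF s(1-3)] colim_map_cls[OF s(1) ab \<mu>] colim_map_cls[OF s(1,2) \<mu>]
      colim_map_cls[OF s(1,3) \<mu>] cod.mult_cls[OF t m_closed[OF \<mu> s(1,2)] m_closed[OF \<mu> s(1,3)]]
      hom_mult[OF \<mu>_hom s(2,3)] ..
qed

text \<open>Since the map is a homomorphism, injectivity is tested on its kernel. Restrictions on
  the side of \<open>H\<close> are absorbed into the representative by \<open>m_pre\<close>, so the
  kernel condition can ask that \<open>\<mu> a\<close> be trivial at the stage of \<mu>
  itself.\<close>

theorem colim_map_iso_iff:
  "colim_map \<in> iso dom.colim cod.colim \<longleftrightarrow>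
     (\<forall>s\<in>Ob J. \<forall>a\<in>carrier (G s). \<forall>(t, \<mu>)\<in>m s. \<mu> a = \<one>\<^bsub>H t\<^esub> \<longrightarrow>
        (\<exists>s'\<in>Ob J. \<exists>w\<in>Hom J s' s. TG s' s w a = \<one>\<^bsub>G s'\<^esub>)) \<and>
     (\<forall>t\<in>Ob I. \<forall>b\<in>carrier (H t). \<exists>s\<in>Ob J. \<exists>(t', \<mu>)\<in>m s. \<exists>u\<in>Hom I t' t. \<exists>a\<in>carrier (G s). \<mu> a = TH t' t u b)"
  (is "_ \<longleftrightarrow> ?inj \<and> ?surj")
proof (intro iffI conjI)
  assume iso: "colim_map \<in> iso dom.colim cod.colim"
  then have inj: "inj_on colim_map (carrier dom.colim)" and surj: "colim_map ` carrier dom.colim = carrier cod.colim"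
    by (auto simp: iso_def bij_betw_def)
  show ?inj
  proof (intro ballI, clarify)
    fix s a t \<mu> assume s: "s \<in> Ob J" "a \<in> carrier (G s)" and \<mu>: "(t, \<mu>) \<in> m s" and 1: "\<mu> a = \<one>\<^bsub>H t\<^esub>"
    have t: "t \<in> Ob I" and \<mu>_hom: "\<mu> \<in> hom (G s) (H t)" using m_hom[OF \<mu> s(1)] by auto
    have one: "\<one>\<^bsub>G s\<^esub> \<in> carrier (G s)" using dom.group[OF s(1)] by (simp add: Group.group_def)
    have "colim_map (dom.cls s a) = colim_map (dom.cls s \<one>\<^bsub>G s\<^esub>)"
      unfolding colim_map_cls[OF s \<mu>] colim_map_cls[OF s(1) one \<mu>] 1
      using hom_one[OF \<mu>_hom dom.group[OF s(1)] cod.group[OF t]] by simp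
    then have "dom.cls s a = dom.cls s \<one>\<^bsub>G s\<^esub>"
      using inj dom.cls_closed[OF s] dom.cls_closed[OF s(1) one] by (simp add: inj_on_def)
    then obtain r u v where r: "r \<in> Ob J" "u \<in> Hom J r s" "v \<in> Hom J r s" "TG r s u a = TG r s v \<one>\<^bsub>G s\<^esub>"
      unfolding dom.cls_eq_iff[OF s] dom.rel_iff by blast
    then have "TG r s u a = \<one>\<^bsub>G r\<^esub>"
      using hom_one[OF dom.T_hom[OF r(3,1) s(1)] dom.group[OF s(1)] dom.group[OF r(1)]] by simp
    then show "\<exists>s'\<in>Ob J. \<exists>w\<in>Hom J s' s. TG s' s w a = \<one>\<^bsub>G s'\<^esub>" using r by blast
  qed
  show ?surj
  proof (intro ballI)
    fix t b assume t: "t \<in> Ob I" "b \<in> carrier (H t)"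
    have "cod.cls t b \<in> colim_map ` carrier dom.colim"
      unfolding surj by (rule cod.cls_closed[OF t])
    then obtain A where A: "A \<in> carrier dom.colim" "colim_map A = cod.cls t b"
      by (elim imageE) simp
    obtain s a where a: "s \<in> Ob J" "a \<in> carrier (G s)" "A = dom.cls s a" using dom.cls_cases[OF A(1)] .
    obtain t1 \<mu> where \<mu>: "(t1, \<mu>) \<in> m s" using m_nonempty[OF a(1)] by auto
    have t1: "t1 \<in> Ob I" using m_hom[OF \<mu> a(1)] by auto
    have "((t1, \<mu> a), (t, b)) \<in> cod.rel"
      using A(2) unfolding a(3) colim_map_cls[OF a(1,2) \<mu>] cod.cls_eq_iff[OF t1 m_closed[OF \<mu> a(1,2)]] .
    then obtain r u v where r: "r \<in> Ob I" "u \<in> Hom I r t1" "v \<in> Hom I r t" "TH r t1 u (\<mu> a) = TH r t v b"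
      unfolding cod.rel_iff by blast
    obtain \<mu>' where "(r, \<mu>') \<in> m s" "\<mu>' a = TH r t1 u (\<mu> a)" using m_pre[OF \<mu> a(1) r(1,2)] a(2) by blast
    then show "\<exists>s\<in>Ob J. \<exists>(t', \<mu>)\<in>m s. \<exists>u\<in>Hom I t' t. \<exists>a\<in>carrier (G s). \<mu> a = TH t' t u b"
      using a(1,2) r(3,4) by (intro bexI[of _ s] bexI[of _ "(r, \<mu>')"]) auto
  qed
next
  assume crit: "?inj \<and> ?surj"
  have "inj_on colim_map (carrier dom.colim)"
  proof (rule inj_onI)
    fix A B assume AB: "A \<in> carrier dom.colim" "B \<in> carrier dom.colim" and eq: "colim_map A = colim_map B"
    obtain s a b where s: "s \<in> Ob J" "a \<in> carrier (G s)" "b \<in> carrier (G s)" "A = dom.cls s a" "B = dom.cls s b"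
      using dom.cls_common[OF AB] .
    obtain t \<mu> where \<mu>: "(t, \<mu>) \<in> m s" using m_nonempty[OF s(1)] by auto
    have t: "t \<in> Ob I" using m_hom[OF \<mu> s(1)] by auto
    note \<mu>a = m_closed[OF \<mu> s(1,2)] and \<mu>b = m_closed[OF \<mu> s(1,3)]
    have "((t, \<mu> a), (t, \<mu> b)) \<in> cod.rel"
      using eq unfolding s(4,5) colim_map_cls[OF s(1,2) \<mu>] colim_map_cls[OF s(1,3) \<mu>] cod.cls_eq_iff[OF t \<mu>a] .
    then obtain r u v where r: "r \<in> Ob I" "u \<in> Hom I r t" "v \<in> Hom I r t" "TH r t u (\<mu> a) = TH r t v (\<mu> b)"
      unfolding cod.rel_iff by blast
    \<comment> \<open>The images of \<open>a\<close> and \<open>b\<close> agree along two arrows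
      \<open>u\<close> and \<open>v\<close>. Once these are equalized, a single representative
      \<open>\<mu>'\<close> takes equal values at \<open>a\<close> and \<open>b\<close>, and the
      kernel condition applies to their quotient.\<close>
    obtain q c where q: "q \<in> Ob I" "c \<in> Hom I q r" "Cmp I q r t u c = Cmp I q r t v c"
      using cofiltered_equalize[OF cod.cof r(1) t r(2,3)] .
    have "TH q t (Cmp I q r t u c) (\<mu> a) = TH q t (Cmp I q r t u c) (\<mu> b)"
      using cod.T_comp[OF q(2) r(2) \<mu>a q(1) r(1) t] cod.T_comp[OF q(2) r(3) \<mu>b q(1) r(1) t] q(3) r(4) by simp
    then obtain \<mu>' where \<mu>': "(q, \<mu>') \<in> m s" "\<mu>' a = \<mu>' b"
      using m_pre[OF \<mu> s(1) q(1) cat_comp[OF cod.I_cat q(2) r(2) q(1) r(1) t]] s(2,3) by metis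
    have \<mu>'_hom: "\<mu>' \<in> hom (G s) (H q)" using m_hom[OF \<mu>'(1) s(1)] by auto
    interpret Gs: Group.group "G s" by (rule dom.group[OF s(1)])
    interpret Hq: Group.group "H q" by (rule cod.group[OF q(1)])
    interpret \<mu>': group_hom "G s" "H q" \<mu>' by unfold_locales (rule \<mu>'_hom)
    have ab: "a \<otimes>\<^bsub>G s\<^esub> inv\<^bsub>G s\<^esub> b \<in> carrier (G s)" using s by simp
    have "\<mu>' (a \<otimes>\<^bsub>G s\<^esub> inv\<^bsub>G s\<^esub> b) = \<one>\<^bsub>H q\<^esub>"
      using s \<mu>'(2) by simp
    then obtain s' w where w: "s' \<in> Ob J" "w \<in> Hom J s' s" "TG s' s w (a \<otimes>\<^bsub>G s\<^esub> inv\<^bsub>G s\<^esub> b) = \<one>\<^bsub>G s'\<^esub>"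
      using crit s(1) ab \<mu>'(1) by blast
    interpret Gs': Group.group "G s'" by (rule dom.group[OF w(1)])
    interpret T: group_hom "G s" "G s'" "TG s' s w" by unfold_locales (rule dom.T_hom[OF w(2,1) s(1)])
    have "TG s' s w a = TG s' s w b"
      using w(3) s by simp (metis Gs'.inv_equality Gs'.inv_inv T.hom_closed Gs'.inv_closed)
    then show "A = B"
      unfolding s(4,5) using dom.cls_T[OF w(2) s(2) w(1) s(1)] dom.cls_T[OF w(2) s(3) w(1) s(1)] by simp
  qed
  moreover have "carrier cod.colim \<subseteq> colim_map ` carrier dom.colim"
  proof
    fix B assume B: "B \<in> carrier cod.colim"
    obtain t b where t: "t \<in> Ob I" "b \<in> carrier (H t)" "B = cod.cls t b" using cod.cls_cases[OF B] .
    obtain s t' \<mu> u a where a: "s \<in> Ob J" "(t', \<mu>) \<in> m s" "u \<in> Hom I t' t" "a \<in> carrier (G s)" "\<mu> a = TH t' t u b"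
      using conjunct2[OF crit, rule_format, OF t(1,2)] by (elim bexE) auto
    have "B = colim_map (dom.cls s a)"
      unfolding colim_map_cls[OF a(1,4,2)] a(5) t(3)
      using cod.cls_T[OF a(3) t(2) _ t(1)] m_hom[OF a(2,1)] by simp
    then show "B \<in> colim_map ` carrier dom.colim" using dom.cls_closed[OF a(1,4)] by blast
  qed
  ultimately show "colim_map \<in> iso dom.colim cod.colim"
    using colim_map_hom by (auto simp: iso_def bij_betw_def hom_def)
qed

end

section \<open>Homology\<close>

text \<open>Treats homology and cohomology at once. The group on \<open>Z\<close> has the
  multiplication of \<open>G\<close>, so the cosets can be formed in \<open>G\<close>.\<close>

locale subquot = comm_group G for G :: "('g, 'c) monoid_scheme" (structure) +
  fixes Z B assumes Z: "subgroup Z G" and B: "subgroup B G" and B_Z: "B \<subseteq> Z"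
begin

definition subquotient :: "'g set monoid" where
  "subquotient = subgroup_generated G Z Mod B"

lemma Z_carrier: "z \<in> Z \<Longrightarrow> z \<in> carrier G"
  using Z by (rule subgroup.mem_carrier)

lemma carrier_subquotient: "carrier subquotient = (\<lambda>z. B #> z) ` Z"
  unfolding subquotient_def carrier_FactGroup subgroup.carrier_subgroup_generated_subgroup[OF Z]
  by (simp add: r_coset_def)

lemma normal_B: "B \<lhd> G"
  using B by (rule subgroup_imp_normal)

lemma mult_subquotient:
  assumes "z \<in> Z" "z' \<in> Z"
  shows "(B #> z) \<otimes>\<^bsub>subquotient\<^esub> (B #> z') = B #> (z \<otimes> z')"
  using normal.rcos_sum[OF normal_B Z_carrier[OF assms(1)] Z_carrier[OF assms(2)]]
  by (simp add: subquotient_def set_mult_def)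

lemma one_subquotient: "\<one>\<^bsub>subquotient\<^esub> = B"
  by (simp add: subquotient_def)

lemma group_subquotient: "Group.group subquotient"
proof -
  have "subgroup B (subgroup_generated G Z)"
    using B B_Z by (simp add: subgroup_subgroup_generated_iff subgroup.carrier_subgroup_generated_subgroup[OF Z])
  then have "B \<lhd> subgroup_generated G Z"
    by (rule comm_group.subgroup_imp_normal[OF abelian_subgroup_generated[OF comm_group_axioms]])
  then show ?thesis unfolding subquotient_def by (rule normal.factorgroup_is_group)
qed

lemma coset_eq_iff:
  assumes z: "z \<in> Z" "z' \<in> Z"
  shows "B #> z = B #> z' \<longleftrightarrow> (\<exists>b\<in>B. z = z' \<otimes> b)"
proof
  assume "B #> z = B #> z'"
  then have "z \<in> B #> z'" using rcos_self[OF Z_carrier[OF z(1)] B] by simp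
  then obtain b where "b \<in> B" "z = b \<otimes> z'" unfolding r_coset_def by blast
  then show "\<exists>b\<in>B. z = z' \<otimes> b"
    using m_comm[OF subgroup.mem_carrier[OF B] Z_carrier[OF z(2)]] by auto
next
  assume "\<exists>b\<in>B. z = z' \<otimes> b"
  then obtain b where "b \<in> B" "z = b \<otimes> z'"
    using m_comm[OF subgroup.mem_carrier[OF B] Z_carrier[OF z(2)]] by auto
  then have "z \<in> B #> z'" unfolding r_coset_def by blast
  then show "B #> z = B #> z'"
    using repr_independence[OF _ Z_carrier[OF z(2)] B] by simp
qed

lemma coset_eq_one_iff:
  assumes z: "z \<in> Z"
  shows "B #> z = \<one>\<^bsub>subquotient\<^esub> \<longleftrightarrow> z \<in> B"
  unfolding one_subquotient using coset_join1[OF _ Z_carrier[OF z] B] coset_join2[OF Z_carrier[OF z] B] by blast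

end

locale subquot_map = src: subquot G Z B + tgt: subquot G' Z' B'
  for G :: "('g, 'c) monoid_scheme" and Z B and G' :: "('h, 'd) monoid_scheme" and Z' B' +
  fixes p
  assumes p: "p \<in> hom G G'" and p_Z: "p ` Z \<subseteq> Z'" and p_B: "p ` B \<subseteq> B'"
begin

definition induced :: "'g set \<Rightarrow> 'h set" where
  "induced = (\<lambda>A\<in>carrier src.subquotient. B' <#>\<^bsub>G'\<^esub> (p ` A))"

text \<open>The image of a coset of \<open>B\<close> may be only a part of a coset of
  \<open>B'\<close>; multiplication by \<open>B'\<close> in \<open>induced\<close> saturates
  it.\<close>

lemma induced_coset:
  assumes z: "z \<in> Z"
  shows "induced (B #>\<^bsub>G\<^esub> z) = B' #>\<^bsub>G'\<^esub> p z"
proof -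
  have zc: "z \<in> carrier G" and pz: "p z \<in> carrier G'"
    using src.Z_carrier[OF z] p by (auto simp: hom_def)
  have "B' <#>\<^bsub>G'\<^esub> (p ` (B #>\<^bsub>G\<^esub> z)) = B' #>\<^bsub>G'\<^esub> p z"
  proof
    show "B' <#>\<^bsub>G'\<^esub> (p ` (B #>\<^bsub>G\<^esub> z)) \<subseteq> B' #>\<^bsub>G'\<^esub> p z"
    proof
      fix y assume "y \<in> B' <#>\<^bsub>G'\<^esub> (p ` (B #>\<^bsub>G\<^esub> z))"
      then obtain b' b where b: "b' \<in> B'" "b \<in> B" "y = b' \<otimes>\<^bsub>G'\<^esub> p (b \<otimes>\<^bsub>G\<^esub> z)"
        unfolding set_mult_def r_coset_def by blast
      have "p b \<in> B'" using b(2) p_B by blast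
      then have "y = (b' \<otimes>\<^bsub>G'\<^esub> p b) \<otimes>\<^bsub>G'\<^esub> p z" "b' \<otimes>\<^bsub>G'\<^esub> p b \<in> B'"
        using b hom_mult[OF p subgroup.mem_carrier[OF src.B b(2)] zc] tgt.m_assoc pz
          subgroup.mem_carrier[OF tgt.B] subgroup.m_closed[OF tgt.B] by auto
      then show "y \<in> B' #>\<^bsub>G'\<^esub> p z" unfolding r_coset_def by blast
    qed
    show "B' #>\<^bsub>G'\<^esub> p z \<subseteq> B' <#>\<^bsub>G'\<^esub> (p ` (B #>\<^bsub>G\<^esub> z))"
      using src.rcos_self[OF zc src.B] unfolding set_mult_def r_coset_def by blast
  qed
  then show ?thesis using z by (simp add: induced_def src.carrier_subquotient)
qed

lemma induced_hom: "induced \<in> hom src.subquotient tgt.subquotient"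
proof (rule homI)
  fix A assume "A \<in> carrier src.subquotient"
  then show "induced A \<in> carrier tgt.subquotient"
    using p_Z by (auto simp: src.carrier_subquotient tgt.carrier_subquotient induced_coset)
next
  fix A A' assume "A \<in> carrier src.subquotient" "A' \<in> carrier src.subquotient"
  then obtain z z' where z: "z \<in> Z" "A = B #>\<^bsub>G\<^esub> z" "z' \<in> Z" "A' = B #>\<^bsub>G\<^esub> z'"
    by (auto simp: src.carrier_subquotient)
  have pz: "p z \<in> Z'" "p z' \<in> Z'" using z p_Z by auto
  show "induced (A \<otimes>\<^bsub>src.subquotient\<^esub> A') = induced A \<otimes>\<^bsub>tgt.subquotient\<^esub> induced A'"
    unfolding z(2,4) src.mult_subquotient[OF z(1,3)] induced_coset[OF z(1)] induced_coset[OF z(3)]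
      induced_coset[OF subgroup.m_closed[OF src.Z z(1,3)]] tgt.mult_subquotient[OF pz]
      hom_mult[OF p src.Z_carrier[OF z(1)] src.Z_carrier[OF z(3)]] ..
qed

end

section \<open>Homology as a functor to groups\<close>

lemma Grp_simps [simp]:
  "Ob Grp = {G. Group.group G}" "Hom Grp = (\<lambda>G H. hom G H \<inter> extensional (carrier G))"
  "category.Id Grp = (\<lambda>G. \<lambda>x\<in>carrier G. x)" "Cmp Grp = (\<lambda>G H K g f. compose (carrier G) g f)"
  by (simp_all add: Grp_def)

lemma category_Grp: "category Grp"
  unfolding category_def
proof (intro conjI ballI)
  fix G :: "'a monoid" assume "G \<in> Ob Grp"
  then show "category.Id Grp G \<in> Hom Grp G G"
    by (auto simp: hom_def Group.group_def monoid.m_closed)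
next
  fix G H K :: "'a monoid" and f g assume "G \<in> Ob Grp" "f \<in> Hom Grp G H" "g \<in> Hom Grp H K"
  then show "Cmp Grp G H K g f \<in> Hom Grp G K"
    by (auto simp: hom_def compose_def Group.group_def monoid.m_closed Pi_iff)
next
  fix G H :: "'a monoid" and f assume "f \<in> Hom Grp G H"
  then show "Cmp Grp G G H f (category.Id Grp G) = f" "Cmp Grp G H H (category.Id Grp H) f = f"
    by (auto simp: fun_eq_iff compose_def extensional_def hom_def Pi_iff)
next
  fix G H K L :: "'a monoid" and f g h assume "f \<in> Hom Grp G H"
  then show "Cmp Grp G K L h (Cmp Grp G H K g f) = Cmp Grp G H L (Cmp Grp H K L h g) f"
    by (auto simp: fun_eq_iff compose_def hom_def Pi_iff)
qed

text \<open>\<open>k\<close> is \<open>w\<close>, followed by a lift along \<open>h\<close>,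
  followed by \<open>u\<close>. Lifts exist because \<open>w\<close> lands in the image of
  \<open>h\<close>, and their choice is immaterial because \<open>u\<close> is trivial on the kernel
  of \<open>h\<close>.\<close>

lemma Grp_inverse_exists:
  assumes H2: "Group.group H2" and h: "h \<in> hom G1 H1" and u: "u \<in> hom G1 G0" and w: "w \<in> hom H2 H1"
    and groups: "Group.group G0" "Group.group G1" "Group.group H1"
    and mono: "\<And>x. x \<in> carrier G1 \<Longrightarrow> h x = \<one>\<^bsub>H1\<^esub> \<Longrightarrow> u x = \<one>\<^bsub>G0\<^esub>"
    and epi: "\<And>y. y \<in> carrier H2 \<Longrightarrow> \<exists>x\<in>carrier G1. w y = h x"
  obtains k where "k \<in> hom H2 G0 \<inter> extensional (carrier H2)"
    "\<And>x y. \<lbrakk>y \<in> carrier H2; x \<in> carrier G1; w y = h x\<rbrakk> \<Longrightarrow> k y = u x"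
proof -
  interpret G0: Group.group G0 by (rule groups)
  interpret G1: Group.group G1 by (rule groups)
  interpret H1: Group.group H1 by (rule groups)
  interpret H2: Group.group H2 by (rule H2)
  interpret h: group_hom G1 H1 h by unfold_locales (rule h)
  interpret u: group_hom G1 G0 u by unfold_locales (rule u)
  have u_eq: "u x = u x'" if "x \<in> carrier G1" "x' \<in> carrier G1" "h x = h x'" for x x'
  proof -
    have "h (x \<otimes>\<^bsub>G1\<^esub> inv\<^bsub>G1\<^esub> x') = \<one>\<^bsub>H1\<^esub>" using that by simp
    then have "u (x \<otimes>\<^bsub>G1\<^esub> inv\<^bsub>G1\<^esub> x') = \<one>\<^bsub>G0\<^esub>" using that mono by simp
    then have "u x \<otimes>\<^bsub>G0\<^esub> inv\<^bsub>G0\<^esub> u x' = \<one>\<^bsub>G0\<^esub>" using that by simp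
    then have "inv\<^bsub>G0\<^esub> (inv\<^bsub>G0\<^esub> u x') = u x" using that by (intro G0.inv_equality) auto
    then show ?thesis using that by simp
  qed
  from epi obtain \<xi> where \<xi>: "\<And>y. y \<in> carrier H2 \<Longrightarrow> \<xi> y \<in> carrier G1 \<and> w y = h (\<xi> y)" by metis
  define k where "k = (\<lambda>y\<in>carrier H2. u (\<xi> y))"
  have k: "k y = u x" if "y \<in> carrier H2" "x \<in> carrier G1" "w y = h x" for x y
    unfolding k_def using that \<xi>[of y] u_eq[of "\<xi> y" x] by simp
  have "k \<in> hom H2 G0"
  proof (rule homI)
    fix y assume y: "y \<in> carrier H2"
    then show "k y \<in> carrier G0" using \<xi> by (simp add: k_def)
    fix y' assume y': "y' \<in> carrier H2"
    have "w (y \<otimes>\<^bsub>H2\<^esub> y') = h (\<xi> y \<otimes>\<^bsub>G1\<^esub> \<xi> y')"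
      using \<xi>[OF y] \<xi>[OF y'] hom_mult[OF w y y'] by simp
    then show "k (y \<otimes>\<^bsub>H2\<^esub> y') = k y \<otimes>\<^bsub>G0\<^esub> k y'"
      using k[of "y \<otimes>\<^bsub>H2\<^esub> y'" "\<xi> y \<otimes>\<^bsub>G1\<^esub> \<xi> y'"] \<xi>[OF y] \<xi>[OF y'] y y' by (simp add: k_def)
  qed
  then show thesis using k by (intro that[of k]) (auto simp: k_def)
qed

context ring
begin

lemma chain_group_simps:
  "carrier (chain_group R n X) = carrier (chain_module R (Simp X n))"
  "c \<otimes>\<^bsub>chain_group R n X\<^esub> d = c \<oplus>\<^bsub>chain_module R (Simp X n)\<^esub> d"
  "\<one>\<^bsub>chain_group R n X\<^esub> = \<zero>\<^bsub>chain_module R (Simp X n)\<^esub>"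
  by (simp_all add: chain_group_def carrier_sum_group a_group)

lemma chain_group_comm: "comm_group (chain_group R n X)"
proof (rule group.group_comm_groupI)
  interpret C: abelian_group "chain_module R (Simp X n)" by (rule left_module_group[OF left_module_chain])
  show "Group.group (chain_group R n X)"
    unfolding chain_group_def by (rule sum_group) (rule a_group)
  show "c \<otimes>\<^bsub>chain_group R n X\<^esub> d = d \<otimes>\<^bsub>chain_group R n X\<^esub> c"
    if "c \<in> carrier (chain_group R n X)" "d \<in> carrier (chain_group R n X)" for c d
    using that C.a_comm unfolding chain_group_simps by blast
qed

lemma chain_group_homI:
  assumes "lin R (chain_module R (Simp X m)) (chain_module R (Simp Y n)) g"
  shows "g \<in> hom (chain_group R m X) (chain_group R n Y)"
  using lin_closed[OF assms] lin_add[OF assms] by (intro homI) (simp_all only: chain_group_simps)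

text \<open>Removes the special role of degree 0: there the condition holds automatically, as the
  differential takes values in the chain module on the empty set.\<close>

lemma cycles_eq:
  "cycles R n X = {c \<in> carrier (chain_module R (simplices X (Suc (Suc n)))).
     differential R X (Suc n) c = \<zero>\<^bsub>chain_module R (simplices X (Suc n))\<^esub>}"
proof -
  have "\<zero>\<^bsub>chain_module R ({} :: 'c set)\<^esub> = (\<lambda>_. undefined)" by (auto simp: fun_eq_iff)
  then show ?thesis
    unfolding cycles_def chain_group_simps by (cases n) (simp_all del: chain_module_simps)
qed

lemma boundaries_eq:
  "boundaries R n X = differential R X (Suc (Suc n)) ` carrier (chain_module R (simplices X (Suc (Suc (Suc n)))))"
  unfolding boundaries_def chain_group_simps by simp

lemma homology_subquot:
  assumes X: "simplicial_set X"
  shows "subquot (chain_group R n X) (cycles R n X) (boundaries R n X)"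
proof (rule subquot.intro[OF chain_group_comm subquot_axioms.intro])
  interpret F: chain_functor sSet R "\<lambda>X n. chain_module R (simplices X n)" "differential R" "chain_map R"
    by (rule chain_functor_sSet[OF ring_axioms])
  interpret G: comm_group "chain_group R m X" for m by (rule chain_group_comm)
  have hom: "boundary R m X \<in> hom (chain_group R (Suc m) X) (chain_group R m X)" for m
    by (rule chain_group_homI[OF boundary_lin[OF X]])
  interpret d: group_hom "chain_group R (Suc m) X" "chain_group R m X" "boundary R m X" for m
    by unfold_locales (rule hom)
  show "subgroup (cycles R n X) (chain_group R n X)"
  proof (cases n)
    case 0
    then show ?thesis using G.subgroup_self by (simp add: cycles_def)
  next
    case (Suc m)
    then show ?thesis using d.subgroup_kernel by (simp add: cycles_def kernel_def)
  qed
  show "subgroup (boundaries R n X) (chain_group R n X)"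
    unfolding boundaries_def by (rule d.img_is_subgroup)
  have XC: "X \<in> Ob sSet" using X by simp
  show "boundaries R n X \<subseteq> cycles R n X"
    unfolding boundaries_eq cycles_eq
    using F.D_D[OF XC] lin_closed[OF F.D_lin[OF XC]] by blast
qed

lemma homology_subquot_map:
  assumes X: "simplicial_set X" and Y: "simplicial_set Y" and h: "h \<in> simplicial_maps X Y"
  shows "subquot_map (chain_group R n X) (cycles R n X) (boundaries R n X)
    (chain_group R n Y) (cycles R n Y) (boundaries R n Y) (push_chain R (Simp X n) (Simp Y n) (h n))"
proof (rule subquot_map.intro[OF homology_subquot[OF X] homology_subquot[OF Y] subquot_map_axioms.intro])
  interpret F: chain_functor sSet R "\<lambda>X n. chain_module R (simplices X n)" "differential R" "chain_map R"
    by (rule chain_functor_sSet[OF ring_axioms])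
  have ob: "h \<in> Hom sSet X Y" "X \<in> Ob sSet" "Y \<in> Ob sSet" using X Y h by simp_all
  have "h n \<in> Simp X n \<rightarrow> Simp Y n" using simplicial_maps_closed[OF h] by auto
  then show "push_chain R (Simp X n) (Simp Y n) (h n) \<in> hom (chain_group R n X) (chain_group R n Y)"
    by (rule chain_group_homI[OF push_lin])
  have eq: "push_chain R (Simp X n) (Simp Y n) (h n) = chain_map R X Y h (Suc (Suc n))" by simp
  have zero: "chain_map R X Y h m \<zero>\<^bsub>chain_module R (simplices X m)\<^esub> = \<zero>\<^bsub>chain_module R (simplices Y m)\<^esub>" for m
    by (rule lin_zero[OF left_module_chain left_module_chain F.Mp_lin[OF ob]])
  show "push_chain R (Simp X n) (Simp Y n) (h n) ` cycles R n X \<subseteq> cycles R n Y"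
    unfolding cycles_eq eq
  proof (intro image_subsetI CollectI conjI; elim CollectE conjE)
    fix c assume c: "c \<in> carrier (chain_module R (simplices X (Suc (Suc n))))"
      "differential R X (Suc n) c = \<zero>\<^bsub>chain_module R (simplices X (Suc n))\<^esub>"
    show "chain_map R X Y h (Suc (Suc n)) c \<in> carrier (chain_module R (simplices Y (Suc (Suc n))))"
      by (rule lin_closed[OF F.Mp_lin[OF ob] c(1)])
    show "differential R Y (Suc n) (chain_map R X Y h (Suc (Suc n)) c) = \<zero>\<^bsub>chain_module R (simplices Y (Suc n))\<^esub>"
      unfolding F.Mp_D[OF ob c(1), symmetric] c(2) by (rule zero)
  qed
  show "push_chain R (Simp X n) (Simp Y n) (h n) ` boundaries R n X \<subseteq> boundaries R n Y"
    unfolding boundaries_eq eq using F.Mp_D[OF ob] lin_closed[OF F.Mp_lin[OF ob]] by blast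
qed

abbreviation hcls where "hcls n X z \<equiv> boundaries R n X #>\<^bsub>chain_group R n X\<^esub> z"

lemma homology_group_eq: "simplicial_set X \<Longrightarrow>
    homology_group R n X = subquot.subquotient (chain_group R n X) (cycles R n X) (boundaries R n X)"
  by (simp add: homology_group_def subquot.subquotient_def[OF homology_subquot])

lemma homology_map_eq:
  assumes "simplicial_set X" "simplicial_set Y" "h \<in> simplicial_maps X Y"
  shows "homology_map R n X Y h = subquot_map.induced (chain_group R n X) (cycles R n X) (boundaries R n X)
    (chain_group R n Y) (boundaries R n Y) (push_chain R (Simp X n) (Simp Y n) (h n))"
  by (simp add: homology_map_def homology_group_eq[OF assms(1)] subquot_map.induced_def[OF homology_subquot_map[OF assms]])

lemma homology_map_hcls:
  assumes "simplicial_set X" "simplicial_set Y" "h \<in> simplicial_maps X Y" "z \<in> cycles R n X"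
  shows "homology_map R n X Y h (hcls n X z) = hcls n Y (chain_map R X Y h (Suc (Suc n)) z)"
  unfolding homology_map_eq[OF assms(1-3)] using subquot_map.induced_coset[OF homology_subquot_map[OF assms(1-3)] assms(4)]
  by simp

lemma chain_map_cycles:
  assumes "simplicial_set X" "simplicial_set Y" "h \<in> simplicial_maps X Y" "z \<in> cycles R n X"
  shows "chain_map R X Y h (Suc (Suc n)) z \<in> cycles R n Y"
  using subquot_map.p_Z[OF homology_subquot_map[OF assms(1-3)]] assms(4) by auto

lemma carrier_homology: "simplicial_set X \<Longrightarrow> carrier (homology_group R n X) = hcls n X ` cycles R n X"
  using subquot.carrier_subquotient[OF homology_subquot] by (simp add: homology_group_eq)

text \<open>On classes of cycles the laws are those of \<open>chain_map\<close>. Off the carrier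
  both sides are undefined, as morphisms of \<open>Grp\<close> are extensional.\<close>

lemma homology_functor: "cat_functor sSet Grp (homology_group R n) (homology_map R n)"
proof (rule cat_functor.intro[OF category_sSet category_Grp])
  interpret F: chain_functor sSet R "\<lambda>X n. chain_module R (simplices X n)" "differential R" "chain_map R"
    by (rule chain_functor_sSet[OF ring_axioms])
  show "homology_group R n X \<in> Ob Grp" if "X \<in> Ob sSet" for X
    using that subquot.group_subquotient[OF homology_subquot] by (simp add: homology_group_eq)
  show Hom: "homology_map R n X Y h \<in> Hom Grp (homology_group R n X) (homology_group R n Y)"
    if "h \<in> Hom sSet X Y" "X \<in> Ob sSet" "Y \<in> Ob sSet" for X Y h
    using that subquot_map.induced_hom[OF homology_subquot_map[of X Y h]]
    by (simp add: homology_group_eq homology_map_eq) (simp add: homology_group_eq homology_map_eq[symmetric] homology_map_def)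
  show "homology_map R n X X (category.Id sSet X) = category.Id Grp (homology_group R n X)" if "X \<in> Ob sSet" for X
  proof
    fix A
    have X: "simplicial_set X" using that by simp
    note id = cat_id[OF category_sSet that, unfolded sSet_simps(2)]
    show "homology_map R n X X (category.Id sSet X) A = category.Id Grp (homology_group R n X) A"
    proof (cases "A \<in> carrier (homology_group R n X)")
      case True
      then obtain z where z: "z \<in> cycles R n X" "A = hcls n X z" using carrier_homology[OF X] by auto
      have zc: "z \<in> carrier (chain_module R (simplices X (Suc (Suc n))))" using z(1) unfolding cycles_eq by blast
      have "homology_map R n X X (category.Id sSet X) A = A"
        unfolding z(2) homology_map_hcls[OF X X id z(1)] F.Mp_Id[OF that zc] ..
      then show ?thesis using True by simp
    qed (simp add: homology_map_def)
  qed
  show "homology_map R n X W (Cmp sSet X Y W h g) =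
    Cmp Grp (homology_group R n X) (homology_group R n Y) (homology_group R n W) (homology_map R n Y W h) (homology_map R n X Y g)"
    if gh: "g \<in> Hom sSet X Y" "h \<in> Hom sSet Y W" and ob: "X \<in> Ob sSet" "Y \<in> Ob sSet" "W \<in> Ob sSet" for X Y W g h
  proof
    fix A
    have s: "simplicial_set X" "simplicial_set Y" "simplicial_set W" "g \<in> simplicial_maps X Y" "h \<in> simplicial_maps Y W"
      using ob gh by simp_all
    note c = cat_comp[OF category_sSet gh ob, unfolded sSet_simps(2)]
    show "homology_map R n X W (Cmp sSet X Y W h g) A =
      Cmp Grp (homology_group R n X) (homology_group R n Y) (homology_group R n W) (homology_map R n Y W h) (homology_map R n X Y g) A"
    proof (cases "A \<in> carrier (homology_group R n X)")
      case True
      then obtain z where z: "z \<in> cycles R n X" "A = hcls n X z" using carrier_homology[OF s(1)] by auto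
      have zc: "z \<in> carrier (chain_module R (simplices X (Suc (Suc n))))" using z(1) unfolding cycles_eq by blast
      have "homology_map R n X W (Cmp sSet X Y W h g) A = homology_map R n Y W h (homology_map R n X Y g A)"
        unfolding z(2) homology_map_hcls[OF s(1,3) c z(1)] homology_map_hcls[OF s(1,2,4) z(1)]
          homology_map_hcls[OF s(2,3,5) chain_map_cycles[OF s(1,2,4) z(1)]] F.Mp_Cmp[OF gh ob zc] ..
      then show ?thesis using True by (simp add: compose_def)
    qed (simp add: homology_map_def compose_def)
  qed
qed

end

section \<open>Cohomology\<close>

lemma cochain_group_simps:
  "carrier (cochain_group n X M) = (Simp X n \<rightarrow>\<^sub>E carrier M)"
  "\<phi> \<otimes>\<^bsub>cochain_group n X M\<^esub> \<psi> = (\<lambda>x\<in>Simp X n. \<phi> x \<oplus>\<^bsub>M\<^esub> \<psi> x)"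
  "\<one>\<^bsub>cochain_group n X M\<^esub> = (\<lambda>x\<in>Simp X n. \<zero>\<^bsub>M\<^esub>)"
  by (simp_all add: cochain_group_def)

lemma cochain_group_comm:
  assumes "abelian_group M" shows "comm_group (cochain_group n X M)"
proof (rule group.group_comm_groupI)
  interpret M: abelian_group M by (rule assms)
  show "Group.group (cochain_group n X M)"
    unfolding cochain_group_def by (rule product_group) (rule M.a_group)
  show "\<phi> \<otimes>\<^bsub>cochain_group n X M\<^esub> \<psi> = \<psi> \<otimes>\<^bsub>cochain_group n X M\<^esub> \<phi>"
    if "\<phi> \<in> carrier (cochain_group n X M)" "\<psi> \<in> carrier (cochain_group n X M)" for \<phi> \<psi>
    using that by (auto simp: cochain_group_simps PiE_iff M.a_comm)
qed

definition pull :: "nat \<Rightarrow> 'x sset \<Rightarrow> (nat \<Rightarrow> 'x \<Rightarrow> 'x) \<Rightarrow> ('x \<Rightarrow> 'e) \<Rightarrow> 'x \<Rightarrow> 'e" where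
  "pull n X h \<phi> = (\<lambda>x\<in>Simp X n. \<phi> (h n x))"

context ring
begin

lemma coboundary_hom:
  assumes X: "simplicial_set X" and M: "left_module R M"
  shows "coboundary n X M \<in> hom (cochain_group n X M) (cochain_group (Suc n) X M)"
proof (rule homI)
  interpret M: abelian_group M by (rule left_module_group[OF M])
  fix \<phi> assume \<phi>: "\<phi> \<in> carrier (cochain_group n X M)"
  then have \<phi>_fun: "\<phi> \<in> Simp X n \<rightarrow> carrier M" by (auto simp: cochain_group_simps)
  then show "coboundary n X M \<phi> \<in> carrier (cochain_group (Suc n) X M)"
    unfolding cochain_group_simps by (rule coboundary_closed[OF X M.abelian_group_axioms])
  fix \<psi> assume "\<psi> \<in> carrier (cochain_group n X M)"
  then have \<psi>_fun: "\<psi> \<in> Simp X n \<rightarrow> carrier M" by (auto simp: cochain_group_simps)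
  have id: "lin R M M (\<lambda>x. x)" by (simp add: lin_def)
  have "(\<Oplus>\<^bsub>M\<^esub>i\<in>{..Suc n}. alt_sign M i (\<phi> (face X n i x) \<oplus>\<^bsub>M\<^esub> \<psi> (face X n i x))) =
     (\<Oplus>\<^bsub>M\<^esub>i\<in>{..Suc n}. alt_sign M i (\<phi> (face X n i x))) \<oplus>\<^bsub>M\<^esub> (\<Oplus>\<^bsub>M\<^esub>i\<in>{..Suc n}. alt_sign M i (\<psi> (face X n i x)))"
    if x: "x \<in> Simp X (Suc n)" for x
  proof -
    have c: "\<phi> (face X n i x) \<in> carrier M" "\<psi> (face X n i x) \<in> carrier M" for i
      using face_closed[OF X x] \<phi>_fun \<psi>_fun by auto
    show ?thesis
      unfolding lin_add[OF lin_alt_sign_map[OF M id] c]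
      by (rule M.finsum_addf) (auto intro: alt_sign_closed[OF M.abelian_group_axioms] c)
  qed
  then show "coboundary n X M (\<phi> \<otimes>\<^bsub>cochain_group n X M\<^esub> \<psi>) =
    coboundary n X M \<phi> \<otimes>\<^bsub>cochain_group (Suc n) X M\<^esub> coboundary n X M \<psi>"
    by (auto simp: cochain_group_simps coboundary_def face_closed[OF X] intro!: restrict_ext)
qed

lemma coboundaries_subset:
  assumes X: "simplicial_set X" and M: "left_module R M"
  shows "coboundaries n X M \<subseteq> cocycles n X M"
proof -
  interpret M: abelian_group M by (rule left_module_group[OF M])
  interpret G: comm_group "cochain_group m X M" for m by (rule cochain_group_comm[OF M.abelian_group_axioms])
  interpret d: group_hom "cochain_group m X M" "cochain_group (Suc m) X M" "coboundary m X M" for m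
    by unfold_locales (rule coboundary_hom[OF X M])
  show ?thesis
  proof (cases n)
    case 0
    then show ?thesis by (simp add: coboundaries_def cocycles_def)
  next
    case (Suc m)
    have "coboundary (Suc m) X M (coboundary m X M \<phi>) = \<one>\<^bsub>cochain_group (Suc (Suc m)) X M\<^esub>"
      if \<phi>: "\<phi> \<in> carrier (cochain_group m X M)" for \<phi>
    proof -
      have "\<phi> \<in> Simp X m \<rightarrow> carrier M" using \<phi> by (auto simp: cochain_group_simps)
      note z = coboundary_coboundary[OF X M this]
      show ?thesis
        using d.hom_closed[OF d.hom_closed[OF \<phi>]] z
        by (auto simp: cochain_group_simps fun_eq_iff PiE_iff extensional_def)
    qed
    then show ?thesis
      using d.hom_closed by (auto simp: Suc coboundaries_def cocycles_def)
  qed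
qed

lemma cohomology_subquot:
  assumes X: "simplicial_set X" and M: "left_module R M"
  shows "subquot (cochain_group n X M) (cocycles n X M) (coboundaries n X M)"
proof (rule subquot.intro[OF cochain_group_comm[OF left_module_group[OF M]] subquot_axioms.intro])
  interpret M: abelian_group M by (rule left_module_group[OF M])
  interpret G: comm_group "cochain_group m X M" for m by (rule cochain_group_comm[OF M.abelian_group_axioms])
  interpret d: group_hom "cochain_group m X M" "cochain_group (Suc m) X M" "coboundary m X M" for m
    by unfold_locales (rule coboundary_hom[OF X M])
  show "subgroup (cocycles n X M) (cochain_group n X M)"
    using d.subgroup_kernel by (simp add: cocycles_def kernel_def)
  show "subgroup (coboundaries n X M) (cochain_group n X M)"
    unfolding coboundaries_def using G.triv_subgroup d.img_is_subgroup by (cases n) simp_all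
qed (rule coboundaries_subset[OF X M])

lemma coboundary_pull:
  assumes X: "simplicial_set X" and h: "h \<in> simplicial_maps X Y"
  shows "coboundary n X M (pull n X h \<phi>) = pull (Suc n) X h (coboundary n Y M \<phi>)"
  unfolding coboundary_def pull_def
  by (rule restrict_ext) (simp add: face_closed[OF X] simplicial_maps_face[OF h] simplicial_maps_closed[OF h])

lemma pull_hom:
  assumes "h \<in> simplicial_maps X Y"
  shows "pull n X h \<in> hom (cochain_group n Y M) (cochain_group n X M)"
  using simplicial_maps_closed[OF assms]
  by (auto simp: hom_def cochain_group_simps pull_def PiE_iff intro!: restrict_ext)

lemma cohomology_subquot_map:
  assumes X: "simplicial_set X" and Y: "simplicial_set Y" and M: "left_module R M" and h: "h \<in> simplicial_maps X Y"
  shows "subquot_map (cochain_group n Y M) (cocycles n Y M) (coboundaries n Y M)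
    (cochain_group n X M) (cocycles n X M) (coboundaries n X M) (pull n X h)"
proof (rule subquot_map.intro[OF cohomology_subquot[OF Y M] cohomology_subquot[OF X M] subquot_map_axioms.intro])
  show "pull n X h \<in> hom (cochain_group n Y M) (cochain_group n X M)" by (rule pull_hom[OF h])
  have one: "pull m X h \<one>\<^bsub>cochain_group m Y M\<^esub> = \<one>\<^bsub>cochain_group m X M\<^esub>" for m
    using simplicial_maps_closed[OF h] by (auto simp: pull_def cochain_group_simps)
  show "pull n X h ` cocycles n Y M \<subseteq> cocycles n X M"
    using hom_in_carrier[OF pull_hom[OF h]] one by (auto simp: cocycles_def coboundary_pull[OF X h])
  show "pull n X h ` coboundaries n Y M \<subseteq> coboundaries n X M"
    using hom_in_carrier[OF pull_hom[OF h]] one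
    by (cases n) (auto simp: coboundaries_def coboundary_pull[OF X h, symmetric] intro!: imageI)
qed

abbreviation ccls where "ccls n X M \<phi> \<equiv> coboundaries n X M #>\<^bsub>cochain_group n X M\<^esub> \<phi>"

lemma cohomology_group_eq: "simplicial_set X \<Longrightarrow> left_module R M \<Longrightarrow>
    cohomology_group n X M = subquot.subquotient (cochain_group n X M) (cocycles n X M) (coboundaries n X M)"
  by (simp add: cohomology_group_def subquot.subquotient_def[OF cohomology_subquot])

lemma cohomology_map_eq:
  assumes "simplicial_set X" "simplicial_set Y" "left_module R M" "h \<in> simplicial_maps X Y"
  shows "cohomology_map n X Y M h = subquot_map.induced (cochain_group n Y M) (cocycles n Y M) (coboundaries n Y M)
    (cochain_group n X M) (coboundaries n X M) (pull n X h)"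
  unfolding cohomology_map_def cohomology_group_eq[OF assms(2,3)]
      subquot_map.induced_def[OF cohomology_subquot_map[OF assms]]
  unfolding pull_def[abs_def] ..

lemma cohomology_map_ccls:
  assumes "simplicial_set X" "simplicial_set Y" "left_module R M" "h \<in> simplicial_maps X Y" "\<phi> \<in> cocycles n Y M"
  shows "cohomology_map n X Y M h (ccls n Y M \<phi>) = ccls n X M (pull n X h \<phi>)"
  unfolding cohomology_map_eq[OF assms(1-4)] by (rule subquot_map.induced_coset[OF cohomology_subquot_map[OF assms(1-4)] assms(5)])

lemma pull_cocycles:
  assumes "simplicial_set X" "simplicial_set Y" "left_module R M" "h \<in> simplicial_maps X Y" "\<phi> \<in> cocycles n Y M"
  shows "pull n X h \<phi> \<in> cocycles n X M"
  using subquot_map.p_Z[OF cohomology_subquot_map[OF assms(1-4)]] assms(5) by auto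

lemma carrier_cohomology: "simplicial_set X \<Longrightarrow> left_module R M \<Longrightarrow>
    carrier (cohomology_group n X M) = ccls n X M ` cocycles n X M"
  using subquot.carrier_subquotient[OF cohomology_subquot] by (simp add: cohomology_group_eq)

lemma group_cohomology: "simplicial_set X \<Longrightarrow> left_module R M \<Longrightarrow> Group.group (cohomology_group n X M)"
  using subquot.group_subquotient[OF cohomology_subquot] by (simp add: cohomology_group_eq)

lemma cohomology_map_hom:
  assumes "simplicial_set X" "simplicial_set Y" "left_module R M" "h \<in> simplicial_maps X Y"
  shows "cohomology_map n X Y M h \<in> hom (cohomology_group n Y M) (cohomology_group n X M)"
  using subquot_map.induced_hom[OF cohomology_subquot_map[OF assms]] assms
  by (simp add: cohomology_group_eq cohomology_map_eq)

lemma cohomology_map_Id: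
  assumes X: "simplicial_set X" and M: "left_module R M" and A: "A \<in> carrier (cohomology_group n X M)"
  shows "cohomology_map n X X M (category.Id sSet X) A = A"
proof -
  obtain \<phi> where \<phi>: "\<phi> \<in> cocycles n X M" "A = ccls n X M \<phi>" using A carrier_cohomology[OF X M] by auto
  have id: "category.Id sSet X \<in> simplicial_maps X X" using cat_id[OF category_sSet, of X] X by simp
  have "\<phi> \<in> Simp X n \<rightarrow>\<^sub>E carrier M" using \<phi>(1) by (simp add: cocycles_def cochain_group_simps)
  then have "pull n X (category.Id sSet X) \<phi> = \<phi>" by (auto simp: pull_def fun_eq_iff PiE_iff extensional_def)
  then show ?thesis unfolding \<phi>(2) cohomology_map_ccls[OF X X M id \<phi>(1)] by simp
qed

lemma cohomology_map_Cmp: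
  assumes ob: "simplicial_set X" "simplicial_set Y" "simplicial_set W" and M: "left_module R M"
    and g: "g \<in> simplicial_maps X Y" and h: "h \<in> simplicial_maps Y W" and A: "A \<in> carrier (cohomology_group n W M)"
  shows "cohomology_map n X W M (Cmp sSet X Y W h g) A = cohomology_map n X Y M g (cohomology_map n Y W M h A)"
proof -
  obtain \<phi> where \<phi>: "\<phi> \<in> cocycles n W M" "A = ccls n W M \<phi>" using A carrier_cohomology[OF ob(3) M] by auto
  have hg: "Cmp sSet X Y W h g \<in> simplicial_maps X W" using cat_comp[OF category_sSet, of g X Y h W] ob g h by simp
  have "pull n X (Cmp sSet X Y W h g) \<phi> = pull n X g (pull n Y h \<phi>)"
    using simplicial_maps_closed[OF g] by (auto simp: pull_def compose_def intro!: restrict_ext)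
  then show ?thesis
    unfolding \<phi>(2) cohomology_map_ccls[OF ob(1,3) M hg \<phi>(1)] cohomology_map_ccls[OF ob(2,3) M h \<phi>(1)]
      cohomology_map_ccls[OF ob(1,2) M g pull_cocycles[OF ob(2,3) M h \<phi>(1)]] by simp
qed

lemma cohomology_system:
  assumes X: "pro_space X" and M: "left_module R M"
  shows "group_system (Idx X) (\<lambda>s. cohomology_group n (Fam X s) M)
     (\<lambda>t s u. cohomology_map n (Fam X t) (Fam X s) M (Trans X t s u))"
proof (rule group_system.intro[OF direct_system.intro group_system_axioms.intro])
  have Fam: "simplicial_set (Fam X s)" if "s \<in> Ob (Idx X)" for s using pro_Fam[OF X that] by simp
  have Trans: "Trans X s t u \<in> simplicial_maps (Fam X s) (Fam X t)"
    if "u \<in> Hom (Idx X) s t" "s \<in> Ob (Idx X)" "t \<in> Ob (Idx X)" for s t u using pro_Trans[OF X that] by simp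
  show "cofiltered (Idx X)" using X by (rule pro_cof)
  show hom: "cohomology_map n (Fam X t) (Fam X s) M (Trans X t s u)
      \<in> hom (cohomology_group n (Fam X s) M) (cohomology_group n (Fam X t) M)"
    if "u \<in> Hom (Idx X) t s" "t \<in> Ob (Idx X)" "s \<in> Ob (Idx X)" for u t s
    using that by (intro cohomology_map_hom Fam Trans M)
  show "cohomology_map n (Fam X t) (Fam X s) M (Trans X t s u) a \<in> carrier (cohomology_group n (Fam X t) M)"
    if "u \<in> Hom (Idx X) t s" "a \<in> carrier (cohomology_group n (Fam X s) M)" "t \<in> Ob (Idx X)" "s \<in> Ob (Idx X)" for u t s a
    using hom[OF that(1,3,4)] that(2) by (rule hom_in_carrier)
  show "cohomology_map n (Fam X s) (Fam X s) M (Trans X s s (category.Id (Idx X) s)) a = a"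
    if "a \<in> carrier (cohomology_group n (Fam X s) M)" "s \<in> Ob (Idx X)" for a s
    unfolding pro_Trans_id[OF X that(2)] by (rule cohomology_map_Id[OF Fam[OF that(2)] M that(1)])
  show "cohomology_map n (Fam X r) (Fam X s) M (Trans X r s (Cmp (Idx X) r t s u v)) a =
      cohomology_map n (Fam X r) (Fam X t) M (Trans X r t v) (cohomology_map n (Fam X t) (Fam X s) M (Trans X t s u) a)"
    if "v \<in> Hom (Idx X) r t" "u \<in> Hom (Idx X) t s" "a \<in> carrier (cohomology_group n (Fam X s) M)"
      "r \<in> Ob (Idx X)" "t \<in> Ob (Idx X)" "s \<in> Ob (Idx X)" for v r t u s a
    unfolding pro_Trans_comp[OF X that(1,2,4,5,6)]
    using that by (intro cohomology_map_Cmp Fam Trans M)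
  show "Group.group (cohomology_group n (Fam X s) M)" if "s \<in> Ob (Idx X)" for s
    by (rule group_cohomology[OF Fam[OF that] M])
qed

section \<open>Cocycles and coboundaries as linear maps on chains\<close>

lemma lin_ext_add:
  assumes M: "left_module R M" and \<phi>: "\<phi> \<in> S \<rightarrow> carrier M" and \<psi>: "\<psi> \<in> S \<rightarrow> carrier M"
    and c: "c \<in> carrier (chain_module R S)"
  shows "lin_ext R M S (\<lambda>x\<in>S. \<phi> x \<oplus>\<^bsub>M\<^esub> \<psi> x) c = lin_ext R M S \<phi> c \<oplus>\<^bsub>M\<^esub> lin_ext R M S \<psi> c"
proof -
  interpret M: abelian_group M by (rule left_module_group[OF M])
  have \<phi>\<psi>: "(\<lambda>x\<in>S. \<phi> x \<oplus>\<^bsub>M\<^esub> \<psi> x) \<in> S \<rightarrow> carrier M" using \<phi> \<psi> by auto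
  show ?thesis
    by (rule lin_unique[OF M lin_ext_lin[OF M \<phi>\<psi>] lin_plus_map[OF M lin_ext_lin[OF M \<phi>] lin_ext_lin[OF M \<psi>]] _ c])
      (simp add: lin_ext_delta[OF M \<phi>\<psi>] lin_ext_delta[OF M \<phi>] lin_ext_delta[OF M \<psi>])
qed

lemma lin_restrict:
  assumes g: "lin R (chain_module R S) M g"
  shows "(\<lambda>x\<in>S. g (delta R S x)) \<in> S \<rightarrow>\<^sub>E carrier M"
  using lin_closed[OF g delta_carrier] by auto

lemma lin_eq_lin_ext:
  assumes M: "left_module R M" and g: "lin R (chain_module R S) M g" and c: "c \<in> carrier (chain_module R S)"
  shows "g c = lin_ext R M S (\<lambda>x\<in>S. g (delta R S x)) c"
proof -
  have r: "(\<lambda>x\<in>S. g (delta R S x)) \<in> S \<rightarrow> carrier M" using lin_restrict[OF g] by auto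
  show ?thesis
    by (rule lin_unique[OF M g lin_ext_lin[OF M r] _ c]) (simp add: lin_ext_delta[OF M r])
qed

text \<open>By adjointness a function on simplices is a cocycle iff its linear extension annihilates
  boundaries, which is how the cones see cocycles.\<close>

lemma cocycles_iff:
  assumes X: "simplicial_set X" and M: "left_module R M"
  shows "\<phi> \<in> cocycles n X M \<longleftrightarrow> \<phi> \<in> Simp X n \<rightarrow>\<^sub>E carrier M \<and>
    (\<forall>c\<in>carrier (chain_module R (Simp X (Suc n))). lin_ext R M (Simp X n) \<phi> (boundary R n X c) = \<zero>\<^bsub>M\<^esub>)"
proof (cases "\<phi> \<in> Simp X n \<rightarrow>\<^sub>E carrier M")
  case True
  then have \<phi>: "\<phi> \<in> Simp X n \<rightarrow> carrier M" by auto
  have cb: "coboundary n X M \<phi> \<in> Simp X (Suc n) \<rightarrow>\<^sub>E carrier M"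
    by (rule coboundary_closed[OF X left_module_group[OF M] \<phi>])
  then have cb': "coboundary n X M \<phi> \<in> Simp X (Suc n) \<rightarrow> carrier M" by auto
  have "coboundary n X M \<phi> = \<one>\<^bsub>cochain_group (Suc n) X M\<^esub> \<longleftrightarrow> (\<forall>x\<in>Simp X (Suc n). coboundary n X M \<phi> x = \<zero>\<^bsub>M\<^esub>)"
    using cb by (auto simp: cochain_group_simps fun_eq_iff PiE_iff extensional_def)
  also have "\<dots> \<longleftrightarrow> (\<forall>c\<in>carrier (chain_module R (Simp X (Suc n))). lin_ext R M (Simp X n) \<phi> (boundary R n X c) = \<zero>\<^bsub>M\<^esub>)"
  proof (intro iffI ballI)
    fix c assume "\<forall>x\<in>Simp X (Suc n). coboundary n X M \<phi> x = \<zero>\<^bsub>M\<^esub>" and c: "c \<in> carrier (chain_module R (Simp X (Suc n)))"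
    then show "lin_ext R M (Simp X n) \<phi> (boundary R n X c) = \<zero>\<^bsub>M\<^esub>"
      unfolding lin_ext_boundary[OF X M \<phi> c] by (intro lin_ext_zero[OF M _ c]) simp
  next
    fix x assume 0: "\<forall>c\<in>carrier (chain_module R (Simp X (Suc n))). lin_ext R M (Simp X n) \<phi> (boundary R n X c) = \<zero>\<^bsub>M\<^esub>"
      and x: "x \<in> Simp X (Suc n)"
    show "coboundary n X M \<phi> x = \<zero>\<^bsub>M\<^esub>"
      using bspec[OF 0 delta_carrier[OF x]] unfolding lin_ext_boundary[OF X M \<phi> delta_carrier[OF x]] lin_ext_delta[OF M cb' x] .
  qed
  finally show ?thesis using True by (simp add: cocycles_def cochain_group_simps(1))
qed (simp add: cocycles_def cochain_group_simps(1))

text \<open>Replaces the case distinction in \<open>coboundaries\<close>: for \<open>n = 0\<close>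
  the map \<chi> starts at the chain module on the empty set, so the condition forces \<phi> to be
  0.\<close>

lemma coboundaries_iff:
  fixes X :: "'x sset"
  assumes X: "simplicial_set X" and M: "left_module R M"
  shows "\<phi> \<in> coboundaries n X M \<longleftrightarrow> \<phi> \<in> Simp X n \<rightarrow>\<^sub>E carrier M \<and>
    (\<exists>\<chi>. lin R (chain_module R (simplices X (Suc n))) M \<chi> \<and>
      (\<forall>c\<in>carrier (chain_module R (Simp X n)). lin_ext R M (Simp X n) \<phi> c = \<chi> (differential R X (Suc n) c)))"
proof (cases n)
  case 0
  interpret M: abelian_group M by (rule left_module_group[OF M])
  \<comment> \<open>The default value of the differential in position 1 is the zero chain, hence
    \<chi> sends it to 0.\<close>
  have zero: "(\<lambda>_. undefined) = \<zero>\<^bsub>chain_module R ({} :: 'x set)\<^esub>" by (auto simp: fun_eq_iff)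
  show ?thesis
  proof
    assume "\<phi> \<in> coboundaries n X M"
    then have \<phi>: "\<phi> = (\<lambda>x\<in>Simp X n. \<zero>\<^bsub>M\<^esub>)" by (simp add: coboundaries_def 0 cochain_group_simps)
    show "\<phi> \<in> Simp X n \<rightarrow>\<^sub>E carrier M \<and>
    (\<exists>\<chi>. lin R (chain_module R (simplices X (Suc n))) M \<chi> \<and>
      (\<forall>c\<in>carrier (chain_module R (Simp X n)). lin_ext R M (Simp X n) \<phi> c = \<chi> (differential R X (Suc n) c)))"
    proof (intro conjI exI[of _ "\<lambda>_. \<zero>\<^bsub>M\<^esub>"] ballI)
      show "lin_ext R M (Simp X n) \<phi> c = \<zero>\<^bsub>M\<^esub>" if "c \<in> carrier (chain_module R (Simp X n))" for c
        by (rule lin_ext_zero[OF M _ that]) (simp add: \<phi>)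
    qed (use lin_zero_map[OF M] in \<open>auto simp: \<phi>\<close>)
  next
    assume "\<phi> \<in> Simp X n \<rightarrow>\<^sub>E carrier M \<and>
    (\<exists>\<chi>. lin R (chain_module R (simplices X (Suc n))) M \<chi> \<and>
      (\<forall>c\<in>carrier (chain_module R (Simp X n)). lin_ext R M (Simp X n) \<phi> c = \<chi> (differential R X (Suc n) c)))"
    then obtain \<chi> where \<phi>: "\<phi> \<in> Simp X 0 \<rightarrow>\<^sub>E carrier M" and \<chi>: "lin R (chain_module R ({} :: 'x set)) M \<chi>"
      "\<And>c. c \<in> carrier (chain_module R (Simp X 0)) \<Longrightarrow> lin_ext R M (Simp X 0) \<phi> c = \<chi> (\<lambda>_. undefined)"
      unfolding 0 simplices.simps differential.simps by blast
    have \<phi>': "\<phi> \<in> Simp X 0 \<rightarrow> carrier M" using \<phi> by auto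
    have "\<phi> x = \<zero>\<^bsub>M\<^esub>" if x: "x \<in> Simp X 0" for x
      using \<chi>(2)[OF delta_carrier[OF x]] unfolding lin_ext_delta[OF M \<phi>' x] zero lin_zero[OF left_module_chain M \<chi>(1)] .
    then show "\<phi> \<in> coboundaries n X M"
      using \<phi> by (auto simp: coboundaries_def 0 cochain_group_simps fun_eq_iff PiE_iff extensional_def)
  qed
next
  case (Suc m)
  show ?thesis
  proof
    assume "\<phi> \<in> coboundaries n X M"
    then obtain \<rho> where \<rho>: "\<rho> \<in> Simp X m \<rightarrow>\<^sub>E carrier M" "\<phi> = coboundary m X M \<rho>"
      by (auto simp: coboundaries_def Suc cochain_group_simps)
    then have \<rho>': "\<rho> \<in> Simp X m \<rightarrow> carrier M" by auto
    show "\<phi> \<in> Simp X n \<rightarrow>\<^sub>E carrier M \<and>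
    (\<exists>\<chi>. lin R (chain_module R (simplices X (Suc n))) M \<chi> \<and>
      (\<forall>c\<in>carrier (chain_module R (Simp X n)). lin_ext R M (Simp X n) \<phi> c = \<chi> (differential R X (Suc n) c)))"
      unfolding \<rho>(2) Suc using coboundary_closed[OF X left_module_group[OF M] \<rho>'] lin_ext_lin[OF M \<rho>'] lin_ext_boundary[OF X M \<rho>']
      unfolding simplices.simps differential.simps
      by (intro conjI exI[of _ "lin_ext R M (Simp X m) \<rho>"] ballI) (simp_all only:)
  next
    assume "\<phi> \<in> Simp X n \<rightarrow>\<^sub>E carrier M \<and>
    (\<exists>\<chi>. lin R (chain_module R (simplices X (Suc n))) M \<chi> \<and>
      (\<forall>c\<in>carrier (chain_module R (Simp X n)). lin_ext R M (Simp X n) \<phi> c = \<chi> (differential R X (Suc n) c)))"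
    then obtain \<chi> where \<phi>: "\<phi> \<in> Simp X (Suc m) \<rightarrow>\<^sub>E carrier M" and \<chi>: "lin R (chain_module R (Simp X m)) M \<chi>"
      "\<And>c. c \<in> carrier (chain_module R (Simp X (Suc m))) \<Longrightarrow> lin_ext R M (Simp X (Suc m)) \<phi> c = \<chi> (boundary R m X c)"
      unfolding Suc simplices.simps differential.simps by blast
    have \<phi>': "\<phi> \<in> Simp X (Suc m) \<rightarrow> carrier M" using \<phi> by auto
    \<comment> \<open>The values of \<chi> on the basis. By adjointness the linear extension of its
      coboundary is \<chi> after the boundary, which by hypothesis is the linear extension of
      \<phi>.\<close>
    let ?\<rho> = "\<lambda>x\<in>Simp X m. \<chi> (delta R (Simp X m) x)"
    have \<rho>: "?\<rho> \<in> Simp X m \<rightarrow>\<^sub>E carrier M" by (rule lin_restrict[OF \<chi>(1)])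
    then have \<rho>': "?\<rho> \<in> Simp X m \<rightarrow> carrier M" by auto
    have cb: "coboundary m X M ?\<rho> \<in> Simp X (Suc m) \<rightarrow>\<^sub>E carrier M"
      by (rule coboundary_closed[OF X left_module_group[OF M] \<rho>'])
    have "\<phi> x = coboundary m X M ?\<rho> x" if x: "x \<in> Simp X (Suc m)" for x
    proof -
      note d = delta_carrier[OF x]
      have "coboundary m X M ?\<rho> \<in> Simp X (Suc m) \<rightarrow> carrier M" using cb by auto
      from lin_ext_delta[OF M this x]
      show ?thesis
        using \<chi>(2)[OF d] lin_eq_lin_ext[OF M \<chi>(1) lin_closed[OF boundary_lin[OF X] d]]
        unfolding lin_ext_delta[OF M \<phi>' x] lin_ext_boundary[OF X M \<rho>' d] by simp
    qed
    then have "\<phi> = coboundary m X M ?\<rho>" using \<phi> cb by (intro PiE_ext) auto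
    then show "\<phi> \<in> coboundaries n X M"
      using \<rho> unfolding coboundaries_def Suc by (auto simp: cochain_group_simps)
  qed
qed

lemma lin_ext_pull:
  assumes P: "simplicial_set P" and M: "left_module R M" and h: "h \<in> simplicial_maps P Q"
    and \<phi>: "\<phi> \<in> Simp Q n \<rightarrow>\<^sub>E carrier M" and c: "c \<in> carrier (chain_module R (Simp P n))"
  shows "lin_ext R M (Simp P n) (pull n P h \<phi>) c = lin_ext R M (Simp Q n) \<phi> (chain_map R P Q h (Suc (Suc n)) c)"
proof -
  have "\<phi> \<in> Simp Q n \<rightarrow> carrier M" "h n \<in> Simp P n \<rightarrow> Simp Q n" using \<phi> simplicial_maps_closed[OF h] by auto
  from lin_ext_push[OF M this c] show ?thesis by (simp add: pull_def)
qed

lemma pull_PiE: "h \<in> simplicial_maps P Q \<Longrightarrow> \<phi> \<in> Simp Q n \<rightarrow>\<^sub>E carrier M \<Longrightarrow> pull n P h \<phi> \<in> Simp P n \<rightarrow>\<^sub>E carrier M"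
  using simplicial_maps_closed[of h P Q] by (auto simp: pull_def)

lemma pull_coboundaries_iff:
  assumes P: "simplicial_set P" and M: "left_module R M" and h: "h \<in> simplicial_maps P Q"
    and \<phi>: "\<phi> \<in> Simp Q n \<rightarrow>\<^sub>E carrier M"
  shows "pull n P h \<phi> \<in> coboundaries n P M \<longleftrightarrow> (\<exists>\<chi>. lin R (chain_module R (simplices P (Suc n))) M \<chi> \<and>
    (\<forall>c\<in>carrier (chain_module R (Simp P n)).
      lin_ext R M (Simp Q n) \<phi> (chain_map R P Q h (Suc (Suc n)) c) = \<chi> (differential R P (Suc n) c)))"
  using pull_PiE[OF h \<phi>] lin_ext_pull[OF P M h \<phi>]
  by (simp only: coboundaries_iff[OF P M] simp_thms cong: ball_cong)

lemma cohomologous_iff: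
  assumes P: "simplicial_set P" and M: "left_module R M"
    and \<phi>: "\<phi> \<in> Simp P n \<rightarrow>\<^sub>E carrier M" and \<psi>: "\<psi> \<in> Simp P n \<rightarrow>\<^sub>E carrier M"
  shows "(\<exists>b\<in>coboundaries n P M. \<phi> = \<psi> \<otimes>\<^bsub>cochain_group n P M\<^esub> b) \<longleftrightarrow>
    (\<exists>\<chi>. lin R (chain_module R (simplices P (Suc n))) M \<chi> \<and>
      (\<forall>c\<in>carrier (chain_module R (Simp P n)).
        lin_ext R M (Simp P n) \<phi> c = lin_ext R M (Simp P n) \<psi> c \<oplus>\<^bsub>M\<^esub> \<chi> (differential R P (Suc n) c)))"
proof -
  have \<phi>': "\<phi> \<in> Simp P n \<rightarrow> carrier M" and \<psi>': "\<psi> \<in> Simp P n \<rightarrow> carrier M" using \<phi> \<psi> by auto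
  interpret F: chain_functor sSet R "\<lambda>X n. chain_module R (simplices X n)" "differential R" "chain_map R"
    by (rule chain_functor_sSet[OF ring_axioms])
  show ?thesis
  proof
    assume "\<exists>b\<in>coboundaries n P M. \<phi> = \<psi> \<otimes>\<^bsub>cochain_group n P M\<^esub> b"
    then obtain b where b: "b \<in> coboundaries n P M" and \<phi>_eq: "\<phi> = (\<lambda>x\<in>Simp P n. \<psi> x \<oplus>\<^bsub>M\<^esub> b x)"
      by (auto simp: cochain_group_simps)
    from b obtain \<chi> where bP: "b \<in> Simp P n \<rightarrow>\<^sub>E carrier M" and \<chi>: "lin R (chain_module R (simplices P (Suc n))) M \<chi>"
      "\<And>c. c \<in> carrier (chain_module R (Simp P n)) \<Longrightarrow> lin_ext R M (Simp P n) b c = \<chi> (differential R P (Suc n) c)"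
      unfolding coboundaries_iff[OF P M] by blast
    have b': "b \<in> Simp P n \<rightarrow> carrier M" using bP by auto
    have "lin_ext R M (Simp P n) \<phi> c = lin_ext R M (Simp P n) \<psi> c \<oplus>\<^bsub>M\<^esub> \<chi> (differential R P (Suc n) c)"
      if "c \<in> carrier (chain_module R (Simp P n))" for c
      unfolding \<phi>_eq \<chi>(2)[OF that, symmetric] by (rule lin_ext_add[OF M \<psi>' b' that])
    then show "\<exists>\<chi>. lin R (chain_module R (simplices P (Suc n))) M \<chi> \<and>
      (\<forall>c\<in>carrier (chain_module R (Simp P n)).
        lin_ext R M (Simp P n) \<phi> c = lin_ext R M (Simp P n) \<psi> c \<oplus>\<^bsub>M\<^esub> \<chi> (differential R P (Suc n) c))"
      using \<chi>(1) by blast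
  next
    assume "\<exists>\<chi>. lin R (chain_module R (simplices P (Suc n))) M \<chi> \<and>
      (\<forall>c\<in>carrier (chain_module R (Simp P n)).
        lin_ext R M (Simp P n) \<phi> c = lin_ext R M (Simp P n) \<psi> c \<oplus>\<^bsub>M\<^esub> \<chi> (differential R P (Suc n) c))"
    then obtain \<chi> where \<chi>: "lin R (chain_module R (simplices P (Suc n))) M \<chi>"
      and eq: "\<And>c. c \<in> carrier (chain_module R (Simp P n)) \<Longrightarrow>
        lin_ext R M (Simp P n) \<phi> c = lin_ext R M (Simp P n) \<psi> c \<oplus>\<^bsub>M\<^esub> \<chi> (differential R P (Suc n) c)" by blast
    have PC: "P \<in> Ob sSet" using P by simp
    have \<chi>D: "lin R (chain_module R (Simp P n)) M (\<lambda>c. \<chi> (differential R P (Suc n) c))"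
      using lin_comp[OF F.D_lin[OF PC] \<chi>] by simp
    let ?b = "\<lambda>x\<in>Simp P n. \<chi> (differential R P (Suc n) (delta R (Simp P n) x))"
    have "?b \<in> coboundaries n P M"
      unfolding coboundaries_iff[OF P M]
      using lin_restrict[OF \<chi>D] \<chi> lin_eq_lin_ext[OF M \<chi>D, symmetric] by blast
    moreover have "\<phi> x = \<psi> x \<oplus>\<^bsub>M\<^esub> ?b x" if x: "x \<in> Simp P n" for x
      using eq[OF delta_carrier[OF x]] x unfolding lin_ext_delta[OF M \<phi>' x] lin_ext_delta[OF M \<psi>' x] by simp
    then have "\<phi> = \<psi> \<otimes>\<^bsub>cochain_group n P M\<^esub> ?b"
      using \<phi> by (auto simp: cochain_group_simps fun_eq_iff PiE_iff extensional_def)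
    ultimately show "\<exists>b\<in>coboundaries n P M. \<phi> = \<psi> \<otimes>\<^bsub>cochain_group n P M\<^esub> b" by blast
  qed
qed

lemma cocycle_of_lin:
  assumes P: "simplicial_set P" and M: "left_module R M" and \<psi>: "lin R (chain_module R (Simp P n)) M \<psi>"
    and \<psi>D: "\<And>c. c \<in> carrier (chain_module R (Simp P (Suc n))) \<Longrightarrow> \<psi> (boundary R n P c) = \<zero>\<^bsub>M\<^esub>"
  obtains \<phi> where "\<phi> \<in> cocycles n P M"
    "\<And>c. c \<in> carrier (chain_module R (Simp P n)) \<Longrightarrow> lin_ext R M (Simp P n) \<phi> c = \<psi> c"
proof (rule that)
  note e = lin_eq_lin_ext[OF M \<psi>, symmetric]
  show "(\<lambda>x\<in>Simp P n. \<psi> (delta R (Simp P n) x)) \<in> cocycles n P M"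
    unfolding cocycles_iff[OF P M] using lin_restrict[OF \<psi>] e[OF lin_closed[OF boundary_lin[OF P]]] \<psi>D by simp
qed (rule lin_eq_lin_ext[OF M \<psi>, symmetric])

lemma lin_of_cocycle:
  assumes P: "simplicial_set P" and M: "left_module R M" and \<phi>: "\<phi> \<in> cocycles n P M"
  shows "lin R (chain_module R (Simp P n)) M (lin_ext R M (Simp P n) \<phi>)"
    and "c \<in> carrier (chain_module R (Simp P (Suc n))) \<Longrightarrow> lin_ext R M (Simp P n) \<phi> (boundary R n P c) = \<zero>\<^bsub>M\<^esub>"
    and "\<phi> \<in> Simp P n \<rightarrow>\<^sub>E carrier M"
  using \<phi> lin_ext_lin[OF M, of \<phi> "Simp P n"] unfolding cocycles_iff[OF P M] by auto

end

section \<open>Pro-spaces\<close>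

locale pro_space_map = R: ring R + pro_map sSet X Y f
  for R :: "('r, 'b) ring_scheme" and X :: "('i, 'j, 'x) pro_space" and Y :: "('k, 'l, 'x) pro_space" and f

sublocale pro_space_map \<subseteq> pro_chain sSet X Y f R "\<lambda>X n. chain_module R (simplices X n)" "differential R" "chain_map R"
  by (rule pro_chain.intro[OF pro_map_axioms chain_functor_sSet[OF R.ring_axioms]])

context pro_space_map
begin

lemma XX_sset: "t \<in> Ob I \<Longrightarrow> simplicial_set (XX t)" and YY_sset: "s \<in> Ob J \<Longrightarrow> simplicial_set (YY s)"
  using XX YY by simp_all

lemma TX_smap: "\<lbrakk>u \<in> Hom I t' t; t' \<in> Ob I; t \<in> Ob I\<rbrakk> \<Longrightarrow> TX t' t u \<in> simplicial_maps (XX t') (XX t)"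
  and TY_smap: "\<lbrakk>w \<in> Hom J s' s; s' \<in> Ob J; s \<in> Ob J\<rbrakk> \<Longrightarrow> TY s' s w \<in> simplicial_maps (YY s') (YY s)"
  using TX TY by simp_all

lemma f_smap: "\<lbrakk>(t, h) \<in> f s; s \<in> Ob J\<rbrakk> \<Longrightarrow> h \<in> simplicial_maps (XX t) (YY s)"
  using fD2 by simp

lemma homology_map_Cmp:
  assumes "g \<in> simplicial_maps P Q" "h \<in> simplicial_maps Q W" "simplicial_set P" "simplicial_set Q" "simplicial_set W"
    and "A \<in> carrier (homology_group R n P)"
  shows "homology_map R n P W (Cmp sSet P Q W h g) A = homology_map R n Q W h (homology_map R n P Q g A)"
  using cat_functor.F_Cmp[OF R.homology_functor, of g P Q h W n] assms by (simp add: compose_def)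

lemma homology_map_hom:
  assumes "h \<in> simplicial_maps P Q" "simplicial_set P" "simplicial_set Q"
  shows "homology_map R n P Q h \<in> hom (homology_group R n P) (homology_group R n Q)"
  using cat_functor.F_Hom[OF R.homology_functor, of h P Q n] assms by simp

lemma homology_group_group: "simplicial_set P \<Longrightarrow> Group.group (homology_group R n P)"
  using cat_functor.F_Ob[OF R.homology_functor, of P n] by simp

lemma hcls_one_iff: "simplicial_set P \<Longrightarrow> z \<in> cycles R n P \<Longrightarrow>
    R.hcls n P z = \<one>\<^bsub>homology_group R n P\<^esub> \<longleftrightarrow> z \<in> boundaries R n P"
  using subquot.coset_eq_one_iff[OF R.homology_subquot] by (simp add: R.homology_group_eq)

lemma hcls_eq_iff: "simplicial_set P \<Longrightarrow> z \<in> cycles R n P \<Longrightarrow> z' \<in> cycles R n P \<Longrightarrow>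
    R.hcls n P z = R.hcls n P z' \<longleftrightarrow>
    (\<exists>b\<in>boundaries R n P. z = z' \<oplus>\<^bsub>chain_module R (simplices P (Suc (Suc n)))\<^esub> b)"
  using subquot.coset_eq_iff[OF R.homology_subquot] by (simp only: R.chain_group_simps simplices.simps)

section \<open>Isomorphisms on the homology of pro-spaces\<close>

lemma mono_arrow_homology:
  "mono_arrow (Suc n) (s', t', h') (s, t, h) (w, u) \<longleftrightarrow>
    (\<forall>x\<in>cycles R n (XX t'). chain_map R (XX t') (YY s') h' (Suc (Suc n)) x \<in> boundaries R n (YY s') \<longrightarrow>
       chain_map R (XX t') (XX t) (TX t' t u) (Suc (Suc n)) x \<in> boundaries R n (XX t))"
  unfolding mono_arrow_def prod.case R.cycles_eq R.boundaries_eq by blast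

lemma epi_arrow_homology:
  "epi_arrow (Suc n) (s', t', h') (s, t, h) (w, u) \<longleftrightarrow>
    (\<forall>y\<in>cycles R n (YY s'). \<exists>x\<in>cycles R n (XX t). \<exists>b\<in>boundaries R n (YY s).
       chain_map R (YY s') (YY s) (TY s' s w) (Suc (Suc n)) y =
       chain_map R (XX t) (YY s) h (Suc (Suc n)) x \<oplus>\<^bsub>chain_module R (simplices (YY s) (Suc (Suc n)))\<^esub> b)"
  unfolding epi_arrow_def prod.case R.cycles_eq R.boundaries_eq by blast

text \<open>The index \<open>Suc n\<close> refers to position \<open>n + 2\<close>, that is to
  simplicial degree \<open>n\<close>. If \<open>k\<close> is a local inverse, one square satisfies
  both conditions: \<open>k\<close> undoes \<open>g\<close> up to a transition map of
  \<open>X\<close>, so this map kills the kernel of \<open>g\<close>; and \<open>h\<close> undoes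
  \<open>k\<close>, so a transition map of \<open>Y\<close> has its image in that of
  \<open>h\<close>. Conversely a mono-arrow and an epi-arrow further out determine a local
  inverse.\<close>

theorem homology_pro_iso_iff:
  "pro_iso Grp (pro_homology R n X) (pro_homology R n Y) (pro_homology_map R n X Y f) \<longleftrightarrow>
     homology_pro_mono (Suc n) \<and> homology_pro_epi (Suc n)"
proof -
  interpret H: functor_pro_map sSet Grp "homology_group R n" "homology_map R n" X Y f
    by (rule functor_pro_map.intro[OF R.homology_functor pro_map_axioms])
  let ?H = "homology_group R n" and ?h = "homology_map R n"
  have "(\<forall>s\<in>Ob J. \<forall>(t, h)\<in>f s. H.F_invertible_at s t h) \<longleftrightarrow> homology_pro_mono (Suc n) \<and> homology_pro_epi (Suc n)"
  proof
    assume inv: "\<forall>s\<in>Ob J. \<forall>(t, h)\<in>f s. H.F_invertible_at s t h"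
    have "\<exists>b\<in>reps. \<exists>p\<in>arrows b a. mono_arrow (Suc n) b a p \<and> epi_arrow (Suc n) b a p" if a: "a \<in> reps" for a
    proof -
      obtain s t h where a_eq: "a = (s, t, h)" by (metis surj_pair)
      note r = repsD[OF a[unfolded a_eq]]
      have "H.F_invertible_at s t h" using inv r(1,3) by blast
      then obtain s' w t' h' u k where k: "s' \<in> Ob J" "w \<in> Hom J s' s" "t' \<in> Ob I" "u \<in> Hom I t' t" "(t', h') \<in> f s'"
        "k \<in> hom (?H (YY s')) (?H (XX t))"
        and kh: "compose (carrier (?H (XX t'))) k (?h (XX t') (YY s') h') = ?h (XX t') (XX t) (TX t' t u)"
        and hk: "compose (carrier (?H (YY s'))) (?h (XX t) (YY s) h) k = ?h (YY s') (YY s) (TY s' s w)"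
        unfolding H.F_invertible_at_def by auto
      \<comment> \<open>The equation for \<open>k\<close> involves the transition map along
        \<open>u\<close>. The square must therefore pass through this arrow, which
        \<open>f_square\<close> alone would not ensure.\<close>
      obtain q v where q: "q \<in> Ob I" "v \<in> Hom I q t'" and sq: "Cmp sSet (XX q) (XX t) (YY s) h (TX q t (Cmp I q t' t u v)) =
         Cmp sSet (XX q) (YY s') (YY s) (TY s' s w) (Cmp sSet (XX q) (XX t') (YY s') h' (TX q t' v))"
        using f_square_along[OF r(1) k(1) r(3) k(2,5,4)] .
      define g where "g = Cmp sSet (XX q) (XX t') (YY s') h' (TX q t' v)"
      have g: "(q, g) \<in> f s'" unfolding g_def by (rule f_pre[OF k(5,1) q(2,1)])
      have b: "(s', q, g) \<in> reps" using g k(1) by (simp add: reps_def)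
      have uv: "Cmp I q t' t u v \<in> Hom I q t" by (rule cat_comp[OF I_cat q(2) k(4) q(1) k(3) r(2)])
      have p: "(w, Cmp I q t' t u v) \<in> arrows (s', q, g) (s, t, h)"
        using sq uv k(2) by (simp only: arrows_def g_def prod.case mem_Collect_eq simp_thms)
      note ss = XX_sset[OF q(1)] XX_sset[OF k(3)] XX_sset[OF r(2)] YY_sset[OF k(1)] YY_sset[OF r(1)]
      note maps = TX_smap[OF q(2,1) k(3)] TX_smap[OF k(4,3) r(2)] TX_smap[OF uv q(1) r(2)] TY_smap[OF k(2,1) r(1)]
        f_smap[OF k(5,1)] f_smap[OF g k(1)] f_smap[OF r(3,1)]
      have kg: "k (?h (XX q) (YY s') g A) = ?h (XX q) (XX t) (TX q t (Cmp I q t' t u v)) A" if A: "A \<in> carrier (?H (XX q))" for A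
      proof -
        have A': "?h (XX q) (XX t') (TX q t' v) A \<in> carrier (?H (XX t'))"
          by (rule hom_in_carrier[OF homology_map_hom[OF maps(1) ss(1,2)] A])
        have "k (?h (XX q) (YY s') g A) = compose (carrier (?H (XX t'))) k (?h (XX t') (YY s') h') (?h (XX q) (XX t') (TX q t' v) A)"
          using A' homology_map_Cmp[OF maps(1,5) ss(1,2,4) A] unfolding g_def by (simp add: compose_def del: sSet_simps)
        also have "\<dots> = ?h (XX q) (XX t) (TX q t (Cmp I q t' t u v)) A"
          unfolding kh TX_comp[OF q(2) k(4) q(1) k(3) r(2)] by (rule homology_map_Cmp[OF maps(1,2) ss(1-3) A, symmetric])
        finally show ?thesis .
      qed
      have "mono_arrow (Suc n) (s', q, g) (s, t, h) (w, Cmp I q t' t u v)"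
        unfolding mono_arrow_homology
      proof (intro ballI impI)
        fix x assume x: "x \<in> cycles R n (XX q)"
          and xb: "chain_map R (XX q) (YY s') g (Suc (Suc n)) x \<in> boundaries R n (YY s')"
        have "R.hcls n (XX t) (chain_map R (XX q) (XX t) (TX q t (Cmp I q t' t u v)) (Suc (Suc n)) x) =
            k (R.hcls n (YY s') (chain_map R (XX q) (YY s') g (Suc (Suc n)) x))"
          using kg[of "R.hcls n (XX q) x"] x
          unfolding R.homology_map_hcls[OF ss(1,4) maps(6) x] R.homology_map_hcls[OF ss(1,3) maps(3) x]
          by (simp add: R.carrier_homology[OF ss(1)])
        also have "\<dots> = \<one>\<^bsub>?H (XX t)\<^esub>"
          using hcls_one_iff[OF ss(4) R.chain_map_cycles[OF ss(1,4) maps(6) x]] xb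
            hom_one[OF k(6) homology_group_group[OF ss(4)] homology_group_group[OF ss(3)]] by simp
        finally show "chain_map R (XX q) (XX t) (TX q t (Cmp I q t' t u v)) (Suc (Suc n)) x \<in> boundaries R n (XX t)"
          using hcls_one_iff[OF ss(3) R.chain_map_cycles[OF ss(1,3) maps(3) x]] by simp
      qed
      moreover have "epi_arrow (Suc n) (s', q, g) (s, t, h) (w, Cmp I q t' t u v)"
        unfolding epi_arrow_homology
      proof
        fix y assume y: "y \<in> cycles R n (YY s')"
        have yc: "R.hcls n (YY s') y \<in> carrier (?H (YY s'))" using y by (simp add: R.carrier_homology[OF ss(4)])
        obtain x where x: "x \<in> cycles R n (XX t)" "k (R.hcls n (YY s') y) = R.hcls n (XX t) x"
          using hom_in_carrier[OF k(6) yc] unfolding R.carrier_homology[OF ss(3)] by blast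
        have "?h (XX t) (YY s) h (k (R.hcls n (YY s') y)) = ?h (YY s') (YY s) (TY s' s w) (R.hcls n (YY s') y)"
          using fun_cong[OF hk, of "R.hcls n (YY s') y"] yc by (simp add: compose_def)
        then have "R.hcls n (YY s) (chain_map R (YY s') (YY s) (TY s' s w) (Suc (Suc n)) y) =
            R.hcls n (YY s) (chain_map R (XX t) (YY s) h (Suc (Suc n)) x)"
          unfolding x(2) R.homology_map_hcls[OF ss(3,5) maps(7) x(1)] R.homology_map_hcls[OF ss(4,5) maps(4) y] by simp
        then show "\<exists>x\<in>cycles R n (XX t). \<exists>b\<in>boundaries R n (YY s).
          chain_map R (YY s') (YY s) (TY s' s w) (Suc (Suc n)) y =
          chain_map R (XX t) (YY s) h (Suc (Suc n)) x \<oplus>\<^bsub>chain_module R (simplices (YY s) (Suc (Suc n)))\<^esub> b"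
          unfolding hcls_eq_iff[OF ss(5) R.chain_map_cycles[OF ss(4,5) maps(4) y] R.chain_map_cycles[OF ss(3,5) maps(7) x(1)]]
          using x(1) by blast
      qed
      ultimately show ?thesis using b p unfolding a_eq by blast
    qed
    then show "homology_pro_mono (Suc n) \<and> homology_pro_epi (Suc n)"
      unfolding homology_pro_mono_def homology_pro_epi_def by blast
  next
    assume me: "homology_pro_mono (Suc n) \<and> homology_pro_epi (Suc n)"
    have "H.F_invertible_at s t h" if a: "(s, t, h) \<in> reps" for s t h
    proof -
      obtain a1 p1 where a1': "a1 \<in> reps" "p1 \<in> arrows a1 (s, t, h)" "mono_arrow (Suc n) a1 (s, t, h) p1"
        using me a unfolding homology_pro_mono_def by blast
      obtain s1 t1 h1 w1 u1 where eq1: "a1 = (s1, t1, h1)" "p1 = (w1, u1)" by (metis surj_pair)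
      note a1 = a1'[unfolded eq1]
      obtain a2 p2 where a2': "a2 \<in> reps" "p2 \<in> arrows a2 (s1, t1, h1)" "epi_arrow (Suc n) a2 (s1, t1, h1) p2"
        using me a1(1) unfolding homology_pro_epi_def by blast
      obtain s2 t2 h2 w2 u2 where eq2: "a2 = (s2, t2, h2)" "p2 = (w2, u2)" by (metis surj_pair)
      note a2 = a2'[unfolded eq2]
      note r = repsD[OF a] and r1 = repsD[OF a1(1)] and r2 = repsD[OF a2(1)]
      note p1 = arrowsD[OF a1(2)] and p2 = arrowsD[OF a2(2)]
      note ss = XX_sset[OF r(2)] XX_sset[OF r1(2)] XX_sset[OF r2(2)] YY_sset[OF r(1)] YY_sset[OF r1(1)] YY_sset[OF r2(1)]
      note fm = f_smap[OF r(3,1)] f_smap[OF r1(3,1)] f_smap[OF r2(3,1)]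
      note um = TX_smap[OF p1(2) r1(2) r(2)] TX_smap[OF p2(2) r2(2) r1(2)]
      note wm = TY_smap[OF p1(1) r1(1) r(1)] TY_smap[OF p2(1) r2(1) r1(1)]
      have sq1: "?h (XX t) (YY s) h (?h (XX t1) (XX t) (TX t1 t u1) A) = ?h (YY s1) (YY s) (TY s1 s w1) (?h (XX t1) (YY s1) h1 A)"
        if "A \<in> carrier (?H (XX t1))" for A
        using homology_map_Cmp[OF um(1) fm(1) ss(2,1,4) that] homology_map_Cmp[OF fm(2) wm(1) ss(2,5,4) that] p1(3)
        by (simp del: sSet_simps)
      have sq2: "?h (XX t1) (YY s1) h1 (?h (XX t2) (XX t1) (TX t2 t1 u2) A) = ?h (YY s2) (YY s1) (TY s2 s1 w2) (?h (XX t2) (YY s2) h2 A)"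
        if "A \<in> carrier (?H (XX t2))" for A
        using homology_map_Cmp[OF um(2) fm(2) ss(3,2,5) that] homology_map_Cmp[OF fm(3) wm(2) ss(3,6,5) that] p2(3)
        by (simp del: sSet_simps)
      have mono: "?h (XX t1) (XX t) (TX t1 t u1) A = \<one>\<^bsub>?H (XX t)\<^esub>"
        if A: "A \<in> carrier (?H (XX t1))" "?h (XX t1) (YY s1) h1 A = \<one>\<^bsub>?H (YY s1)\<^esub>" for A
      proof -
        obtain x where x: "x \<in> cycles R n (XX t1)" "A = R.hcls n (XX t1) x"
          using A(1) unfolding R.carrier_homology[OF ss(2)] by blast
        have "chain_map R (XX t1) (YY s1) h1 (Suc (Suc n)) x \<in> boundaries R n (YY s1)"
          using A(2) unfolding x(2) R.homology_map_hcls[OF ss(2,5) fm(2) x(1)]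
            hcls_one_iff[OF ss(5) R.chain_map_cycles[OF ss(2,5) fm(2) x(1)]] .
        then have "chain_map R (XX t1) (XX t) (TX t1 t u1) (Suc (Suc n)) x \<in> boundaries R n (XX t)"
          using a1(3) x(1) unfolding mono_arrow_homology by blast
        then show ?thesis
          unfolding x(2) R.homology_map_hcls[OF ss(2,1) um(1) x(1)]
            hcls_one_iff[OF ss(1) R.chain_map_cycles[OF ss(2,1) um(1) x(1)]] .
      qed
      have epi: "\<exists>A\<in>carrier (?H (XX t1)). ?h (YY s2) (YY s1) (TY s2 s1 w2) B = ?h (XX t1) (YY s1) h1 A"
        if B: "B \<in> carrier (?H (YY s2))" for B
      proof -
        obtain y where y: "y \<in> cycles R n (YY s2)" "B = R.hcls n (YY s2) y"
          using B unfolding R.carrier_homology[OF ss(6)] by blast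
        obtain x where x: "x \<in> cycles R n (XX t1)"
          and xb: "\<exists>b\<in>boundaries R n (YY s1). chain_map R (YY s2) (YY s1) (TY s2 s1 w2) (Suc (Suc n)) y =
            chain_map R (XX t1) (YY s1) h1 (Suc (Suc n)) x \<oplus>\<^bsub>chain_module R (simplices (YY s1) (Suc (Suc n)))\<^esub> b"
          using a2(3) y(1) unfolding epi_arrow_homology by blast
        have "?h (YY s2) (YY s1) (TY s2 s1 w2) B = ?h (XX t1) (YY s1) h1 (R.hcls n (XX t1) x)"
          using xb unfolding y(2) R.homology_map_hcls[OF ss(6,5) wm(2) y(1)] R.homology_map_hcls[OF ss(2,5) fm(2) x]
            hcls_eq_iff[OF ss(5) R.chain_map_cycles[OF ss(6,5) wm(2) y(1)] R.chain_map_cycles[OF ss(2,5) fm(2) x]] .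
        then show ?thesis using x unfolding R.carrier_homology[OF ss(2)] by blast
      qed
      \<comment> \<open>On homology \<open>k\<close> is \<open>w2\<close>, a lift along
        \<open>h1\<close>, then \<open>u1\<close>. The epi-arrow from \<open>a2\<close> provides the
        lifts, and the mono-arrow from \<open>a1\<close> makes the result independent of
        them.\<close>
      obtain k where k: "k \<in> hom (?H (YY s2)) (?H (XX t)) \<inter> extensional (carrier (?H (YY s2)))"
        and k_eq: "\<And>A B. \<lbrakk>B \<in> carrier (?H (YY s2)); A \<in> carrier (?H (XX t1));
          ?h (YY s2) (YY s1) (TY s2 s1 w2) B = ?h (XX t1) (YY s1) h1 A\<rbrakk> \<Longrightarrow> k B = ?h (XX t1) (XX t) (TX t1 t u1) A"
        by (rule Grp_inverse_exists[OF homology_group_group[OF ss(6)] homology_map_hom[OF fm(2) ss(2,5)]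
            homology_map_hom[OF um(1) ss(2,1)] homology_map_hom[OF wm(2) ss(6,5)]
            homology_group_group[OF ss(1)] homology_group_group[OF ss(2)] homology_group_group[OF ss(5)] mono epi])
          (assumption, assumption, assumption, rule that, assumption, blast)
      have "compose (carrier (?H (XX t2))) k (?h (XX t2) (YY s2) h2) = ?h (XX t2) (XX t) (TX t2 t (Cmp I t2 t1 t u1 u2))"
      proof
        fix A
        show "compose (carrier (?H (XX t2))) k (?h (XX t2) (YY s2) h2) A = ?h (XX t2) (XX t) (TX t2 t (Cmp I t2 t1 t u1 u2)) A"
        proof (cases "A \<in> carrier (?H (XX t2))")
          case True
          have "k (?h (XX t2) (YY s2) h2 A) = ?h (XX t1) (XX t) (TX t1 t u1) (?h (XX t2) (XX t1) (TX t2 t1 u2) A)"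
            by (rule k_eq[OF hom_in_carrier[OF homology_map_hom[OF fm(3) ss(3,6)] True]
                  hom_in_carrier[OF homology_map_hom[OF um(2) ss(3,2)] True] sq2[OF True, symmetric]])
          also have "\<dots> = ?h (XX t2) (XX t) (TX t2 t (Cmp I t2 t1 t u1 u2)) A"
            unfolding TX_comp[OF p2(2) p1(2) r2(2) r1(2) r(2)]
            by (rule homology_map_Cmp[OF um(2,1) ss(3,2,1) True, symmetric])
          finally show ?thesis using True by (simp add: compose_def)
        qed (simp add: compose_def homology_map_def)
      qed
      moreover have "compose (carrier (?H (YY s2))) (?h (XX t) (YY s) h) k = ?h (YY s2) (YY s) (TY s2 s (Cmp J s2 s1 s w1 w2))"
      proof
        fix B
        show "compose (carrier (?H (YY s2))) (?h (XX t) (YY s) h) k B = ?h (YY s2) (YY s) (TY s2 s (Cmp J s2 s1 s w1 w2)) B"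
        proof (cases "B \<in> carrier (?H (YY s2))")
          case True
          obtain A where A: "A \<in> carrier (?H (XX t1))" "?h (YY s2) (YY s1) (TY s2 s1 w2) B = ?h (XX t1) (YY s1) h1 A"
            using epi[OF True] by blast
          have "?h (XX t) (YY s) h (k B) = ?h (YY s1) (YY s) (TY s1 s w1) (?h (YY s2) (YY s1) (TY s2 s1 w2) B)"
            unfolding k_eq[OF True A] sq1[OF A(1)] A(2) ..
          also have "\<dots> = ?h (YY s2) (YY s) (TY s2 s (Cmp J s2 s1 s w1 w2)) B"
            unfolding TY_comp[OF p2(1) p1(1) r2(1) r1(1) r(1)]
            by (rule homology_map_Cmp[OF wm(2,1) ss(6,5,4) True, symmetric])
          finally show ?thesis using True by (simp add: compose_def)
        qed (simp add: compose_def homology_map_def)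
      qed
      ultimately show ?thesis
        unfolding H.F_invertible_at_def Grp_simps
        using r2(1-3) k cat_comp[OF I_cat p2(2) p1(2) r2(2) r1(2) r(2)] cat_comp[OF J_cat p2(1) p1(1) r2(1) r1(1) r(1)] by blast
    qed
    then show "\<forall>s\<in>Ob J. \<forall>(t, h)\<in>f s. H.F_invertible_at s t h"
      unfolding reps_def by blast
  qed
  then show ?thesis
    unfolding pro_homology_def pro_homology_map_def using H.pro_iso_levelwise_iff by simp
qed

section \<open>Isomorphisms on the cohomology of pro-spaces\<close>

lemma cohomology_system_map:
  assumes M: "left_module R M"
  shows "system_map J (\<lambda>s. cohomology_group n (YY s) M) (\<lambda>t s u. cohomology_map n (YY t) (YY s) M (TY t s u))
    I (\<lambda>s. cohomology_group n (XX s) M) (\<lambda>t s u. cohomology_map n (XX t) (XX s) M (TX t s u))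
    (\<lambda>s. {(t, cohomology_map n (XX t) (YY s) M h) | t h. (t, h) \<in> f s})"
proof (rule system_map.intro[OF R.cohomology_system[OF Y M] R.cohomology_system[OF X M] system_map_axioms.intro])
  interpret cod: group_system I "\<lambda>s. cohomology_group n (XX s) M" "\<lambda>t s u. cohomology_map n (XX t) (XX s) M (TX t s u)"
    by (rule R.cohomology_system[OF X M])
  let ?m = "\<lambda>s. {(t, cohomology_map n (XX t) (YY s) M h) | t h. (t, h) \<in> f s}"
  show "?m s \<noteq> {}" if s: "s \<in> Ob J" for s
  proof -
    obtain t h where "(t, h) \<in> f s" using f_nonempty[OF s] .
    then show ?thesis by blast
  qed
  have hom: "cohomology_map n (XX t) (YY s) M h \<in> hom (cohomology_group n (YY s) M) (cohomology_group n (XX t) M)"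
    if "(t, h) \<in> f s" "s \<in> Ob J" for t h s
    by (rule R.cohomology_map_hom[OF XX_sset[OF fD1[OF that]] YY_sset[OF that(2)] M f_smap[OF that]])
  show "t \<in> Ob I \<and> \<mu> \<in> hom (cohomology_group n (YY s) M) (cohomology_group n (XX t) M)"
    if \<mu>: "(t, \<mu>) \<in> ?m s" and s: "s \<in> Ob J" for t \<mu> s
  proof -
    obtain h where "(t, h) \<in> f s" "\<mu> = cohomology_map n (XX t) (YY s) M h" using \<mu> by blast
    then show ?thesis using hom fD1 s by blast
  qed
  have pre: "cohomology_map n (XX t') (YY s) M (Cmp sSet (XX t') (XX t) (YY s) h (TX t' t u)) a =
      cohomology_map n (XX t') (XX t) M (TX t' t u) (cohomology_map n (XX t) (YY s) M h a)"
    if h: "(t, h) \<in> f s" and s: "s \<in> Ob J" and t': "t' \<in> Ob I" and u: "u \<in> Hom I t' t"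
      and a: "a \<in> carrier (cohomology_group n (YY s) M)" for t h s t' u a
    by (rule R.cohomology_map_Cmp[OF XX_sset[OF t'] XX_sset[OF fD1[OF h s]] YY_sset[OF s] M
          TX_smap[OF u t' fD1[OF h s]] f_smap[OF h s] a])
  show "((t, \<mu> a), (t', \<mu>' a)) \<in> cod.rel"
    if \<mu>: "(t, \<mu>) \<in> ?m s" "(t', \<mu>') \<in> ?m s" and s: "s \<in> Ob J" and a: "a \<in> carrier (cohomology_group n (YY s) M)"
    for t \<mu> s t' \<mu>' a
  proof -
    obtain h h' where h: "(t, h) \<in> f s" "\<mu> = cohomology_map n (XX t) (YY s) M h"
      and h': "(t', h') \<in> f s" "\<mu>' = cohomology_map n (XX t') (YY s) M h'" using \<mu> by blast
    obtain r u v where r: "r \<in> Ob I" "u \<in> Hom I r t" "v \<in> Hom I r t'"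
      "Cmp sSet (XX r) (XX t) (YY s) h (TX r t u) = Cmp sSet (XX r) (XX t') (YY s) h' (TX r t' v)"
      using f_join[OF h(1) h'(1) s] .
    show ?thesis
      unfolding cod.rel_iff
      using r(1-3) fD1[OF h(1) s] fD1[OF h'(1) s] hom_in_carrier[OF hom[OF h(1) s] a] hom_in_carrier[OF hom[OF h'(1) s] a]
        pre[OF h(1) s r(1,2) a] pre[OF h'(1) s r(1,3) a] r(4) h(2) h'(2) by auto
  qed
  show "\<exists>\<mu>'. (t', \<mu>') \<in> ?m s \<and> (\<forall>a\<in>carrier (cohomology_group n (YY s) M).
      \<mu>' a = cohomology_map n (XX t') (XX t) M (TX t' t u) (\<mu> a))"
    if \<mu>: "(t, \<mu>) \<in> ?m s" and s: "s \<in> Ob J" and t': "t' \<in> Ob I" and u: "u \<in> Hom I t' t" for t \<mu> s t' u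
  proof -
    obtain h where h: "(t, h) \<in> f s" "\<mu> = cohomology_map n (XX t) (YY s) M h" using \<mu> by blast
    show ?thesis using f_pre[OF h(1) s u t'] pre[OF h(1) s t' u] h(2) by blast
  qed
  show "\<exists>\<mu>'. (t, \<mu>') \<in> ?m s \<and> (\<forall>a\<in>carrier (cohomology_group n (YY s) M).
      \<mu>' a = \<mu> (cohomology_map n (YY s') (YY s) M (TY s' s w) a))"
    if \<mu>: "(t, \<mu>) \<in> ?m s'" and s: "s \<in> Ob J" and s': "s' \<in> Ob J" and w: "w \<in> Hom J s' s" for t \<mu> s' s w
  proof -
    obtain h where h: "(t, h) \<in> f s'" "\<mu> = cohomology_map n (XX t) (YY s') M h" using \<mu> by blast
    have "cohomology_map n (XX t) (YY s) M (Cmp sSet (XX t) (YY s') (YY s) (TY s' s w) h) a =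
      \<mu> (cohomology_map n (YY s') (YY s) M (TY s' s w) a)" if "a \<in> carrier (cohomology_group n (YY s) M)" for a
      unfolding h(2)
      by (rule R.cohomology_map_Cmp[OF XX_sset[OF fD1[OF h(1) s']] YY_sset[OF s'] YY_sset[OF s] M f_smap[OF h(1) s']
            TY_smap[OF w s' s] that])
    then show ?thesis using f_post[OF h(1) w s' s] by blast
  qed
qed

lemma ccls_one_iff:
  assumes P: "simplicial_set P" and M: "left_module R M" and \<phi>: "\<phi> \<in> cocycles n P M"
  shows "R.ccls n P M \<phi> = \<one>\<^bsub>cohomology_group n P M\<^esub> \<longleftrightarrow> \<phi> \<in> coboundaries n P M"
  using subquot.coset_eq_one_iff[OF R.cohomology_subquot[OF P M] \<phi>] by (simp add: R.cohomology_group_eq[OF P M])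

text \<open>The two halves of \<open>colim_map_iso_iff\<close>, translated by the correspondence
  between cocycles on simplices and linear maps on chains that annihilate boundaries. Again
  \<open>Suc n\<close> stands for simplicial degree \<open>n\<close>.\<close>

theorem cohomology_iso_iff:
  assumes M: "left_module R M"
  shows "pro_cohomology_map n X Y M f \<in> iso (pro_cohomology n Y M) (pro_cohomology n X M) \<longleftrightarrow>
    cohomology_pro_inj (Suc n) M \<and> cohomology_pro_surj (Suc n) M"
proof -
  let ?H = "\<lambda>P. cohomology_group n P M" and ?h = "\<lambda>P Q. cohomology_map n P Q M"
  let ?ext = "\<lambda>P. lin_ext R M (Simp P n)"
  interpret S: system_map J "\<lambda>s. ?H (YY s)" "\<lambda>t s u. ?h (YY t) (YY s) (TY t s u)"
    I "\<lambda>s. ?H (XX s)" "\<lambda>t s u. ?h (XX t) (XX s) (TX t s u)"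
    "\<lambda>s. {(t, ?h (XX t) (YY s) h) | t h. (t, h) \<in> f s}"
    by (rule cohomology_system_map[OF M])
  have map_eq: "pro_cohomology_map n X Y M f = S.colim_map"
  proof -
    have "{(t, ?h (XX t) (YY s) h a) | s a t h. (s, a) \<in> A \<and> (t, h) \<in> f s} =
      {(t, \<mu> a) | s a t \<mu>. (s, a) \<in> A \<and> (t, \<mu>) \<in> {(t, ?h (XX t) (YY s) h) | t h. (t, h) \<in> f s}}" for A
      by blast
    then show ?thesis unfolding pro_cohomology_map_def S.colim_map_def pro_cohomology_def by simp
  qed
  have "(\<forall>s\<in>Ob J. \<forall>a\<in>carrier (?H (YY s)). \<forall>(t, \<mu>)\<in>{(t, ?h (XX t) (YY s) h) | t h. (t, h) \<in> f s}.
      \<mu> a = \<one>\<^bsub>?H (XX t)\<^esub> \<longrightarrow> (\<exists>s'\<in>Ob J. \<exists>w\<in>Hom J s' s. ?h (YY s') (YY s) (TY s' s w) a = \<one>\<^bsub>?H (YY s')\<^esub>)) \<longleftrightarrow>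
    cohomology_pro_inj (Suc n) M" (is "?inj \<longleftrightarrow> _")
  proof
    assume inj: ?inj
    show "cohomology_pro_inj (Suc n) M"
      unfolding cohomology_pro_inj_def simplices.simps differential.simps
    proof (intro allI impI)
      fix s t h \<psi> \<chi>
      assume a: "(s, t, h) \<in> reps" and \<psi>: "lin R (chain_module R (Simp (YY s) n)) M \<psi>"
        and \<psi>D: "\<forall>y\<in>carrier (chain_module R (Simp (YY s) (Suc n))). \<psi> (boundary R n (YY s) y) = \<zero>\<^bsub>M\<^esub>"
        and \<chi>: "lin R (chain_module R (simplices (XX t) (Suc n))) M \<chi>"
        and \<psi>h: "\<forall>x\<in>carrier (chain_module R (Simp (XX t) n)).
          \<psi> (chain_map R (XX t) (YY s) h (Suc (Suc n)) x) = \<chi> (differential R (XX t) (Suc n) x)"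
      note r = repsD[OF a]
      note ss = XX_sset[OF r(2)] YY_sset[OF r(1)] and h = f_smap[OF r(3,1)]
      \<comment> \<open>The cocycle whose linear extension is \<psi>. The hypothesis
        \<open>inj\<close> is about classes of such functions on simplices.\<close>
      obtain \<phi> where \<phi>: "\<phi> \<in> cocycles n (YY s) M"
        "\<And>c. c \<in> carrier (chain_module R (Simp (YY s) n)) \<Longrightarrow> ?ext (YY s) \<phi> c = \<psi> c"
        by (rule R.cocycle_of_lin[OF ss(2) M \<psi>]) (use \<psi>D in blast)+
      note \<phi>P = R.lin_of_cocycle(3)[OF ss(2) M \<phi>(1)]
      have push: "chain_map R P Q g (Suc (Suc n)) c \<in> carrier (chain_module R (Simp Q n))"
        if "g \<in> simplicial_maps P Q" "simplicial_set P" "simplicial_set Q" "c \<in> carrier (chain_module R (Simp P n))" for P Q :: "'x sset" and g c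
        using lin_closed[OF Mp_lin[of g P Q "Suc (Suc n)"], of c] that unfolding sSet_simps simplices.simps by blast
      have "pull n (XX t) h \<phi> \<in> coboundaries n (XX t) M"
        unfolding R.pull_coboundaries_iff[OF ss(1) M h \<phi>P]
        by (rule exI[of _ \<chi>]) (use \<chi> \<psi>h \<phi>(2)[OF push[OF h ss]] in \<open>simp del: chain_module_simps chain_map.simps\<close>)
      then have "?h (XX t) (YY s) h (R.ccls n (YY s) M \<phi>) = \<one>\<^bsub>?H (XX t)\<^esub>"
        unfolding R.cohomology_map_ccls[OF ss M h \<phi>(1)] ccls_one_iff[OF ss(1) M R.pull_cocycles[OF ss M h \<phi>(1)]] .
      moreover have "R.ccls n (YY s) M \<phi> \<in> carrier (?H (YY s))"
        using \<phi>(1) R.carrier_cohomology[OF ss(2) M] by auto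
      ultimately obtain s' w where w: "s' \<in> Ob J" "w \<in> Hom J s' s"
        "?h (YY s') (YY s) (TY s' s w) (R.ccls n (YY s) M \<phi>) = \<one>\<^bsub>?H (YY s')\<^esub>"
        using inj r(1,3) by blast
      note ss' = YY_sset[OF w(1)] and wm = TY_smap[OF w(2,1) r(1)]
      have "pull n (YY s') (TY s' s w) \<phi> \<in> coboundaries n (YY s') M"
        using w(3) unfolding R.cohomology_map_ccls[OF ss' ss(2) M wm \<phi>(1)]
          ccls_one_iff[OF ss' M R.pull_cocycles[OF ss' ss(2) M wm \<phi>(1)]] .
      then obtain \<chi>' where "lin R (chain_module R (simplices (YY s') (Suc n))) M \<chi>'"
        "\<And>c. c \<in> carrier (chain_module R (Simp (YY s') n)) \<Longrightarrow>
          ?ext (YY s) \<phi> (chain_map R (YY s') (YY s) (TY s' s w) (Suc (Suc n)) c) = \<chi>' (differential R (YY s') (Suc n) c)"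
        unfolding R.pull_coboundaries_iff[OF ss' M wm \<phi>P] by blast
      then show "\<exists>s'\<in>Ob J. \<exists>w\<in>Hom J s' s. \<exists>\<chi>'. lin R (chain_module R (simplices (YY s') (Suc n))) M \<chi>' \<and>
         (\<forall>y\<in>carrier (chain_module R (Simp (YY s') n)).
            \<psi> (chain_map R (YY s') (YY s) (TY s' s w) (Suc (Suc n)) y) = \<chi>' (differential R (YY s') (Suc n) y))"
        using w(1,2) \<phi>(2)[OF push[OF wm ss' ss(2)]]
        by (intro bexI[of _ s'] bexI[of _ w] exI[of _ \<chi>'] conjI ballI) (simp_all del: chain_module_simps chain_map.simps)
    qed
  next
    assume inj: "cohomology_pro_inj (Suc n) M"
    show ?inj
    proof (intro ballI, clarify)
      fix s A t h assume s: "s \<in> Ob J" and A: "A \<in> carrier (?H (YY s))" and h: "(t, h) \<in> f s"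
        and one: "?h (XX t) (YY s) h A = \<one>\<^bsub>?H (XX t)\<^esub>"
      note t = fD1[OF h s] and hm = f_smap[OF h s]
      note ss = XX_sset[OF t] YY_sset[OF s]
      obtain \<phi> where \<phi>: "\<phi> \<in> cocycles n (YY s) M" "A = R.ccls n (YY s) M \<phi>"
        using A R.carrier_cohomology[OF ss(2) M] by auto
      note \<phi>l = R.lin_of_cocycle[OF ss(2) M \<phi>(1)]
      have "pull n (XX t) h \<phi> \<in> coboundaries n (XX t) M"
        using one unfolding \<phi>(2) R.cohomology_map_ccls[OF ss M hm \<phi>(1)]
          ccls_one_iff[OF ss(1) M R.pull_cocycles[OF ss M hm \<phi>(1)]] .
      then obtain \<chi> where \<chi>: "lin R (chain_module R (simplices (XX t) (Suc n))) M \<chi>"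
        "\<And>c. c \<in> carrier (chain_module R (Simp (XX t) n)) \<Longrightarrow>
          ?ext (YY s) \<phi> (chain_map R (XX t) (YY s) h (Suc (Suc n)) c) = \<chi> (differential R (XX t) (Suc n) c)"
        unfolding R.pull_coboundaries_iff[OF ss(1) M hm \<phi>l(3)] by blast
      have a: "(s, t, h) \<in> reps" using s h by (simp add: reps_def)
      obtain s' w \<chi>' where w: "s' \<in> Ob J" "w \<in> Hom J s' s" and \<chi>': "lin R (chain_module R (simplices (YY s') (Suc n))) M \<chi>'"
        "\<And>y. y \<in> carrier (chain_module R (Simp (YY s') n)) \<Longrightarrow>
            ?ext (YY s) \<phi> (chain_map R (YY s') (YY s) (TY s' s w) (Suc (Suc n)) y) = \<chi>' (differential R (YY s') (Suc n) y)"
        using inj[unfolded cohomology_pro_inj_def simplices.simps differential.simps, rule_format, OF a \<phi>l(1,2) \<chi>] by blast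
      note ss' = YY_sset[OF w(1)] and wm = TY_smap[OF w(2,1) s]
      have "pull n (YY s') (TY s' s w) \<phi> \<in> coboundaries n (YY s') M"
        unfolding R.pull_coboundaries_iff[OF ss' M wm \<phi>l(3)] using \<chi>' by blast
      then have "?h (YY s') (YY s) (TY s' s w) A = \<one>\<^bsub>?H (YY s')\<^esub>"
        unfolding \<phi>(2) R.cohomology_map_ccls[OF ss' ss(2) M wm \<phi>(1)]
          ccls_one_iff[OF ss' M R.pull_cocycles[OF ss' ss(2) M wm \<phi>(1)]] .
      then show "\<exists>s'\<in>Ob J. \<exists>w\<in>Hom J s' s. ?h (YY s') (YY s) (TY s' s w) A = \<one>\<^bsub>?H (YY s')\<^esub>"
        using w by blast
    qed
  qed
  moreover have "(\<forall>t\<in>Ob I. \<forall>b\<in>carrier (?H (XX t)). \<exists>s\<in>Ob J. \<exists>(t', \<mu>)\<in>{(t, ?h (XX t) (YY s) h) | t h. (t, h) \<in> f s}.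
      \<exists>u\<in>Hom I t' t. \<exists>a\<in>carrier (?H (YY s)). \<mu> a = ?h (XX t') (XX t) (TX t' t u) b) \<longleftrightarrow>
    cohomology_pro_surj (Suc n) M" (is "?surj \<longleftrightarrow> _")
  proof -
    \<comment> \<open>Equality of cohomology classes at the stage \<open>t'\<close>, rewritten as
      the equation between linear maps that occurs in \<open>cohomology_pro_surj\<close>; \<chi> is
      the linear form of the coboundary by which the two cocycles differ.\<close>
    have eq: "?h (XX t') (YY s) h (R.ccls n (YY s) M \<rho>) = ?h (XX t') (XX t) (TX t' t u) (R.ccls n (XX t) M \<phi>) \<longleftrightarrow>
      (\<exists>\<chi>. lin R (chain_module R (simplices (XX t') (Suc n))) M \<chi> \<and>
        (\<forall>c\<in>carrier (chain_module R (Simp (XX t') n)).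
          ?ext (XX t) \<phi> (chain_map R (XX t') (XX t) (TX t' t u) (Suc (Suc n)) c) =
          ?ext (YY s) \<rho> (chain_map R (XX t') (YY s) h (Suc (Suc n)) c) \<oplus>\<^bsub>M\<^esub> \<chi> (differential R (XX t') (Suc n) c)))"
      if s: "s \<in> Ob J" and t: "t \<in> Ob I" and h: "(t', h) \<in> f s" and u: "u \<in> Hom I t' t"
        and \<rho>: "\<rho> \<in> cocycles n (YY s) M" and \<phi>: "\<phi> \<in> cocycles n (XX t) M" for s t t' h u \<rho> \<phi>
    proof -
      note t' = fD1[OF h s] and hm = f_smap[OF h s]
      note um = TX_smap[OF u t' t]
      note ss = XX_sset[OF t'] XX_sset[OF t] YY_sset[OF s]
      note \<rho>P = R.lin_of_cocycle(3)[OF ss(3) M \<rho>] and \<phi>P = R.lin_of_cocycle(3)[OF ss(2) M \<phi>]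
      note pz = R.pull_cocycles[OF ss(1,3) M hm \<rho>] R.pull_cocycles[OF ss(1,2) M um \<phi>]
      note pP = R.lin_of_cocycle(3)[OF ss(1) M pz(1)] R.lin_of_cocycle(3)[OF ss(1) M pz(2)]
      have "?h (XX t') (YY s) h (R.ccls n (YY s) M \<rho>) = ?h (XX t') (XX t) (TX t' t u) (R.ccls n (XX t) M \<phi>) \<longleftrightarrow>
        R.ccls n (XX t') M (pull n (XX t') (TX t' t u) \<phi>) = R.ccls n (XX t') M (pull n (XX t') h \<rho>)"
        unfolding R.cohomology_map_ccls[OF ss(1,3) M hm \<rho>] R.cohomology_map_ccls[OF ss(1,2) M um \<phi>] by (rule eq_commute)
      also have "\<dots> \<longleftrightarrow> (\<exists>b\<in>coboundaries n (XX t') M. pull n (XX t') (TX t' t u) \<phi> =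
          pull n (XX t') h \<rho> \<otimes>\<^bsub>cochain_group n (XX t') M\<^esub> b)"
        by (rule subquot.coset_eq_iff[OF R.cohomology_subquot[OF ss(1) M] pz(2,1)])
      also note R.cohomologous_iff[OF ss(1) M pP(2,1)]
      finally show ?thesis
        using R.lin_ext_pull[OF ss(1) M hm \<rho>P] R.lin_ext_pull[OF ss(1) M um \<phi>P] by (simp only: cong: ball_cong)
    qed
    show ?thesis
    proof
      assume surj: ?surj
      show "cohomology_pro_surj (Suc n) M"
        unfolding cohomology_pro_surj_def simplices.simps differential.simps
      proof (intro allI impI)
        fix t \<psi> assume t: "t \<in> Ob I" and \<psi>: "lin R (chain_module R (Simp (XX t) n)) M \<psi>"
          and \<psi>D: "\<forall>y\<in>carrier (chain_module R (Simp (XX t) (Suc n))). \<psi> (boundary R n (XX t) y) = \<zero>\<^bsub>M\<^esub>"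
        note sst = XX_sset[OF t]
        obtain \<phi> where \<phi>: "\<phi> \<in> cocycles n (XX t) M"
          "\<And>c. c \<in> carrier (chain_module R (Simp (XX t) n)) \<Longrightarrow> ?ext (XX t) \<phi> c = \<psi> c"
          by (rule R.cocycle_of_lin[OF sst M \<psi>]) (use \<psi>D in blast)+
        have "R.ccls n (XX t) M \<phi> \<in> carrier (?H (XX t))" using \<phi>(1) R.carrier_cohomology[OF sst M] by auto
        then obtain s t' h u A where s: "s \<in> Ob J" and h: "(t', h) \<in> f s" and u: "u \<in> Hom I t' t"
          and A: "A \<in> carrier (?H (YY s))" "?h (XX t') (YY s) h A = ?h (XX t') (XX t) (TX t' t u) (R.ccls n (XX t) M \<phi>)"
          using surj t by blast
        note sss = YY_sset[OF s]
        obtain \<rho> where \<rho>: "\<rho> \<in> cocycles n (YY s) M" "A = R.ccls n (YY s) M \<rho>"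
          using A(1) R.carrier_cohomology[OF sss M] by auto
        note \<rho>l = R.lin_of_cocycle[OF sss M \<rho>(1)]
        obtain \<chi> where \<chi>: "lin R (chain_module R (simplices (XX t') (Suc n))) M \<chi>"
          "\<And>c. c \<in> carrier (chain_module R (Simp (XX t') n)) \<Longrightarrow>
          ?ext (XX t) \<phi> (chain_map R (XX t') (XX t) (TX t' t u) (Suc (Suc n)) c) =
          ?ext (YY s) \<rho> (chain_map R (XX t') (YY s) h (Suc (Suc n)) c) \<oplus>\<^bsub>M\<^esub> \<chi> (differential R (XX t') (Suc n) c)"
          using A(2) unfolding \<rho>(2) eq[OF s t h u \<rho>(1) \<phi>(1)] by blast
        have "\<psi> (chain_map R (XX t') (XX t) (TX t' t u) (Suc (Suc n)) c) =
          ?ext (YY s) \<rho> (chain_map R (XX t') (YY s) h (Suc (Suc n)) c) \<oplus>\<^bsub>M\<^esub> \<chi> (differential R (XX t') (Suc n) c)"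
          if c: "c \<in> carrier (chain_module R (Simp (XX t') n))" for c
        proof -
          have "chain_map R (XX t') (XX t) (TX t' t u) (Suc (Suc n)) c \<in> carrier (chain_module R (Simp (XX t) n))"
            using lin_closed[OF Mp_lin[OF TX[OF u fD1[OF h s] t] XX[OF fD1[OF h s]] XX[OF t], of "Suc (Suc n)"], of c] c
            unfolding simplices.simps by blast
          from \<phi>(2)[OF this] \<chi>(2)[OF c] show ?thesis by simp
        qed
        moreover have "(s, t', h) \<in> reps" using s h by (simp add: reps_def)
        ultimately show "\<exists>s t' h u \<psi>' \<chi>. (s, t', h) \<in> reps \<and> u \<in> Hom I t' t \<and> lin R (chain_module R (Simp (YY s) n)) M \<psi>' \<and>
           (\<forall>y\<in>carrier (chain_module R (Simp (YY s) (Suc n))). \<psi>' (boundary R n (YY s) y) = \<zero>\<^bsub>M\<^esub>) \<and>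
           lin R (chain_module R (simplices (XX t') (Suc n))) M \<chi> \<and>
           (\<forall>x\<in>carrier (chain_module R (Simp (XX t') n)). \<psi> (chain_map R (XX t') (XX t) (TX t' t u) (Suc (Suc n)) x) =
              \<psi>' (chain_map R (XX t') (YY s) h (Suc (Suc n)) x) \<oplus>\<^bsub>M\<^esub> \<chi> (differential R (XX t') (Suc n) x))"
          using u \<rho>l(1,2) \<chi>(1) by blast
      qed
    next
      assume surj: "cohomology_pro_surj (Suc n) M"
      show ?surj
      proof (intro ballI)
        fix t B assume t: "t \<in> Ob I" and B: "B \<in> carrier (?H (XX t))"
        note sst = XX_sset[OF t]
        obtain \<phi> where \<phi>: "\<phi> \<in> cocycles n (XX t) M" "B = R.ccls n (XX t) M \<phi>"
          using B R.carrier_cohomology[OF sst M] by auto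
        note \<phi>l = R.lin_of_cocycle[OF sst M \<phi>(1)]
        obtain s t' h u \<psi>' \<chi> where a: "(s, t', h) \<in> reps" and u: "u \<in> Hom I t' t"
          and \<psi>': "lin R (chain_module R (Simp (YY s) n)) M \<psi>'"
            "\<And>y. y\<in>carrier (chain_module R (Simp (YY s) (Suc n))) \<Longrightarrow> \<psi>' (boundary R n (YY s) y) = \<zero>\<^bsub>M\<^esub>"
          and \<chi>: "lin R (chain_module R (simplices (XX t') (Suc n))) M \<chi>"
            "\<And>x. x\<in>carrier (chain_module R (Simp (XX t') n)) \<Longrightarrow> ?ext (XX t) \<phi> (chain_map R (XX t') (XX t) (TX t' t u) (Suc (Suc n)) x) =
              \<psi>' (chain_map R (XX t') (YY s) h (Suc (Suc n)) x) \<oplus>\<^bsub>M\<^esub> \<chi> (differential R (XX t') (Suc n) x)"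
          using surj[unfolded cohomology_pro_surj_def simplices.simps differential.simps, rule_format, OF t \<phi>l(1,2)] by blast
        note r = repsD[OF a]
        note sss = YY_sset[OF r(1)]
        obtain \<rho> where \<rho>: "\<rho> \<in> cocycles n (YY s) M"
          "\<And>c. c \<in> carrier (chain_module R (Simp (YY s) n)) \<Longrightarrow> ?ext (YY s) \<rho> c = \<psi>' c"
          by (rule R.cocycle_of_lin[OF sss M \<psi>']) blast+
        have "?ext (XX t) \<phi> (chain_map R (XX t') (XX t) (TX t' t u) (Suc (Suc n)) c) =
          ?ext (YY s) \<rho> (chain_map R (XX t') (YY s) h (Suc (Suc n)) c) \<oplus>\<^bsub>M\<^esub> \<chi> (differential R (XX t') (Suc n) c)"
          if c: "c \<in> carrier (chain_module R (Simp (XX t') n))" for c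
        proof -
          have "chain_map R (XX t') (YY s) h (Suc (Suc n)) c \<in> carrier (chain_module R (Simp (YY s) n))"
            using lin_closed[OF Mp_lin[OF r(4,6,5), of "Suc (Suc n)"], of c] c unfolding simplices.simps by blast
          from \<rho>(2)[OF this] \<chi>(2)[OF c] show ?thesis by simp
        qed
        then have "?h (XX t') (YY s) h (R.ccls n (YY s) M \<rho>) = ?h (XX t') (XX t) (TX t' t u) B"
          unfolding \<phi>(2) eq[OF r(1) t r(3) u \<rho>(1) \<phi>(1)] using \<chi>(1) by blast
        moreover have "R.ccls n (YY s) M \<rho> \<in> carrier (?H (YY s))" using \<rho>(1) R.carrier_cohomology[OF sss M] by auto
        ultimately show "\<exists>s\<in>Ob J. \<exists>(t', \<mu>)\<in>{(t, ?h (XX t) (YY s) h) | t h. (t, h) \<in> f s}.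
            \<exists>u\<in>Hom I t' t. \<exists>a\<in>carrier (?H (YY s)). \<mu> a = ?h (XX t') (XX t) (TX t' t u) B"
          using r(1,3) u by blast
      qed
    qed
  qed
  ultimately show ?thesis
    unfolding map_eq pro_cohomology_def S.colim_map_iso_iff by simp
qed

end

theorem proposition5p5:
  fixes R :: "'r ring"
    and X :: "('i, 'j, 'x) pro_space"
    and Y :: "('k, 'l, 'x) pro_space"
    and f :: "'k \<Rightarrow> ('i \<times> (nat \<Rightarrow> 'x \<Rightarrow> 'x)) set"
  assumes "ring R"
    and "pro_space X"
    and "pro_space Y"
    and "f \<in> pro_hom sSet X Y"
  shows "homology_weak_equivalence R X Y f \<longleftrightarrow>
    (\<forall>n. \<forall>M :: ('r, ('m, 'x, 'r) module_elt) module. left_module R M \<longrightarrow>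
       pro_cohomology_map n X Y M f \<in> iso (pro_cohomology n Y M) (pro_cohomology n X M))"
proof -
  interpret pro_space_map R X Y f
    by (rule pro_space_map.intro[OF assms(1) pro_map.intro[OF category_sSet assms(2-4)]])
  \<comment> \<open>Elements of the quotient of a cone module are sets of pairs of chains. The
    second summand of \<open>module_elt\<close> contains a copy of them, whatever \<open>'m\<close>
    is.\<close>
  have inj: "inj (Inr :: (('x \<Rightarrow> 'r) \<times> ('x \<Rightarrow> 'r)) set \<Rightarrow> ('m, 'x, 'r) module_elt)" by simp
  show ?thesis
    unfolding homology_weak_equivalence_def homology_pro_iso_iff homology_iff_cohomology[OF inj]
    by (simp add: cohomology_iso_iff)
qed

end
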